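(* Let $M$ be a compact smooth $n$-manifold and $E\to M$ a smooth vector bundle of rank $r$. Let $e\in\mathbb{R}$, $q\in(1,\infty)$, and let $\Lambda=\{(U_\alpha,\varphi_\alpha,\rho_\alpha,\psi_\alpha)\}_{\alpha=1}^N$ be an augmented total trivialization atlas for $E\to M$. If $e$ is a noninteger less than $-1$, assume further that $\Lambda$ is GL compatible with itself. If $u\in W^{e,q}(M,E;\Lambda)$, then for all $1\le\alpha\le N$ and $1\le i\le r$, $[H_\alpha(u)]^i$ belongs to $W^{e,q}_{loc}(\varphi_\alpha(U_\alpha))$. Moreover, if $\xi\in C_c^\infty(\varphi_\alpha(U_\alpha))$, then $$\|\xi\,[H_\alpha(u)]^i\|_{W^{e,q}(\varphi_\alpha(U_\alpha))}\le C\,\|u\|_{W^{e,q}(M,E;\Lambda)},$$ where the constant $C$ may depend on $\xi$ but not on $u$.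
   Context: Manifolds are smooth, Hausdorff and second countable; $E_U=\pi^{-1}(U)$ for a bundle $\pi:E\to M$. Trivializations. A total trivialization triple $(U,\varphi,\rho)$ for $E$ consists of a smooth chart $(U,\varphi)$ of $M$ and a smooth map $\rho=(\rho^1,\dots,\rho^r):E_U\to\mathbb{R}^r$ that is a linear isomorphism on each fibre and such that $(\pi,\rho):E_U\to U\times\mathbb{R}^r$ is a diffeomorphism. An augmented total trivialization atlas is a finite collection $\{(U_\alpha,\varphi_\alpha,\rho_\alpha,\psi_\alpha)\}_{1\le\alpha\le N}$ of such triples, whose charts form a smooth atlas of $M$, together with a smooth nonnegative partition of unity $\{\psi_\alpha\}$ with $\mathrm{supp}\,\psi_\alpha\subseteq U_\alpha$. Euclidean spaces. Let $\Omega\subseteq\mathbb{R}^n$ be nonempty open, $1<p<\infty$. For $k\in\mathbb{N}_0$, $\|u\|_{W^{k,p}(\Omega)}=\sum_{|\nu|\le k}\|\partial^\nu u\|_{L^p(\Omega)}$; for $s=k+\theta$, $\theta\in(0,1)$, $\|u\|_{W^{s,p}(\Omega)}=\|u\|_{W^{k,p}(\Omega)}+\sum_{|\nu|=k}\big(\iint_{\Omega\times\Omega}\frac{|\partial^\nu u(x)-\partial^\nu u(y)|^p}{|x-y|^{n+\theta p}}dx\,dy\big)^{1/p}$; $W^{s,p}(\Omega)$ is the set of $u\in L^p(\Omega)$ with finite norm. For $s\ge0$, $W^{s,p}_0(\Omega)$ is the closure of $C_c^\infty(\Omega)$ in $W^{s,p}(\Omega)$. For $s<0$, $W^{s,p}(\Omega)=(W_0^{-s,p'}(\Omega))^*$,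 $1/p+1/p'=1$, viewed as a subspace of $D'(\Omega)$ by restriction to $C_c^\infty(\Omega)$. $W^{s,p}_{loc}(\Omega)=\{v\in D'(\Omega):\varphi v\in W^{s,p}(\Omega)\ \forall\varphi\in C_c^\infty(\Omega)\}$. Distributions. Let $\mathcal{D}$ be the density bundle of $M$ and $E^\vee=\mathrm{Hom}(E,\mathcal{D})$. $D'(M,E)$ is the topological dual of $D(M,E^\vee)=C^\infty_c(M,E^\vee)$ with its usual test-function topology. For $u\in D'(M,E)$, the local representation $H_\alpha(u)\in D'(\varphi_\alpha(U_\alpha))^r$ has components $[H_\alpha(u)]^l(\xi)=\langle u,g_{l,\xi}\rangle$, where $g_{l,\xi}$ is the section of $E^\vee$ supported in $U_\alpha$ with $g_{l,\xi}(x)(a)=\xi(\varphi_\alpha(x))\,\rho_\alpha^l(a)\,|dx^1\wedge\cdots\wedge dx^n|_x$ for $a\in E_x$, $\varphi_\alpha=(x^i)$. If $u$ is the regular distribution $\eta\mapsto\int_M\eta(f)$ given by a section $f$, then $[H_\alpha(u)]^l=\rho_\alpha^l\circ f\circ\varphi_\alpha^{-1}$. Sobolev spaces. $W^{e,q}(M,E;\Lambda)=\{u\in D'(M,E):\|u\|_{W^{e,q}(M,E;\Lambda)}:=\sum_{\alpha=1}^N\sum_{l=1}^r\|[H_\alpha(\psi_\alpha u)]^l\|_{W^{e,q}(\varphi_\alpha(U_\alpha))}<\infty\}$. GL compatibility. $\Lambda$ is GL compatible with itself if every $\varphi_\alpha(U_\alpha)$ is either $\mathbb{R}^n$ or a nonempty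 bounded open set with Lipschitz boundary, and whenever $U_\alpha\cap U_\beta\ne\emptyset$ each of $\varphi_\alpha(U_\alpha\cap U_\beta)$ and $\varphi_\beta(U_\alpha\cap U_\beta)$ is a nonempty bounded open set with Lipschitz boundary or all of $\mathbb{R}^n$. *)

theory Defs
  imports "HOL-Analysis.Analysis"
begin

section \<open>Smooth maps between Euclidean spaces and multi-index derivatives\<close>

fun Ck_on :: "nat \<Rightarrow> 'a::euclidean_space set \<Rightarrow> ('a \<Rightarrow> 'b::euclidean_space) \<Rightarrow> bool" where
  "Ck_on 0 S f \<longleftrightarrow> continuous_on S f"
| "Ck_on (Suc k) S f \<longleftrightarrow>
     (\<forall>x\<in>S. f differentiable (at x)) \<and> (\<forall>v. Ck_on k S (\<lambda>x. frechet_derivative f (at x) v))"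

text \<open>Only used for open \<open>S\<close>, where the derivatives at points of \<open>S\<close> do not depend on the values
  of \<open>f\<close> outside \<open>S\<close>.\<close>

definition smooth_on :: "'a::euclidean_space set \<Rightarrow> ('a \<Rightarrow> 'b::euclidean_space) \<Rightarrow> bool" where
  "smooth_on S f \<longleftrightarrow> (\<forall>k. Ck_on k S f)"

definition pd :: "'n::finite \<Rightarrow> (real^'n \<Rightarrow> real) \<Rightarrow> (real^'n \<Rightarrow> real)" where
  "pd i f = (\<lambda>x. frechet_derivative f (at x) (axis i 1))"

definition order_of :: "('n::finite \<Rightarrow> nat) \<Rightarrow> nat" where
  "order_of \<nu> = (\<Sum>i\<in>UNIV. \<nu> i)"

text \<open>The operator \<open>\<partial>\<^sup>\<nu>\<close>: the index type carries no order, so an arbitrary order of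
  differentiation is chosen; it is applied to smooth functions only, where it does not matter.\<close>

definition mpd :: "('n::finite \<Rightarrow> nat) \<Rightarrow> (real^'n \<Rightarrow> real) \<Rightarrow> (real^'n \<Rightarrow> real)" where
  "mpd \<nu> f = foldr pd (SOME is. \<forall>i. count_list is i = \<nu> i) f"


section \<open>Test-function topologies and their duals\<close>

text \<open>A common description for \<open>D(\<Omega>)\<close> and \<open>D(M, E\<^sup>\<or>)\<close>.  \<open>P\<close> is a family of seminorms and
  \<open>\<D>\<close> a directed family of vector spaces of functions (one for each compact set of supports), each
  with the locally convex topology given by \<open>P\<close>.  The union \<open>\<Union>\<D>\<close> carries the topology having as
  base all translates of convex balanced sets whose trace on each member of \<open>\<D>\<close> is open, that
  is, the locally convex inductive limit topology.\<close>

definition seminorm_open :: "(('x \<Rightarrow> real) \<Rightarrow> real) set \<Rightarrow> ('x \<Rightarrow> real) set \<Rightarrow> ('x \<Rightarrow> real) set \<Rightarrow> bool" where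
  "seminorm_open P D V \<longleftrightarrow> V \<subseteq> D \<and>
     (\<forall>f\<in>V. \<exists>F \<epsilon>. finite F \<and> F \<subseteq> P \<and> \<epsilon> > 0 \<and>
        {g\<in>D. \<forall>p\<in>F. p (\<lambda>x. g x - f x) < \<epsilon>} \<subseteq> V)"

definition lf_nbhds :: "(('x \<Rightarrow> real) \<Rightarrow> real) set \<Rightarrow> ('x \<Rightarrow> real) set set \<Rightarrow> ('x \<Rightarrow> real) set set" where
  "lf_nbhds P \<D> = {W. W \<subseteq> \<Union>\<D> \<and>
     (\<forall>f\<in>W. \<forall>g\<in>W. \<forall>t\<in>{0..1}. (\<lambda>x. (1 - t) * f x + t * g x) \<in> W) \<and>
     (\<forall>f\<in>W. \<forall>c. \<bar>c\<bar> \<le> 1 \<longrightarrow> (\<lambda>x. c * f x) \<in> W) \<and>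
     (\<forall>D\<in>\<D>. seminorm_open P D (W \<inter> D))}"

definition lf_topology :: "(('x \<Rightarrow> real) \<Rightarrow> real) set \<Rightarrow> ('x \<Rightarrow> real) set set \<Rightarrow> ('x \<Rightarrow> real) topology" where
  "lf_topology P \<D> = topology_generated_by
     {(\<lambda>w x. f x + w x) ` W | f W. f \<in> \<Union>\<D> \<and> W \<in> lf_nbhds P \<D>}"

definition linear_functional_on :: "('x \<Rightarrow> real) set \<Rightarrow> (('x \<Rightarrow> real) \<Rightarrow> real) \<Rightarrow> bool" where
  "linear_functional_on V u \<longleftrightarrow>
     (\<forall>f\<in>V. \<forall>g\<in>V. \<forall>a b. u (\<lambda>x. a * f x + b * g x) = a * u f + b * u g)"

definition lf_dual :: "(('x \<Rightarrow> real) \<Rightarrow> real) set \<Rightarrow> ('x \<Rightarrow> real) set set \<Rightarrow> (('x \<Rightarrow> real) \<Rightarrow> real) set" where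
  "lf_dual P \<D> = {u. linear_functional_on (\<Union>\<D>) u \<and>
     continuous_map (lf_topology P \<D>) euclideanreal u}"


section \<open>Distributions on open subsets of Euclidean space\<close>

text \<open>Elements of \<open>C\<^sub>c\<^sup>\<infinity>(\<Omega>)\<close> are extended by zero to the whole space.  A distribution is a total
  function on functions, of which only the values at test functions are ever used.\<close>

definition test_functions_in :: "(real^'n::finite) set \<Rightarrow> (real^'n \<Rightarrow> real) set" where
  "test_functions_in K = {\<eta>. smooth_on UNIV \<eta> \<and> (\<forall>x. x \<notin> K \<longrightarrow> \<eta> x = 0)}"

definition test_function_family :: "(real^'n::finite) set \<Rightarrow> (real^'n \<Rightarrow> real) set set" where
  "test_function_family \<Omega> = {test_functions_in K | K. compact K \<and> K \<subseteq> \<Omega>}"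

definition test_functions :: "(real^'n::finite) set \<Rightarrow> (real^'n \<Rightarrow> real) set" where
  "test_functions \<Omega> = \<Union>(test_function_family \<Omega>)"

definition test_seminorms :: "((real^'n::finite \<Rightarrow> real) \<Rightarrow> real) set" where
  "test_seminorms = range (\<lambda>\<nu> \<eta>. SUP x. \<bar>mpd \<nu> \<eta> x\<bar>)"

definition distributions :: "(real^'n::finite) set \<Rightarrow> ((real^'n \<Rightarrow> real) \<Rightarrow> real) set" where
  "distributions \<Omega> = lf_dual test_seminorms (test_function_family \<Omega>)"

definition dist_mult :: "('x \<Rightarrow> real) \<Rightarrow> (('x \<Rightarrow> real) \<Rightarrow> real) \<Rightarrow> (('x \<Rightarrow> real) \<Rightarrow> real)" where
  "dist_mult \<phi> T = (\<lambda>\<eta>. T (\<lambda>x. \<phi> x * \<eta> x))"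

definition locally_integrable :: "(real^'n::finite) set \<Rightarrow> (real^'n \<Rightarrow> real) \<Rightarrow> bool" where
  "locally_integrable \<Omega> f \<longleftrightarrow> (\<forall>K. compact K \<and> K \<subseteq> \<Omega> \<longrightarrow> f absolutely_integrable_on K)"

definition regular_dist :: "(real^'n::finite) set \<Rightarrow> (real^'n \<Rightarrow> real) \<Rightarrow> ((real^'n \<Rightarrow> real) \<Rightarrow> real)" where
  "regular_dist \<Omega> f = (\<lambda>\<eta>. integral\<^sup>L (lebesgue_on \<Omega>) (\<lambda>x. f x * \<eta> x))"

definition is_weak_deriv ::
  "(real^'n::finite) set \<Rightarrow> ('n \<Rightarrow> nat) \<Rightarrow> (real^'n \<Rightarrow> real) \<Rightarrow> (real^'n \<Rightarrow> real) \<Rightarrow> bool" where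
  "is_weak_deriv \<Omega> \<nu> f g \<longleftrightarrow> locally_integrable \<Omega> f \<and> locally_integrable \<Omega> g \<and>
     (\<forall>\<eta>\<in>test_functions \<Omega>. regular_dist \<Omega> f (mpd \<nu> \<eta>) = (-1) ^ order_of \<nu> * regular_dist \<Omega> g \<eta>)"


section \<open>Sobolev-Slobodeckij spaces on open subsets of Euclidean space\<close>

definition enn_root :: "real \<Rightarrow> ennreal \<Rightarrow> ennreal" where
  "enn_root p I = (if I = \<infinity> then \<infinity> else ennreal (enn2real I powr (1 / p)))"

definition Lp_norm :: "real \<Rightarrow> (real^'n::finite) set \<Rightarrow> (real^'n \<Rightarrow> real) \<Rightarrow> ennreal" where
  "Lp_norm p \<Omega> f = enn_root p (\<integral>\<^sup>+x. ennreal (\<bar>f x\<bar> powr p) \<partial>lebesgue_on \<Omega>)"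

definition gagliardo :: "real \<Rightarrow> real \<Rightarrow> (real^'n::finite) set \<Rightarrow> (real^'n \<Rightarrow> real) \<Rightarrow> ennreal" where
  "gagliardo \<theta> p \<Omega> f = enn_root p
     (\<integral>\<^sup>+x. (\<integral>\<^sup>+y. ennreal (\<bar>f x - f y\<bar> powr p / norm (x - y) powr (real CARD('n) + \<theta> * p))
        \<partial>lebesgue_on \<Omega>) \<partial>lebesgue_on \<Omega>)"

text \<open>The norm of \<open>W\<^bsup>s,p\<^esup>(\<Omega>)\<close> for \<open>s \<ge> 0\<close>.  Weak derivatives are unique up to null sets, so all
  members of each of the sets below have the same norm; the infimum over the empty set is \<open>\<infinity>\<close>,
  which covers the case that the weak derivative does not exist as a function.\<close>

definition sob_norm_fun :: "real \<Rightarrow> real \<Rightarrow> (real^'n::finite) set \<Rightarrow> (real^'n \<Rightarrow> real) \<Rightarrow> ennreal" where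
  "sob_norm_fun s p \<Omega> f =
     (let k = nat \<lfloor>s\<rfloor>; \<theta> = s - of_int \<lfloor>s\<rfloor> in
        (\<Sum>\<nu> | order_of \<nu> \<le> k. INF g\<in>{g. is_weak_deriv \<Omega> \<nu> f g}. Lp_norm p \<Omega> g) +
        (if \<theta> = 0 then 0
         else \<Sum>\<nu> | order_of \<nu> = k. INF g\<in>{g. is_weak_deriv \<Omega> \<nu> f g}. gagliardo \<theta> p \<Omega> g))"

definition sob_fun_space :: "real \<Rightarrow> real \<Rightarrow> (real^'n::finite) set \<Rightarrow> (real^'n \<Rightarrow> real) set" where
  "sob_fun_space s p \<Omega> = {f \<in> borel_measurable (lebesgue_on \<Omega>).
     Lp_norm p \<Omega> f < \<infinity> \<and> sob_norm_fun s p \<Omega> f < \<infinity>}"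

definition sob_fun_space0 :: "real \<Rightarrow> real \<Rightarrow> (real^'n::finite) set \<Rightarrow> (real^'n \<Rightarrow> real) set" where
  "sob_fun_space0 s p \<Omega> = {f \<in> sob_fun_space s p \<Omega>.
     \<forall>\<epsilon>>0. \<exists>\<eta>\<in>test_functions \<Omega>. sob_norm_fun s p \<Omega> (\<lambda>x. f x - \<eta> x) < \<epsilon>}"

text \<open>Norm on the dual of \<open>W\<^sub>0\<^bsup>s,p\<^esup>(\<Omega>)\<close>, with value \<open>\<infinity>\<close> at unbounded functionals.  A functional of
  finite norm takes equal values at functions that agree almost everywhere on \<open>\<Omega>\<close>.\<close>

definition sob0_dual_norm ::
  "real \<Rightarrow> real \<Rightarrow> (real^'n::finite) set \<Rightarrow> ((real^'n \<Rightarrow> real) \<Rightarrow> real) \<Rightarrow> ennreal" where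
  "sob0_dual_norm s p \<Omega> L =
     (SUP f\<in>{f \<in> sob_fun_space0 s p \<Omega>. sob_norm_fun s p \<Omega> f \<le> 1}. ennreal \<bar>L f\<bar>)"

definition sob0_dual :: "real \<Rightarrow> real \<Rightarrow> (real^'n::finite) set \<Rightarrow> ((real^'n \<Rightarrow> real) \<Rightarrow> real) set" where
  "sob0_dual s p \<Omega> = {L. linear_functional_on (sob_fun_space0 s p \<Omega>) L \<and> sob0_dual_norm s p \<Omega> L < \<infinity>}"

text \<open>The norm of a distribution \<open>T\<close>, equal to \<open>\<infinity>\<close> if \<open>T\<close> is not in the space: for \<open>s \<ge> 0\<close> the
  norm of the function (unique almost everywhere) representing \<open>T\<close>; for \<open>s < 0\<close> the norm of the
  (by density unique) element of the dual of \<open>W\<^sub>0\<^bsup>-s,p'\<^esup>(\<Omega>)\<close> restricting to \<open>T\<close>.\<close>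

definition sob_norm :: "real \<Rightarrow> real \<Rightarrow> (real^'n::finite) set \<Rightarrow> ((real^'n \<Rightarrow> real) \<Rightarrow> real) \<Rightarrow> ennreal" where
  "sob_norm s p \<Omega> T =
     (if s \<ge> 0
      then INF f\<in>{f \<in> sob_fun_space s p \<Omega>. \<forall>\<eta>\<in>test_functions \<Omega>. T \<eta> = regular_dist \<Omega> f \<eta>}.
             sob_norm_fun s p \<Omega> f
      else INF L\<in>{L \<in> sob0_dual (- s) (p / (p - 1)) \<Omega>. \<forall>\<eta>\<in>test_functions \<Omega>. T \<eta> = L \<eta>}.
             sob0_dual_norm (- s) (p / (p - 1)) \<Omega> L)"

definition sob_space :: "real \<Rightarrow> real \<Rightarrow> (real^'n::finite) set \<Rightarrow> ((real^'n \<Rightarrow> real) \<Rightarrow> real) set" where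
  "sob_space s p \<Omega> = {T \<in> distributions \<Omega>. sob_norm s p \<Omega> T < \<infinity>}"

definition sob_space_loc :: "real \<Rightarrow> real \<Rightarrow> (real^'n::finite) set \<Rightarrow> ((real^'n \<Rightarrow> real) \<Rightarrow> real) set" where
  "sob_space_loc s p \<Omega> =
     {T \<in> distributions \<Omega>. \<forall>\<phi>\<in>test_functions \<Omega>. dist_mult \<phi> T \<in> sob_space s p \<Omega>}"

text \<open>Locally \<open>\<Omega>\<close> is the strict epigraph of a Lipschitz function \<open>\<gamma>\<close> of the components orthogonal to
  some unit vector \<open>e\<close>.\<close>

definition lipschitz_boundary :: "(real^'n::finite) set \<Rightarrow> bool" where
  "lipschitz_boundary \<Omega> \<longleftrightarrow> (\<forall>x\<in>frontier \<Omega>. \<exists>r>0. \<exists>e L \<gamma>. norm e = 1 \<and>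
     L-lipschitz_on {y. y \<bullet> e = 0} \<gamma> \<and>
     \<Omega> \<inter> ball x r = {y \<in> ball x r. \<gamma> (y - (y \<bullet> e) *\<^sub>R e) < y \<bullet> e})"

definition lipschitz_domain :: "(real^'n::finite) set \<Rightarrow> bool" where
  "lipschitz_domain \<Omega> \<longleftrightarrow> \<Omega> \<noteq> {} \<and> bounded \<Omega> \<and> open \<Omega> \<and> lipschitz_boundary \<Omega>"


section \<open>Smooth manifolds\<close>

text \<open>A manifold is given by an atlas; its points are the union of the chart domains, an open
  subset of a Hausdorff second countable type.\<close>

type_synonym ('a, 'b) chart = "'a set \<times> ('a \<Rightarrow> 'b)"

fun is_chart :: "('a::topological_space, 'b::euclidean_space) chart \<Rightarrow> bool" where
  "is_chart (U, \<phi>) \<longleftrightarrow> open U \<and> open (\<phi> ` U) \<and> (\<exists>g. homeomorphism U (\<phi> ` U) \<phi> g)"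

fun compatible :: "('a, 'b::euclidean_space) chart \<Rightarrow> ('a, 'b) chart \<Rightarrow> bool" where
  "compatible (U, \<phi>) (V, \<psi>) \<longleftrightarrow>
     smooth_on (\<phi> ` (U \<inter> V)) (\<psi> \<circ> inv_into U \<phi>) \<and> smooth_on (\<psi> ` (U \<inter> V)) (\<phi> \<circ> inv_into V \<psi>)"

definition points :: "('a, 'b) chart set \<Rightarrow> 'a set" where
  "points A = \<Union>(fst ` A)"

definition smooth_manifold ::
  "('a::{t2_space, second_countable_topology}, 'b::euclidean_space) chart set \<Rightarrow> bool" where
  "smooth_manifold A \<longleftrightarrow> (\<forall>c\<in>A. is_chart c) \<and> (\<forall>c\<in>A. \<forall>d\<in>A. compatible c d)"

definition smooth_chart ::
  "('a::topological_space, 'b::euclidean_space) chart set \<Rightarrow> ('a, 'b) chart \<Rightarrow> bool" where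
  "smooth_chart A c \<longleftrightarrow> is_chart c \<and> fst c \<subseteq> points A \<and> (\<forall>d\<in>A. compatible c d)"

definition smooth_map ::
  "('a::topological_space, 'b::euclidean_space) chart set \<Rightarrow>
   ('c::topological_space, 'd::euclidean_space) chart set \<Rightarrow> ('a \<Rightarrow> 'c) \<Rightarrow> bool" where
  "smooth_map A B f \<longleftrightarrow> f ` points A \<subseteq> points B \<and>
     (\<forall>x\<in>points A. \<exists>U \<phi> V \<psi>. smooth_chart A (U, \<phi>) \<and> smooth_chart B (V, \<psi>) \<and>
        x \<in> U \<and> f ` U \<subseteq> V \<and> smooth_on (\<phi> ` U) (\<psi> \<circ> f \<circ> inv_into U \<phi>))"

definition diffeomorphism ::
  "('a::topological_space, 'b::euclidean_space) chart set \<Rightarrow>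
   ('c::topological_space, 'd::euclidean_space) chart set \<Rightarrow> ('a \<Rightarrow> 'c) \<Rightarrow> bool" where
  "diffeomorphism A B f \<longleftrightarrow> bij_betw f (points A) (points B) \<and>
     smooth_map A B f \<and> smooth_map B A (inv_into (points A) f)"

definition euclid :: "('b::euclidean_space, 'b) chart set" where
  "euclid = {(UNIV, \<lambda>x. x)}"

definition open_submanifold :: "('a, 'b) chart set \<Rightarrow> 'a set \<Rightarrow> ('a, 'b) chart set" where
  "open_submanifold A W = (\<lambda>(U, \<phi>). (U \<inter> W, \<phi>)) ` A"

definition product_manifold ::
  "('a, 'b) chart set \<Rightarrow> ('c, 'd) chart set \<Rightarrow> ('a \<times> 'c, 'b \<times> 'd) chart set" where
  "product_manifold A B = {(U \<times> V, map_prod \<phi> \<psi>) | U \<phi> V \<psi>. (U, \<phi>) \<in> A \<and> (V, \<psi>) \<in> B}"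


section \<open>Vector bundles and trivializations\<close>

record ('m, 'e, 'n, 'r) vbundle =
  base :: "('m, real^'n) chart set"
  tot :: "('e, (real^'n) \<times> (real^'r)) chart set"
  proj :: "'e \<Rightarrow> 'm"
  vadd :: "'e \<Rightarrow> 'e \<Rightarrow> 'e"
  vscale :: "real \<Rightarrow> 'e \<Rightarrow> 'e"

definition fibre :: "('m, 'e, 'n::finite, 'r::finite) vbundle \<Rightarrow> 'm \<Rightarrow> 'e set" where
  "fibre E x = {a \<in> points (tot E). proj E a = x}"

definition preimage :: "('m, 'e, 'n::finite, 'r::finite) vbundle \<Rightarrow> 'm set \<Rightarrow> 'e set" where
  "preimage E U = {a \<in> points (tot E). proj E a \<in> U}"

definition real_vector_space_on ::
  "'a set \<Rightarrow> ('a \<Rightarrow> 'a \<Rightarrow> 'a) \<Rightarrow> (real \<Rightarrow> 'a \<Rightarrow> 'a) \<Rightarrow> bool" where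
  "real_vector_space_on V ad sm \<longleftrightarrow>
     (\<forall>a\<in>V. \<forall>b\<in>V. ad a b \<in> V \<and> ad a b = ad b a) \<and>
     (\<forall>a\<in>V. \<forall>b\<in>V. \<forall>c\<in>V. ad (ad a b) c = ad a (ad b c)) \<and>
     (\<exists>z\<in>V. (\<forall>a\<in>V. ad z a = a) \<and> (\<forall>a\<in>V. \<exists>b\<in>V. ad a b = z)) \<and>
     (\<forall>a\<in>V. \<forall>t. sm t a \<in> V) \<and>
     (\<forall>a\<in>V. sm 1 a = a) \<and>
     (\<forall>a\<in>V. \<forall>s t. sm s (sm t a) = sm (s * t) a) \<and>
     (\<forall>a\<in>V. \<forall>s t. sm (s + t) a = ad (sm s a) (sm t a)) \<and>
     (\<forall>a\<in>V. \<forall>b\<in>V. \<forall>t. sm t (ad a b) = ad (sm t a) (sm t b))"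

definition linear_iso_on_fibre ::
  "('m, 'e, 'n::finite, 'r::finite) vbundle \<Rightarrow> 'm \<Rightarrow> ('e \<Rightarrow> real^'r) \<Rightarrow> bool" where
  "linear_iso_on_fibre E x \<rho> \<longleftrightarrow> bij_betw \<rho> (fibre E x) UNIV \<and>
     (\<forall>a\<in>fibre E x. \<forall>b\<in>fibre E x. \<rho> (vadd E a b) = \<rho> a + \<rho> b) \<and>
     (\<forall>a\<in>fibre E x. \<forall>t. \<rho> (vscale E t a) = t *\<^sub>R \<rho> a)"

definition local_trivialization ::
  "('m::topological_space, 'e::topological_space, 'n::finite, 'r::finite) vbundle \<Rightarrow>
   'm set \<Rightarrow> ('e \<Rightarrow> real^'r) \<Rightarrow> bool" where
  "local_trivialization E U \<rho> \<longleftrightarrow>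
     smooth_map (open_submanifold (tot E) (preimage E U)) euclid \<rho> \<and>
     (\<forall>x\<in>U. linear_iso_on_fibre E x \<rho>) \<and>
     diffeomorphism (open_submanifold (tot E) (preimage E U))
       (product_manifold (open_submanifold (base E) U) euclid) (\<lambda>a. (proj E a, \<rho> a))"

definition smooth_vector_bundle ::
  "('m::{t2_space, second_countable_topology}, 'e::{t2_space, second_countable_topology},
    'n::finite, 'r::finite) vbundle \<Rightarrow> bool" where
  "smooth_vector_bundle E \<longleftrightarrow>
     smooth_manifold (base E) \<and> smooth_manifold (tot E) \<and>
     smooth_map (tot E) (base E) (proj E) \<and> proj E ` points (tot E) = points (base E) \<and>
     (\<forall>x\<in>points (base E). real_vector_space_on (fibre E x) (vadd E) (vscale E)) \<and>
     (\<forall>x\<in>points (base E). \<exists>U \<rho>. open U \<and> x \<in> U \<and> U \<subseteq> points (base E) \<and> local_trivialization E U \<rho>)"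

definition total_triv_triple ::
  "('m::topological_space, 'e::topological_space, 'n::finite, 'r::finite) vbundle \<Rightarrow>
   'm set \<Rightarrow> ('m \<Rightarrow> real^'n) \<Rightarrow> ('e \<Rightarrow> real^'r) \<Rightarrow> bool" where
  "total_triv_triple E U \<phi> \<rho> \<longleftrightarrow> smooth_chart (base E) (U, \<phi>) \<and> local_trivialization E U \<rho>"

record ('m, 'e, 'n, 'r) aug_triv =
  chart_dom :: "'m set"
  chart_map :: "'m \<Rightarrow> real^'n"
  triv :: "'e \<Rightarrow> real^'r"
  pou :: "'m \<Rightarrow> real"

definition aug_total_triv_atlas ::
  "('m::topological_space, 'e::topological_space, 'n::finite, 'r::finite) vbundle \<Rightarrow>
   nat \<Rightarrow> (nat \<Rightarrow> ('m, 'e, 'n, 'r) aug_triv) \<Rightarrow> bool" where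
  "aug_total_triv_atlas E N \<Lambda> \<longleftrightarrow>
     (\<forall>\<alpha>\<in>{1..N}. total_triv_triple E (chart_dom (\<Lambda> \<alpha>)) (chart_map (\<Lambda> \<alpha>)) (triv (\<Lambda> \<alpha>))) \<and>
     (\<Union>\<alpha>\<in>{1..N}. chart_dom (\<Lambda> \<alpha>)) = points (base E) \<and>
     (\<forall>\<alpha>\<in>{1..N}. smooth_map (base E) euclid (pou (\<Lambda> \<alpha>)) \<and>
        (\<forall>x\<in>points (base E). 0 \<le> pou (\<Lambda> \<alpha>) x) \<and>
        points (base E) \<inter> closure {x \<in> points (base E). pou (\<Lambda> \<alpha>) x \<noteq> 0} \<subseteq> chart_dom (\<Lambda> \<alpha>)) \<and>
     (\<forall>x\<in>points (base E). (\<Sum>\<alpha>=1..N. pou (\<Lambda> \<alpha>) x) = 1)"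

definition image_domain :: "('m, 'e, 'n::finite, 'r::finite) aug_triv \<Rightarrow> (real^'n) set" where
  "image_domain \<tau> = chart_map \<tau> ` chart_dom \<tau>"

definition GL_compatible :: "nat \<Rightarrow> (nat \<Rightarrow> ('m, 'e, 'n::finite, 'r::finite) aug_triv) \<Rightarrow> bool" where
  "GL_compatible N \<Lambda> \<longleftrightarrow>
     (\<forall>\<alpha>\<in>{1..N}. image_domain (\<Lambda> \<alpha>) = UNIV \<or> lipschitz_domain (image_domain (\<Lambda> \<alpha>))) \<and>
     (\<forall>\<alpha>\<in>{1..N}. \<forall>\<beta>\<in>{1..N}. let W = chart_dom (\<Lambda> \<alpha>) \<inter> chart_dom (\<Lambda> \<beta>) in W \<noteq> {} \<longrightarrow>
        (\<forall>\<gamma>\<in>{\<alpha>, \<beta>}. chart_map (\<Lambda> \<gamma>) ` W = UNIV \<or> lipschitz_domain (chart_map (\<Lambda> \<gamma>) ` W)))"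


section \<open>Tangent vectors, densities and sections of the functional dual bundle\<close>

text \<open>A tangent vector at \<open>x\<close> is the family of its coordinate representations in all smooth charts
  around \<open>x\<close>, which transform by the derivatives of the transition maps.\<close>

type_synonym ('m, 'n) tangent = "('m, real^'n) chart \<Rightarrow> real^'n"

definition transition_deriv ::
  "('m, real^'n::finite) chart \<Rightarrow> ('m, real^'n) chart \<Rightarrow> 'm \<Rightarrow> real^'n \<Rightarrow> real^'n" where
  "transition_deriv c d x = frechet_derivative (snd d \<circ> inv_into (fst c) (snd c)) (at (snd c x))"

definition tangent_space ::
  "('m::topological_space, real^'n::finite) chart set \<Rightarrow> 'm \<Rightarrow> ('m, 'n) tangent set" where
  "tangent_space A x = {v.
     (\<forall>c d. smooth_chart A c \<and> x \<in> fst c \<and> smooth_chart A d \<and> x \<in> fst d \<longrightarrow>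
        v d = transition_deriv c d x (v c)) \<and>
     (\<forall>c. \<not> (smooth_chart A c \<and> x \<in> fst c) \<longrightarrow> v c = 0)}"

definition coord_frame ::
  "('m::topological_space, real^'n::finite) chart set \<Rightarrow> ('m, real^'n) chart \<Rightarrow> 'm \<Rightarrow>
   'n \<Rightarrow> ('m, 'n) tangent" where
  "coord_frame A c x = (\<lambda>i d. if smooth_chart A d \<and> x \<in> fst d
     then transition_deriv c d x (axis i 1) else 0)"

text \<open>Densities on the tangent space at \<open>x\<close>: functions of \<open>n\<close> tangent vectors that scale by the
  absolute value of the determinant (and vanish, by convention, outside the tangent space).\<close>

definition densities ::
  "('m::topological_space, real^'n::finite) chart set \<Rightarrow> 'm \<Rightarrow> (('n \<Rightarrow> ('m, 'n) tangent) \<Rightarrow> real) set" where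
  "densities A x = {\<mu>.
     (\<forall>X. (\<forall>i. X i \<in> tangent_space A x) \<longrightarrow> (\<forall>a :: real^'n^'n.
        \<mu> (\<lambda>i c. \<Sum>j\<in>UNIV. a $ i $ j *\<^sub>R X j c) = \<bar>det a\<bar> * \<mu> X)) \<and>
     (\<forall>X. \<not> (\<forall>i. X i \<in> tangent_space A x) \<longrightarrow> \<mu> X = 0)}"

text \<open>\<open>|dx\<^sup>1 \<and> \<dots> \<and> dx\<^sup>n|\<close> at \<open>x\<close> for the chart \<open>c\<close> with coordinates \<open>x\<^sup>i\<close>\<close>

definition coord_density ::
  "('m::topological_space, real^'n::finite) chart set \<Rightarrow> ('m, real^'n) chart \<Rightarrow> 'm \<Rightarrow>
   ('n \<Rightarrow> ('m, 'n) tangent) \<Rightarrow> real" where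
  "coord_density A c x = (\<lambda>X. if \<forall>i. X i \<in> tangent_space A x
     then \<bar>det (\<chi> i j. X i c $ j)\<bar> else 0)"

definition fibre_frame ::
  "('m, 'e, 'n::finite, 'r::finite) vbundle \<Rightarrow> ('e \<Rightarrow> real^'r) \<Rightarrow> 'm \<Rightarrow> 'r \<Rightarrow> 'e" where
  "fibre_frame E \<rho> x l = inv_into (fibre E x) \<rho> (axis l 1)"

text \<open>A section \<open>\<eta>\<close> of \<open>E\<^sup>\<or> = Hom(E, D)\<close> is written as \<open>\<eta> (x, a, X) = \<eta>(x)(a)(X)\<close>, where \<open>a\<close> is in the
  fibre of \<open>E\<close> over \<open>x\<close> and \<open>X\<close> is a tuple of tangent vectors at \<open>x\<close>; it is \<open>0\<close> at all other arguments.\<close>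

type_synonym ('m, 'e, 'n) dual_section = "'m \<times> 'e \<times> ('n \<Rightarrow> ('m, 'n) tangent) \<Rightarrow> real"

text \<open>The coefficient functions, on the image of the chart, of a section in the local frame
  \<open>\<rho>\<^sup>l \<otimes> |dx\<^sup>1 \<and> \<dots> \<and> dx\<^sup>n|\<close> of \<open>E\<^sup>\<or>\<close>.\<close>

definition section_coeff ::
  "('m::topological_space, 'e, 'n::finite, 'r::finite) vbundle \<Rightarrow>
   'm set \<Rightarrow> ('m \<Rightarrow> real^'n) \<Rightarrow> ('e \<Rightarrow> real^'r) \<Rightarrow> 'r \<Rightarrow>
   ('m, 'e, 'n) dual_section \<Rightarrow> (real^'n \<Rightarrow> real)" where
  "section_coeff E U \<phi> \<rho> l \<eta> = (\<lambda>z. let x = inv_into U \<phi> z in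
     \<eta> (x, fibre_frame E \<rho> x l, coord_frame (base E) (U, \<phi>) x))"

definition smooth_dual_sections ::
  "('m::topological_space, 'e::topological_space, 'n::finite, 'r::finite) vbundle \<Rightarrow>
   ('m, 'e, 'n) dual_section set" where
  "smooth_dual_sections E = {\<eta>.
     (\<forall>x\<in>points (base E).
        (\<forall>a\<in>fibre E x. (\<lambda>X. \<eta> (x, a, X)) \<in> densities (base E) x) \<and>
        (\<forall>a\<in>fibre E x. \<forall>b\<in>fibre E x. \<forall>X. \<eta> (x, vadd E a b, X) = \<eta> (x, a, X) + \<eta> (x, b, X)) \<and>
        (\<forall>a\<in>fibre E x. \<forall>t X. \<eta> (x, vscale E t a, X) = t * \<eta> (x, a, X))) \<and>
     (\<forall>x a X. \<not> (x \<in> points (base E) \<and> a \<in> fibre E x) \<longrightarrow> \<eta> (x, a, X) = 0) \<and>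
     (\<forall>U \<phi> \<rho>. total_triv_triple E U \<phi> \<rho> \<longrightarrow>
        (\<forall>l. smooth_on (\<phi> ` U) (section_coeff E U \<phi> \<rho> l \<eta>)))}"


section \<open>Distributions and Sobolev spaces of sections\<close>

definition test_section_family ::
  "('m::topological_space, 'e::topological_space, 'n::finite, 'r::finite) vbundle \<Rightarrow>
   ('m, 'e, 'n) dual_section set set" where
  "test_section_family E =
     {{\<eta> \<in> smooth_dual_sections E. \<forall>x a X. x \<notin> K \<longrightarrow> \<eta> (x, a, X) = 0} | K.
        compact K \<and> K \<subseteq> points (base E)}"

definition section_seminorms ::
  "('m::topological_space, 'e::topological_space, 'n::finite, 'r::finite) vbundle \<Rightarrow>
   (('m, 'e, 'n) dual_section \<Rightarrow> real) set" where
  "section_seminorms E =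
     {\<lambda>\<eta>. SUP z\<in>\<phi> ` K. \<bar>mpd \<nu> (section_coeff E U \<phi> \<rho> l \<eta>) z\<bar> | U \<phi> \<rho> K \<nu> l.
        total_triv_triple E U \<phi> \<rho> \<and> compact K \<and> K \<noteq> {} \<and> K \<subseteq> U}"

definition bundle_distributions ::
  "('m::topological_space, 'e::topological_space, 'n::finite, 'r::finite) vbundle \<Rightarrow>
   (('m, 'e, 'n) dual_section \<Rightarrow> real) set" where
  "bundle_distributions E = lf_dual (section_seminorms E) (test_section_family E)"

definition pou_mult ::
  "('m \<Rightarrow> real) \<Rightarrow> (('m, 'e, 'n) dual_section \<Rightarrow> real) \<Rightarrow> (('m, 'e, 'n) dual_section \<Rightarrow> real)" where
  "pou_mult \<psi> u = dist_mult (\<lambda>(x, a, X). \<psi> x) u"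

text \<open>The section \<open>g\<^bsub>l,\<xi>\<^esub>\<close> of \<open>E\<^sup>\<or>\<close>, and the components of the local representation \<open>H\<^sub>\<alpha>(u)\<close>.\<close>

definition local_test_section ::
  "('m::topological_space, 'e, 'n::finite, 'r::finite) vbundle \<Rightarrow> ('m, 'e, 'n, 'r) aug_triv \<Rightarrow>
   'r \<Rightarrow> (real^'n \<Rightarrow> real) \<Rightarrow> ('m, 'e, 'n) dual_section" where
  "local_test_section E \<tau> l \<xi> = (\<lambda>(x, a, X). if x \<in> chart_dom \<tau> \<and> a \<in> fibre E x
     then \<xi> (chart_map \<tau> x) * (triv \<tau> a $ l) * coord_density (base E) (chart_dom \<tau>, chart_map \<tau>) x X else 0)"

definition local_rep ::
  "('m::topological_space, 'e, 'n::finite, 'r::finite) vbundle \<Rightarrow> ('m, 'e, 'n, 'r) aug_triv \<Rightarrow>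
   (('m, 'e, 'n) dual_section \<Rightarrow> real) \<Rightarrow> 'r \<Rightarrow> ((real^'n \<Rightarrow> real) \<Rightarrow> real)" where
  "local_rep E \<tau> u l = (\<lambda>\<xi>. u (local_test_section E \<tau> l \<xi>))"

definition bundle_sob_norm ::
  "('m::topological_space, 'e, 'n::finite, 'r::finite) vbundle \<Rightarrow> nat \<Rightarrow>
   (nat \<Rightarrow> ('m, 'e, 'n, 'r) aug_triv) \<Rightarrow> real \<Rightarrow> real \<Rightarrow> (('m, 'e, 'n) dual_section \<Rightarrow> real) \<Rightarrow> ennreal" where
  "bundle_sob_norm E N \<Lambda> e q u =
     (\<Sum>\<alpha>=1..N. \<Sum>l\<in>UNIV. sob_norm e q (image_domain (\<Lambda> \<alpha>))
        (local_rep E (\<Lambda> \<alpha>) (pou_mult (pou (\<Lambda> \<alpha>)) u) l))"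

definition bundle_sob_space ::
  "('m::topological_space, 'e::topological_space, 'n::finite, 'r::finite) vbundle \<Rightarrow> nat \<Rightarrow>
   (nat \<Rightarrow> ('m, 'e, 'n, 'r) aug_triv) \<Rightarrow> real \<Rightarrow> real \<Rightarrow> (('m, 'e, 'n) dual_section \<Rightarrow> real) set" where
  "bundle_sob_space E N \<Lambda> e q =
     {u \<in> bundle_distributions E. bundle_sob_norm E N \<Lambda> e q u < \<infinity>}"

end

theory Submission
 imports Defs
begin

text \<open>Let \<open>\<xi>\<close> be a test function on the image of the chart \<open>\<alpha>\<close>.  Because \<open>\<Sum>\<psi>\<^sub>\<beta> = 1\<close>, a test section
  with coefficient \<open>\<xi>\<eta>\<close> in the frame \<open>\<alpha>\<close> is the sum of its products with the \<open>\<psi>\<^sub>\<beta>\<close>.  Over the overlap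
  with \<open>U\<^sub>\<beta>\<close> its coefficients in the frame \<open>\<beta>\<close> are \<open>\<eta> \<circ> T\<^sub>\<beta>\<close> times smooth functions, where \<open>T\<^sub>\<beta>\<close> is the
  change of coordinates; these functions contain \<open>\<xi>\<close>, the change of trivialization and the absolute value of
  the Jacobian determinant.  Since \<open>supp \<psi>\<^sub>\<beta>\<close> and the preimage of \<open>supp \<xi>\<close> meet in a compact subset of
  the overlap, the smooth functions may be replaced by test functions \<open>m\<^sub>\<beta>\<^sub>l\<close> on it
  (\<open>localized_section\<close>).  Evaluating \<open>u\<close> gives (\<open>local_rep_decomposition\<close>)
  \<open>\<xi> H\<^sub>\<alpha>(u)\<^sup>i (\<eta>) = \<Sum>\<beta> l. H\<^sub>\<beta>(\<psi>\<^sub>\<beta> u)\<^sup>l (m\<^sub>\<beta>\<^sub>l (\<eta> \<circ> T\<^sub>\<beta>))\<close>,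
  and the estimate follows once \<open>F \<mapsto> (\<eta> \<mapsto> F (m (\<eta> \<circ> T)))\<close> is bounded for the norms of
  \<open>W\<^bsup>e,q\<^esup>\<close>, for a diffeomorphism \<open>T\<close> of open sets and a test function \<open>m\<close> on its domain
  (\<open>sob_norm_pull\<close>).

  For \<open>e < 0\<close> this is dual to the boundedness of the weighted pullback \<open>\<eta> \<mapsto> m (\<eta> \<circ> T)\<close> on \<open>W\<^bsup>-e,q'\<^esup>\<close>.  For
  \<open>e \<ge> 0\<close> the distribution is a function, and it is transformed by the adjoint, which is again a weighted
  pullback, along the inverse of \<open>T\<close>.  So everything rests on weighted pullbacks being bounded on \<open>W\<^bsup>s,p\<^esup>\<close>
 for \<open>s \<ge> 0\<close> and \<open>1 < p < \<infinity>\<close> (\<open>sob_pull\<close>); they have compact support in the domain of \<open>T\<close> and are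
 estimated on the whole space.  For integer \<open>s\<close> this is the chain rule for weak derivatives
 (\<open>weak_pds_pull\<close>) with the change of variables formula.  For \<open>s = k + \<theta>\<close> the Gagliardo energy of
 \<open>m (g \<circ> T)\<close> is bounded by splitting the differences into differences of \<open>m\<close> and of \<open>g\<close>
 (\<open>frac_energy_pull\<close>).  Derivatives of order \<open>k\<close> of a weighted pullback also contain derivatives of lower order,
 whose Gagliardo energy is not part of the norm; it is controlled by their weak gradients, because
 a difference of function values is a mean of the gradient along a segment
 (\<open>difference_formula\<close>, \<open>frac_energy_gradient\<close>).

 Finally \<open>H\<^sub>\<alpha>(u)\<^sup>i\<close> and \<open>\<xi> H\<^sub>\<alpha>(u)\<^sup>i\<close> are distributions because they are compositions of continuous functionals with
 linear maps that are bounded on each step of the inductive limit (\<open>lf_dual_pullback\<close>).\<close>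

section \<open>Calculus of smooth maps\<close>

lemma Ck_on_SucD:
 "Ck_on (Suc k) S f \<Longrightarrow> x \<in> S \<Longrightarrow> (f has_derivative frechet_derivative f (at x)) (at x)"
 by (simp add: frechet_derivative_works[symmetric])

lemma Ck_on_cong:
 assumes S: "open S" and "\<And>x. x \<in> S \<Longrightarrow> f x = g x" and "Ck_on k S f"
 shows "Ck_on k S g"
 using assms(2,3)
proof (induction k arbitrary: f g)
 case 0
 thus ?case by (simp cong: continuous_on_cong_simp)
next
 case (Suc k)
 have d: "(g has_derivative frechet_derivative f (at x)) (at x)" if "x \<in> S" for x
  using has_derivative_transform_within_open[OF Ck_on_SucD[OF Suc.prems(2) that] S that] Suc.prems(1)
  by blast
 hence e: "frechet_derivative f (at x) = frechet_derivative g (at x)" if "x \<in> S" for x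
  using frechet_derivative_at that by blast
 have "Ck_on k S (\<lambda>x. frechet_derivative g (at x) v)" for v
  by (rule Suc.IH[of "\<lambda>x. frechet_derivative f (at x) v"]) (use e Suc.prems in auto)
 thus ?case using d by (auto simp: differentiable_def)
qed

lemma Ck_on_SucI:
 assumes S: "open S" and d: "\<And>x. x \<in> S \<Longrightarrow> (f has_derivative f' x) (at x)"
  and c: "\<And>v. Ck_on k S (\<lambda>x. f' x v)"
 shows "Ck_on (Suc k) S f"
proof -
 have "Ck_on k S (\<lambda>x. frechet_derivative f (at x) v)" for v
  by (rule Ck_on_cong[OF S _ c[of v]]) (use d frechet_derivative_at in fastforce)
 thus ?thesis using d by (auto simp: differentiable_def)
qed

lemma Ck_on_pred: "Ck_on (Suc k) S f \<Longrightarrow> Ck_on k S f"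
proof (induction k arbitrary: f)
 case 0
 thus ?case
  by (auto intro!: continuous_at_imp_continuous_on differentiable_imp_continuous_within)
qed simp

lemma Ck_on_subset: "Ck_on k S f \<Longrightarrow> T \<subseteq> S \<Longrightarrow> Ck_on k T f"
 by (induction k arbitrary: f) (auto intro: continuous_on_subset)

lemma Ck_on_local:
 assumes "\<And>x. x \<in> S \<Longrightarrow> \<exists>N. open N \<and> x \<in> N \<and> Ck_on k N f"
 shows "Ck_on k S f"
 using assms
proof (induction k arbitrary: f)
 case 0
 thus ?case
  by (auto intro!: continuous_at_imp_continuous_on) (metis continuous_on_eq_continuous_at)
next
 case (Suc k)
 thus ?case
  by simp meson
qed

lemma Ck_on_const: "open S \<Longrightarrow> Ck_on k S (\<lambda>x. c)"
proof (induction k arbitrary: c)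
 case (Suc k)
 show ?case by (rule Ck_on_SucI[OF Suc.prems]) (auto intro!: derivative_eq_intros Suc)
qed simp

lemma Ck_on_bounded_linear:
 assumes "open S" "bounded_linear h" "Ck_on k S f"
 shows "Ck_on k S (\<lambda>x. h (f x))"
 using assms(3)
proof (induction k arbitrary: f)
 case 0
 thus ?case using bounded_linear.continuous_on[OF assms(2)] by auto
next
 case (Suc k)
 show ?case
  by (rule Ck_on_SucI[OF assms(1) bounded_linear.has_derivative[OF assms(2) Ck_on_SucD[OF Suc.prems]]])
    (use Suc in auto)
qed

lemma Ck_on_add: "open S \<Longrightarrow> Ck_on k S f \<Longrightarrow> Ck_on k S g \<Longrightarrow> Ck_on k S (\<lambda>x. f x + g x)"
proof (induction k arbitrary: f g)
 case (Suc k)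
 show ?case
  by (rule Ck_on_SucI[OF Suc.prems(1) has_derivative_add[OF Ck_on_SucD Ck_on_SucD]])
   (use Suc in auto)
qed (auto intro: continuous_on_add)

lemma Ck_on_sum: "open S \<Longrightarrow> (\<And>i. i \<in> I \<Longrightarrow> Ck_on k S (f i)) \<Longrightarrow> Ck_on k S (\<lambda>x. \<Sum>i\<in>I. f i x)"
 by (induction I rule: infinite_finite_induct) (auto intro: Ck_on_const Ck_on_add)

lemma Ck_on_scaleR:
 "open S \<Longrightarrow> Ck_on k S f \<Longrightarrow> Ck_on k S g \<Longrightarrow> Ck_on k S (\<lambda>x. f x *\<^sub>R g x)"
proof (induction k arbitrary: f g)
 case (Suc k)
 note p = Ck_on_pred[OF Suc.prems(2)] Ck_on_pred[OF Suc.prems(3)]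
 show ?case
  by (rule Ck_on_SucI[OF Suc.prems(1) has_derivative_scaleR[OF Ck_on_SucD Ck_on_SucD]])
   (use Suc p in \<open>auto intro!: Ck_on_add\<close>)
qed (auto intro: continuous_on_scaleR)

text \<open>The derivative of the composition is expanded in a basis, which makes it a sum of products of
  functions that are of class \<open>C\<^sup>k\<close> by induction.\<close>

lemma Ck_on_compose:
 fixes f :: "'a::euclidean_space \<Rightarrow> 'b::euclidean_space" and g :: "'b \<Rightarrow> 'c::euclidean_space"
 assumes S: "open S" and fS: "f ` S \<subseteq> T" and "Ck_on k S f" "Ck_on k T g"
 shows "Ck_on k S (\<lambda>x. g (f x))"
 using assms(3,4)
proof (induction k arbitrary: g)
 case 0
 thus ?case using fS continuous_on_compose2 by auto
next
 case (Suc k)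
 let ?g' = "\<lambda>y. frechet_derivative g (at y)" and ?f' = "\<lambda>x. frechet_derivative f (at x)"
 have d: "((\<lambda>x. g (f x)) has_derivative (\<lambda>v. ?g' (f x) (?f' x v))) (at x)" if "x \<in> S" for x
  using has_derivative_compose[OF Ck_on_SucD[OF Suc.prems(1) that] Ck_on_SucD[OF Suc.prems(2)]] fS that
  by auto
 have e: "(\<Sum>b\<in>Basis. (?f' x v \<bullet> b) *\<^sub>R ?g' (f x) b) = ?g' (f x) (?f' x v)" if "x \<in> S" for x v
 proof -
  have l: "linear (?g' (f x))"
   using has_derivative_linear Ck_on_SucD[OF Suc.prems(2)] fS that by blast
  have "?g' (f x) (?f' x v) = ?g' (f x) (\<Sum>b\<in>Basis. (?f' x v \<bullet> b) *\<^sub>R b)"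
   by (simp add: euclidean_representation)
  thus ?thesis by (simp add: linear_sum[OF l] linear_cmul[OF l])
 qed
 show ?case
 proof (rule Ck_on_SucI[OF S d])
  fix v
  have "Ck_on k S (\<lambda>x. \<Sum>b\<in>Basis. (?f' x v \<bullet> b) *\<^sub>R ?g' (f x) b)"
  proof (intro Ck_on_sum Ck_on_scaleR S)
   fix b
   show "Ck_on k S (\<lambda>x. ?f' x v \<bullet> b)"
    using Suc.prems(1) by (intro Ck_on_bounded_linear[OF S bounded_linear_inner_left]) auto
   show "Ck_on k S (\<lambda>x. ?g' (f x) b)"
    using Suc.prems by (intro Suc.IH Ck_on_pred[OF Suc.prems(1)]) auto
  qed
  thus "Ck_on k S (\<lambda>x. ?g' (f x) (?f' x v))"
   by (rule Ck_on_cong[OF S, rotated]) (rule e)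
 qed
qed

lemma smooth_on_Ck: "smooth_on S f \<Longrightarrow> Ck_on k S f"
 by (simp add: smooth_on_def)

lemma smooth_on_cong: "open S \<Longrightarrow> (\<And>x. x \<in> S \<Longrightarrow> f x = g x) \<Longrightarrow> smooth_on S f \<Longrightarrow> smooth_on S g"
 unfolding smooth_on_def using Ck_on_cong by blast

lemma smooth_on_subset: "smooth_on S f \<Longrightarrow> T \<subseteq> S \<Longrightarrow> smooth_on T f"
 unfolding smooth_on_def using Ck_on_subset by blast

lemma smooth_on_local:
 "(\<And>x. x \<in> S \<Longrightarrow> \<exists>N. open N \<and> x \<in> N \<and> smooth_on N f) \<Longrightarrow> smooth_on S f"
 unfolding smooth_on_def using Ck_on_local by meson

lemma smooth_on_const: "open S \<Longrightarrow> smooth_on S (\<lambda>x. c)"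
 unfolding smooth_on_def using Ck_on_const by blast

lemma smooth_on_bounded_linear:
 "open S \<Longrightarrow> bounded_linear h \<Longrightarrow> smooth_on S f \<Longrightarrow> smooth_on S (\<lambda>x. h (f x))"
 unfolding smooth_on_def using Ck_on_bounded_linear by blast

lemma smooth_on_add: "open S \<Longrightarrow> smooth_on S f \<Longrightarrow> smooth_on S g \<Longrightarrow> smooth_on S (\<lambda>x. f x + g x)"
 unfolding smooth_on_def using Ck_on_add by blast

lemma smooth_on_sum:
 "open S \<Longrightarrow> (\<And>i. i \<in> I \<Longrightarrow> smooth_on S (f i)) \<Longrightarrow> smooth_on S (\<lambda>x. \<Sum>i\<in>I. f i x)"
 unfolding smooth_on_def using Ck_on_sum[of S I _ f] by blast

lemma smooth_on_scaleR:
 "open S \<Longrightarrow> smooth_on S f \<Longrightarrow> smooth_on S g \<Longrightarrow> smooth_on S (\<lambda>x. f x *\<^sub>R g x)"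
 unfolding smooth_on_def using Ck_on_scaleR by blast

lemma smooth_on_mult:
 fixes f g :: "'a::euclidean_space \<Rightarrow> real"
 shows "open S \<Longrightarrow> smooth_on S f \<Longrightarrow> smooth_on S g \<Longrightarrow> smooth_on S (\<lambda>x. f x * g x)"
 using smooth_on_scaleR[of S f g] by simp

lemma smooth_on_prod:
 fixes f :: "'i \<Rightarrow> 'a::euclidean_space \<Rightarrow> real"
 shows "open S \<Longrightarrow> (\<And>i. i \<in> I \<Longrightarrow> smooth_on S (f i)) \<Longrightarrow> smooth_on S (\<lambda>x. \<Prod>i\<in>I. f i x)"
 by (induction I rule: infinite_finite_induct) (auto intro: smooth_on_const smooth_on_mult)

lemma smooth_on_compose:
 assumes "open S" "f ` S \<subseteq> T" "smooth_on S f" "smooth_on T g"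
 shows "smooth_on S (\<lambda>x. g (f x))"
 using Ck_on_compose[OF assms(1,2)] assms(3,4) unfolding smooth_on_def by blast

lemma smooth_on_id: "open S \<Longrightarrow> smooth_on S (\<lambda>x. x)"
 unfolding smooth_on_def
proof
 fix k assume S: "open S"
 show "Ck_on k S (\<lambda>x. x)"
 proof (cases k)
  case (Suc j)
  show ?thesis unfolding Suc
   by (rule Ck_on_SucI[OF S has_derivative_ident]) (rule Ck_on_const[OF S])
 qed simp
qed

lemma smooth_on_diff:
 fixes f g :: "'a::euclidean_space \<Rightarrow> 'b::euclidean_space"
 shows "open S \<Longrightarrow> smooth_on S f \<Longrightarrow> smooth_on S g \<Longrightarrow> smooth_on S (\<lambda>x. f x - g x)"
 using smooth_on_add[of S f "\<lambda>x. - g x"]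
  smooth_on_bounded_linear[OF _ bounded_linear_minus[OF bounded_linear_ident], of S g] by simp

lemma smooth_on_continuous: "smooth_on S f \<Longrightarrow> continuous_on S f"
 using smooth_on_Ck[of S f 0] by simp

lemma smooth_on_has_derivative:
 "smooth_on S f \<Longrightarrow> x \<in> S \<Longrightarrow> (f has_derivative frechet_derivative f (at x)) (at x)"
 using smooth_on_Ck[of S f "Suc 0"] Ck_on_SucD by blast

lemma smooth_on_frechet: "smooth_on S f \<Longrightarrow> smooth_on S (\<lambda>x. frechet_derivative f (at x) v)"
 unfolding smooth_on_def using Ck_on.simps(2) by blast

text \<open>The derivative of \<open>1 / f\<close> is, up to sign, the square of \<open>1 / f\<close> times the derivative of \<open>f\<close>,
  so induction on the order applies.\<close>

lemma smooth_on_inverse: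
 fixes f :: "'a::euclidean_space \<Rightarrow> real"
 assumes S: "open S" and nz: "\<And>x. x \<in> S \<Longrightarrow> f x \<noteq> 0" and f: "smooth_on S f"
 shows "smooth_on S (\<lambda>x. inverse (f x))"
proof -
 have "Ck_on k S (\<lambda>x. inverse (f x))" for k
 proof (induction k)
  case 0
  thus ?case using nz smooth_on_continuous[OF f] by (auto intro: continuous_on_inverse)
 next
  case (Suc k)
  have k: "Ck_on k S (\<lambda>x. frechet_derivative f (at x) v)" for v
   using smooth_on_frechet[OF f] smooth_on_Ck by blast
  have "Ck_on k S (\<lambda>x. (-1) *\<^sub>R (inverse (f x) *\<^sub>R (frechet_derivative f (at x) v *\<^sub>R inverse (f x))))" for v
   by (intro Ck_on_scaleR Ck_on_const S Suc k)
  thus ?case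
   by (intro Ck_on_SucI[OF S Deriv.has_derivative_inverse[OF nz smooth_on_has_derivative[OF f]]]) (auto simp: mult.assoc)
 qed
 thus ?thesis by (simp add: smooth_on_def)
qed

lemma smooth_on_abs:
 fixes f :: "'a::euclidean_space \<Rightarrow> real"
 assumes S: "open S" and nz: "\<And>x. x \<in> S \<Longrightarrow> f x \<noteq> 0" and f: "smooth_on S f"
 shows "smooth_on S (\<lambda>x. \<bar>f x\<bar>)"
proof (rule smooth_on_local)
 fix x assume x: "x \<in> S"
 define P where "P = S \<inter> f -` {0<..}"
 define M where "M = S \<inter> f -` {..<0}"
 have o: "open P" "open M"
  unfolding P_def M_def
  by (auto intro!: continuous_open_preimage smooth_on_continuous[OF f] S)
 have "smooth_on P (\<lambda>x. \<bar>f x\<bar>)"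
  by (rule smooth_on_cong[OF o(1) _ smooth_on_subset[OF f]]) (auto simp: P_def)
 moreover have "smooth_on M (\<lambda>x. \<bar>f x\<bar>)"
  by (rule smooth_on_cong[OF o(2) _ smooth_on_bounded_linear[OF o(2) bounded_linear_minus[OF bounded_linear_ident] smooth_on_subset[OF f]]])
    (auto simp: M_def)
 moreover have "x \<in> P \<or> x \<in> M" using nz[OF x] x by (auto simp: P_def M_def)
 ultimately show "\<exists>N. open N \<and> x \<in> N \<and> smooth_on N (\<lambda>x. \<bar>f x\<bar>)" using o by blast
qed

lemma smooth_on_nth: "open S \<Longrightarrow> smooth_on S f \<Longrightarrow> smooth_on S (\<lambda>x. f x $ i)"
 by (rule smooth_on_bounded_linear[OF _ bounded_linear_vec_nth])

lemma smooth_on_det: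
 fixes A :: "'a::euclidean_space \<Rightarrow> real^'n^'n"
 assumes S: "open S" and A: "\<And>i j. smooth_on S (\<lambda>x. A x $ i $ j)"
 shows "smooth_on S (\<lambda>x. det (A x))"
 unfolding det_def
 by (intro smooth_on_sum smooth_on_mult smooth_on_const smooth_on_prod S A)

lemma smooth_on_Pair:
 assumes S: "open S" and "smooth_on S f" "smooth_on S g"
 shows "smooth_on S (\<lambda>x. (f x, g x))"
proof -
 have "smooth_on S (\<lambda>x. (f x, 0) + (0, g x))"
  by (intro smooth_on_add S smooth_on_bounded_linear[OF S _ assms(2), of "\<lambda>u. (u, 0)"]
    smooth_on_bounded_linear[OF S _ assms(3), of "\<lambda>u. (0, u)"] bounded_linear_Pair
    bounded_linear_ident bounded_linear_zero)
 thus ?thesis by simp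
qed

text \<open>By the mean value theorem applied twice, the second difference quotient
  of \<open>f\<close> in the directions \<open>u\<close> and \<open>v\<close> is a value of either iterated derivative near \<open>x\<close>.\<close>

lemma second_difference:
 fixes f :: "'a::euclidean_space \<Rightarrow> real"
 assumes f: "smooth_on (ball x r) f" and h: "0 < h" "h * (norm u + norm v) < r"
 shows "\<exists>y. norm (y - x) \<le> h * (norm u + norm v) \<and>
  f (x + h *\<^sub>R u + h *\<^sub>R v) - f (x + h *\<^sub>R u) - f (x + h *\<^sub>R v) + f x =
  h\<^sup>2 * frechet_derivative (\<lambda>z. frechet_derivative f (at z) u) (at y) v"
proof -
 let ?D = "\<lambda>z. frechet_derivative f (at z)"
 let ?E = "\<lambda>z. frechet_derivative (\<lambda>z. ?D z u) (at z) v"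
 have near: "norm (s *\<^sub>R u + t *\<^sub>R v) \<le> h * (norm u + norm v)" if "0 \<le> s" "s \<le> h" "0 \<le> t" "t \<le> h" for s t
 proof -
  have "norm (s *\<^sub>R u + t *\<^sub>R v) \<le> s * norm u + t * norm v"
   using that by (metis norm_triangle_le norm_scaleR abs_of_nonneg order_refl)
  also have "\<dots> \<le> h * norm u + h * norm v"
   using that by (intro add_mono mult_right_mono) auto
  finally show ?thesis by (simp add: distrib_left)
 qed
 have inb: "x + s *\<^sub>R u + t *\<^sub>R v \<in> ball x r" if "0 \<le> s" "s \<le> h" "0 \<le> t" "t \<le> h" for s t
 proof -
  have "dist x (x + (s *\<^sub>R u + t *\<^sub>R v)) = norm (s *\<^sub>R u + t *\<^sub>R v)"
   using dist_norm[of "x + (s *\<^sub>R u + t *\<^sub>R v)" x] by (simp add: dist_commute)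
  thus ?thesis using near[OF that] h(2) by (simp add: add.assoc)
 qed
 have d1: "((\<lambda>s. f (x + s *\<^sub>R u + t *\<^sub>R v)) has_derivative (\<lambda>\<delta>. \<delta> * ?D (x + s *\<^sub>R u + t *\<^sub>R v) u)) (at s)"
  if "0 \<le> s" "s \<le> h" "0 \<le> t" "t \<le> h" for s t
 proof -
  have "((\<lambda>s. f (x + s *\<^sub>R u + t *\<^sub>R v)) has_derivative (\<lambda>\<delta>. ?D (x + s *\<^sub>R u + t *\<^sub>R v) (\<delta> *\<^sub>R u))) (at s)"
   by (rule has_derivative_compose[where f = "\<lambda>s. x + s *\<^sub>R u + t *\<^sub>R v" and g = f,
      OF _ smooth_on_has_derivative[OF f inb[OF that]]])
     (auto intro!: derivative_eq_intros)
  moreover have "linear (?D (x + s *\<^sub>R u + t *\<^sub>R v))"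
   using smooth_on_has_derivative[OF f inb[OF that]] has_derivative_linear by blast
  ultimately show ?thesis by (simp add: linear_cmul)
 qed
 define g where "g s = f (x + s *\<^sub>R u + h *\<^sub>R v) - f (x + s *\<^sub>R u + 0 *\<^sub>R v)" for s
 have "\<exists>s>0. s < h \<and> g h - g 0 = (h - 0) * (?D (x + s *\<^sub>R u + h *\<^sub>R v) u - ?D (x + s *\<^sub>R u + 0 *\<^sub>R v) u)"
 proof (rule MVT2[OF h(1)])
  fix s assume s: "0 \<le> s" "s \<le> h"
  have "(g has_derivative (\<lambda>\<delta>. \<delta> * ?D (x + s *\<^sub>R u + h *\<^sub>R v) u - \<delta> * ?D (x + s *\<^sub>R u + 0 *\<^sub>R v) u)) (at s)"
   unfolding g_def using h(1) by (intro has_derivative_diff d1 s) auto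
  thus "(g has_real_derivative ?D (x + s *\<^sub>R u + h *\<^sub>R v) u - ?D (x + s *\<^sub>R u + 0 *\<^sub>R v) u) (at s)"
   unfolding has_field_derivative_def by (rule has_derivative_eq_rhs) (simp add: fun_eq_iff algebra_simps)
 qed
 then obtain s where s: "0 < s" "s < h"
  and g: "g h - g 0 = h * (?D (x + s *\<^sub>R u + h *\<^sub>R v) u - ?D (x + s *\<^sub>R u + 0 *\<^sub>R v) u)" by auto
 have "\<exists>t>0. t < h \<and> ?D (x + s *\<^sub>R u + h *\<^sub>R v) u - ?D (x + s *\<^sub>R u + 0 *\<^sub>R v) u = (h - 0) * ?E (x + s *\<^sub>R u + t *\<^sub>R v)"
 proof (rule MVT2[OF h(1), of "\<lambda>t. ?D (x + s *\<^sub>R u + t *\<^sub>R v) u"])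
  fix t assume t: "0 \<le> t" "t \<le> h"
  note hd = smooth_on_has_derivative[OF smooth_on_frechet[OF f, of u] inb[OF _ _ t]]
  have "((\<lambda>t. ?D (x + s *\<^sub>R u + t *\<^sub>R v) u) has_derivative
    (\<lambda>\<delta>. frechet_derivative (\<lambda>z. ?D z u) (at (x + s *\<^sub>R u + t *\<^sub>R v)) (\<delta> *\<^sub>R v))) (at t)"
   using s by (intro has_derivative_compose[where f = "\<lambda>t. x + s *\<^sub>R u + t *\<^sub>R v"
      and g = "\<lambda>z. ?D z u", OF _ hd]) (auto intro!: derivative_eq_intros)
  moreover have "linear (frechet_derivative (\<lambda>z. ?D z u) (at (x + s *\<^sub>R u + t *\<^sub>R v)))"
   using hd[of s] s has_derivative_linear by fastforce
  ultimately show "((\<lambda>t. ?D (x + s *\<^sub>R u + t *\<^sub>R v) u) has_real_derivative ?E (x + s *\<^sub>R u + t *\<^sub>R v)) (at t)"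
   by (simp add: has_field_derivative_def linear_cmul mult_commute_abs)
 qed
 then obtain t where t: "0 < t" "t < h"
  and e: "?D (x + s *\<^sub>R u + h *\<^sub>R v) u - ?D (x + s *\<^sub>R u + 0 *\<^sub>R v) u = h * ?E (x + s *\<^sub>R u + t *\<^sub>R v)" by auto
 have "f (x + h *\<^sub>R u + h *\<^sub>R v) - f (x + h *\<^sub>R u) - f (x + h *\<^sub>R v) + f x = g h - g 0"
  by (simp add: g_def)
 also have "\<dots> = h\<^sup>2 * ?E (x + s *\<^sub>R u + t *\<^sub>R v)"
  using g e by (simp add: power2_eq_square)
 finally show ?thesis
  using near[of s t] s t by (intro exI[of _ "x + s *\<^sub>R u + t *\<^sub>R v"]) (auto simp: algebra_simps)
qed

text \<open>Second differences are symmetric in \<open>u\<close> and \<open>v\<close>; as the increment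
  \<open>h\<close> tends to \<open>0\<close>, both iterated derivatives are limits of the same
  quotients.\<close>

lemma frechet_derivative_commute:
 fixes f :: "'a::euclidean_space \<Rightarrow> real"
 assumes S: "open S" and f: "smooth_on S f" and x: "x \<in> S"
 shows "frechet_derivative (\<lambda>z. frechet_derivative f (at z) u) (at x) v =
     frechet_derivative (\<lambda>z. frechet_derivative f (at z) v) (at x) u"
proof -
 let ?A = "\<lambda>y. frechet_derivative (\<lambda>z. frechet_derivative f (at z) u) (at y) v"
 let ?B = "\<lambda>y. frechet_derivative (\<lambda>z. frechet_derivative f (at z) v) (at y) u"
 obtain r where r: "r > 0" "ball x r \<subseteq> S" using S x openE by blast
 note fr = smooth_on_subset[OF f r(2)]
 define c where "c = norm u + norm v + 1"
 have c: "c > 0" "norm u + norm v < c" by (auto simp: c_def add_nonneg_pos)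
 define h where "h n = r / (c * real (Suc (Suc n)))" for n
 have hp: "h n > 0" for n using r c by (simp add: h_def)
 have hr: "h n * (norm u + norm v) \<le> r / real (Suc (Suc n))" for n
 proof -
  have "h n * (norm u + norm v) \<le> h n * c" using hp[of n] c by (intro mult_left_mono) auto
  thus ?thesis using c by (simp add: h_def)
 qed
 have lt: "r / real (Suc (Suc n)) < r" for n
  using r by (simp add: field_simps add_pos_nonneg)
 have hlt: "h n * (norm u + norm v) < r" "h n * (norm v + norm u) < r" for n
  using hr[of n] lt[of n] by (auto simp: add.commute)
 have "\<forall>n. \<exists>y z. norm (y - x) \<le> r / real (Suc (Suc n)) \<and> norm (z - x) \<le> r / real (Suc (Suc n)) \<and> ?A y = ?B z"
 proof
  fix n
  obtain y where y: "norm (y - x) \<le> h n * (norm u + norm v)"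
   "f (x + h n *\<^sub>R u + h n *\<^sub>R v) - f (x + h n *\<^sub>R u) - f (x + h n *\<^sub>R v) + f x = (h n)\<^sup>2 * ?A y"
   using second_difference[OF fr hp hlt(1)] by blast
  obtain z where z: "norm (z - x) \<le> h n * (norm v + norm u)"
   "f (x + h n *\<^sub>R v + h n *\<^sub>R u) - f (x + h n *\<^sub>R v) - f (x + h n *\<^sub>R u) + f x = (h n)\<^sup>2 * ?B z"
   using second_difference[OF fr hp hlt(2)] by blast
  have "(h n)\<^sup>2 * ?A y = (h n)\<^sup>2 * ?B z" using y(2) z(2) by (simp add: algebra_simps)
  hence "?A y = ?B z" using hp[of n] by simp
  thus "\<exists>y z. norm (y - x) \<le> r / real (Suc (Suc n)) \<and> norm (z - x) \<le> r / real (Suc (Suc n)) \<and> ?A y = ?B z"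
   using order_trans[OF y(1) hr] order_trans[OF z(1)[unfolded add.commute[of "norm v"]] hr]
   by (intro exI[of _ y] exI[of _ z]) simp
 qed
 then obtain y z where yz: "\<And>n. norm (y n - x) \<le> r / real (Suc (Suc n))"
   "\<And>n. norm (z n - x) \<le> r / real (Suc (Suc n))" "\<And>n. ?A (y n) = ?B (z n)" by metis
 have l0: "(\<lambda>n. r / real (Suc (Suc n))) \<longlonglongrightarrow> 0"
  using LIMSEQ_Suc[OF LIMSEQ_Suc[OF lim_const_over_n[of r]]] by simp
 have "y \<longlonglongrightarrow> x" "z \<longlonglongrightarrow> x"
  by (rule LIM_zero_cancel, rule Lim_null_comparison[OF always_eventually l0], simp add: yz(1,2) del: of_nat_Suc)+
 moreover have "isCont ?A x" "isCont ?B x"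
  using smooth_on_continuous[OF smooth_on_frechet[OF smooth_on_frechet[OF f]]] S x
  by (auto simp: continuous_on_eq_continuous_at)
 ultimately have "(\<lambda>n. ?A (y n)) \<longlonglongrightarrow> ?A x" "(\<lambda>n. ?B (z n)) \<longlonglongrightarrow> ?B x"
  by (auto intro: isCont_tendsto_compose)
 thus ?thesis using yz(3) LIMSEQ_unique by auto
qed

section \<open>Smooth cutoff functions\<close>

text \<open>All derivatives of \<open>exp (- 1 / x)\<close>, extended by \<open>0\<close>, are linear
  combinations of these functions.\<close>

definition flat :: "nat \<Rightarrow> real \<Rightarrow> real" where
 "flat n x = (if x > 0 then inverse x ^ n * exp (- inverse x) else 0)"

lemma flat_tendsto_0: "(flat n \<longlongrightarrow> 0) (at 0)"
proof (rule filterlim_split_at)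
 show "(flat n \<longlongrightarrow> 0) (at_left 0)"
  by (rule Lim_transform_eventually[OF tendsto_const])
    (auto simp: flat_def eventually_at_filter)
 have "((\<lambda>x. inverse x ^ n / exp (inverse x)) \<longlongrightarrow> (0::real)) (at_right 0)"
  by (rule filterlim_compose[OF tendsto_power_div_exp_0 filterlim_inverse_at_top_right])
 thus "(flat n \<longlongrightarrow> 0) (at_right 0)"
  by (rule Lim_transform_eventually)
    (auto simp: flat_def eventually_at_filter exp_minus divide_inverse)
qed

text \<open>At \<open>0\<close> the difference quotient of \<open>flat n\<close> is \<open>flat (Suc n)\<close>,
  which tends to \<open>0\<close>.\<close>

lemma flat_deriv: "(flat n has_real_derivative (- real n * flat (Suc n) x + flat (n + 2) x)) (at x)"
proof (cases "x = 0")
 case True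
 have "((\<lambda>h. (flat n (0 + h) - flat n 0) / h) \<longlongrightarrow> 0) (at 0)"
  by (rule Lim_transform_eventually[OF flat_tendsto_0[of "Suc n"]])
    (auto simp: flat_def eventually_at_filter divide_inverse)
 thus ?thesis unfolding True by (simp add: DERIV_def flat_def)
next
 case False
 show ?thesis
 proof (cases "x > 0")
  case True
  have e: "\<forall>\<^sub>F y in nhds x. flat n y = inverse y ^ n * exp (- inverse y)"
   using eventually_nhds_in_open[of "{0<..}" x] True by (auto simp: flat_def elim!: eventually_mono)
  have "((\<lambda>y. inverse y ^ n * exp (- inverse y)) has_real_derivative
      (- real n * flat (Suc n) x + flat (n + 2) x)) (at x)"
  proof (rule DERIV_cong)
   have i: "((\<lambda>y. inverse y) has_real_derivative - (inverse x * inverse x)) (at x)"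
    using DERIV_inverse[of x] True by (simp add: power2_eq_square)
   thus "((\<lambda>y. inverse y ^ n * exp (- inverse y)) has_real_derivative
     of_nat n * (- (inverse x * inverse x) * inverse x ^ (n - Suc 0)) * exp (- inverse x) +
     exp (- inverse x) * - (- (inverse x * inverse x)) * inverse x ^ n) (at x)"
    by (intro DERIV_mult DERIV_power DERIV_fun_exp DERIV_minus)
   show "of_nat n * (- (inverse x * inverse x) * inverse x ^ (n - Suc 0)) * exp (- inverse x) +
     exp (- inverse x) * - (- (inverse x * inverse x)) * inverse x ^ n =
     - real n * flat (Suc n) x + flat (n + 2) x"
   proof -
    have "of_nat n * (- (t * t) * t ^ (n - Suc 0)) * E + E * - (- (t * t)) * t ^ n =
     - real n * (t ^ Suc n * E) + t ^ (n + 2) * E" for t E :: real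
     by (cases n) (simp_all add: algebra_simps)
    from this[of "inverse x" "exp (- inverse x)"] True show ?thesis
     unfolding flat_def by (simp only: if_True)
   qed
  qed
  thus ?thesis by (subst DERIV_cong_ev[OF refl e refl])
 next
  case neg: False
  have e: "\<forall>\<^sub>F y in nhds x. flat n y = 0"
   using eventually_nhds_in_open[of "{..<0}" x] neg \<open>x \<noteq> 0\<close> by (auto simp: flat_def elim!: eventually_mono)
  have "((\<lambda>y. 0) has_real_derivative (- real n * flat (Suc n) x + flat (n + 2) x)) (at x)"
   using neg by (auto simp: flat_def)
  thus ?thesis by (subst DERIV_cong_ev[OF refl e refl])
 qed
qed

lemma smooth_on_flat: "smooth_on UNIV (flat n)"
proof -
 have "Ck_on k UNIV (flat n)" for k
 proof (induction k arbitrary: n)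
  case 0
  show ?case using DERIV_isCont[OF flat_deriv] by (auto intro!: continuous_at_imp_continuous_on)
 next
  case (Suc k)
  have "Ck_on k UNIV (\<lambda>x. v *\<^sub>R ((- real n) *\<^sub>R flat (Suc n) x + flat (n + 2) x))" for v
   by (intro Ck_on_scaleR Ck_on_add Ck_on_const Suc open_UNIV)
  thus ?case
   using flat_deriv[of n]
   by (intro Ck_on_SucI[OF open_UNIV]) (auto simp: has_field_derivative_def mult.commute)
 qed
 thus ?thesis by (simp add: smooth_on_def)
qed

definition unit_step :: "real \<Rightarrow> real" where
 "unit_step t = flat 0 t / (flat 0 t + flat 0 (1 - t))"

lemma flat_0_pos: "flat 0 t \<ge> 0" "flat 0 t > 0 \<longleftrightarrow> t > 0"
 by (auto simp: flat_def)

lemma unit_step_denominator: "flat 0 t + flat 0 (1 - t) > 0"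
 using flat_0_pos[of t] flat_0_pos[of "1 - t"] by (smt (verit))

lemma unit_step_simps: "t \<le> 0 \<Longrightarrow> unit_step t = 0" "t \<ge> 1 \<Longrightarrow> unit_step t = 1"
 "0 \<le> unit_step t" "unit_step t \<le> 1"
 using flat_0_pos[of t] flat_0_pos[of "1 - t"] unit_step_denominator[of t]
 by (auto simp: unit_step_def flat_def)

lemma smooth_on_unit_step: "smooth_on UNIV unit_step"
proof -
 have 1: "smooth_on UNIV (\<lambda>t. flat 0 (1 - t))"
  by (rule smooth_on_compose[OF open_UNIV _ _ smooth_on_flat])
    (auto intro!: smooth_on_diff smooth_on_const smooth_on_id)
 have "smooth_on UNIV (\<lambda>t. flat 0 t * inverse (flat 0 t + flat 0 (1 - t)))"
  by (intro smooth_on_mult smooth_on_inverse smooth_on_add smooth_on_flat 1 open_UNIV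
    less_imp_neq[OF unit_step_denominator, symmetric])
 thus ?thesis by (simp add: unit_step_def[abs_def] divide_inverse)
qed

definition ball_bump :: "'a::euclidean_space \<Rightarrow> real \<Rightarrow> 'a \<Rightarrow> real" where
 "ball_bump c r x = flat 0 (r\<^sup>2 - (x - c) \<bullet> (x - c))"

lemma ball_bump_pos: "r > 0 \<Longrightarrow> ball_bump c r x > 0 \<longleftrightarrow> x \<in> ball c r"
proof -
 assume r: "r > 0"
 have "ball_bump c r x > 0 \<longleftrightarrow> (norm (x - c))\<^sup>2 < r\<^sup>2"
  unfolding ball_bump_def flat_0_pos(2) by (simp add: dot_square_norm)
 also have "\<dots> \<longleftrightarrow> norm (x - c) < r"
  using r power_strict_mono[of "norm (x - c)" r 2] power_less_imp_less_base[of "norm (x - c)" 2 r] by auto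
 finally show ?thesis by (simp add: dist_norm norm_minus_commute)
qed

lemma ball_bump_nonneg: "ball_bump c r x \<ge> 0"
 by (simp add: ball_bump_def flat_0_pos)

lemma smooth_on_ball_bump: "smooth_on UNIV (ball_bump c r)"
 unfolding ball_bump_def[abs_def]
proof (rule smooth_on_compose[OF open_UNIV _ _ smooth_on_flat])
 have "smooth_on UNIV (\<lambda>x. r\<^sup>2 - (\<Sum>b\<in>Basis. ((x - c) \<bullet> b) * ((x - c) \<bullet> b)))"
  by (intro smooth_on_diff smooth_on_const smooth_on_sum smooth_on_mult open_UNIV
    smooth_on_bounded_linear[OF open_UNIV bounded_linear_inner_left] smooth_on_id)
 thus "smooth_on UNIV (\<lambda>x. r\<^sup>2 - (x - c) \<bullet> (x - c))"
  by (simp add: euclidean_inner[symmetric])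
qed auto

text \<open>A finite sum of bumps covering \<open>K\<close> is bounded below by some \<open>e > 0\<close> near
  \<open>K\<close>; dividing by \<open>e\<close> and applying the smooth step truncates it to \<open>1\<close>
 there.\<close>

lemma smooth_cutoff:
 fixes K V :: "'a::euclidean_space set"
 assumes K: "compact K" and V: "open V" "K \<subseteq> V"
 obtains \<kappa> O' L where "smooth_on UNIV \<kappa>" "\<And>x. 0 \<le> \<kappa> x" "\<And>x. \<kappa> x \<le> (1::real)" "open O'" "K \<subseteq> O'"
  "\<And>x. x \<in> O' \<Longrightarrow> \<kappa> x = 1" "compact L" "L \<subseteq> V" "\<And>x. x \<notin> L \<Longrightarrow> \<kappa> x = 0"
proof (cases "K = {}")
 case True
 show thesis
  by (rule that[of "\<lambda>x. 0" "{}" "{}"]) (auto simp: True intro!: smooth_on_const)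
next
 case False
 have "\<forall>x\<in>K. \<exists>r>0. cball x r \<subseteq> V" using V open_contains_cball by blast
 then obtain r where r: "\<And>x. x \<in> K \<Longrightarrow> r x > 0 \<and> cball x (r x) \<subseteq> V" by metis
 obtain F where F: "F \<subseteq> K" "finite F" "K \<subseteq> (\<Union>x\<in>F. ball x (r x))"
  using compactE_image[OF K, of K "\<lambda>x. ball x (r x)"] r by force
 define \<Phi> where "\<Phi> x = (\<Sum>c\<in>F. ball_bump c (r c) x)" for x
 have sm: "smooth_on UNIV \<Phi>"
  unfolding \<Phi>_def[abs_def] by (intro smooth_on_sum smooth_on_ball_bump open_UNIV)
 have pos: "\<Phi> x > 0" if "x \<in> K" for x
 proof -
  obtain c where "c \<in> F" "x \<in> ball c (r c)" using F(3) \<open>x \<in> K\<close> by blast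
  thus ?thesis unfolding \<Phi>_def
   using F r ball_bump_pos[of "r c" c x] by (intro sum_pos2[OF F(2)]) (auto intro: ball_bump_nonneg)
 qed
 obtain x0 where x0: "x0 \<in> K" "\<And>x. x \<in> K \<Longrightarrow> \<Phi> x0 \<le> \<Phi> x"
  using continuous_attains_inf[OF K False continuous_on_subset[OF smooth_on_continuous[OF sm]]] by auto
 define e where "e = \<Phi> x0 / 2"
 have e: "e > 0" "\<And>x. x \<in> K \<Longrightarrow> \<Phi> x > e" using pos[OF x0(1)] x0(2) by (force simp: e_def)+
 show thesis
 proof (rule that[of "\<lambda>x. unit_step (inverse e * \<Phi> x)" "{x. \<Phi> x > e}" "\<Union>c\<in>F. cball c (r c)"])
  show "smooth_on UNIV (\<lambda>x. unit_step (inverse e * \<Phi> x))"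
   by (rule smooth_on_compose[OF open_UNIV _ _ smooth_on_unit_step])
     (auto intro!: smooth_on_mult smooth_on_const sm)
  show "open {x. \<Phi> x > e}"
   using open_Collect_less[OF continuous_on_const smooth_on_continuous[OF sm]] by simp
  show "unit_step (inverse e * \<Phi> x) = 1" if "x \<in> {x. e < \<Phi> x}" for x
   using that e by (intro unit_step_simps) (auto simp: field_simps)
  show "compact (\<Union>c\<in>F. cball c (r c))" using F by (intro compact_UN) auto
  show "(\<Union>c\<in>F. cball c (r c)) \<subseteq> V" using F r by auto
  show "unit_step (inverse e * \<Phi> x) = 0" if "x \<notin> (\<Union>c\<in>F. cball c (r c))" for x
  proof -
   have "ball_bump c (r c) x = 0" if c: "c \<in> F" for c
    using \<open>x \<notin> _\<close> ball_bump_pos[of "r c" c x] ball_bump_nonneg[of c "r c" x] c r F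
    by (force simp: less_le)
   thus ?thesis by (simp add: \<Phi>_def unit_step_simps)
  qed
 qed (use e unit_step_simps in auto)
qed

section \<open>Iterated partial derivatives\<close>

text \<open>Lists of directions admit induction with one derivative at a time; multi-indices are translated into
  lists by \<open>list_of\<close>, and back by counting.\<close>

definition pds :: "'n::finite list \<Rightarrow> (real^'n \<Rightarrow> real) \<Rightarrow> (real^'n \<Rightarrow> real)" where
 "pds is f = foldr pd is f"

lemma pds_simps: "pds [] f = f" "pds (i # is) f = pd i (pds is f)" "pds (is @ js) f = pds is (pds js f)"
 by (simp_all add: pds_def)

lemma smooth_on_pd: "smooth_on S f \<Longrightarrow> smooth_on S (pd i f)"
 unfolding pd_def by (rule smooth_on_frechet)

lemma smooth_on_pds: "smooth_on S f \<Longrightarrow> smooth_on S (pds is f)"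
 by (induction "is") (auto simp: pds_simps intro: smooth_on_pd)

lemma pd_eqI: "(f has_derivative f') (at x) \<Longrightarrow> pd i f x = f' (axis i 1)"
 unfolding pd_def by (metis frechet_derivative_at)

lemma frechet_derivative_pd:
 assumes "f differentiable (at x)"
 shows "frechet_derivative f (at x) v = (\<Sum>i\<in>UNIV. v $ i * pd i f x)"
proof -
 have l: "linear (frechet_derivative f (at x))"
  using assms linear_frechet_derivative by blast
 have "frechet_derivative f (at x) v = frechet_derivative f (at x) (\<Sum>i\<in>UNIV. v $ i *\<^sub>R axis i 1)"
  by (simp add: basis_expansion scalar_mult_eq_scaleR[symmetric])
 thus ?thesis by (simp add: linear_sum[OF l] linear_cmul[OF l] pd_def)
qed

lemma pd_cong:
 assumes "open S" "\<And>x. x \<in> S \<Longrightarrow> f x = g x" "x \<in> S" "f differentiable (at x)"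
 shows "pd i f x = pd i g x"
 unfolding pd_def using frechet_derivative_transform_within_open[OF assms(4,1,3)] assms(2) by simp

lemma pds_cong:
 assumes S: "open S" and e: "\<And>x. x \<in> S \<Longrightarrow> f x = g x" and f: "smooth_on S f" and x: "x \<in> S"
 shows "pds is f x = pds is g x"
 using x
proof (induction "is" arbitrary: x)
 case (Cons i "is")
 have "pds is f differentiable (at x)"
  using smooth_on_has_derivative[OF smooth_on_pds[OF f] Cons.prems] by (auto simp: differentiable_def)
 thus ?case using pd_cong[OF S Cons.IH Cons.prems] by (simp add: pds_simps)
qed (simp add: e pds_simps)

lemma pd_add: "smooth_on S f \<Longrightarrow> smooth_on S g \<Longrightarrow> x \<in> S \<Longrightarrow> pd i (\<lambda>x. f x + g x) x = pd i f x + pd i g x"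
 by (subst pd_eqI[OF has_derivative_add[OF smooth_on_has_derivative smooth_on_has_derivative]])
   (auto simp: pd_def)

lemma pd_mult:
 "smooth_on S f \<Longrightarrow> smooth_on S g \<Longrightarrow> x \<in> S \<Longrightarrow> pd i (\<lambda>x. f x * g x) x = f x * pd i g x + pd i f x * g x"
 by (subst pd_eqI[OF has_derivative_mult[OF smooth_on_has_derivative smooth_on_has_derivative]])
   (auto simp: pd_def)

lemma pd_const: "pd i (\<lambda>x. c) = (\<lambda>x. 0)"
 by (rule ext, rule pd_eqI[OF has_derivative_const])

lemma pd_chain:
 assumes T: "smooth_on S T" and g: "smooth_on R g" and x: "x \<in> S" "T x \<in> R"
 shows "pd i (\<lambda>y. g (T y)) x = (\<Sum>j\<in>UNIV. frechet_derivative T (at x) (axis i 1) $ j * pd j g (T x))"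
proof -
 note hg = smooth_on_has_derivative[OF g x(2)]
 have "pd i (\<lambda>y. g (T y)) x = frechet_derivative g (at (T x)) (frechet_derivative T (at x) (axis i 1))"
  by (rule pd_eqI[OF has_derivative_compose[OF smooth_on_has_derivative[OF T x(1)] hg]])
 thus ?thesis using frechet_derivative_pd[of g "T x"] hg by (auto simp: differentiable_def)
qed

lemma pds_cmult:
 assumes S: "open S" and f: "smooth_on S f" and x: "x \<in> S"
 shows "pds is (\<lambda>x. c * f x) x = c * pds is f x"
 using x
proof (induction "is" arbitrary: x)
 case (Cons i "is")
 have "pd i (pds is (\<lambda>x. c * f x)) x = pd i (\<lambda>x. c * pds is f x) x"
  using Cons smooth_on_has_derivative[OF smooth_on_pds[OF smooth_on_mult[OF S smooth_on_const[OF S, of c] f]]]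
  by (intro pd_cong[OF S]) (auto simp: differentiable_def)
 also have "\<dots> = c * pd i (pds is f) x"
  using pd_mult[OF smooth_on_const[OF S] smooth_on_pds[OF f] Cons.prems] by (simp add: pd_const)
 finally show ?case by (simp add: pds_simps)
qed (simp add: pds_simps)

lemma pd_commute:
 assumes "open S" "smooth_on S f" "x \<in> S"
 shows "pd i (pd j f) x = pd j (pd i f) x"
 using frechet_derivative_commute[OF assms] by (simp add: pd_def)

lemma pds_commute:
 assumes f: "smooth_on UNIV f"
 shows "pds is (pd i f) = pd i (pds is f)"
proof (induction "is")
 case (Cons j "is")
 thus ?case
  using pd_commute[OF open_UNIV smooth_on_pds[OF f]] by (auto simp: pds_simps)
qed (simp add: pds_simps)

lemma pds_count:
 assumes f: "smooth_on UNIV f"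
 shows "(\<And>i. count_list is i = count_list js i) \<Longrightarrow> pds is f = pds js f"
proof (induction "is" arbitrary: js)
 case Nil
 hence "js = []" by (metis count_list.simps(1) count_list_0_iff list.set_intros(1) neq_Nil_conv)
 thus ?case by simp
next
 case (Cons i "is")
 have "i \<in> set js" using Cons.prems[of i] by (metis count_list_0_iff count_list.simps(2) nat.simps(3) add_is_0 one_neq_zero)
 then obtain as bs where js: "js = as @ i # bs" by (meson split_list)
 have "count_list is k = count_list (as @ bs) k" for k
  using Cons.prems[of k] by (auto simp: js split: if_splits)
 hence "pds is f = pds (as @ bs) f" by (rule Cons.IH)
 thus ?case using pds_commute[OF smooth_on_pds[OF f], of as i bs] by (simp add: js pds_simps)
qed

lemma ex_count_list:
 fixes \<nu> :: "'n::finite \<Rightarrow> nat"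
 shows "\<exists>is. \<forall>i. count_list is i = \<nu> i"
proof -
 have "\<exists>is. \<forall>i. count_list is i = (if i \<in> A then \<nu> i else 0)" for A :: "'n set"
 proof (induction A rule: infinite_finite_induct)
  case (insert a A)
  then obtain "is" where i: "\<forall>i. count_list is i = (if i \<in> A then \<nu> i else 0)" by blast
  have r: "count_list (replicate n a) i = (if i = a then n else 0)" for n i
   by (induction n) auto
  show ?case using i insert(2) by (intro exI[of _ "replicate (\<nu> a) a @ is"]) (auto simp: r)
 qed (auto intro: exI[of _ "[]"])
 from this[of UNIV] show ?thesis by simp
qed

definition list_of :: "('n::finite \<Rightarrow> nat) \<Rightarrow> 'n list" where
 "list_of \<nu> = (SOME is. \<forall>i. count_list is i = \<nu> i)"

lemma count_list_of: "count_list (list_of \<nu>) i = \<nu> i"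
 unfolding list_of_def using someI_ex[OF ex_count_list] by blast

lemma mpd_eq_pds: "mpd \<nu> f = pds (list_of \<nu>) f"
 by (simp add: mpd_def pds_def list_of_def)

lemma length_eq_order_of: "order_of (count_list is) = length is"
 unfolding order_of_def by (rule sum_count_set) auto

lemma length_list_of: "length (list_of \<nu>) = order_of \<nu>"
 using length_eq_order_of[of "list_of \<nu>"] count_list_of by (metis ext)

lemma pds_eq_mpd: "smooth_on UNIV f \<Longrightarrow> pds is f = mpd (count_list is) f"
 unfolding mpd_eq_pds by (rule pds_count) (simp_all add: count_list_of)

lemma finite_order_le: "finite {\<nu> :: 'n::finite \<Rightarrow> nat. order_of \<nu> \<le> k}"
proof -
 have "{\<nu> :: 'n \<Rightarrow> nat. order_of \<nu> \<le> k} \<subseteq> PiE UNIV (\<lambda>_. {..k})"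
  unfolding order_of_def by auto (metis UNIV_I finite member_le_sum order_trans zero_le)
 thus ?thesis by (rule finite_subset) (intro finite_PiE; simp)
qed

section \<open>Test functions\<close>

lemma test_functions_iff:
 "\<eta> \<in> test_functions \<O> \<longleftrightarrow> smooth_on UNIV \<eta> \<and> (\<exists>K. compact K \<and> K \<subseteq> \<O> \<and> (\<forall>x. x \<notin> K \<longrightarrow> \<eta> x = 0))"
 by (auto simp: test_functions_def test_function_family_def test_functions_in_def)

lemma test_functionsI:
 assumes "open V" "smooth_on V \<eta>" "compact K" "K \<subseteq> V" "\<And>x. x \<notin> K \<Longrightarrow> \<eta> x = 0"
 shows "\<eta> \<in> test_functions V"
proof -
 have c: "open (- K)" using assms(3) by (simp add: compact_imp_closed open_Compl)
 have "smooth_on (- K) \<eta>"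
  by (rule smooth_on_cong[OF c _ smooth_on_const[OF c, of 0]]) (simp add: assms(5))
 hence "smooth_on UNIV \<eta>"
  using assms c by (intro smooth_on_local) (metis Compl_iff subsetD)
 thus ?thesis using assms by (auto simp: test_functions_iff)
qed

lemma test_functions_mono: "\<eta> \<in> test_functions V \<Longrightarrow> V \<subseteq> \<O> \<Longrightarrow> \<eta> \<in> test_functions \<O>"
 by (auto simp: test_functions_iff)

lemma test_functions_smooth: "\<eta> \<in> test_functions V \<Longrightarrow> smooth_on S \<eta>"
 by (auto simp: test_functions_iff intro: smooth_on_subset)

lemma test_functions_zero: "(\<lambda>x. 0) \<in> test_functions V"
 by (auto simp: test_functions_iff intro!: smooth_on_const exI[of _ "{}"])

lemma test_functions_outside: "\<eta> \<in> test_functions V \<Longrightarrow> x \<notin> V \<Longrightarrow> \<eta> x = 0"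
 by (auto simp: test_functions_iff)

lemma test_functions_add:
 assumes "\<eta> \<in> test_functions V" "\<zeta> \<in> test_functions V"
 shows "(\<lambda>x. \<eta> x + \<zeta> x) \<in> test_functions V"
proof -
 obtain K L where "compact K" "K \<subseteq> V" "\<forall>x. x \<notin> K \<longrightarrow> \<eta> x = 0"
  "compact L" "L \<subseteq> V" "\<forall>x. x \<notin> L \<longrightarrow> \<zeta> x = 0"
  using assms by (auto simp: test_functions_iff)
 thus ?thesis using assms
  by (auto simp: test_functions_iff intro!: smooth_on_add exI[of _ "K \<union> L"])
qed

lemma test_functions_mult:
 assumes V: "open V" and m: "m \<in> test_functions V" and g: "smooth_on V g"
 shows "(\<lambda>x. m x * g x) \<in> test_functions V"
proof -
 obtain K where "compact K" "K \<subseteq> V" "\<forall>x. x \<notin> K \<longrightarrow> m x = 0"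
  using m by (auto simp: test_functions_iff)
 thus ?thesis
  by (intro test_functionsI[OF V smooth_on_mult[OF V test_functions_smooth[OF m] g]]) auto
qed

lemma test_functions_cmult: "m \<in> test_functions V \<Longrightarrow> (\<lambda>x. c * m x) \<in> test_functions V"
 by (auto simp: test_functions_iff intro!: smooth_on_mult smooth_on_const)

lemma test_functions_sum:
 "(\<And>i. i \<in> I \<Longrightarrow> f i \<in> test_functions V) \<Longrightarrow> (\<lambda>x. \<Sum>i\<in>I. f i x) \<in> test_functions V"
 by (induction I rule: infinite_finite_induct) (auto intro: test_functions_zero test_functions_add)

lemma test_functions_pd:
 assumes m: "m \<in> test_functions V"
 shows "pd i m \<in> test_functions V"
proof -
 obtain K where K: "compact K" "K \<subseteq> V" "\<forall>x. x \<notin> K \<longrightarrow> m x = 0"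
  using m by (auto simp: test_functions_iff)
 have "pd i m x = 0" if "x \<notin> K" for x
 proof -
  have o: "open (- K)" using K(1) by (simp add: compact_imp_closed open_Compl)
  have "pd i m x = pd i (\<lambda>x. 0) x"
   by (rule sym, rule pd_cong[OF o]) (use K that in auto)
  thus ?thesis by (simp add: pd_const)
 qed
 thus ?thesis using K m by (auto simp: test_functions_iff intro!: smooth_on_pd)
qed

lemma test_functions_pds: "m \<in> test_functions V \<Longrightarrow> pds is m \<in> test_functions V"
 by (induction "is") (auto simp: pds_simps intro: test_functions_pd)

lemma test_functions_bounded:
 assumes "m \<in> test_functions V"
 obtains B where "B \<ge> 0" "\<And>x. \<bar>m x\<bar> \<le> B"
proof -
 obtain K where K: "compact K" "\<forall>x. x \<notin> K \<longrightarrow> m x = 0" and s: "smooth_on UNIV m"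
  using assms by (auto simp: test_functions_iff)
 have "bounded (m ` K)"
  using K(1) smooth_on_continuous[OF s]
  by (intro compact_imp_bounded compact_continuous_image) (auto intro: continuous_on_subset)
 then obtain B where B: "\<And>x. x \<in> K \<Longrightarrow> \<bar>m x\<bar> \<le> B" by (auto simp: bounded_iff)
 show thesis proof (rule that[of "max B 0"])
  show "\<bar>m x\<bar> \<le> max B 0" for x using B[of x] K(2) by (cases "x \<in> K") auto
 qed simp
qed

lemma test_functions_cutoff:
 fixes K V :: "(real^'n::finite) set"
 assumes "compact K" "open V" "K \<subseteq> V"
 obtains \<kappa> O' where "\<kappa> \<in> test_functions V" "\<And>x. 0 \<le> \<kappa> x" "\<And>x. \<kappa> x \<le> 1" "open O'" "K \<subseteq> O'"
  "\<And>x. x \<in> O' \<Longrightarrow> \<kappa> x = 1"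
 using smooth_cutoff[OF assms] by (smt (verit) test_functions_iff)

section \<open>Change of variables\<close>

text \<open>The measure of a differentiable image is known for coordinates indexed by a well-ordered finite type.
  This type enumerates an arbitrary finite index type, and the formula is transported along the induced
  permutation of coordinates.\<close>

typedef 'n rank = "{..<CARD('n::finite)}"
 by (rule exI[of _ 0]) (simp add: card_gt_0_iff)

instantiation rank :: (finite) linorder
begin
definition less_eq_rank :: "'a rank \<Rightarrow> 'a rank \<Rightarrow> bool" where
 "less_eq_rank x y \<longleftrightarrow> Rep_rank x \<le> Rep_rank y"
definition less_rank :: "'a rank \<Rightarrow> 'a rank \<Rightarrow> bool" where
 "less_rank x y \<longleftrightarrow> Rep_rank x < Rep_rank y"
instance
 by standard (auto simp: less_eq_rank_def less_rank_def Rep_rank_inject)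
end

instance rank :: (finite) wellorder
proof
 fix P :: "'a rank \<Rightarrow> bool" and a
 assume h: "\<And>x. (\<And>y. y < x \<Longrightarrow> P y) \<Longrightarrow> P x"
 show "P a"
  by (induction "Rep_rank a" arbitrary: a rule: less_induct) (rule h, simp add: less_rank_def)
qed

instance rank :: (finite) finite
proof
 have "(UNIV :: 'a rank set) = Abs_rank ` {..<CARD('a)}"
  using type_definition.Abs_image[OF type_definition_rank] by auto
 thus "finite (UNIV :: 'a rank set)" by (metis finite_imageI finite_lessThan)
qed

lemma card_rank: "CARD('n rank) = CARD('n::finite)"
 using type_definition.card[OF type_definition_rank] by simp

definition rank_of :: "'n::finite \<Rightarrow> 'n rank" where
 "rank_of = (SOME f. bij f)"

lemma bij_rank_of: "bij (rank_of :: 'n::finite \<Rightarrow> 'n rank)"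
proof -
 have "\<exists>f :: 'n \<Rightarrow> 'n rank. bij f"
  using finite_same_card_bij[of "UNIV :: 'n set" "UNIV :: 'n rank set"] by (simp add: card_rank)
 thus ?thesis unfolding rank_of_def by (rule someI_ex)
qed

definition from_rank :: "real^('n rank) \<Rightarrow> real^'n::finite" where
 "from_rank v = (\<chi> i. v $ rank_of i)"

definition to_rank :: "real^'n::finite \<Rightarrow> real^('n rank)" where
 "to_rank v = (\<chi> k. v $ inv rank_of k)"

lemma to_from_rank: "to_rank (from_rank v) = v" "from_rank (to_rank w) = w"
 by (simp_all add: to_rank_def from_rank_def vec_eq_iff bij_is_inj bij_is_surj bij_rank_of surj_f_inv_f)

lemma linear_rank: "linear from_rank" "linear to_rank"
 by (auto intro!: linearI simp: from_rank_def to_rank_def vec_eq_iff)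

lemma bounded_linear_rank: "bounded_linear from_rank" "bounded_linear to_rank"
 by (simp_all add: linear_rank linear_conv_bounded_linear[symmetric])

lemma prod_Basis_vec: "(\<Prod>b\<in>(Basis :: (real^'k::finite) set). f b) = (\<Prod>i\<in>UNIV. f (axis i 1))"
proof -
 have "(Basis :: (real^'k) set) = range (\<lambda>i. axis i 1)" by (auto simp: Basis_vec_def)
 moreover have "inj (\<lambda>i::'k. axis i (1::real))" by (auto intro!: injI simp: axis_eq_axis)
 ultimately show ?thesis by (subst (1) \<open>Basis = _\<close>) (subst prod.reindex; simp)
qed

lemma borel_measurable_rank[measurable]:
 "from_rank \<in> borel_measurable borel" "to_rank \<in> borel_measurable borel"
 by (simp_all add: borel_measurable_continuous_onI linear_continuous_on bounded_linear_rank)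

lemma lborel_rank: "distr lborel borel from_rank = (lborel :: (real^'n::finite) measure)"
proof (rule lborel_eqI[symmetric])
 fix l u :: "real^'n" assume lu: "\<And>b. b \<in> Basis \<Longrightarrow> l \<bullet> b \<le> u \<bullet> b"
 have le: "l $ i \<le> u $ i" for i using lu[of "axis i 1"] by (simp add: inner_axis)
 have "from_rank -` box l u = box (to_rank l) (to_rank u)"
  using bij_rank_of[where 'n = 'n]
  by (auto simp: mem_box_cart from_rank_def to_rank_def) (metis bij_inv_eq_iff)+
 hence "emeasure (distr lborel borel from_rank) (box l u) = emeasure lborel (box (to_rank l) (to_rank u))"
  by (subst emeasure_distr) auto
 also have "\<dots> = ennreal (\<Prod>b\<in>Basis. (to_rank u - to_rank l) \<bullet> b)"
  by (rule emeasure_lborel_box) (auto simp: Basis_vec_def inner_axis to_rank_def le)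
 also have "(\<Prod>b\<in>Basis. (to_rank u - to_rank l) \<bullet> b) = (\<Prod>k\<in>UNIV. (u - l) $ inv rank_of k)"
  by (simp add: prod_Basis_vec inner_axis to_rank_def)
 also have "\<dots> = (\<Prod>i\<in>UNIV. (u - l) $ i)"
  using prod.reindex_bij_betw[OF bij_imp_bij_inv[OF bij_rank_of], of "\<lambda>i. (u - l) $ i"] by simp
 also have "\<dots> = (\<Prod>b\<in>Basis. (u - l) \<bullet> b)" by (simp add: prod_Basis_vec inner_axis)
 finally show "emeasure (distr lborel borel from_rank) (box l u) = ennreal (\<Prod>b\<in>Basis. (u - l) \<bullet> b)" .
qed simp

locale diffeo =
 fixes W' W :: "(real^'n::finite) set" and T S :: "real^'n \<Rightarrow> real^'n"
 assumes open_dom: "open W'" and open_cod: "open W"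
  and maps: "\<And>y. y \<in> W' \<Longrightarrow> T y \<in> W" "\<And>x. x \<in> W \<Longrightarrow> S x \<in> W'"
  and inverses: "\<And>y. y \<in> W' \<Longrightarrow> S (T y) = y" "\<And>x. x \<in> W \<Longrightarrow> T (S x) = x"
  and smooth: "smooth_on W' T" "smooth_on W S"

lemma (in diffeo) diffeo_sym: "diffeo W W' S T"
 by unfold_locales (auto intro: open_dom open_cod maps inverses smooth)

context diffeo
begin

lemma borel_dom[measurable]: "W' \<in> sets borel" "W \<in> sets borel"
 using open_dom open_cod by auto

lemma borel_T[measurable]: "(\<lambda>y. indicator W' y *\<^sub>R T y) \<in> borel_measurable borel"
 by (intro borel_measurable_continuous_on_indicator smooth_on_continuous smooth borel_dom)

lemma borel_comp[measurable]:
 assumes [measurable]: "F \<in> borel_measurable borel"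
 shows "(\<lambda>y. indicator W' y * (F (T y) :: ennreal)) \<in> borel_measurable borel"
  and "h \<in> borel_measurable borel \<Longrightarrow> (\<lambda>y. indicator W' y * (h (T y) :: real)) \<in> borel_measurable borel"
proof -
 have "(\<lambda>y. indicator W' y * F (T y)) = (\<lambda>y. indicator W' y * F (indicator W' y *\<^sub>R T y))"
  by (auto simp: indicator_def)
 thus "(\<lambda>y. indicator W' y * F (T y)) \<in> borel_measurable borel" by simp
 assume [measurable]: "h \<in> borel_measurable borel"
 have "(\<lambda>y. indicator W' y * h (T y)) = (\<lambda>y. indicator W' y * h (indicator W' y *\<^sub>R T y))"
  by (auto simp: indicator_def)
 thus "(\<lambda>y. indicator W' y * h (T y)) \<in> borel_measurable borel" by simp
qed

lemma derivative_inverse: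
 assumes y: "y \<in> W'"
 shows "frechet_derivative S (at (T y)) (frechet_derivative T (at y) v) = v"
proof -
 have "((\<lambda>y. S (T y)) has_derivative (\<lambda>v. frechet_derivative S (at (T y)) (frechet_derivative T (at y) v))) (at y)"
  by (rule has_derivative_compose[OF smooth_on_has_derivative[OF smooth(1) y]
     smooth_on_has_derivative[OF smooth(2) maps(1)[OF y]]])
 hence "((\<lambda>y. y) has_derivative (\<lambda>v. frechet_derivative S (at (T y)) (frechet_derivative T (at y) v))) (at y)"
  by (rule has_derivative_transform_within_open[OF _ open_dom y]) (simp add: inverses)
 from has_derivative_unique[OF this has_derivative_ident] show ?thesis by (rule fun_cong)
qed

definition jac :: "real^'n \<Rightarrow> real" where
 "jac y = \<bar>det (matrix (\<lambda>v. to_rank (frechet_derivative T (at y) (from_rank v))))\<bar>"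

lemma jac_pos: assumes y: "y \<in> W'" shows "jac y > 0"
proof -
 let ?f = "\<lambda>v. to_rank (frechet_derivative T (at y) (from_rank v))"
 have l: "linear (frechet_derivative T (at y))"
  using has_derivative_linear[OF smooth_on_has_derivative[OF smooth(1) y]] .
 have lin: "linear ?f"
  using linear_compose[OF linear_compose[OF linear_rank(1) l] linear_rank(2)] by (simp add: o_def)
 have "inj ?f"
 proof (rule injI)
  fix v w assume "?f v = ?f w"
  hence "frechet_derivative T (at y) (from_rank v) = frechet_derivative T (at y) (from_rank w)"
   by (metis to_from_rank(2))
  hence "from_rank v = from_rank w" using derivative_inverse[OF y] by metis
  thus "v = w" by (metis to_from_rank(1))
 qed
 thus ?thesis using det_nz_iff_inj[OF lin] by (simp add: jac_def)
qed

lemma jac_nonneg: "jac y \<ge> 0"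
 by (simp add: jac_def)

lemma smooth_jac: "smooth_on W' jac"
proof -
 have "smooth_on W' (\<lambda>y. \<bar>det (matrix (\<lambda>v. to_rank (frechet_derivative T (at y) (from_rank v))))\<bar>)"
 proof (intro smooth_on_abs smooth_on_det open_dom)
  show "det (matrix (\<lambda>v. to_rank (frechet_derivative T (at y) (from_rank v)))) \<noteq> 0" if "y \<in> W'" for y
   using jac_pos[OF that] by (simp add: jac_def)
  show "smooth_on W' (\<lambda>y. matrix (\<lambda>v. to_rank (frechet_derivative T (at y) (from_rank v))) $ i $ j)" for i j
   unfolding matrix_def by (simp add: to_rank_def) (intro smooth_on_nth open_dom smooth_on_frechet smooth)
 qed
 thus ?thesis by (simp add: jac_def[abs_def])
qed

lemma borel_jac[measurable]: "(\<lambda>y. indicator W' y * jac y) \<in> borel_measurable borel"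
 using borel_measurable_continuous_on_indicator[OF borel_dom(1) smooth_on_continuous[OF smooth_jac]] by simp

text \<open>In the ranked coordinates, \<open>B\<close> is mapped injectively onto the image of
  \<open>A\<close>, whose measure is therefore the integral of the Jacobian over \<open>B\<close>.\<close>

lemma cov_finite:
 assumes A[measurable]: "A \<in> sets borel" and AW: "A \<subseteq> W" and fin: "emeasure lborel A < \<infinity>"
 shows "(\<integral>\<^sup>+y. indicator W' y * ennreal (jac y) * indicator A (T y) \<partial>lborel) = emeasure lborel A"
proof -
 define B where "B = {z. from_rank z \<in> W' \<and> T (from_rank z) \<in> A}"
 define t where "t z = to_rank (T (from_rank z))" for z
 have Bm: "B \<in> sets borel"
 proof -
  have "B = from_rank -` (W' \<inter> (\<lambda>y. indicator W' y *\<^sub>R T y) -` A) \<inter> space borel"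
   by (auto simp: B_def)
  also have "\<dots> \<in> sets borel"
   by (intro measurable_sets[OF borel_measurable_rank(1)] sets.Int borel_dom)
     (use measurable_sets[OF borel_T A] in simp)
  finally show ?thesis .
 qed
 have tB: "t ` B = from_rank -` A"
 proof (intro equalityI subsetI)
  fix z assume z: "z \<in> from_rank -` A"
  hence "from_rank z \<in> W" using AW by auto
  hence "z = t (to_rank (S (from_rank z)))" "to_rank (S (from_rank z)) \<in> B"
   using z by (auto simp: t_def B_def to_from_rank inverses maps)
  thus "z \<in> t ` B" by blast
 qed (auto simp: t_def B_def to_from_rank)
 have inj: "inj_on t B"
  by (rule inj_onI) (metis (mono_tags, lifting) B_def t_def inverses(1) mem_Collect_eq to_from_rank)
 have der: "(t has_derivative (\<lambda>v. to_rank (frechet_derivative T (at (from_rank z)) (from_rank v)))) (at z within B)"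
  if "z \<in> B" for z
  unfolding t_def
  by (rule has_derivative_at_withinI, rule bounded_linear.has_derivative[OF bounded_linear_rank(2)],
    rule has_derivative_compose[OF bounded_linear_imp_has_derivative[OF bounded_linear_rank(1)]
     smooth_on_has_derivative[OF smooth(1)]]) (use that in \<open>auto simp: B_def\<close>)
 have mA: "from_rank -` A \<in> sets borel" "emeasure lborel (from_rank -` A) = emeasure lborel A"
  using measurable_sets[OF borel_measurable_rank(1) A] emeasure_distr[of from_rank lborel borel A]
  by (auto simp: lborel_rank)
 hence "t ` B \<in> lmeasurable \<and> measure lebesgue (t ` B) = measure lborel A"
  using fin by (auto simp: tB fmeasurable_def measure_def emeasure_completion)
 hence hi: "((\<lambda>z. \<bar>det (matrix (\<lambda>v. to_rank (frechet_derivative T (at (from_rank z)) (from_rank v))))\<bar>) has_integral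
   measure lborel A) B"
  using has_measure_differentiable_image[OF _ der inj, of "measure lborel A"] Bm
  by (auto intro: sets_completionI_sets)
 have "(\<integral>\<^sup>+y. indicator W' y * ennreal (jac y) * indicator A (T y) \<partial>lborel) =
    (\<integral>\<^sup>+y. ennreal (indicator W' y * jac y) * (indicator W' y * indicator A (T y)) \<partial>distr lborel borel from_rank)"
  unfolding lborel_rank by (intro nn_integral_cong) (auto simp: indicator_def)
 also have "\<dots> = (\<integral>\<^sup>+z. ennreal (indicator W' (from_rank z) * jac (from_rank z)) *
   (indicator W' (from_rank z) * indicator A (T (from_rank z))) \<partial>lborel)"
  by (subst nn_integral_distr) auto
 also have "\<dots> = (\<integral>\<^sup>+z. ennreal (indicator B z *
   \<bar>det (matrix (\<lambda>v. to_rank (frechet_derivative T (at (from_rank z)) (from_rank v))))\<bar>) \<partial>lborel)"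
  by (intro nn_integral_cong) (auto simp: indicator_def B_def jac_def)
 also have "\<dots> = ennreal (measure lborel A)"
  using nn_integral_has_integral_lebesgue[OF _ hi] by simp
 also have "\<dots> = emeasure lborel A"
  using fin by (simp add: emeasure_eq_ennreal_measure less_top)
 finally show ?thesis .
qed

text \<open>The two measures agree on bounded Borel sets, and these exhaust every Borel set.\<close>

lemma cov_distr:
 "distr (density lborel (\<lambda>y. ennreal (indicator W' y * jac y))) borel (\<lambda>y. indicator W' y *\<^sub>R T y) =
  density lborel (indicator W)" (is "?\<mu> = ?\<nu>")
proof (rule measure_eqI)
 fix A assume "A \<in> sets ?\<mu>"
 hence [measurable]: "A \<in> sets borel" by simp
 have *: "emeasure ?\<mu> B = (\<integral>\<^sup>+y. indicator W' y * ennreal (jac y) * indicator (B \<inter> W) (T y) \<partial>lborel)"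
  if [measurable]: "B \<in> sets borel" for B
 proof -
  have "emeasure ?\<mu> B = (\<integral>\<^sup>+y. indicator B y \<partial>?\<mu>)" by simp
  also have "\<dots> = (\<integral>\<^sup>+y. ennreal (indicator W' y * jac y) * indicator B (indicator W' y *\<^sub>R T y) \<partial>lborel)"
   by (subst nn_integral_distr, simp, simp, subst nn_integral_density) auto
  also have "\<dots> = (\<integral>\<^sup>+y. indicator W' y * ennreal (jac y) * indicator (B \<inter> W) (T y) \<partial>lborel)"
   by (intro nn_integral_cong) (auto simp: indicator_def maps)
  finally show ?thesis .
 qed
 have "emeasure ?\<mu> (A \<inter> ball 0 (real n)) = emeasure ?\<nu> (A \<inter> ball 0 (real n))" for n
 proof -
  have "emeasure lborel (A \<inter> ball 0 (real n) \<inter> W) \<le> emeasure lborel (ball 0 (real n) :: (real^'n) set)"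
   by (intro emeasure_mono) auto
  hence "emeasure lborel (A \<inter> ball 0 (real n) \<inter> W) < \<infinity>"
   by (rule order_le_less_trans) (simp add: emeasure_ball)
  hence "emeasure ?\<mu> (A \<inter> ball 0 (real n)) = emeasure lborel (A \<inter> ball 0 (real n) \<inter> W)"
   by (subst *) (auto intro!: cov_finite)
  also have "\<dots> = emeasure ?\<nu> (A \<inter> ball 0 (real n))"
   by (subst emeasure_density, simp, simp, subst nn_integral_indicator[symmetric], simp, intro nn_integral_cong)
     (auto simp: indicator_def)
  finally show ?thesis .
 qed
 note eq = this
 have sup: "(SUP n. emeasure M (A \<inter> ball 0 (real n))) = emeasure M A"
  if "sets M = sets borel" for M :: "(real^'n) measure"
 proof -
  have "(SUP n. emeasure M (A \<inter> ball 0 (real n))) = emeasure M (\<Union>n. A \<inter> ball 0 (real n))"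
  proof (rule SUP_emeasure_incseq)
   show "range (\<lambda>n. A \<inter> ball 0 (real n)) \<subseteq> sets M" by (auto simp: that)
   show "incseq (\<lambda>n. A \<inter> ball 0 (real n))"
    unfolding incseq_def by (intro allI impI Int_mono subset_ball order_refl) simp
  qed
  also have "(\<Union>n. A \<inter> ball 0 (real n)) = A"
   by (auto intro: reals_Archimedean2)
  finally show ?thesis .
 qed
 have "emeasure ?\<mu> A = (SUP n. emeasure ?\<mu> (A \<inter> ball 0 (real n)))"
  by (rule sup[symmetric]) simp
 also have "\<dots> = (SUP n. emeasure ?\<nu> (A \<inter> ball 0 (real n)))" by (simp only: eq)
 also have "\<dots> = emeasure ?\<nu> A" by (rule sup) simp
 finally show "emeasure ?\<mu> A = emeasure ?\<nu> A" .
qed simp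

lemma nn_cov:
 assumes [measurable]: "F \<in> borel_measurable borel"
 shows "(\<integral>\<^sup>+y. indicator W' y * ennreal (jac y) * F (T y) \<partial>lborel) = (\<integral>\<^sup>+x. indicator W x * F x \<partial>lborel)"
proof -
 have "(\<integral>\<^sup>+x. indicator W x * F x \<partial>lborel) = (\<integral>\<^sup>+x. F x \<partial>density lborel (indicator W))"
  by (subst nn_integral_density) auto
 also have "\<dots> = (\<integral>\<^sup>+y. ennreal (indicator W' y * jac y) * F (indicator W' y *\<^sub>R T y) \<partial>lborel)"
  unfolding cov_distr[symmetric] by (subst nn_integral_distr, simp, simp, subst nn_integral_density) auto
 also have "\<dots> = (\<integral>\<^sup>+y. indicator W' y * ennreal (jac y) * F (T y) \<partial>lborel)"
  by (intro nn_integral_cong) (auto simp: indicator_def)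
 finally show ?thesis ..
qed

lemma integral_cov:
 fixes h :: "real^'n \<Rightarrow> real"
 assumes [measurable]: "h \<in> borel_measurable borel"
 shows "(LBINT x. indicator W x * h x) = (LBINT y. indicator W' y * jac y * h (T y))"
proof -
 have "(LBINT x. indicator W x * h x) = (\<integral>x. h x \<partial>density lborel (\<lambda>x. ennreal (indicator W x)))"
  by (subst integral_density) auto
 also have "\<dots> = (\<integral>x. h x \<partial>density lborel (indicator W))" by (simp add: ennreal_indicator)
 also have "\<dots> = (LBINT y. (indicator W' y * jac y) * h (indicator W' y *\<^sub>R T y))"
  unfolding cov_distr[symmetric]
  by (subst integral_distr, simp, simp, subst integral_density)
    (auto simp: jac_nonneg)
 also have "\<dots> = (LBINT y. indicator W' y * jac y * h (T y))"
  by (intro Bochner_Integration.integral_cong) (auto simp: indicator_def)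
 finally show ?thesis .
qed

lemma AE_cov:
 assumes "AE x in lborel. x \<in> W \<longrightarrow> P x"
 shows "AE y in lborel. y \<in> W' \<longrightarrow> P (T y)"
proof -
 obtain N where N: "N \<in> null_sets lborel" "{x. \<not> (x \<in> W \<longrightarrow> P x)} \<subseteq> N"
  using assms by (auto simp: eventually_ae_filter)
 have [measurable]: "N \<in> sets borel" using N by auto
 have "(\<integral>\<^sup>+y. indicator W' y * ennreal (jac y) * indicator N (T y) \<partial>lborel) =
    (\<integral>\<^sup>+x. indicator W x * indicator N x \<partial>lborel)"
  by (rule nn_cov) simp
 also have "\<dots> \<le> (\<integral>\<^sup>+x. indicator N x \<partial>lborel)"
  by (intro nn_integral_mono) (auto simp: indicator_def)
 also have "\<dots> = 0" using N by auto
 finally have "(\<integral>\<^sup>+y. ennreal (indicator W' y * jac y) * (indicator W' y * indicator N (T y)) \<partial>lborel) = 0"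
  by (subst (asm) nn_integral_cong[where v = "\<lambda>y. ennreal (indicator W' y * jac y) * (indicator W' y * indicator N (T y))"])
    (auto simp: indicator_def)
 hence "AE y in lborel. ennreal (indicator W' y * jac y) * (indicator W' y * indicator N (T y)) = 0"
  by (subst (asm) nn_integral_0_iff_AE) auto
 thus ?thesis
 proof (rule AE_mp, intro AE_I2 impI)
  fix y assume "ennreal (indicator W' y * jac y) * (indicator W' y * indicator N (T y)) = 0" "y \<in> W'"
  hence "T y \<notin> N" using jac_pos[of y] by (auto simp: indicator_def split: if_splits)
  thus "P (T y)" using N(2) maps(1)[OF \<open>y \<in> W'\<close>] by auto
 qed
qed

end

section \<open>Functions on open sets up to null sets\<close>

lemma borel_version:
 fixes g :: "real^'n::finite \<Rightarrow> real"
 assumes \<O>: "open \<O>" and g: "g \<in> borel_measurable (lebesgue_on \<O>)"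
 obtains g' where "g' \<in> borel_measurable borel" "AE x in lborel. x \<in> \<O> \<longrightarrow> g x = g' x" "\<And>x. x \<notin> \<O> \<Longrightarrow> g' x = 0"
proof -
 have "(\<lambda>x. indicator \<O> x *\<^sub>R g x) \<in> borel_measurable lebesgue"
  using g \<O> borel_measurable_restrict_space_iff[of \<O> lebesgue g] by auto
 then obtain h where h: "h \<in> borel_measurable lborel" "AE x in lborel. indicator \<O> x *\<^sub>R g x = h x"
  using completion_ex_borel_measurable_real[of _ lborel] by blast
 have [measurable]: "h \<in> borel_measurable borel" "\<O> \<in> sets borel" using h \<O> by auto
 show thesis
 proof (rule that[of "\<lambda>x. indicator \<O> x * h x"])
  show "AE x in lborel. x \<in> \<O> \<longrightarrow> g x = indicator \<O> x * h x"
   using h(2) by (rule AE_mp) (auto intro!: AE_I2)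
 qed auto
qed

lemma nn_integral_lebesgue_on:
 "open \<O> \<Longrightarrow> (\<integral>\<^sup>+x. f x \<partial>lebesgue_on \<O>) = (\<integral>\<^sup>+x. f x * indicator \<O> x \<partial>lborel)"
 by (subst nn_integral_restrict_space) (auto simp: nn_integral_completion)

lemma lebesgue_integral_version:
 fixes g :: "real^'n::finite \<Rightarrow> real"
 assumes \<O>: "open \<O>" and g: "AE x in lborel. x \<in> \<O> \<longrightarrow> g x = g' x"
  and [measurable]: "g' \<in> borel_measurable borel" "\<eta> \<in> borel_measurable borel"
 shows "(\<integral>x. g x * \<eta> x \<partial>lebesgue_on \<O>) = (LBINT x. indicator \<O> x * (g' x * \<eta> x))"
proof -
 have [measurable]: "\<O> \<in> sets borel" using \<O> by auto
 have "(\<integral>x. g x * \<eta> x \<partial>lebesgue_on \<O>) = (\<integral>x. indicator \<O> x *\<^sub>R (g x * \<eta> x) \<partial>lebesgue)"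
  by (rule integral_restrict_space) auto
 also have "\<dots> = (\<integral>x. indicator \<O> x * (g' x * \<eta> x) \<partial>lebesgue)"
 proof (rule integral_cong_AE)
  have 1: "(\<lambda>x. indicator \<O> x * (g' x * \<eta> x)) \<in> borel_measurable lborel" by measurable
  thus m: "(\<lambda>x. indicator \<O> x * (g' x * \<eta> x)) \<in> borel_measurable lebesgue"
   by (rule measurable_completion)
  have ae: "AE x in lborel. indicator \<O> x * (g' x * \<eta> x) = indicator \<O> x *\<^sub>R (g x * \<eta> x)"
   using g by (rule AE_mp) (auto intro!: AE_I2 simp: indicator_def)
  show "(\<lambda>x. indicator \<O> x *\<^sub>R (g x * \<eta> x)) \<in> borel_measurable lebesgue"
   by (rule borel_measurable_AE[OF m AE_completion[OF ae]])
  show "AE x in lebesgue. indicator \<O> x *\<^sub>R (g x * \<eta> x) = indicator \<O> x * (g' x * \<eta> x)"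
   using AE_completion[OF ae] by (auto elim: eventually_mono)
 qed
 also have "\<dots> = (LBINT x. indicator \<O> x * (g' x * \<eta> x))"
  by (rule integral_completion) measurable
 finally show ?thesis .
qed

lemma borel_test_function: "\<eta> \<in> test_functions V \<Longrightarrow> \<eta> \<in> borel_measurable borel"
 by (intro borel_measurable_continuous_onI smooth_on_continuous) (rule test_functions_smooth)

text \<open>Measurability is checked on each set of an exhaustion of \<open>\<O>\<close> by compact
  sets.\<close>

lemma locally_integrable_measurable:
 assumes \<O>: "open \<O>" and f: "locally_integrable \<O> f"
 shows "f \<in> borel_measurable (lebesgue_on \<O>)"
proof -
 obtain C where C: "\<And>n::nat. compact (C n)" "\<And>n. C n \<subseteq> \<O>" "\<Union>(range C) = \<O>"
  using open_Union_compact_subsets[OF \<O>] by metis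
 show ?thesis
 proof (rule measurable_piecewise_restrict[of "range C"])
  fix X assume "X \<in> range C"
  then obtain n where n: "X = C n" by auto
  have m: "C n \<in> sets lebesgue" using C(1)[of n] by (simp add: borel_compact)
  show "X \<inter> space (lebesgue_on \<O>) \<in> sets (lebesgue_on \<O>)"
   using C(2)[of n] m by (auto simp: n sets_restrict_space intro!: image_eqI[of _ _ "C n"])
  have "f \<in> borel_measurable (lebesgue_on (C n))"
   using f C by (intro absolutely_integrable_measurable[THEN iffD1, THEN conjunct1] m)
    (auto simp: locally_integrable_def)
  moreover have "restrict_space (lebesgue_on \<O>) X = lebesgue_on (C n)"
   using C(2)[of n] m \<O> by (subst restrict_restrict_space) (auto simp: n Int_absorb1)
  ultimately show "f \<in> borel_measurable (restrict_space (lebesgue_on \<O>) X)" by simp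
 qed (use C in auto)
qed

text \<open>Composition with \<open>T\<close> and Fubini's theorem need Borel functions, while weak derivatives
  are only Lebesgue measurable; hence norms and pairings are computed with Borel versions.\<close>

definition version_on :: "(real^'n::finite) set \<Rightarrow> (real^'n \<Rightarrow> real) \<Rightarrow> (real^'n \<Rightarrow> real) \<Rightarrow> bool" where
 "version_on \<O> g g' \<longleftrightarrow> g' \<in> borel_measurable borel \<and> (AE x in lborel. x \<in> \<O> \<longrightarrow> g x = g' x)"

lemma version_exists:
 assumes "open \<O>" "g \<in> borel_measurable (lebesgue_on \<O>)"
 obtains g' where "version_on \<O> g g'"
 using borel_version[OF assms] unfolding version_on_def by metis

lemma version_measurable:
 assumes \<O>: "open \<O>" and v: "version_on \<O> g g'"
 shows "g \<in> borel_measurable (lebesgue_on \<O>)"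
proof -
 have [measurable]: "g' \<in> borel_measurable borel" "\<O> \<in> sets borel" using v \<O> by (auto simp: version_on_def)
 have "(\<lambda>x. indicator \<O> x *\<^sub>R g' x) \<in> borel_measurable lborel" by simp
 from measurable_completion[OF this]
 have "(\<lambda>x. indicator \<O> x *\<^sub>R g x) \<in> borel_measurable lebesgue"
  by (rule borel_measurable_AE)
    (use AE_completion[where M = lborel and P = "\<lambda>x. x \<in> \<O> \<longrightarrow> g x = g' x"] v in
    \<open>auto simp: version_on_def indicator_def elim: eventually_mono\<close>)
 thus ?thesis using borel_measurable_restrict_space_iff[of \<O> lebesgue g] \<O> by auto
qed

lemma locally_integrable_version:
 assumes \<O>: "open \<O>" and v: "version_on \<O> g g'"
 shows "locally_integrable \<O> g \<longleftrightarrow> (\<forall>K. compact K \<and> K \<subseteq> \<O> \<longrightarrow> integrable lborel (\<lambda>x. indicator K x * g' x))"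
proof -
 have "g absolutely_integrable_on K \<longleftrightarrow> integrable lborel (\<lambda>x. indicator K x * g' x)"
  if K: "compact K" "K \<subseteq> \<O>" for K
 proof -
  have [measurable]: "g' \<in> borel_measurable borel" "K \<in> sets borel"
   using v K by (auto simp: version_on_def borel_compact)
  have m0: "(\<lambda>x. indicator K x * g' x) \<in> borel_measurable lborel" by simp
  note m = measurable_completion[OF m0]
  have ae: "AE x in lebesgue. indicator K x * g' x = indicator K x *\<^sub>R g x"
   using AE_completion[where M = lborel and P = "\<lambda>x. x \<in> \<O> \<longrightarrow> g x = g' x"] v K(2)
   by (auto simp: version_on_def indicator_def elim!: eventually_mono)
  have "g absolutely_integrable_on K \<longleftrightarrow> integrable lebesgue (\<lambda>x. indicator K x * g' x)"
   unfolding set_integrable_def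
   by (rule integrable_cong_AE[OF borel_measurable_AE[OF m ae] m]) (use ae in \<open>auto elim: eventually_mono\<close>)
  thus ?thesis using integrable_completion[OF m0] by simp
 qed
 thus ?thesis unfolding locally_integrable_def by blast
qed

lemma regular_dist_version:
 assumes \<O>: "open \<O>" and v: "version_on \<O> g g'" and \<eta>: "\<eta> \<in> test_functions \<O>"
 shows "regular_dist \<O> g \<eta> = (LBINT x. g' x * \<eta> x)"
proof -
 have "regular_dist \<O> g \<eta> = (LBINT x. indicator \<O> x * (g' x * \<eta> x))"
  unfolding regular_dist_def
  using v by (intro lebesgue_integral_version[OF \<O>] borel_test_function[OF \<eta>]) (auto simp: version_on_def)
 also have "\<dots> = (LBINT x. g' x * \<eta> x)"
  by (intro Bochner_Integration.integral_cong) (auto simp: indicator_def test_functions_outside[OF \<eta>])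
 finally show ?thesis .
qed

lemma integrable_times_test_function:
 assumes g: "g \<in> borel_measurable borel" and \<eta>: "\<eta> \<in> test_functions \<O>"
  and i: "\<And>K. compact K \<Longrightarrow> K \<subseteq> \<O> \<Longrightarrow> integrable lborel (\<lambda>x. indicator K x * g x)"
 shows "integrable lborel (\<lambda>x. g x * \<eta> x)"
proof -
 note [measurable] = g borel_test_function[OF \<eta>]
 obtain K where K: "compact K" "K \<subseteq> \<O>" "\<And>x. x \<notin> K \<Longrightarrow> \<eta> x = 0"
  using \<eta> by (auto simp: test_functions_iff)
 obtain B where B: "\<And>x. \<bar>\<eta> x\<bar> \<le> B" using test_functions_bounded[OF \<eta>] by blast
 show ?thesis
 proof (rule Bochner_Integration.integrable_bound[OF integrable_mult_left[OF i[OF K(1,2)], of B]])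
  show "AE x in lborel. norm (g x * \<eta> x) \<le> norm (indicator K x * g x * B)"
  proof (intro AE_I2)
   fix x
   have "\<bar>\<eta> x\<bar> \<le> \<bar>B\<bar>" using B[of x] by linarith
   thus "norm (g x * \<eta> x) \<le> norm (indicator K x * g x * B)"
    using K(3)[of x] by (cases "x \<in> K") (auto simp: abs_mult intro: mult_left_mono)
  qed
 qed simp
qed

section \<open>The fundamental lemma of the calculus of variations\<close>

text \<open>Cutoff functions that are \<open>1\<close> on \<open>K\<close> and vanish outside shrinking neighbourhoods of \<open>K\<close> converge to the
  indicator of \<open>K\<close>.\<close>

lemma integral_compact_zero:
 fixes g :: "real^'n::finite \<Rightarrow> real"
 assumes \<O>: "open \<O>" and g[measurable]: "g \<in> borel_measurable borel"
  and i: "\<And>K. compact K \<Longrightarrow> K \<subseteq> \<O> \<Longrightarrow> integrable lborel (\<lambda>x. indicator K x * g x)"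
  and z: "\<And>\<eta>. \<eta> \<in> test_functions \<O> \<Longrightarrow> (LBINT x. g x * \<eta> x) = 0"
  and K: "compact K" "K \<subseteq> \<O>"
 shows "(LBINT x. indicator K x * g x) = 0"
proof -
 obtain \<kappa> O' where \<kappa>: "\<kappa> \<in> test_functions \<O>" "open O'" "K \<subseteq> O'" "\<And>x. x \<in> O' \<Longrightarrow> \<kappa> x = 1"
  using test_functions_cutoff[OF K(1) \<O> K(2)] by metis
 obtain L where L: "compact L" "L \<subseteq> \<O>" "\<And>x. x \<notin> L \<Longrightarrow> \<kappa> x = 0"
  using \<kappa>(1) by (auto simp: test_functions_iff)
 have O'L: "O' \<subseteq> L" using \<kappa>(4) L(3) by force
 define V where "V n = O' \<inter> (\<Union>x\<in>K. ball x (1 / real (Suc n)))" for n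
 have "\<exists>\<eta>. \<eta> \<in> test_functions (V n) \<and> (\<forall>x. 0 \<le> \<eta> x \<and> \<eta> x \<le> 1) \<and> (\<forall>x\<in>K. \<eta> x = 1)" for n
 proof -
  have "open (V n)" "K \<subseteq> V n" using \<kappa>(2,3) by (auto simp: V_def intro!: bexI)
  from test_functions_cutoff[OF K(1) this] show ?thesis by (metis subsetD)
 qed
 then obtain \<eta> where \<eta>: "\<And>n. \<eta> n \<in> test_functions (V n)" "\<And>n x. 0 \<le> \<eta> n x" "\<And>n x. \<eta> n x \<le> 1"
  "\<And>n x. x \<in> K \<Longrightarrow> \<eta> n x = 1" by metis
 have V\<O>: "V n \<subseteq> \<O>" for n using O'L L(2) by (auto simp: V_def)
 have [measurable]: "\<eta> n \<in> borel_measurable borel" "K \<in> sets borel" for n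
  using borel_test_function[OF \<eta>(1)] K(1) by (auto simp: borel_compact)
 have "(\<lambda>n. LBINT x. g x * \<eta> n x) \<longlonglongrightarrow> (LBINT x. indicator K x * g x)"
 proof (rule integral_dominated_convergence[where w = "\<lambda>x. \<bar>indicator L x * g x\<bar>"])
  show "integrable lborel (\<lambda>x. \<bar>indicator L x * g x\<bar>)"
   using i[OF L(1,2)] by (rule integrable_abs)
  show "AE x in lborel. norm (g x * \<eta> n x) \<le> \<bar>indicator L x * g x\<bar>" for n
  proof (intro AE_I2)
   fix x
   show "norm (g x * \<eta> n x) \<le> \<bar>indicator L x * g x\<bar>"
   proof (cases "x \<in> L")
    case True
    thus ?thesis
     using \<eta>(2,3)[of n x] by (simp add: abs_mult mult_left_le)
   next
    case False
    hence "\<eta> n x = 0" using O'L test_functions_outside[OF \<eta>(1)] by (auto simp: V_def)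
    thus ?thesis by simp
   qed
  qed
  show "AE x in lborel. (\<lambda>n. g x * \<eta> n x) \<longlonglongrightarrow> indicator K x * g x"
  proof (intro AE_I2)
   fix x
   show "(\<lambda>n. g x * \<eta> n x) \<longlonglongrightarrow> indicator K x * g x"
   proof (cases "x \<in> K")
    case True
    thus ?thesis by (simp add: \<eta>(4))
   next
    case False
    then obtain e where e: "e > 0" "ball x e \<inter> K = {}"
     using K(1) compact_imp_closed by (metis closed_def disjoint_eq_subset_Compl openE ComplI)
    obtain n0 where n0: "1 / real (Suc n0) < e" using e(1) nat_approx_posE by blast
    have "\<eta> n x = 0" if "n \<ge> n0" for n
    proof -
     have "1 / real (Suc n) \<le> 1 / real (Suc n0)" using that by (simp add: frac_le)
     hence "x \<notin> V n" using e n0 by (auto simp: V_def dist_commute disjoint_iff)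
     thus ?thesis by (rule test_functions_outside[OF \<eta>(1)])
    qed
    hence "\<forall>\<^sub>F n in sequentially. g x * \<eta> n x = indicator K x * g x"
     using False by (auto simp: eventually_sequentially)
    thus ?thesis by (rule tendsto_eventually)
   qed
  qed
 qed simp_all
 moreover have "(LBINT x. g x * \<eta> n x) = 0" for n
  by (rule z) (rule test_functions_mono[OF \<eta>(1) V\<O>])
 ultimately show ?thesis by (simp add: LIMSEQ_const_iff)
qed

text \<open>Up to a null set, the set where \<open>g\<close> is positive is a countable union of compact sets,
  and the integral of \<open>g\<close> over each of them is \<open>0\<close>.\<close>

lemma fundamental_lemma_pos:
 fixes g :: "real^'n::finite \<Rightarrow> real"
 assumes \<O>: "open \<O>" and g[measurable]: "g \<in> borel_measurable borel"
  and i: "\<And>K. compact K \<Longrightarrow> K \<subseteq> \<O> \<Longrightarrow> integrable lborel (\<lambda>x. indicator K x * g x)"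
  and z: "\<And>\<eta>. \<eta> \<in> test_functions \<O> \<Longrightarrow> (LBINT x. g x * \<eta> x) = 0"
 shows "AE x in lborel. x \<in> \<O> \<longrightarrow> g x \<le> 0"
proof -
 define A where "A = {x\<in>\<O>. g x > 0}"
 have [measurable]: "\<O> \<in> sets borel" using \<O> by auto
 have Am: "A \<in> sets borel" unfolding A_def by measurable
 have "A \<in> sets lebesgue" using Am by (simp add: sets_completionI_sets)
 then obtain C N where C: "fsigma C" "N \<in> null_sets lebesgue" "C \<union> N = A"
  using lebesgue_set_almost_fsigma by metis
 obtain F where F: "\<And>n::nat. compact (F n)" "C = \<Union>(range F)"
  using C(1) unfolding fsigma_Union_compact by (metis image_subset_iff mem_Collect_eq UNIV_I)
 have "F n \<in> null_sets lebesgue" for n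
 proof -
  have FA: "F n \<subseteq> A" using C F by auto
  hence F\<O>: "F n \<subseteq> \<O>" by (auto simp: A_def)
  have [measurable]: "F n \<in> sets borel" using F(1) by (simp add: borel_compact)
  have "AE x in lborel. indicator (F n) x * g x = 0"
  proof (subst integral_nonneg_eq_0_iff_AE[symmetric])
   show "integrable lborel (\<lambda>x. indicator (F n) x * g x)" by (rule i[OF F(1) F\<O>])
   show "AE x in lborel. 0 \<le> indicator (F n) x * g x"
    using FA by (intro AE_I2) (auto simp: indicator_def A_def less_imp_le)
   show "(LBINT x. indicator (F n) x * g x) = 0"
    by (rule integral_compact_zero[OF \<O> g i z F(1) F\<O>])
  qed
  hence "AE x in lborel. x \<notin> F n"
   by (rule AE_mp) (use FA in \<open>auto simp: indicator_def A_def intro!: AE_I2\<close>)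
  hence "F n \<in> null_sets lborel" by (subst AE_iff_null_sets) auto
  thus ?thesis by (rule null_sets_completionI)
 qed
 hence "C \<in> null_sets lebesgue" unfolding F(2) by (intro null_sets_UN)
 hence "A \<in> null_sets lebesgue" using C(2,3) by auto
 hence "AE x in lebesgue. x \<notin> A" by (rule AE_not_in)
 hence "AE x in lborel. x \<notin> A" by (simp add: AE_completion_iff)
 thus ?thesis by (rule AE_mp) (auto simp: A_def intro!: AE_I2)
qed

lemma fundamental_lemma:
 fixes g :: "real^'n::finite \<Rightarrow> real"
 assumes \<O>: "open \<O>" and g[measurable]: "g \<in> borel_measurable borel"
  and i: "\<And>K. compact K \<Longrightarrow> K \<subseteq> \<O> \<Longrightarrow> integrable lborel (\<lambda>x. indicator K x * g x)"
  and z: "\<And>\<eta>. \<eta> \<in> test_functions \<O> \<Longrightarrow> (LBINT x. g x * \<eta> x) = 0"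
 shows "AE x in lborel. x \<in> \<O> \<longrightarrow> g x = 0"
proof -
 have "AE x in lborel. x \<in> \<O> \<longrightarrow> g x \<le> 0" by (rule fundamental_lemma_pos[OF \<O> g i z])
 moreover have "AE x in lborel. x \<in> \<O> \<longrightarrow> - g x \<le> 0"
  by (rule fundamental_lemma_pos[OF \<O>]) (use i z in auto)
 ultimately show ?thesis by eventually_elim auto
qed

section \<open>The singular kernel\<close>

text \<open>The part of the Gagliardo integrand that remains when a difference at distance \<open>|z|\<close> is
  of order \<open>min 1 |z|\<close>.\<close>

definition kernel :: "real \<Rightarrow> real \<Rightarrow> 'a::euclidean_space \<Rightarrow> real" where
 "kernel \<theta> p z = min 1 (norm z powr p) / norm z powr (real DIM('a) + \<theta> * p)"

lemma kernel_shell: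
 fixes z :: "'a::euclidean_space"
 assumes r: "r > 0" and p: "p > 0" and \<theta>: "\<theta> > 0" and z: "r < norm z" "norm z \<le> 2 * r"
 shows "kernel \<theta> p z \<le> min 1 ((2 * r) powr p) / r powr (real DIM('a) + \<theta> * p)"
 unfolding kernel_def using assms
 by (intro frac_le min.mono powr_mono2) auto

text \<open>On the shell \<open>r < |z| \<le> 2 r\<close> the kernel is comparable to a constant, and the shells with \<open>r\<close> a
  power of 2 contribute geometric series.\<close>

lemma shell_integral:
 fixes p \<theta> r :: real
 assumes r: "r > 0" and p: "p > 0" and \<theta>: "\<theta> > 0"
 shows "(\<integral>\<^sup>+z. ennreal (kernel \<theta> p z) * indicator {z. r < norm z \<and> norm z \<le> 2 * r} (z :: 'a::euclidean_space) \<partial>lborel)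
   \<le> ennreal (unit_ball_vol (real DIM('a)) * 2 ^ DIM('a) * min 1 ((2 * r) powr p) / r powr (\<theta> * p))"
proof -
 let ?c = "min 1 ((2 * r) powr p) / r powr (real DIM('a) + \<theta> * p)"
 have "(\<integral>\<^sup>+z. ennreal (kernel \<theta> p z) * indicator {z. r < norm z \<and> norm z \<le> 2 * r} (z :: 'a) \<partial>lborel)
   \<le> (\<integral>\<^sup>+z. ennreal ?c * indicator (cball 0 (2 * r) :: 'a set) z \<partial>lborel)"
  by (intro nn_integral_mono)
    (auto simp: indicator_def intro!: ennreal_leI kernel_shell[OF r p \<theta>])
 also have "\<dots> = ennreal ?c * ennreal (unit_ball_vol (real DIM('a)) * (2 * r) ^ DIM('a))"
  using r by (subst nn_integral_cmult_indicator) (auto simp: emeasure_cball)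
 also have "\<dots> = ennreal (?c * (unit_ball_vol (real DIM('a)) * (2 * r) ^ DIM('a)))"
  by (rule ennreal_mult[symmetric]) (use r in auto)
 also have "?c * (unit_ball_vol (real DIM('a)) * (2 * r) ^ DIM('a)) =
   unit_ball_vol (real DIM('a)) * 2 ^ DIM('a) * min 1 ((2 * r) powr p) / r powr (\<theta> * p)"
  using r by (simp add: powr_add powr_realpow power_mult_distrib)
 finally show ?thesis .
qed

lemma kernel_integrable:
 fixes p \<theta> :: real
 assumes p: "p > 0" and \<theta>: "0 < \<theta>" "\<theta> < 1"
 shows "(\<integral>\<^sup>+z. ennreal (kernel \<theta> p (z :: 'a::euclidean_space)) \<partial>lborel) < \<infinity>"
proof -
 let ?k = "\<lambda>z :: 'a. ennreal (kernel \<theta> p z)" and ?q = "2 powr (- ((1 - \<theta>) * p)) :: real" and ?r = "2 powr (- (\<theta> * p)) :: real"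
 define V where "V = unit_ball_vol (real DIM('a)) * 2 ^ DIM('a)"
 have V: "V \<ge> 0" by (simp add: V_def)
 define s where "s r = {z :: 'a. r < norm z \<and> norm z \<le> 2 * r}" for r
 define a where "a j = (2::real) powr (- real (Suc j))" for j :: nat
 define b where "b j = (2::real) powr (real j)" for j :: nat
 have pos: "a j > 0" "b j > 0" for j by (auto simp: a_def b_def)
 have [measurable]: "s r \<in> sets borel" for r
 proof -
  have "s r = {z. r < norm z} \<inter> {z. norm z \<le> 2 * r}" by (auto simp: s_def)
  also have "\<dots> \<in> sets borel" by measurable
  finally show ?thesis .
 qed
 have [measurable]: "kernel \<theta> p \<in> borel_measurable (borel :: 'a measure)"
  unfolding kernel_def by measurable
 have cover: "?k z \<le> (\<Sum>j. ?k z * indicator (s (a j)) z)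
    + (\<Sum>j. ?k z * indicator (s (b j)) z)" for z :: 'a
 proof -
  have sum_ge: "?k z \<le> (\<Sum>j. ?k z * indicator (s (c j)) z)"
   if "z \<in> s (c j)" for c :: "nat \<Rightarrow> real" and j
  proof -
   have "?k z = (\<Sum>i\<in>{j}. ?k z * indicator (s (c i)) z)"
    using that by simp
   also have "\<dots> \<le> (\<Sum>j. ?k z * indicator (s (c j)) z)"
    by (intro sum_le_suminf) auto
   finally show ?thesis .
  qed
  show ?thesis
  proof (cases "z = 0")
   case True
   thus ?thesis by (simp add: kernel_def)
  next
   case False
   define t where "t = log 2 (norm z)"
   have nz: "norm z = 2 powr t" using False by (simp add: t_def)
   show ?thesis
   proof (cases "t \<le> 0")
    case True
    define j where "j = nat \<lfloor>- t\<rfloor>"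
    have "real j \<le> - t" "- t < real j + 1" using True by (auto simp: j_def)
    hence "z \<in> s (a j)"
     by (auto simp: s_def a_def nz powr_mult_base intro!: powr_less_mono powr_mono)
    from sum_ge[of a j, OF this] show ?thesis by (rule order_trans) simp
   next
    case False
    define j where "j = nat (\<lceil>t\<rceil> - 1)"
    have "\<lceil>t\<rceil> \<ge> 1" using False by linarith
    hence "real j < t" "t \<le> real j + 1" by (auto simp: j_def) linarith+
    hence "z \<in> s (b j)"
     by (auto simp: s_def b_def nz powr_mult_base add.commute intro!: powr_less_mono powr_mono)
    from sum_ge[of b j, OF this] show ?thesis by (rule order_trans) simp
   qed
  qed
 qed
 have A: "(\<integral>\<^sup>+z. ?k z * indicator (s (a j)) z \<partial>lborel)
   \<le> ennreal (V * 2 powr (\<theta> * p) * ?q ^ j)" for j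
 proof -
  have "min 1 ((2 * a j) powr p) / a j powr (\<theta> * p) \<le> (2 * a j) powr p / a j powr (\<theta> * p)"
   by (intro divide_right_mono) auto
  also have "\<dots> = 2 powr (\<theta> * p) * ?q ^ j"
   by (simp add: a_def powr_mult_base powr_powr powr_diff[symmetric] powr_realpow[symmetric] powr_add[symmetric] algebra_simps)
  finally have "V * (min 1 ((2 * a j) powr p) / a j powr (\<theta> * p)) \<le> V * (2 powr (\<theta> * p) * ?q ^ j)"
   using V by (rule mult_left_mono)
  thus ?thesis
   unfolding s_def using order_trans[OF shell_integral[OF pos(1) p \<theta>(1), where 'a = 'a] ennreal_leI]
   by (simp add: V_def mult.assoc)
 qed
 have B: "(\<integral>\<^sup>+z. ?k z * indicator (s (b j)) z \<partial>lborel)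
   \<le> ennreal (V * ?r ^ j)" for j
 proof -
  have "min 1 ((2 * b j) powr p) / b j powr (\<theta> * p) \<le> 1 / b j powr (\<theta> * p)"
   by (intro divide_right_mono) auto
  also have "\<dots> = ?r ^ j"
   by (simp add: b_def powr_powr powr_minus_divide[symmetric] powr_realpow[symmetric] algebra_simps)
  finally have "V * (min 1 ((2 * b j) powr p) / b j powr (\<theta> * p)) \<le> V * ?r ^ j"
   using V by (rule mult_left_mono)
  thus ?thesis
   unfolding s_def using order_trans[OF shell_integral[OF pos(2) p \<theta>(1), where 'a = 'a] ennreal_leI]
   by (simp add: V_def mult.assoc)
 qed
 have geo: "(\<Sum>j. ennreal (C * q ^ j)) < \<infinity>" if "C \<ge> 0" "0 < q" "q < 1" for C q :: real
  using that summable_mult[OF summable_geometric[of q], of C]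
  by (subst suminf_ennreal2) auto
 have "(\<integral>\<^sup>+z. ?k z \<partial>lborel) \<le>
   (\<integral>\<^sup>+z. (\<Sum>j. ?k z * indicator (s (a j)) z)
    + (\<Sum>j. ?k z * indicator (s (b j)) z) \<partial>lborel)"
  by (intro nn_integral_mono cover)
 also have "\<dots> = (\<Sum>j. \<integral>\<^sup>+z. ?k z * indicator (s (a j)) z \<partial>lborel)
    + (\<Sum>j. \<integral>\<^sup>+z. ?k z * indicator (s (b j)) z \<partial>lborel)"
  by (subst nn_integral_add, simp, simp, subst (1 2) nn_integral_suminf) simp_all
 also have "\<dots> \<le> (\<Sum>j. ennreal (V * 2 powr (\<theta> * p) * ?q ^ j))
    + (\<Sum>j. ennreal (V * ?r ^ j))"
  by (intro add_mono suminf_le A B) auto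
 also have "\<dots> < \<infinity>"
 proof -
  have q: "?q < (1::real)" "?r < (1::real)"
   using p \<theta> powr_less_mono[of "- ((1 - \<theta>) * p)" 0 "2::real"] powr_less_mono[of "- (\<theta> * p)" 0 "2::real"]
   by simp_all
  have 1: "(\<Sum>j. ennreal (V * 2 powr (\<theta> * p) * ?q ^ j)) < \<infinity>"
   by (rule geo[OF _ _ q(1)]) (use V in auto)
  have 2: "(\<Sum>j. ennreal (V * ?r ^ j)) < \<infinity>"
   by (rule geo[OF V _ q(2)]) auto
  show ?thesis using 1 2 by (simp only: infinity_ennreal_def ennreal_add_less_top)
 qed
 finally show ?thesis .
qed

section \<open>Roots of extended reals\<close>

lemma enn_root_mono: "p > 0 \<Longrightarrow> I \<le> J \<Longrightarrow> enn_root p I \<le> enn_root p J"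
 by (auto simp: enn_root_def top.extremum_unique less_top intro!: ennreal_leI powr_mono2 enn2real_mono)

lemma enn_root_ennreal: "x \<ge> 0 \<Longrightarrow> enn_root p (ennreal x) = ennreal (x powr (1 / p))"
 by (simp add: enn_root_def)

lemma enn_root_cmult:
 assumes "c > 0"
 shows "enn_root p (ennreal c * I) = ennreal (c powr (1 / p)) * enn_root p I"
proof (cases I)
 case (real x)
 thus ?thesis using assms
  by (simp add: ennreal_mult[symmetric] enn_root_ennreal powr_mult)
qed (use assms in \<open>simp add: enn_root_def ennreal_mult_top\<close>)

text \<open>A crude constant: norms are only ever compared up to constants.\<close>

lemma enn_root_add:
 assumes p: "p \<ge> 1"
 shows "enn_root p (I + J) \<le> 2 * (enn_root p I + enn_root p J)"
proof -
 have "enn_root p (I + J) \<le> enn_root p (ennreal 2 * max I J)"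
  using p by (intro enn_root_mono) (auto simp: max_def mult_2 intro: add_mono)
 also have "\<dots> = ennreal (2 powr (1 / p)) * enn_root p (max I J)" by (rule enn_root_cmult) simp
 also have "\<dots> \<le> 2 * (enn_root p I + enn_root p J)"
 proof (rule mult_mono)
  have "2 powr (1 / p) \<le> 2 powr (1::real)" using p by (intro powr_mono) (auto simp: field_simps)
  thus "ennreal (2 powr (1 / p)) \<le> 2" using ennreal_leI by fastforce
  show "enn_root p (max I J) \<le> enn_root p I + enn_root p J" by (simp add: max_def)
 qed auto
 finally show ?thesis .
qed

definition p_energy :: "real \<Rightarrow> (real^'n::finite) set \<Rightarrow> (real^'n \<Rightarrow> real) \<Rightarrow> ennreal" where
 "p_energy p \<O> g = (\<integral>\<^sup>+x. indicator \<O> x * ennreal (\<bar>g x\<bar> powr p) \<partial>lborel)"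

definition frac_energy :: "real \<Rightarrow> real \<Rightarrow> (real^'n::finite) set \<Rightarrow> (real^'n \<Rightarrow> real) \<Rightarrow> ennreal" where
 "frac_energy \<theta> p \<O> g = (\<integral>\<^sup>+x. \<integral>\<^sup>+y. indicator \<O> x * indicator \<O> y *
   ennreal (\<bar>g x - g y\<bar> powr p / norm (x - y) powr (real CARD('n) + \<theta> * p)) \<partial>lborel \<partial>lborel)"

lemma Lp_norm_version:
 assumes \<O>: "open \<O>" and v: "version_on \<O> g g'"
 shows "Lp_norm p \<O> g = enn_root p (p_energy p \<O> g')"
proof -
 have "(\<integral>\<^sup>+x. ennreal (\<bar>g x\<bar> powr p) \<partial>lebesgue_on \<O>) = p_energy p \<O> g'"
  unfolding nn_integral_lebesgue_on[OF \<O>] p_energy_def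
  by (rule nn_integral_cong_AE) (use v in \<open>auto simp: version_on_def indicator_def elim!: eventually_mono\<close>)
 thus ?thesis by (simp add: Lp_norm_def)
qed

lemma gagliardo_version:
 fixes \<O> :: "(real^'n::finite) set"
 assumes \<O>: "open \<O>" and v: "version_on \<O> g g'"
 shows "gagliardo \<theta> p \<O> g = enn_root p (frac_energy \<theta> p \<O> g')"
proof -
 let ?k = "\<lambda>g x y. ennreal (\<bar>g x - g y\<bar> powr p / norm (x - y) powr (real CARD('n) + \<theta> * p))"
 have [measurable]: "g' \<in> borel_measurable borel" "\<O> \<in> sets borel" using v \<O> by (auto simp: version_on_def)
 have ae: "AE x in lborel. x \<in> \<O> \<longrightarrow> g x = g' x" using v by (simp add: version_on_def)
 have "(\<integral>\<^sup>+x. (\<integral>\<^sup>+y. ?k g x y \<partial>lebesgue_on \<O>) \<partial>lebesgue_on \<O>) =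
    (\<integral>\<^sup>+x. (\<integral>\<^sup>+y. ?k g x y * indicator \<O> y \<partial>lborel) * indicator \<O> x \<partial>lborel)"
  unfolding nn_integral_lebesgue_on[OF \<O>] ..
 also have "\<dots> = frac_energy \<theta> p \<O> g'"
  unfolding frac_energy_def
 proof (rule nn_integral_cong_AE, use ae in eventually_elim)
  fix x assume x: "x \<in> \<O> \<longrightarrow> g x = g' x"
  show "(\<integral>\<^sup>+y. ?k g x y * indicator \<O> y \<partial>lborel) * indicator \<O> x =
    (\<integral>\<^sup>+y. indicator \<O> x * indicator \<O> y * ?k g' x y \<partial>lborel)"
  proof (cases "x \<in> \<O>")
   case True
   hence "(\<integral>\<^sup>+y. ?k g x y * indicator \<O> y \<partial>lborel) = (\<integral>\<^sup>+y. indicator \<O> x * indicator \<O> y * ?k g' x y \<partial>lborel)"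
    using x by (intro nn_integral_cong_AE) (use ae in \<open>auto simp: indicator_def elim!: eventually_mono\<close>)
   thus ?thesis using True by simp
  qed simp
 qed
 finally show ?thesis by (simp add: gagliardo_def)
qed

section \<open>Weighted pullbacks along diffeomorphisms\<close>

text \<open>The same operation transforms functions and, by composition, distributions.\<close>

definition pull :: "(real^'n::finite \<Rightarrow> real) \<Rightarrow> (real^'n \<Rightarrow> real^'n) \<Rightarrow> (real^'n \<Rightarrow> real) \<Rightarrow> real^'n \<Rightarrow> real" where
 "pull m T f = (\<lambda>y. m y * f (T y))"

lemma pd_sum_list:
 assumes S: "open S" and "\<And>a. a \<in> set xs \<Longrightarrow> smooth_on S (f a)" and x: "x \<in> S"
 shows "pd i (\<lambda>x. \<Sum>a\<leftarrow>xs. f a x) x = (\<Sum>a\<leftarrow>xs. pd i (f a) x)"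
  and "smooth_on S (\<lambda>x. \<Sum>a\<leftarrow>xs. f a x)"
proof -
 have "pd i (\<lambda>x. \<Sum>a\<leftarrow>xs. f a x) x = (\<Sum>a\<leftarrow>xs. pd i (f a) x) \<and> smooth_on S (\<lambda>x. \<Sum>a\<leftarrow>xs. f a x)"
  using assms(2)
 proof (induction xs)
  case (Cons a xs)
  hence "smooth_on S (\<lambda>x. \<Sum>a\<leftarrow>xs. f a x)" "smooth_on S (f a)" by auto
  thus ?case using Cons pd_add[of S "f a" "\<lambda>x. \<Sum>a\<leftarrow>xs. f a x" x i] smooth_on_add[OF S] x by auto
 qed (auto simp: pd_const intro: smooth_on_const[OF S])
 thus "pd i (\<lambda>x. \<Sum>a\<leftarrow>xs. f a x) x = (\<Sum>a\<leftarrow>xs. pd i (f a) x)"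
  "smooth_on S (\<lambda>x. \<Sum>a\<leftarrow>xs. f a x)" by auto
qed

lemma ex_UNIV_list: "\<exists>us :: 'n::finite list. \<forall>h :: 'n \<Rightarrow> real. (\<Sum>k\<in>UNIV. h k) = (\<Sum>k\<leftarrow>us. h k)"
proof -
 obtain us :: "'n list" where "set us = UNIV" "distinct us"
  using finite_distinct_list[of "UNIV :: 'n set"] by auto
 thus ?thesis by (metis sum.distinct_set_conv_list)
qed

context diffeo
begin

definition dT :: "'n \<Rightarrow> 'n \<Rightarrow> real^'n \<Rightarrow> real" where
 "dT i j y = frechet_derivative T (at y) (axis i 1) $ j"

lemma smooth_dT: "smooth_on W' (dT i j)"
 unfolding dT_def by (intro smooth_on_nth open_dom smooth_on_frechet smooth)

text \<open>Weight of the adjoint of a weighted pullback along \<open>T\<close>, which is a weighted pullback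
  along \<open>S\<close>; \<open>1 / jac\<close> is the Jacobian of \<open>S\<close>.\<close>

definition adj :: "(real^'n \<Rightarrow> real) \<Rightarrow> real^'n \<Rightarrow> real" where
 "adj m = (\<lambda>x. if x \<in> W then m (S x) / jac (S x) else 0)"

lemma smooth_comp: "smooth_on W' g \<Longrightarrow> smooth_on W (\<lambda>x. g (S x))" "smooth_on W g \<Longrightarrow> smooth_on W' (\<lambda>y. g (T y))"
 using smooth_on_compose[OF open_cod _ smooth(2), of W' g] smooth_on_compose[OF open_dom _ smooth(1), of W g]
  maps by auto

lemma test_adj:
 assumes m: "m \<in> test_functions W'"
 shows "adj m \<in> test_functions W"
proof -
 obtain K where K: "compact K" "K \<subseteq> W'" "\<And>x. x \<notin> K \<Longrightarrow> m x = 0"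
  using m by (auto simp: test_functions_iff)
 have "smooth_on W' (\<lambda>y. m y * inverse (jac y))"
  using jac_pos by (intro smooth_on_mult open_dom test_functions_smooth[OF m] smooth_on_inverse smooth_jac) force+
 from smooth_comp(1)[OF this] have "smooth_on W (adj m)"
  by (rule smooth_on_cong[OF open_cod, rotated]) (simp add: adj_def divide_inverse)
 moreover have "compact (T ` K)"
  using K smooth_on_continuous[OF smooth(1)] by (intro compact_continuous_image) (auto intro: continuous_on_subset)
 moreover have "T ` K \<subseteq> W" using K maps by auto
 moreover have "adj m x = 0" if "x \<notin> T ` K" for x
 proof (cases "x \<in> W")
  case True
  hence "S x \<notin> K" using that by (metis image_eqI inverses(2))
  thus ?thesis by (simp add: adj_def K)
 qed (simp add: adj_def)
 ultimately show ?thesis by (rule test_functionsI[OF open_cod])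
qed

lemma test_pull: "m \<in> test_functions W' \<Longrightarrow> smooth_on W g \<Longrightarrow> pull m T g \<in> test_functions W'"
 unfolding pull_def by (rule test_functions_mult[OF open_dom _ smooth_comp(2)])

lemma pd_pull:
 assumes m: "m \<in> test_functions W'" and \<eta>: "smooth_on UNIV \<eta>"
 shows "pd i (pull m T \<eta>) y = pull (pd i m) T \<eta> y + (\<Sum>j\<in>UNIV. pull (\<lambda>y. m y * dT i j y) T (pd j \<eta>) y)"
proof (cases "y \<in> W'")
 case True
 have "pd i (pull m T \<eta>) y = m y * pd i (\<lambda>y. \<eta> (T y)) y + pd i m y * \<eta> (T y)"
  unfolding pull_def
  by (rule pd_mult[OF test_functions_smooth[OF m] smooth_comp(2)[OF smooth_on_subset[OF \<eta> subset_UNIV]] True])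
 also have "pd i (\<lambda>y. \<eta> (T y)) y = (\<Sum>j\<in>UNIV. dT i j y * pd j \<eta> (T y))"
  unfolding dT_def by (rule pd_chain[OF smooth(1) \<eta> True UNIV_I])
 finally show ?thesis by (simp add: pull_def sum_distrib_left algebra_simps)
next
 case False
 have "pd i (pull m T \<eta>) y = 0" "m y = 0" "pd i m y = 0"
  using False test_functions_outside test_functions_pd[OF test_pull[OF m smooth_on_subset[OF \<eta> subset_UNIV]]]
   m test_functions_pd[OF m] by blast+
 thus ?thesis by (simp add: pull_def)
qed

text \<open>The weights \<open>c\<close> are independent of \<open>\<eta>\<close>, so this bounds derivatives of
  pullbacks uniformly.\<close>

lemma pds_pull:
 assumes m: "m \<in> test_functions W'"
 shows "\<exists>xs. (\<forall>(c, is)\<in>set xs. c \<in> test_functions W' \<and> length is \<le> length js) \<and>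
  (\<forall>\<eta>. smooth_on UNIV \<eta> \<longrightarrow> (\<forall>y. pds js (pull m T \<eta>) y = (\<Sum>(c, is)\<leftarrow>xs. pull c T (pds is \<eta>) y)))"
proof (induction js)
 case Nil
 show ?case by (rule exI[of _ "[(m, [])]"]) (simp add: m pds_simps)
next
 case (Cons j js)
 then obtain xs where xs: "\<And>c is. (c, is) \<in> set xs \<Longrightarrow> c \<in> test_functions W' \<and> length is \<le> length js"
  and e: "\<And>\<eta> y. smooth_on UNIV \<eta> \<Longrightarrow> pds js (pull m T \<eta>) y = (\<Sum>(c, is)\<leftarrow>xs. pull c T (pds is \<eta>) y)"
  by fast
 obtain us :: "'n list" where us: "\<And>h :: 'n \<Rightarrow> real. (\<Sum>k\<in>UNIV. h k) = (\<Sum>k\<leftarrow>us. h k)"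
  using ex_UNIV_list by metis
 define F where "F = (\<lambda>(c, is). (pd j c, is) # map (\<lambda>k. (\<lambda>y. c y * dT j k y, k # is)) us)"
 show ?case
 proof (intro exI[of _ "concat (map F xs)"] conjI allI impI)
  show "\<forall>(c, is)\<in>set (concat (map F xs)). c \<in> test_functions W' \<and> length is \<le> length (j # js)"
   using xs by (fastforce simp: F_def intro: test_functions_pd test_functions_mult[OF open_dom] smooth_dT)
  fix \<eta> :: "real^'n \<Rightarrow> real" and y assume \<eta>: "smooth_on UNIV \<eta>"
  have sm: "smooth_on UNIV ((\<lambda>(c, is). pull c T (pds is \<eta>)) a)" if "a \<in> set xs" for a
   using that xs
   by (cases a rule: prod.exhaust) (auto intro!: test_functions_smooth[OF test_pull] smooth_on_subset[OF smooth_on_pds[OF \<eta>]])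
  have "pds js (pull m T \<eta>) = (\<lambda>y. \<Sum>a\<leftarrow>xs. (\<lambda>(c, is). pull c T (pds is \<eta>)) a y)"
   by (rule ext) (simp add: e[OF \<eta>] case_prod_beta')
  hence "pds (j # js) (pull m T \<eta>) y = pd j (\<lambda>y. \<Sum>a\<leftarrow>xs. (\<lambda>(c, is). pull c T (pds is \<eta>)) a y) y"
   by (simp add: pds_simps)
  also have "\<dots> = (\<Sum>a\<leftarrow>xs. pd j ((\<lambda>(c, is). pull c T (pds is \<eta>)) a) y)"
   by (rule pd_sum_list(1)[OF open_UNIV sm UNIV_I])
  also have "\<dots> = (\<Sum>a\<leftarrow>xs. \<Sum>(c, is)\<leftarrow>F a. pull c T (pds is \<eta>) y)"
  proof (intro arg_cong[where f = sum_list] map_cong refl)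
   fix a assume a: "a \<in> set xs"
   obtain c "is" where ci: "a = (c, is)" by force
   have "pd j (pull c T (pds is \<eta>)) y = pull (pd j c) T (pds is \<eta>) y +
     (\<Sum>k\<leftarrow>us. pull (\<lambda>y. c y * dT j k y) T (pds (k # is) \<eta>) y)"
    using xs a pd_pull[OF _ smooth_on_pds[OF \<eta>]] unfolding ci us[symmetric] pds_simps by blast
   thus "pd j ((\<lambda>(c, is). pull c T (pds is \<eta>)) a) y = (\<Sum>(c, is)\<leftarrow>F a. pull c T (pds is \<eta>) y)"
    by (simp add: ci F_def o_def)
  qed
  also have "\<dots> = (\<Sum>(c, is)\<leftarrow>concat (map F xs). pull c T (pds is \<eta>) y)"
   by (induction xs) auto
  finally show "pds (j # js) (pull m T \<eta>) y = (\<Sum>(c, is)\<leftarrow>concat (map F xs). pull c T (pds is \<eta>) y)" .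
 qed
qed

text \<open>The product and chain rules solved for the term in which the derivative falls on \<open>\<zeta>\<close>.\<close>

lemma pull_pd:
 fixes j :: 'n
 assumes m: "m \<in> test_functions W" and \<zeta>: "smooth_on UNIV \<zeta>"
 defines "b \<equiv> \<lambda>k x. m x * dT j k (S x)"
 shows "pull m S (pd j \<zeta>) x = (\<Sum>k\<in>UNIV. pd k (pull (b k) S \<zeta>) x) + pull (\<lambda>x. - (\<Sum>k\<in>UNIV. pd k (b k) x)) S \<zeta> x"
  and "b k \<in> test_functions W"
proof -
 interpret R: diffeo W W' S T by (rule diffeo_sym)
 have b: "b k \<in> test_functions W" for k
  unfolding b_def by (rule test_functions_mult[OF open_cod m smooth_comp(1)[OF smooth_dT]])
 show "b k \<in> test_functions W" by (rule b)
 have sz: "smooth_on W (\<lambda>x. \<zeta> (S x))" by (rule smooth_comp(1)[OF smooth_on_subset[OF \<zeta> subset_UNIV]])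
 show "pull m S (pd j \<zeta>) x = (\<Sum>k\<in>UNIV. pd k (pull (b k) S \<zeta>) x) + pull (\<lambda>x. - (\<Sum>k\<in>UNIV. pd k (b k) x)) S \<zeta> x"
 proof (cases "x \<in> W")
  case x: True
  have "(\<Sum>k\<in>UNIV. pd k (pull (b k) S \<zeta>) x) = (\<Sum>k\<in>UNIV. b k x * pd k (\<lambda>x. \<zeta> (S x)) x + pd k (b k) x * \<zeta> (S x))"
   unfolding pull_def by (intro sum.cong refl pd_mult[OF test_functions_smooth[OF b] sz x])
  also have "\<dots> = m x * (\<Sum>k\<in>UNIV. frechet_derivative T (at (S x)) (axis j 1) $ k * pd k (\<lambda>x. \<zeta> (S x)) x)
    + (\<Sum>k\<in>UNIV. pd k (b k) x) * \<zeta> (S x)"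
   by (simp add: sum.distrib sum_distrib_left sum_distrib_right b_def dT_def mult.assoc)
  also have "(\<Sum>k\<in>UNIV. frechet_derivative T (at (S x)) (axis j 1) $ k * pd k (\<lambda>x. \<zeta> (S x)) x) =
    frechet_derivative (\<lambda>x. \<zeta> (S x)) (at x) (frechet_derivative T (at (S x)) (axis j 1))"
   using smooth_on_has_derivative[OF sz x] by (intro frechet_derivative_pd[symmetric]) (auto simp: differentiable_def)
  also have "frechet_derivative (\<lambda>x. \<zeta> (S x)) (at x) =
    (\<lambda>v. frechet_derivative \<zeta> (at (S x)) (frechet_derivative S (at x) v))"
   by (rule frechet_derivative_at[symmetric], rule has_derivative_compose[OF smooth_on_has_derivative[OF smooth(2) x]
      smooth_on_has_derivative[OF \<zeta> UNIV_I]])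
  also have "frechet_derivative S (at x) (frechet_derivative T (at (S x)) (axis j 1)) = axis j 1"
   using derivative_inverse[OF maps(2)[OF x]] by (simp add: inverses x)
  finally show ?thesis by (simp add: pull_def pd_def)
 next
  case False
  have "pd k (pull (b k) S \<zeta>) x = 0" for k
   using test_functions_outside[OF test_functions_pd[OF R.test_pull[OF b smooth_on_subset[OF \<zeta> subset_UNIV]]] False] .
  thus ?thesis
   using test_functions_outside[OF m False] test_functions_outside[OF test_functions_pd[OF b] False]
   by (simp add: pull_def)
 qed
qed

text \<open>Repeated use of \<open>pull_pd\<close> writes a pullback of a derivative as a sum of derivatives of
  pullbacks; this is the form in which the definition of weak derivatives can be applied.\<close>

lemma pull_pds:
 assumes m: "m \<in> test_functions W"
 shows "\<exists>xs. (\<forall>(c, is)\<in>set xs. c \<in> test_functions W \<and> length is \<le> length js) \<and>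
  (\<forall>\<eta>. smooth_on UNIV \<eta> \<longrightarrow> (\<forall>x. pull m S (pds js \<eta>) x = (\<Sum>(c, is)\<leftarrow>xs. pds is (pull c S \<eta>) x)))"
 using m
proof (induction js arbitrary: m)
 case Nil
 thus ?case by (intro exI[of _ "[(m, [])]"]) (simp add: pds_simps)
next
 case (Cons j js)
 interpret R: diffeo W W' S T by (rule diffeo_sym)
 define b where "b k x = m x * dT j k (S x)" for k x
 define d where "d x = - (\<Sum>k\<in>UNIV. pd k (b k) x)" for x
 have bt: "b k \<in> test_functions W" for k
  using pull_pd(2)[OF Cons.prems smooth_on_const[OF open_UNIV], of j k] by (simp add: b_def[abs_def])
 have dt: "d \<in> test_functions W"
 proof -
  have "(\<lambda>x. (-1) * (\<Sum>k\<in>UNIV. pd k (b k) x)) \<in> test_functions W"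
   by (intro test_functions_cmult test_functions_sum test_functions_pd bt)
  thus ?thesis by (simp add: d_def[abs_def])
 qed
 obtain us :: "'n list" where us: "\<And>h :: 'n \<Rightarrow> real. (\<Sum>k\<in>UNIV. h k) = (\<Sum>k\<leftarrow>us. h k)"
  using ex_UNIV_list by metis
 have "\<forall>k. \<exists>xs. (\<forall>(c, is)\<in>set xs. c \<in> test_functions W \<and> length is \<le> length js) \<and>
  (\<forall>\<eta>. smooth_on UNIV \<eta> \<longrightarrow> (\<forall>x. pull (b k) S (pds js \<eta>) x = (\<Sum>(c, is)\<leftarrow>xs. pds is (pull c S \<eta>) x)))"
  using Cons.IH[OF bt] by blast
 then obtain xs where xs: "\<And>k c is. (c, is) \<in> set (xs k) \<Longrightarrow> c \<in> test_functions W \<and> length is \<le> length js"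
  and xe: "\<And>k \<eta> x. smooth_on UNIV \<eta> \<Longrightarrow> pull (b k) S (pds js \<eta>) x = (\<Sum>(c, is)\<leftarrow>xs k. pds is (pull c S \<eta>) x)"
  unfolding choice_iff by fast
 obtain ys where ys: "\<And>c is. (c, is) \<in> set ys \<Longrightarrow> c \<in> test_functions W \<and> length is \<le> length js"
  and ye: "\<And>\<eta> x. smooth_on UNIV \<eta> \<Longrightarrow> pull d S (pds js \<eta>) x = (\<Sum>(c, is)\<leftarrow>ys. pds is (pull c S \<eta>) x)"
  using Cons.IH[OF dt] by fast
 define F where "F k = map (\<lambda>(c, is). (c, k # is)) (xs k)" for k
 show ?case
 proof (intro exI[of _ "concat (map F us) @ ys"] conjI allI impI)
  show "\<forall>(c, is)\<in>set (concat (map F us) @ ys). c \<in> test_functions W \<and> length is \<le> length (j # js)"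
   using xs ys by (fastforce simp: F_def)
  fix \<eta> :: "real^'n \<Rightarrow> real" and x assume \<eta>: "smooth_on UNIV \<eta>"
  have sm: "smooth_on UNIV ((\<lambda>(c, is). pds is (pull c S \<eta>)) a)" if "a \<in> set (xs k)" for a k
   using that xs
   by (cases a rule: prod.exhaust) (auto intro!: test_functions_smooth[OF test_functions_pds[OF R.test_pull]] smooth_on_subset[OF \<eta>])
  have k: "pd k (pull (b k) S (pds js \<eta>)) x = (\<Sum>(c, is)\<leftarrow>F k. pds is (pull c S \<eta>) x)" for k
  proof -
   have "pull (b k) S (pds js \<eta>) = (\<lambda>x. \<Sum>a\<leftarrow>xs k. (\<lambda>(c, is). pds is (pull c S \<eta>)) a x)"
    by (rule ext) (simp add: xe[OF \<eta>] case_prod_beta')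
   hence "pd k (pull (b k) S (pds js \<eta>)) x = (\<Sum>a\<leftarrow>xs k. pd k ((\<lambda>(c, is). pds is (pull c S \<eta>)) a) x)"
    using pd_sum_list(1)[OF open_UNIV sm[where k = k] UNIV_I] by simp
   also have "\<dots> = (\<Sum>(c, is)\<leftarrow>F k. pds is (pull c S \<eta>) x)"
    by (simp add: F_def o_def case_prod_beta' pds_simps)
   finally show ?thesis .
  qed
  have "pull m S (pds (j # js) \<eta>) x = (\<Sum>k\<in>UNIV. pd k (pull (b k) S (pds js \<eta>)) x) + pull d S (pds js \<eta>) x"
   using pull_pd(1)[OF Cons.prems smooth_on_pds[OF \<eta>], of j js x] by (simp add: pds_simps b_def[abs_def] d_def[abs_def])
  also have "\<dots> = (\<Sum>k\<leftarrow>us. \<Sum>(c, is)\<leftarrow>F k. pds is (pull c S \<eta>) x) + (\<Sum>(c, is)\<leftarrow>ys. pds is (pull c S \<eta>) x)"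
   by (simp add: us k ye[OF \<eta>])
  also have "(\<Sum>k\<leftarrow>us. \<Sum>(c, is)\<leftarrow>F k. pds is (pull c S \<eta>) x) = (\<Sum>(c, is)\<leftarrow>concat (map F us). pds is (pull c S \<eta>) x)"
   by (induction us) auto
  finally show "pull m S (pds (j # js) \<eta>) x = (\<Sum>(c, is)\<leftarrow>concat (map F us) @ ys. pds is (pull c S \<eta>) x)"
   by simp
 qed
qed

lemma borel_pull:
 assumes m: "m \<in> test_functions W'" and f[measurable]: "f \<in> borel_measurable borel"
 shows "pull m T f \<in> borel_measurable borel"
proof -
 note [measurable] = borel_test_function[OF m]
 have "pull m T f = (\<lambda>y. m y * (indicator W' y * f (T y)))"
  using test_functions_outside[OF m] by (auto simp: pull_def indicator_def fun_eq_iff)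
 also have "\<dots> \<in> borel_measurable borel" using borel_comp(2)[OF _ f] f by measurable
 finally show ?thesis .
qed

lemma version_pull:
 assumes W: "W \<subseteq> \<O>" and m: "m \<in> test_functions W'" and v: "version_on \<O> f f'"
 shows "version_on UNIV (pull m T f) (pull m T f')"
proof -
 have "AE x in lborel. x \<in> W \<longrightarrow> f x = f' x"
  using v W by (auto simp: version_on_def elim!: eventually_mono)
 hence "AE y in lborel. y \<in> W' \<longrightarrow> f (T y) = f' (T y)" by (rule AE_cov)
 hence "AE y in lborel. pull m T f y = pull m T f' y"
  by eventually_elim (use test_functions_outside[OF m] in \<open>auto simp: pull_def\<close>)
 thus ?thesis using borel_pull[OF m] v by (simp add: version_on_def)
qed

lemma pull_adjoint:
 assumes m: "m \<in> test_functions W'" and f[measurable]: "f \<in> borel_measurable borel"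
  and g[measurable]: "g \<in> borel_measurable borel"
 shows "(LBINT y. pull m T f y * g y) = (LBINT x. f x * pull (adj m) S g x)"
proof -
 interpret R: diffeo W W' S T by (rule diffeo_sym)
 define h where "h x = f x * pull (adj m) S g x" for x
 have [measurable]: "h \<in> borel_measurable borel"
  unfolding h_def using R.borel_pull[OF test_adj[OF m] g] by measurable
 have "(LBINT x. f x * pull (adj m) S g x) = (LBINT x. indicator W x * h x)"
  by (intro Bochner_Integration.integral_cong) (auto simp: h_def indicator_def pull_def adj_def)
 also have "\<dots> = (LBINT y. indicator W' y * jac y * h (T y))" by (rule integral_cov) simp
 also have "\<dots> = (LBINT y. pull m T f y * g y)"
 proof (intro Bochner_Integration.integral_cong refl)
  fix y show "indicator W' y * jac y * h (T y) = pull m T f y * g y"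
   using jac_pos[of y] test_functions_outside[OF m, of y]
   by (auto simp: indicator_def h_def pull_def adj_def maps inverses)
 qed
 finally show ?thesis ..
qed

lemma integrable_pull:
 assumes W: "W \<subseteq> \<O>" and m: "m \<in> test_functions W'" and f[measurable]: "f \<in> borel_measurable borel"
  and i: "\<And>K. compact K \<Longrightarrow> K \<subseteq> \<O> \<Longrightarrow> integrable lborel (\<lambda>x. indicator K x * f x)"
 shows "integrable lborel (pull m T f)"
proof -
 note [measurable] = borel_pull[OF m f] borel_test_function[OF test_adj[OF m]]
 have fi: "integrable lborel (\<lambda>x. f x * adj m x)"
  by (rule integrable_times_test_function[OF f test_functions_mono[OF test_adj[OF m] W] i])
 have "(\<integral>\<^sup>+y. ennreal (norm (pull m T f y)) \<partial>lborel) =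
   (\<integral>\<^sup>+y. indicator W' y * ennreal (jac y) * ennreal (norm (f (T y) * adj m (T y))) \<partial>lborel)"
 proof (intro nn_integral_cong)
  fix y show "ennreal (norm (pull m T f y)) = indicator W' y * ennreal (jac y) * ennreal (norm (f (T y) * adj m (T y)))"
   using jac_pos[of y] test_functions_outside[OF m, of y]
   by (auto simp: indicator_def pull_def adj_def maps inverses ennreal_mult[symmetric] abs_mult)
 qed
 also have "\<dots> = (\<integral>\<^sup>+x. indicator W x * ennreal (norm (f x * adj m x)) \<partial>lborel)" by (rule nn_cov) simp
 also have "\<dots> \<le> (\<integral>\<^sup>+x. ennreal (norm (f x * adj m x)) \<partial>lborel)"
  by (intro nn_integral_mono) (auto simp: indicator_def)
 also have "\<dots> < \<infinity>" using fi by (simp add: integrable_iff_bounded)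
 finally show ?thesis by (simp add: integrable_iff_bounded)
qed

end

section \<open>Weak derivatives\<close>

definition weak_pds :: "(real^'n::finite) set \<Rightarrow> 'n list \<Rightarrow> (real^'n \<Rightarrow> real) \<Rightarrow> (real^'n \<Rightarrow> real) \<Rightarrow> bool" where
 "weak_pds \<O> is f g \<longleftrightarrow> locally_integrable \<O> f \<and> locally_integrable \<O> g \<and>
   (\<forall>\<eta>\<in>test_functions \<O>. regular_dist \<O> f (pds is \<eta>) = (-1) ^ length is * regular_dist \<O> g \<eta>)"

lemma is_weak_deriv_iff: "is_weak_deriv \<O> \<nu> f g \<longleftrightarrow> weak_pds \<O> (list_of \<nu>) f g"
 by (simp add: is_weak_deriv_def weak_pds_def mpd_eq_pds length_list_of)

lemma weak_pds_iff: "weak_pds \<O> is f g \<longleftrightarrow> is_weak_deriv \<O> (count_list is) f g"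
proof -
 have "pds is \<eta> = mpd (count_list is) \<eta>" if "\<eta> \<in> test_functions \<O>" for \<eta>
  by (rule pds_eq_mpd[OF test_functions_smooth[OF that]])
 thus ?thesis by (simp add: is_weak_deriv_def weak_pds_def length_eq_order_of cong: ball_cong)
qed

text \<open>A weak derivative of order \<open>is @ js\<close> is one of order \<open>js\<close> of the one of
  order \<open>is\<close>; this gives derivatives of lower order a weak gradient.\<close>

lemma weak_pds_shift:
 assumes "weak_pds \<O> is f g" "weak_pds \<O> (is @ js) f h"
 shows "weak_pds \<O> js g h"
 using assms test_functions_pds
 by (force simp: weak_pds_def pds_simps power_add)

lemma version_add:
 "version_on \<O> f f' \<Longrightarrow> version_on \<O> g g' \<Longrightarrow> version_on \<O> (\<lambda>x. f x + g x) (\<lambda>x. f' x + g' x)"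
 unfolding version_on_def by (auto elim: eventually_elim2)

lemma version_cmult: "version_on \<O> f f' \<Longrightarrow> version_on \<O> (\<lambda>x. c * f x) (\<lambda>x. c * f' x)"
 unfolding version_on_def by (auto elim: eventually_mono)

lemma version_zero: "version_on \<O> (\<lambda>x. 0) (\<lambda>x. 0)"
 by (simp add: version_on_def)

lemma version_sum_list:
 "(\<And>a. a \<in> set xs \<Longrightarrow> version_on \<O> (f a) (f' a)) \<Longrightarrow>
  version_on \<O> (\<lambda>x. \<Sum>a\<leftarrow>xs. f a x) (\<lambda>x. \<Sum>a\<leftarrow>xs. f' a x)"
 by (induction xs) (auto intro: version_zero version_add)

lemma integral_sum_list:
 fixes f :: "'b \<Rightarrow> 'a \<Rightarrow> real"
 assumes "\<And>a. a \<in> set xs \<Longrightarrow> integrable M (f a)"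
 shows "integrable M (\<lambda>x. \<Sum>a\<leftarrow>xs. f a x)" "(\<integral>x. (\<Sum>a\<leftarrow>xs. f a x) \<partial>M) = (\<Sum>a\<leftarrow>xs. \<integral>x. f a x \<partial>M)"
proof -
 have "integrable M (\<lambda>x. \<Sum>a\<leftarrow>xs. f a x) \<and> (\<integral>x. (\<Sum>a\<leftarrow>xs. f a x) \<partial>M) = (\<Sum>a\<leftarrow>xs. \<integral>x. f a x \<partial>M)"
  using assms by (induction xs) auto
 thus "integrable M (\<lambda>x. \<Sum>a\<leftarrow>xs. f a x)" "(\<integral>x. (\<Sum>a\<leftarrow>xs. f a x) \<partial>M) = (\<Sum>a\<leftarrow>xs. \<integral>x. f a x \<partial>M)"
  by auto
qed

lemma integrable_locally:
 assumes "open \<O>" "version_on \<O> g g'" "integrable lborel g'"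
 shows "locally_integrable \<O> g"
 unfolding locally_integrable_version[OF assms(1,2)]
 using assms(3) by (auto intro!: integrable_real_mult_indicator simp: mult.commute borel_compact)

lemma sum_list_mult_right: "(\<Sum>a\<leftarrow>xs. f a) * (c::real) = (\<Sum>a\<leftarrow>xs. f a * c)"
 by (induction xs) (auto simp: distrib_right)

text \<open>The chain rule for weak derivatives: the derivatives are moved onto the test function, the
  integral is transformed to \<open>\<O>\<close>, and there the transformed test function is a sum of derivatives
  of test functions.\<close>

lemma (in diffeo) weak_pds_pull:
 assumes \<O>: "open \<O>" "W \<subseteq> \<O>" and m: "m \<in> test_functions W'"
 shows "\<exists>xs. (\<forall>(c, is)\<in>set xs. c \<in> test_functions W' \<and> length is \<le> length js) \<and>
  (\<forall>f g. (\<forall>is. length is \<le> length js \<longrightarrow> weak_pds \<O> is f (g is)) \<longrightarrow>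
    weak_pds UNIV js (pull m T f) (\<lambda>y. \<Sum>(c, is)\<leftarrow>xs. pull c T (g is) y))"
proof -
 interpret R: diffeo W W' S T by (rule diffeo_sym)
 obtain ys where ys: "\<And>c is. (c, is) \<in> set ys \<Longrightarrow> c \<in> test_functions W \<and> length is \<le> length js"
  and ye: "\<And>\<eta> x. smooth_on UNIV \<eta> \<Longrightarrow> pull (adj m) S (pds js \<eta>) x = (\<Sum>(c, is)\<leftarrow>ys. pds is (pull c S \<eta>) x)"
  using pull_pds[OF test_adj[OF m], of js] by fast
 define sg where "sg is = (-1::real) ^ (length js + length is)" for "is" :: "'n list"
 define xs where "xs = map (\<lambda>(c, is). (\<lambda>y. sg is * R.adj c y, is)) ys"
 show ?thesis
 proof (intro exI[of _ xs] conjI allI impI)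
  show xt: "\<forall>(c, is)\<in>set xs. c \<in> test_functions W' \<and> length is \<le> length js"
   using ys by (auto simp: xs_def intro!: test_functions_cmult R.test_adj)
  fix f and g :: "'n list \<Rightarrow> real^'n \<Rightarrow> real"
  assume w: "\<forall>is. length is \<le> length js \<longrightarrow> weak_pds \<O> is f (g is)"
  hence li: "locally_integrable \<O> f" "\<And>is. length is \<le> length js \<Longrightarrow> locally_integrable \<O> (g is)"
   by (auto simp: weak_pds_def)
  obtain f' where f': "version_on \<O> f f'"
   using version_exists[OF \<O>(1) locally_integrable_measurable[OF \<O>(1) li(1)]] .
  have "\<forall>is. \<exists>g'. length is \<le> length js \<longrightarrow> version_on \<O> (g is) g'"
   using version_exists[OF \<O>(1) locally_integrable_measurable[OF \<O>(1) li(2)]] by metis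
  then obtain g' where g': "\<And>is. length is \<le> length js \<Longrightarrow> version_on \<O> (g is) (g' is)" by metis
  have fm: "f' \<in> borel_measurable borel" "\<And>is. length is \<le> length js \<Longrightarrow> g' is \<in> borel_measurable borel"
   using f' g' by (auto simp: version_on_def)
  note fi = locally_integrable_version[OF \<O>(1) f', THEN iffD1, OF li(1), rule_format]
  have gi: "integrable lborel (\<lambda>x. indicator K x * g' is x)"
   if "length is \<le> length js" "compact K" "K \<subseteq> \<O>" for "is" K
   using locally_integrable_version[OF \<O>(1) g'[OF that(1)], THEN iffD1, OF li(2)[OF that(1)]] that by blast
  let ?G = "\<lambda>y. \<Sum>(c, is)\<leftarrow>xs. pull c T (g is) y" and ?G' = "\<lambda>y. \<Sum>(c, is)\<leftarrow>xs. pull c T (g' is) y"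
  have vf: "version_on UNIV (pull m T f) (pull m T f')" by (rule version_pull[OF \<O>(2) m f'])
  have vG: "version_on UNIV ?G ?G'"
   using version_sum_list[of xs UNIV "\<lambda>(c, is). pull c T (g is)" "\<lambda>(c, is). pull c T (g' is)"] xt
   by (force simp: case_prod_beta' intro: version_pull[OF \<O>(2) _ g'])
  have iG: "integrable lborel (\<lambda>y. (\<lambda>(c, is). pull c T (g' is)) a y)" if "a \<in> set xs" for a
   using that xt integrable_pull[OF \<O>(2) _ fm(2) gi] by auto
  have IG: "integrable lborel ?G'"
   using integral_sum_list(1)[OF iG] by (simp add: case_prod_beta')
  show "weak_pds UNIV js (pull m T f) ?G"
   unfolding weak_pds_def
  proof (intro conjI ballI)
   show "locally_integrable UNIV (pull m T f)"
    by (rule integrable_locally[OF open_UNIV vf integrable_pull[OF \<O>(2) m fm(1) fi]]) auto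
   show "locally_integrable UNIV ?G" by (rule integrable_locally[OF open_UNIV vG IG])
   fix \<eta> :: "real^'n \<Rightarrow> real" assume \<eta>: "\<eta> \<in> test_functions UNIV"
   note \<eta>s = test_functions_smooth[OF \<eta>, of UNIV] and \<eta>m = borel_test_function[OF \<eta>]
   have pt: "pull c S \<eta> \<in> test_functions \<O>" if "(c, is) \<in> set ys" for c "is"
    using that ys by (intro test_functions_mono[OF R.test_pull \<O>(2)] smooth_on_subset[OF \<eta>s]) auto
   have tm: "(LBINT x. f' x * pds is (pull c S \<eta>) x) =
     (-1) ^ length js * (LBINT y. pull (\<lambda>y. sg is * R.adj c y) T (g' is) y * \<eta> y)"
    if ci: "(c, is) \<in> set ys" for c "is"
   proof -
    have c: "c \<in> test_functions W" "length is \<le> length js" using ys[OF ci] by auto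
    have "(LBINT x. f' x * pds is (pull c S \<eta>) x) = regular_dist \<O> f (pds is (pull c S \<eta>))"
     by (rule regular_dist_version[OF \<O>(1) f' test_functions_pds[OF pt[OF ci]], symmetric])
    also have "\<dots> = (-1) ^ length is * regular_dist \<O> (g is) (pull c S \<eta>)"
     using w c(2) pt[OF ci] by (auto simp: weak_pds_def)
    also have "regular_dist \<O> (g is) (pull c S \<eta>) = (LBINT x. g' is x * pull c S \<eta> x)"
     by (rule regular_dist_version[OF \<O>(1) g'[OF c(2)] pt[OF ci]])
    also have "\<dots> = (LBINT x. pull c S \<eta> x * g' is x)" by (simp add: mult.commute)
    also have "\<dots> = (LBINT y. \<eta> y * pull (R.adj c) T (g' is) y)"
     by (rule R.pull_adjoint[OF c(1) \<eta>m fm(2)[OF c(2)]])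
    also have "(-1) ^ length is * \<dots> = (-1) ^ length js * (LBINT y. pull (\<lambda>y. sg is * R.adj c y) T (g' is) y * \<eta> y)"
    proof -
     have "(LBINT y. pull (\<lambda>y. sg is * R.adj c y) T (g' is) y * \<eta> y) =
       (LBINT y. sg is * (\<eta> y * pull (R.adj c) T (g' is) y))"
      by (intro Bochner_Integration.integral_cong) (simp_all add: pull_def)
     also have "\<dots> = sg is * (LBINT y. \<eta> y * pull (R.adj c) T (g' is) y)" by simp
     finally show ?thesis by (simp add: sg_def power_add)
    qed
    finally show ?thesis .
   qed
   have it: "integrable lborel (\<lambda>x. f' x * pds is (pull c S \<eta>) x)" if "(c, is) \<in> set ys" for c "is"
    by (rule integrable_times_test_function[OF fm(1) test_functions_pds[OF pt[OF that]] fi]) auto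
   have "regular_dist UNIV (pull m T f) (pds js \<eta>) = (LBINT y. pull m T f' y * pds js \<eta> y)"
    by (rule regular_dist_version[OF open_UNIV vf test_functions_pds[OF \<eta>]])
   also have "\<dots> = (LBINT x. f' x * pull (adj m) S (pds js \<eta>) x)"
    by (rule pull_adjoint[OF m fm(1) borel_test_function[OF test_functions_pds[OF \<eta>]]])
   also have "\<dots> = (LBINT x. (\<Sum>a\<leftarrow>ys. (\<lambda>(c, is) x. f' x * pds is (pull c S \<eta>) x) a x))"
    by (intro Bochner_Integration.integral_cong refl)
      (simp add: ye[OF \<eta>s] sum_list_mult_right mult.commute[of "f' _"] case_prod_beta')
   also have "\<dots> = (\<Sum>a\<leftarrow>ys. LBINT x. (\<lambda>(c, is) x. f' x * pds is (pull c S \<eta>) x) a x)"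
    by (rule integral_sum_list(2)) (use it in auto)
   also have "\<dots> = (\<Sum>a\<leftarrow>ys. (-1) ^ length js *
     (LBINT y. (\<lambda>(c, is) y. pull (\<lambda>y. sg is * R.adj c y) T (g' is) y * \<eta> y) a y))"
    by (intro arg_cong[where f = sum_list] map_cong refl) (use tm in auto)
   also have "\<dots> = (-1) ^ length js * (\<Sum>a\<leftarrow>xs. LBINT y. (\<lambda>(c, is) y. pull c T (g' is) y * \<eta> y) a y)"
    by (simp add: xs_def o_def case_prod_beta' sum_list_const_mult)
   also have "(\<Sum>a\<leftarrow>xs. LBINT y. (\<lambda>(c, is) y. pull c T (g' is) y * \<eta> y) a y) =
     (LBINT y. (\<Sum>a\<leftarrow>xs. (\<lambda>(c, is) y. pull c T (g' is) y * \<eta> y) a y))"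
   proof (rule integral_sum_list(2)[symmetric])
    fix a assume a: "a \<in> set xs"
    obtain c "is" where ci: "a = (c, is)" by force
    have "integrable lborel (pull c T (g' is))" "pull c T (g' is) \<in> borel_measurable borel"
     using iG[OF a] by (auto simp: ci)
    thus "integrable lborel ((\<lambda>(c, is) y. pull c T (g' is) y * \<eta> y) a)"
     unfolding ci prod.case
     using integrable_mult_indicator[where M = lborel and f = "pull c T (g' is)"]
     by (intro integrable_times_test_function[OF _ \<eta>]) (auto simp: borel_compact)
   qed
   also have "\<dots> = (LBINT y. ?G' y * \<eta> y)"
    by (simp add: sum_list_mult_right case_prod_beta')
   also have "\<dots> = regular_dist UNIV ?G \<eta>"
    by (rule regular_dist_version[OF open_UNIV vG \<eta>, symmetric])
   finally show "regular_dist UNIV (pull m T f) (pds js \<eta>) = (-1) ^ length js * regular_dist UNIV ?G \<eta>" .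
  qed
 qed
qed

text \<open>The difference of versions of \<open>g\<close> and \<open>h\<close> is orthogonal to all test functions.\<close>

lemma weak_pds_unique:
 assumes \<O>: "open \<O>" and w: "weak_pds \<O> is f g" "weak_pds \<O> is f h" and v: "version_on \<O> g g'"
 shows "version_on \<O> h g'"
proof -
 have li: "locally_integrable \<O> g" "locally_integrable \<O> h" using w by (auto simp: weak_pds_def)
 obtain h' where h': "version_on \<O> h h'"
  using version_exists[OF \<O> locally_integrable_measurable[OF \<O> li(2)]] .
 note ig = locally_integrable_version[OF \<O> v, THEN iffD1, OF li(1), rule_format]
  and ih = locally_integrable_version[OF \<O> h', THEN iffD1, OF li(2), rule_format]
 have m: "g' \<in> borel_measurable borel" "h' \<in> borel_measurable borel" using v h' by (auto simp: version_on_def)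
 have "AE x in lborel. x \<in> \<O> \<longrightarrow> h' x - g' x = 0"
 proof (rule fundamental_lemma[OF \<O>])
  show "(\<lambda>x. h' x - g' x) \<in> borel_measurable borel" using m by measurable
  show "integrable lborel (\<lambda>x. indicator K x * (h' x - g' x))" if "compact K" "K \<subseteq> \<O>" for K
   using Bochner_Integration.integrable_diff[OF ih ig, of K K] that by (simp add: right_diff_distrib)
  fix \<eta> assume \<eta>: "\<eta> \<in> test_functions \<O>"
  have "(-1) ^ length is * regular_dist \<O> g \<eta> = (-1::real) ^ length is * regular_dist \<O> h \<eta>"
   using w \<eta> by (metis weak_pds_def)
  hence "regular_dist \<O> g \<eta> = regular_dist \<O> h \<eta>" by simp
  hence "(LBINT x. h' x * \<eta> x) - (LBINT x. g' x * \<eta> x) = 0"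
   by (simp add: regular_dist_version[OF \<O> v \<eta>] regular_dist_version[OF \<O> h' \<eta>])
  thus "(LBINT x. (h' x - g' x) * \<eta> x) = 0"
   using integrable_times_test_function[OF m(2) \<eta> ih] integrable_times_test_function[OF m(1) \<eta> ig]
   by (simp add: left_diff_distrib)
 qed
 thus ?thesis
  using h' m(1) unfolding version_on_def by (auto elim: eventually_elim2)
qed

section \<open>Boundedness of weighted pullbacks\<close>

lemma powr_add_bound:
 fixes a b p :: real
 assumes "0 \<le> a" "0 \<le> b" "0 \<le> p"
 shows "(a + b) powr p \<le> 2 powr p * (a powr p + b powr p)"
proof -
 have "(a + b) powr p \<le> (2 * max a b) powr p" using assms by (intro powr_mono2) auto
 also have "\<dots> = 2 powr p * max a b powr p" using assms by (simp add: powr_mult)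
 also have "\<dots> \<le> 2 powr p * (a powr p + b powr p)" by (intro mult_left_mono) (auto simp: max_def)
 finally show ?thesis .
qed

lemma abs_powr_add_bound: "0 \<le> p \<Longrightarrow> \<bar>a + b\<bar> powr p \<le> 2 powr p * (\<bar>a\<bar> powr p + \<bar>b\<bar> powr p)" for a b p :: real
 by (rule order_trans[OF powr_mono2 powr_add_bound]) auto

lemma sum_powr_bound:
 fixes a :: "'i::finite \<Rightarrow> real"
 assumes "\<And>i. a i \<ge> 0" "p \<ge> 0"
 shows "(\<Sum>i\<in>UNIV. a i) powr p \<le> real CARD('i) powr p * (\<Sum>i\<in>UNIV. a i powr p)"
proof -
 define M where "M = Max (range a)"
 have M: "a i \<le> M" for i by (simp add: M_def)
 have "M \<in> range a" unfolding M_def by (rule Max_in) auto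
 then obtain j where j: "M = a j" by auto
 have "(\<Sum>i\<in>UNIV. a i) \<le> real CARD('i) * M" using sum_bounded_above[of UNIV a M] M by simp
 hence "(\<Sum>i\<in>UNIV. a i) powr p \<le> (real CARD('i) * M) powr p"
  using assms by (intro powr_mono2) (auto intro: sum_nonneg)
 also have "\<dots> = real CARD('i) powr p * a j powr p" using assms by (simp add: j powr_mult)
 also have "\<dots> \<le> real CARD('i) powr p * (\<Sum>i\<in>UNIV. a i powr p)"
  by (intro mult_left_mono member_le_sum) auto
 finally show ?thesis .
qed

lemma nn_integral_translate:
 assumes [measurable]: "F \<in> borel_measurable borel"
 shows "(\<integral>\<^sup>+y. F (c + y) \<partial>lborel) = (\<integral>\<^sup>+y. F (y :: 'a::euclidean_space) \<partial>lborel)"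
 by (subst (2) lborel_distr_plus[symmetric, of c]) (subst nn_integral_distr; simp)

lemma nn_integral2_cmult_add3:
 fixes F G H :: "'a::euclidean_space \<Rightarrow> 'a \<Rightarrow> ennreal"
 assumes F: "(\<lambda>(x, y). F x y) \<in> borel_measurable (borel \<Otimes>\<^sub>M borel)"
  and G: "(\<lambda>(x, y). G x y) \<in> borel_measurable (borel \<Otimes>\<^sub>M borel)"
  and H: "(\<lambda>(x, y). H x y) \<in> borel_measurable (borel \<Otimes>\<^sub>M borel)"
 shows "(\<integral>\<^sup>+x. \<integral>\<^sup>+y. c * (F x y + G x y + H x y) \<partial>lborel \<partial>lborel) =
  c * ((\<integral>\<^sup>+x. \<integral>\<^sup>+y. F x y \<partial>lborel \<partial>lborel) + (\<integral>\<^sup>+x. \<integral>\<^sup>+y. G x y \<partial>lborel \<partial>lborel) + (\<integral>\<^sup>+x. \<integral>\<^sup>+y. H x y \<partial>lborel \<partial>lborel))"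
proof -
 have s: "sets (lborel \<Otimes>\<^sub>M lborel) = sets (borel \<Otimes>\<^sub>M (borel :: 'a measure))"
  "sets (borel \<Otimes>\<^sub>M lborel) = sets (borel \<Otimes>\<^sub>M (borel :: 'a measure))"
  by (auto intro!: sets_pair_measure_cong)
 have 1: "I x \<in> borel_measurable borel" "(\<lambda>x. \<integral>\<^sup>+y. I x y \<partial>lborel) \<in> borel_measurable borel"
  if I: "(\<lambda>(x, y). I x y) \<in> borel_measurable (borel \<Otimes>\<^sub>M borel)" for I :: "'a \<Rightarrow> 'a \<Rightarrow> ennreal" and x
  using measurable_compose[OF measurable_Pair1' I, of x] lborel.borel_measurable_nn_integral[of I borel] I
  by (simp_all add: measurable_cong_sets[OF s(2) refl])
 note m = 1[OF F] 1[OF G] 1[OF H]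
 have "(\<integral>\<^sup>+y. c * (F x y + G x y + H x y) \<partial>lborel) =
   c * ((\<integral>\<^sup>+y. F x y \<partial>lborel) + (\<integral>\<^sup>+y. G x y \<partial>lborel) + (\<integral>\<^sup>+y. H x y \<partial>lborel))" for x
  using m by (simp add: nn_integral_cmult nn_integral_add)
 thus ?thesis using m by (simp add: nn_integral_cmult nn_integral_add)
qed

lemma borel_kernel[measurable]: "kernel \<theta> p \<in> borel_measurable borel"
 unfolding kernel_def by measurable

lemma kernel_nonneg: "kernel \<theta> p z \<ge> 0"
 by (auto simp: kernel_def)

lemma kernel_translate:
 "(\<integral>\<^sup>+y. ennreal (kernel \<theta> p (x - y)) \<partial>lborel) = (\<integral>\<^sup>+z. ennreal (kernel \<theta> p (z :: 'a)) \<partial>lborel)"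
 for x :: "'a::euclidean_space"
proof -
 have "kernel \<theta> p (x - y) = kernel \<theta> p (- x + y)" for y
  using norm_minus_commute[of x y] by (simp add: kernel_def)
 thus ?thesis using nn_integral_translate[of "\<lambda>z. ennreal (kernel \<theta> p z)" "- x"] by simp
qed

lemma lipschitz_test_function:
 fixes c :: "real^'n::finite \<Rightarrow> real"
 assumes c: "c \<in> test_functions V"
 obtains L where "L > 0" "\<And>x y. \<bar>c x - c y\<bar> \<le> L * norm (x - y)"
proof -
 have "\<forall>i. \<exists>B\<ge>0. \<forall>x. \<bar>pd i c x\<bar> \<le> B" using test_functions_bounded[OF test_functions_pd[OF c]] by metis
 then obtain B where B: "\<And>i. B i \<ge> 0" "\<And>i x. \<bar>pd i c x\<bar> \<le> B i" by metis
 define L where "L = (\<Sum>i\<in>UNIV. B i) + 1"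
 have L: "L > 0" unfolding L_def using sum_nonneg[of UNIV B] B(1) by simp
 have "\<bar>c x - c y\<bar> \<le> L * norm (x - y)" for x y
 proof -
  have "onorm (frechet_derivative c (at z)) \<le> L" for z
  proof (rule onorm_le)
   fix v
   have d: "c differentiable (at z)"
    using smooth_on_has_derivative[OF test_functions_smooth[OF c] UNIV_I] by (auto simp: differentiable_def)
   have "norm (frechet_derivative c (at z) v) \<le> (\<Sum>i\<in>UNIV. \<bar>v $ i * pd i c z\<bar>)"
    unfolding frechet_derivative_pd[OF d] by (simp add: sum_abs)
   also have "\<dots> \<le> (\<Sum>i\<in>UNIV. norm v * B i)"
    unfolding abs_mult by (intro sum_mono mult_mono component_le_norm_cart B) auto
   also have "\<dots> = norm v * (\<Sum>i\<in>UNIV. B i)" by (simp add: sum_distrib_left)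
   also have "\<dots> \<le> L * norm v" by (simp add: L_def algebra_simps)
   finally show "norm (frechet_derivative c (at z) v) \<le> L * norm v" .
  qed
  from differentiable_bound[where f = c and f' = "\<lambda>z. frechet_derivative c (at z)", OF convex_UNIV _ this UNIV_I UNIV_I]
  show ?thesis using smooth_on_has_derivative[OF test_functions_smooth[OF c] UNIV_I] by simp
 qed
 with L that show thesis by blast
qed

context diffeo
begin

text \<open>\<open>W'\<close> need not be convex; the product of \<open>T\<close> with a cutoff that is
  \<open>1\<close> on \<open>K\<close> is a test function on the whole space, where the mean value theorem
  applies.\<close>

lemma lipschitz_on_compact:
 assumes K: "compact K" "K \<subseteq> W'"
 obtains L where "L > 0" "\<And>x y. x \<in> K \<Longrightarrow> y \<in> K \<Longrightarrow> norm (T x - T y) \<le> L * norm (x - y)"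
proof -
 obtain \<kappa> O' where \<kappa>: "\<kappa> \<in> test_functions W'" "K \<subseteq> O'" "\<And>x. x \<in> O' \<Longrightarrow> \<kappa> x = 1"
  using test_functions_cutoff[OF K(1) open_dom K(2)] by metis
 have "(\<lambda>y. \<kappa> y * T y $ i) \<in> test_functions W'" for i
  by (rule test_functions_mult[OF open_dom \<kappa>(1) smooth_on_nth[OF open_dom smooth(1)]])
 hence "\<forall>i. \<exists>L>0. \<forall>x y. \<bar>\<kappa> x * T x $ i - \<kappa> y * T y $ i\<bar> \<le> L * norm (x - y)"
  by (meson lipschitz_test_function)
 then obtain L where L: "\<And>i. L i > 0" "\<And>i x y. \<bar>\<kappa> x * T x $ i - \<kappa> y * T y $ i\<bar> \<le> L i * norm (x - y)" by metis
 show thesis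
 proof (rule that[of "\<Sum>i\<in>UNIV. L i"])
  show "(\<Sum>i\<in>UNIV. L i) > 0" using L(1) by (intro sum_pos) auto
  fix x y assume xy: "x \<in> K" "y \<in> K"
  have "norm (T x - T y) \<le> (\<Sum>i\<in>UNIV. \<bar>(T x - T y) $ i\<bar>)" by (rule norm_le_l1_cart)
  also have "\<dots> \<le> (\<Sum>i\<in>UNIV. L i * norm (x - y))"
  proof (rule sum_mono)
   fix i show "\<bar>(T x - T y) $ i\<bar> \<le> L i * norm (x - y)"
    using L(2)[of x i y] \<kappa> xy by (simp add: subsetD)
  qed
  finally show "norm (T x - T y) \<le> (\<Sum>i\<in>UNIV. L i) * norm (x - y)" by (simp add: sum_distrib_right)
 qed
qed

text \<open>On \<open>K\<close> the Jacobian is bounded below by a positive constant.\<close>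

lemma nn_pull_bound:
 assumes K: "compact K" "K \<subseteq> W'"
 obtains C where "C > 0" "\<And>F. F \<in> borel_measurable borel \<Longrightarrow>
  (\<integral>\<^sup>+y. indicator K y * F (T y) \<partial>lborel) \<le> ennreal C * (\<integral>\<^sup>+x. indicator W x * F x \<partial>lborel)"
proof -
 obtain d where d: "d > 0" "\<And>y. y \<in> K \<Longrightarrow> d \<le> jac y"
 proof (cases "K = {}")
  case False
  obtain y where y: "y \<in> K" "\<And>z. z \<in> K \<Longrightarrow> jac y \<le> jac z"
   using continuous_attains_inf[OF K(1) False continuous_on_subset[OF smooth_on_continuous[OF smooth_jac] K(2)]]
   by auto
  thus thesis using that[of "jac y"] jac_pos K(2) by auto
 qed (use that[of 1] in auto)
 show thesis
 proof (rule that[of "1 / d"])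
  fix F :: "real^'n \<Rightarrow> ennreal" assume F[measurable]: "F \<in> borel_measurable borel"
  have [measurable]: "(\<lambda>y. indicator W' y * ennreal (jac y) * F (T y)) \<in> borel_measurable borel"
  proof -
   have "(\<lambda>y. indicator W' y * ennreal (jac y) * F (T y)) =
     (\<lambda>y. ennreal (indicator W' y * jac y) * (indicator W' y * F (T y)))"
    by (auto simp: indicator_def)
   also have "\<dots> \<in> borel_measurable borel"
    using borel_comp(1)[OF F] borel_jac by measurable
   finally show ?thesis .
  qed
  have "(\<integral>\<^sup>+y. indicator K y * F (T y) \<partial>lborel) \<le>
    (\<integral>\<^sup>+y. ennreal (1 / d) * (indicator W' y * ennreal (jac y) * F (T y)) \<partial>lborel)"
  proof (rule nn_integral_mono)
   fix y
   show "indicator K y * F (T y) \<le> ennreal (1 / d) * (indicator W' y * ennreal (jac y) * F (T y))"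
   proof (cases "y \<in> K")
    case True
    have "1 \<le> ennreal (1 / d * jac y)"
     using d(1) d(2)[OF True] by (simp add: field_simps)
    also have "\<dots> = ennreal (1 / d) * ennreal (jac y)" using d(1) by (intro ennreal_mult) (auto simp: jac_nonneg)
    finally have "1 * F (T y) \<le> ennreal (1 / d) * ennreal (jac y) * F (T y)" by (rule mult_right_mono) simp
    thus ?thesis using True K(2) by (auto simp: mult.assoc)
   qed simp
  qed
  also have "\<dots> = ennreal (1 / d) * (\<integral>\<^sup>+y. indicator W' y * ennreal (jac y) * F (T y) \<partial>lborel)"
   by (rule nn_integral_cmult) simp
  finally show "(\<integral>\<^sup>+y. indicator K y * F (T y) \<partial>lborel) \<le> ennreal (1 / d) * (\<integral>\<^sup>+x. indicator W x * F x \<partial>lborel)"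
   by (simp add: nn_cov)
 qed (use d in simp)
qed

lemma nn_pull_bound2:
 assumes K: "compact K" "K \<subseteq> W'"
 obtains C where "C > 0" "\<And>H. (\<lambda>(x, y). H x y) \<in> borel_measurable (borel \<Otimes>\<^sub>M borel) \<Longrightarrow>
  (\<integral>\<^sup>+x. \<integral>\<^sup>+y. indicator K x * indicator K y * H (T x) (T y) \<partial>lborel \<partial>lborel) \<le>
  ennreal C * (\<integral>\<^sup>+x. \<integral>\<^sup>+y. indicator W x * indicator W y * H x y \<partial>lborel \<partial>lborel)"
proof -
 obtain C where C: "C > 0" "\<And>F. F \<in> borel_measurable borel \<Longrightarrow>
  (\<integral>\<^sup>+y. indicator K y * F (T y) \<partial>lborel) \<le> ennreal C * (\<integral>\<^sup>+x. indicator W x * F x \<partial>lborel)"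
  using nn_pull_bound[OF K] by blast
 show thesis
 proof (rule that[of "C * C"])
  fix H :: "real^'n \<Rightarrow> real^'n \<Rightarrow> ennreal"
  assume H: "(\<lambda>(x, y). H x y) \<in> borel_measurable (borel \<Otimes>\<^sub>M borel)"
  have H1[measurable]: "H u \<in> borel_measurable borel" for u
   using measurable_compose[OF measurable_Pair1' H, of u] by simp
  have H2[measurable]: "(\<lambda>(x, y). H x y) \<in> borel_measurable (borel \<Otimes>\<^sub>M lborel)"
   using H by (simp cong: measurable_cong_sets sets_pair_measure_cong)
  define F where "F u = (\<integral>\<^sup>+y. indicator W y * H u y \<partial>lborel)" for u
  have F[measurable]: "F \<in> borel_measurable borel"
   unfolding F_def
   by (rule lborel.borel_measurable_nn_integral) (simp add: case_prod_beta' measurable_compose[OF _ H2[unfolded case_prod_beta']])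
  have "(\<integral>\<^sup>+x. \<integral>\<^sup>+y. indicator K x * indicator K y * H (T x) (T y) \<partial>lborel \<partial>lborel) \<le>
    (\<integral>\<^sup>+x. indicator K x * (ennreal C * F (T x)) \<partial>lborel)"
  proof (rule nn_integral_mono)
   fix x
   show "(\<integral>\<^sup>+y. indicator K x * indicator K y * H (T x) (T y) \<partial>lborel) \<le> indicator K x * (ennreal C * F (T x))"
    using C(2)[OF H1, of "T x"] by (cases "x \<in> K") (auto simp: F_def)
  qed
  also have "\<dots> \<le> ennreal C * (\<integral>\<^sup>+x. indicator W x * (ennreal C * F x) \<partial>lborel)"
   by (rule C(2)) simp
  also have "(\<integral>\<^sup>+x. indicator W x * (ennreal C * F x) \<partial>lborel) = ennreal C * (\<integral>\<^sup>+x. indicator W x * F x \<partial>lborel)"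
   by (subst nn_integral_cmult[symmetric]) (auto simp: mult.left_commute)
  also have "(\<integral>\<^sup>+x. indicator W x * F x \<partial>lborel) =
    (\<integral>\<^sup>+x. \<integral>\<^sup>+y. indicator W x * indicator W y * H x y \<partial>lborel \<partial>lborel)"
   by (intro nn_integral_cong) (auto simp: F_def indicator_def)
  finally show "(\<integral>\<^sup>+x. \<integral>\<^sup>+y. indicator K x * indicator K y * H (T x) (T y) \<partial>lborel \<partial>lborel) \<le>
   ennreal (C * C) * (\<integral>\<^sup>+x. \<integral>\<^sup>+y. indicator W x * indicator W y * H x y \<partial>lborel \<partial>lborel)"
   using C(1) by (simp add: ennreal_mult mult.assoc)
 qed (use C in simp)
qed

lemma p_energy_pull:
 assumes W: "W \<subseteq> \<O>" and m: "m \<in> test_functions W'" and p: "p \<ge> 0"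
 obtains C where "C > 0" "\<And>g. g \<in> borel_measurable borel \<Longrightarrow> p_energy p UNIV (pull m T g) \<le> ennreal C * p_energy p \<O> g"
proof -
 obtain K where K: "compact K" "K \<subseteq> W'" "\<And>x. x \<notin> K \<Longrightarrow> m x = 0" using m by (auto simp: test_functions_iff)
 obtain B where B: "B \<ge> 0" "\<And>x. \<bar>m x\<bar> \<le> B" using test_functions_bounded[OF m] by blast
 obtain C where C: "C > 0" "\<And>F. F \<in> borel_measurable borel \<Longrightarrow>
  (\<integral>\<^sup>+y. indicator K y * F (T y) \<partial>lborel) \<le> ennreal C * (\<integral>\<^sup>+x. indicator W x * F x \<partial>lborel)"
  using nn_pull_bound[OF K(1,2)] by blast
 show thesis
 proof (rule that[of "C * (B + 1) powr p"])
  fix g :: "real^'n \<Rightarrow> real" assume g[measurable]: "g \<in> borel_measurable borel"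
  have "p_energy p UNIV (pull m T g) \<le> (\<integral>\<^sup>+y. indicator K y * ennreal ((B + 1) powr p * \<bar>g (T y)\<bar> powr p) \<partial>lborel)"
   unfolding p_energy_def
  proof (rule nn_integral_mono)
   fix y
   have "\<bar>m y * g (T y)\<bar> powr p \<le> (B + 1) powr p * \<bar>g (T y)\<bar> powr p"
    unfolding abs_mult powr_mult using B(2)[of y] p by (intro mult_right_mono powr_mono2) auto
   thus "indicator UNIV y * ennreal (\<bar>pull m T g y\<bar> powr p) \<le> indicator K y * ennreal ((B + 1) powr p * \<bar>g (T y)\<bar> powr p)"
    using K(3)[of y] by (cases "y \<in> K") (auto simp: pull_def intro: ennreal_leI)
  qed
  also have "\<dots> \<le> ennreal C * (\<integral>\<^sup>+x. indicator W x * ennreal ((B + 1) powr p * \<bar>g x\<bar> powr p) \<partial>lborel)"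
   by (rule C(2)) measurable
  also have "(\<integral>\<^sup>+x. indicator W x * ennreal ((B + 1) powr p * \<bar>g x\<bar> powr p) \<partial>lborel) =
    (\<integral>\<^sup>+x. ennreal ((B + 1) powr p) * (indicator W x * ennreal (\<bar>g x\<bar> powr p)) \<partial>lborel)"
   by (intro nn_integral_cong) (auto simp: ennreal_mult mult.left_commute)
  also have "\<dots> = ennreal ((B + 1) powr p) * (\<integral>\<^sup>+x. indicator W x * ennreal (\<bar>g x\<bar> powr p) \<partial>lborel)"
   by (rule nn_integral_cmult) measurable
  also have "\<dots> \<le> ennreal ((B + 1) powr p) * p_energy p \<O> g"
   unfolding p_energy_def using W by (intro mult_left_mono nn_integral_mono) (auto simp: indicator_def)
  finally show "p_energy p UNIV (pull m T g) \<le> ennreal (C * (B + 1) powr p) * p_energy p \<O> g"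
   using C(1) by (simp add: ennreal_mult mult.assoc mult_left_mono)
 qed (use C B in simp)
qed

text \<open>The numerator of the Gagliardo integrand of \<open>m \<cdot> (g \<circ> T)\<close> is split by
  \<open>h x - h y = g (T x) (m x - m y) + m y (g (T x) - g (T y))\<close>, with \<open>x\<close> and \<open>y\<close> exchanged in
  case only \<open>y\<close> lies in the support of \<open>m\<close>.  As \<open>m\<close> is Lipschitz, the first part gains
  enough to be integrable; the second part is transported by \<open>T\<close>, which is Lipschitz on the support.\<close>

lemma frac_energy_pull:
 assumes W: "W \<subseteq> \<O>" and \<O>: "open \<O>" and m: "m \<in> test_functions W'" and p: "p > 0" and \<theta>: "0 < \<theta>" "\<theta> < 1"
 obtains C where "C > 0" "\<And>g. g \<in> borel_measurable borel \<Longrightarrow>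
  frac_energy \<theta> p UNIV (pull m T g) \<le> ennreal C * (p_energy p \<O> g + frac_energy \<theta> p \<O> g)"
proof -
 obtain K where K: "compact K" "K \<subseteq> W'" "\<And>x. x \<notin> K \<Longrightarrow> m x = 0" using m by (auto simp: test_functions_iff)
 obtain B where B: "B \<ge> 0" "\<And>x. \<bar>m x\<bar> \<le> B" using test_functions_bounded[OF m] by blast
 obtain L where L: "L > 0" "\<And>x y. \<bar>m x - m y\<bar> \<le> L * norm (x - y)" using lipschitz_test_function[OF m] by blast
 obtain M where M: "M > 0" "\<And>x y. x \<in> K \<Longrightarrow> y \<in> K \<Longrightarrow> norm (T x - T y) \<le> M * norm (x - y)"
  using lipschitz_on_compact[OF K(1,2)] by blast
 obtain C1 where C1: "C1 > 0" "\<And>F. F \<in> borel_measurable borel \<Longrightarrow>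
  (\<integral>\<^sup>+y. indicator K y * F (T y) \<partial>lborel) \<le> ennreal C1 * (\<integral>\<^sup>+x. indicator W x * F x \<partial>lborel)"
  using nn_pull_bound[OF K(1,2)] by blast
 obtain C2 where C2: "C2 > 0" "\<And>H. (\<lambda>(x, y). H x y) \<in> borel_measurable (borel \<Otimes>\<^sub>M borel) \<Longrightarrow>
  (\<integral>\<^sup>+x. \<integral>\<^sup>+y. indicator K x * indicator K y * H (T x) (T y) \<partial>lborel \<partial>lborel) \<le>
  ennreal C2 * (\<integral>\<^sup>+x. \<integral>\<^sup>+y. indicator W x * indicator W y * H x y \<partial>lborel \<partial>lborel)"
  using nn_pull_bound2[OF K(1,2)] by blast
 define a where "a = real CARD('n) + \<theta> * p"
 define Q where "Q = max L (2 * B)"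
 have Q: "Q > 0" using L(1) by (simp add: Q_def)
 define N where "N = enn2real (\<integral>\<^sup>+z. ennreal (kernel \<theta> p (z :: real^'n)) \<partial>lborel)"
 have N: "(\<integral>\<^sup>+z. ennreal (kernel \<theta> p (z :: real^'n)) \<partial>lborel) = ennreal N" "N \<ge> 0"
  using kernel_integrable[OF p \<theta>, where 'a = "real^'n"] by (simp_all add: N_def less_top)
 let ?Z = "Q powr p * N" and ?Y = "B powr p * M powr a"
 have mk: "\<bar>m x - m y\<bar> powr p / norm (x - y) powr a \<le> Q powr p * kernel \<theta> p (x - y)" for x y
 proof -
  have "\<bar>m x - m y\<bar> \<le> Q * min 1 (norm (x - y))"
  proof -
   have "\<bar>m x - m y\<bar> \<le> Q * norm (x - y)"
    by (rule order_trans[OF L(2)]) (auto simp: Q_def intro: mult_right_mono)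
   moreover have "\<bar>m x - m y\<bar> \<le> Q * 1" using B(2)[of x] B(2)[of y] unfolding Q_def by linarith
   ultimately show ?thesis using Q by (auto simp: min_def)
  qed
  hence "\<bar>m x - m y\<bar> powr p \<le> (Q * min 1 (norm (x - y))) powr p" using p by (intro powr_mono2) auto
  also have "\<dots> = Q powr p * min 1 (norm (x - y) powr p)"
   using Q p powr_le1[of p "norm (x - y)"] ge_one_powr_ge_zero[of "norm (x - y)" p] by (auto simp: powr_mult min_def)
  finally show ?thesis by (simp add: kernel_def a_def divide_right_mono)
 qed
 show thesis
 proof (rule that[of "3 powr p * (2 * (C1 * ?Z) + ?Y * C2 + 1)"])
  show "0 < 3 powr p * (2 * (C1 * ?Z) + ?Y * C2 + 1)"
   using C1 C2 N by (intro mult_pos_pos add_nonneg_pos add_nonneg_nonneg mult_nonneg_nonneg) auto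
  fix g :: "real^'n \<Rightarrow> real" assume g[measurable]: "g \<in> borel_measurable borel"
  let ?E = "p_energy p \<O> g" and ?F = "frac_energy \<theta> p \<O> g"
  define h where "h = pull m T g"
  define H where "H u v = ennreal (\<bar>g u - g v\<bar> powr p / norm (u - v) powr a)" for u v
  define e where "e x = indicator K x * ennreal (\<bar>g (T x)\<bar> powr p)" for x
  have Km: "K \<in> sets borel" using K(1) by (simp add: borel_compact)
  have Hm: "(\<lambda>(x, y). H x y) \<in> borel_measurable (borel \<Otimes>\<^sub>M borel)"
   unfolding H_def by measurable
  have em[measurable]: "e \<in> borel_measurable borel"
  proof -
   have "e = (\<lambda>x. indicator K x * (indicator W' x * ennreal (\<bar>g (T x)\<bar> powr p)))"
    using K(2) by (auto simp: e_def indicator_def fun_eq_iff)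
   also have "\<dots> \<in> borel_measurable borel"
    using borel_comp(1)[of "\<lambda>x. ennreal (\<bar>g x\<bar> powr p)"] Km by measurable
   finally show ?thesis .
  qed
  let ?k = "\<lambda>x y. ennreal (Q powr p * kernel \<theta> p (x - y))"
  let ?D = "\<lambda>x y. ennreal ?Y * (indicator K x * indicator K y * H (T x) (T y))"
  have split: "ennreal (\<bar>h x - h y\<bar> powr p / norm (x - y) powr a) \<le>
    ennreal (3 powr p) * (e x * ?k x y + e y * ?k x y + ?D x y)" for x y
  proof -
   have one: "ennreal (\<bar>g (T u) * (m x - m y)\<bar> powr p / norm (x - y) powr a) \<le> e u * ?k x y" if "u \<in> K" for u
   proof -
    have "\<bar>g (T u) * (m x - m y)\<bar> powr p / norm (x - y) powr a =
      \<bar>g (T u)\<bar> powr p * (\<bar>m x - m y\<bar> powr p / norm (x - y) powr a)"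
     by (simp add: abs_mult powr_mult)
    also have "\<dots> \<le> \<bar>g (T u)\<bar> powr p * (Q powr p * kernel \<theta> p (x - y))"
     by (intro mult_left_mono mk) auto
    finally show ?thesis using that
     by (simp add: e_def ennreal_mult[symmetric] kernel_nonneg ennreal_leI)
   qed
   have three: "ennreal t \<le> ennreal (3 powr p) * ennreal t" for t
   proof -
    have "1 \<le> (3::real) powr p" using p by (intro ge_one_powr_ge_zero) auto
    hence "1 * ennreal t \<le> ennreal (3 powr p) * ennreal t" by (intro mult_right_mono) auto
    thus ?thesis by simp
   qed
   consider "x \<in> K" "y \<in> K" | "x \<in> K" "y \<notin> K" | "x \<notin> K" "y \<in> K" | "x \<notin> K" "y \<notin> K" by blast
   thus ?thesis
   proof cases
    case 1
    have xy: "T x = T y \<longleftrightarrow> x = y" using 1 K(2) inverses(1) by (metis subsetD)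
    have "\<bar>h x - h y\<bar> powr p \<le> (\<bar>g (T x) * (m x - m y)\<bar> + \<bar>m y * (g (T x) - g (T y))\<bar>) powr p"
     using p by (intro powr_mono2) (auto simp: h_def pull_def algebra_simps)
    also have "\<dots> \<le> 2 powr p * (\<bar>g (T x) * (m x - m y)\<bar> powr p + \<bar>m y * (g (T x) - g (T y))\<bar> powr p)"
     using p by (intro powr_add_bound) auto
    also have "\<dots> \<le> 3 powr p * (\<bar>g (T x) * (m x - m y)\<bar> powr p + \<bar>m y * (g (T x) - g (T y))\<bar> powr p)"
     using p by (intro mult_right_mono powr_mono2) auto
    finally have "\<bar>h x - h y\<bar> powr p / norm (x - y) powr a \<le>
      3 powr p * (\<bar>g (T x) * (m x - m y)\<bar> powr p / norm (x - y) powr a + \<bar>m y * (g (T x) - g (T y))\<bar> powr p / norm (x - y) powr a)"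
     by (simp add: divide_right_mono add_divide_distrib[symmetric])
    hence "ennreal (\<bar>h x - h y\<bar> powr p / norm (x - y) powr a) \<le> ennreal (3 powr p) *
      (ennreal (\<bar>g (T x) * (m x - m y)\<bar> powr p / norm (x - y) powr a) + ennreal (\<bar>m y * (g (T x) - g (T y))\<bar> powr p / norm (x - y) powr a))"
     by (simp add: ennreal_mult[symmetric] ennreal_plus[symmetric] ennreal_leI del: ennreal_plus)
    also have "\<dots> \<le> ennreal (3 powr p) * (e x * ?k x y + ?D x y)"
    proof (intro mult_left_mono add_mono one 1)
     have "\<bar>m y * (g (T x) - g (T y))\<bar> powr p / norm (x - y) powr a \<le>
       ?Y * (\<bar>g (T x) - g (T y)\<bar> powr p / norm (T x - T y) powr a)"
     proof (cases "x = y")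
      case False
      hence n: "norm (x - y) > 0" "norm (T x - T y) > 0" using xy by auto
      have "norm (T x - T y) powr a \<le> (M * norm (x - y)) powr a"
       using p \<theta> M(2)[OF 1] by (intro powr_mono2) (auto simp: a_def)
      hence "norm (T x - T y) powr a \<le> M powr a * norm (x - y) powr a"
       using M(1) by (simp add: powr_mult)
      hence i: "1 / norm (x - y) powr a \<le> M powr a / norm (T x - T y) powr a"
       using n by (simp add: field_simps)
      have "\<bar>m y * (g (T x) - g (T y))\<bar> powr p \<le> B powr p * \<bar>g (T x) - g (T y)\<bar> powr p"
       unfolding abs_mult powr_mult using B(2)[of y] p by (intro mult_right_mono powr_mono2) auto
      from mult_mono[OF this i] show ?thesis by (simp add: ac_simps)
     qed simp
     thus "ennreal (\<bar>m y * (g (T x) - g (T y))\<bar> powr p / norm (x - y) powr a) \<le> ?D x y"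
      using 1 by (simp add: H_def ennreal_mult[symmetric] ennreal_leI)
    qed auto
    also have "\<dots> \<le> ennreal (3 powr p) * (e x * ?k x y + e y * ?k x y + ?D x y)"
     by (intro mult_left_mono add_mono) auto
    finally show ?thesis .
   next
    case 2
    hence "h x - h y = g (T x) * (m x - m y)" by (simp add: h_def pull_def K(3))
    hence "ennreal (\<bar>h x - h y\<bar> powr p / norm (x - y) powr a) \<le> e x * ?k x y"
     using one[OF 2(1)] by simp
    also have "\<dots> \<le> e x * ?k x y + e y * ?k x y + ?D x y" by (simp add: add.assoc)
    also have "\<dots> \<le> ennreal (3 powr p) * (e x * ?k x y + e y * ?k x y + ?D x y)"
     using three[of 1] mult_right_mono[of 1 "ennreal (3 powr p)"] by auto
    finally show ?thesis .
   next
    case 3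
    hence "h x - h y = g (T y) * (m x - m y)" by (simp add: h_def pull_def K(3))
    hence "ennreal (\<bar>h x - h y\<bar> powr p / norm (x - y) powr a) \<le> e y * ?k x y"
     using one[OF 3(2)] by simp
    also have "\<dots> \<le> e x * ?k x y + e y * ?k x y + ?D x y"
     by (intro add_increasing2 add_increasing order_refl) auto
    also have "\<dots> \<le> ennreal (3 powr p) * (e x * ?k x y + e y * ?k x y + ?D x y)"
     using three[of 1] mult_right_mono[of 1 "ennreal (3 powr p)"] by auto
    finally show ?thesis .
   next
    case 4
    thus ?thesis by (simp add: h_def pull_def K(3))
   qed
  qed
  have km[measurable]: "(\<lambda>(x, y). ?k x y) \<in> borel_measurable (borel \<Otimes>\<^sub>M borel)" by measurable
  have HT: "(\<lambda>(x, y). indicator K x * indicator K y * H (T x) (T y)) \<in> borel_measurable (borel \<Otimes>\<^sub>M borel)"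
  proof -
   have "(\<lambda>(x, y). indicator K x * indicator K y * H (T x) (T y)) =
     (\<lambda>(x, y). indicator K x * indicator K y * H (indicator W' x *\<^sub>R T x) (indicator W' y *\<^sub>R T y))"
    using K(2) by (auto simp: indicator_def fun_eq_iff)
   also have "\<dots> \<in> borel_measurable (borel \<Otimes>\<^sub>M borel)" unfolding H_def using Km by measurable
   finally show ?thesis .
  qed
  note [measurable] = HT[unfolded case_prod_beta']
  have i1: "(\<integral>\<^sup>+x. \<integral>\<^sup>+y. e x * ?k x y \<partial>lborel \<partial>lborel) = ennreal ?Z * (\<integral>\<^sup>+x. e x \<partial>lborel)"
  proof -
   have "(\<integral>\<^sup>+y. e x * ?k x y \<partial>lborel) = ennreal ?Z * e x" for x
   proof -
    have "(\<integral>\<^sup>+y. e x * ?k x y \<partial>lborel) = e x * (ennreal (Q powr p) * (\<integral>\<^sup>+y. ennreal (kernel \<theta> p (x - y)) \<partial>lborel))"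
     by (simp add: ennreal_mult kernel_nonneg nn_integral_cmult)
    thus ?thesis using N by (simp add: kernel_translate ennreal_mult mult.commute)
   qed
   thus ?thesis by (simp add: nn_integral_cmult)
  qed
  have i2: "(\<integral>\<^sup>+x. \<integral>\<^sup>+y. e y * ?k x y \<partial>lborel \<partial>lborel) = ennreal ?Z * (\<integral>\<^sup>+x. e x \<partial>lborel)"
  proof -
   have "(\<integral>\<^sup>+x. \<integral>\<^sup>+y. e y * ?k x y \<partial>lborel \<partial>lborel) = (\<integral>\<^sup>+y. \<integral>\<^sup>+x. e y * ?k x y \<partial>lborel \<partial>lborel)"
    by (rule lborel_pair.Fubini'[symmetric]) measurable
   also have "\<dots> = (\<integral>\<^sup>+y. \<integral>\<^sup>+x. e y * ?k y x \<partial>lborel \<partial>lborel)"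
    by (intro nn_integral_cong) (simp add: kernel_def norm_minus_commute)
   finally show ?thesis using i1 by simp
  qed
  have i3: "(\<integral>\<^sup>+x. \<integral>\<^sup>+y. ?D x y \<partial>lborel \<partial>lborel) \<le> ennreal ?Y * (ennreal C2 * ?F)"
  proof -
   have "(\<integral>\<^sup>+x. \<integral>\<^sup>+y. ?D x y \<partial>lborel \<partial>lborel) = ennreal ?Y *
     (\<integral>\<^sup>+x. \<integral>\<^sup>+y. indicator K x * indicator K y * H (T x) (T y) \<partial>lborel \<partial>lborel)"
    using nn_integral2_cmult_add3[of _ "\<lambda>x y. 0" "\<lambda>x y. 0", OF HT, of "ennreal ?Y"]
    by simp
   also have "\<dots> \<le> ennreal ?Y * (ennreal C2 * (\<integral>\<^sup>+x. \<integral>\<^sup>+y. indicator W x * indicator W y * H x y \<partial>lborel \<partial>lborel))"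
    by (intro mult_left_mono C2(2) Hm) auto
   also have "\<dots> \<le> ennreal ?Y * (ennreal C2 * ?F)"
    unfolding frac_energy_def H_def a_def using W
    by (intro mult_left_mono nn_integral_mono) (auto simp: indicator_def)
   finally show ?thesis .
  qed
  have i4: "(\<integral>\<^sup>+x. e x \<partial>lborel) \<le> ennreal C1 * ?E"
  proof -
   have "(\<integral>\<^sup>+x. e x \<partial>lborel) \<le> ennreal C1 * (\<integral>\<^sup>+x. indicator W x * ennreal (\<bar>g x\<bar> powr p) \<partial>lborel)"
    unfolding e_def by (rule C1(2)) measurable
   also have "\<dots> \<le> ennreal C1 * ?E"
    unfolding p_energy_def using W by (intro mult_left_mono nn_integral_mono) (auto simp: indicator_def)
   finally show ?thesis .
  qed
  have "frac_energy \<theta> p UNIV h \<le> (\<integral>\<^sup>+x. \<integral>\<^sup>+y. ennreal (3 powr p) * (e x * ?k x y + e y * ?k x y + ?D x y) \<partial>lborel \<partial>lborel)"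
   unfolding frac_energy_def using split by (intro nn_integral_mono) (simp add: a_def)
  also have "\<dots> = ennreal (3 powr p) * ((\<integral>\<^sup>+x. \<integral>\<^sup>+y. e x * ?k x y \<partial>lborel \<partial>lborel) +
    (\<integral>\<^sup>+x. \<integral>\<^sup>+y. e y * ?k x y \<partial>lborel \<partial>lborel) + (\<integral>\<^sup>+x. \<integral>\<^sup>+y. ?D x y \<partial>lborel \<partial>lborel))"
  proof (rule nn_integral2_cmult_add3)
   show "(\<lambda>(x, y). e x * ?k x y) \<in> borel_measurable (borel \<Otimes>\<^sub>M borel)"
    "(\<lambda>(x, y). e y * ?k x y) \<in> borel_measurable (borel \<Otimes>\<^sub>M borel)" by measurable
   show "(\<lambda>(x, y). ?D x y) \<in> borel_measurable (borel \<Otimes>\<^sub>M borel)"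
    using borel_measurable_times_ennreal[OF borel_measurable_const[of "ennreal ?Y"] HT[unfolded case_prod_beta']]
    by (simp add: case_prod_beta')
  qed
  also have "\<dots> \<le> ennreal (3 powr p) * (ennreal ?Z * (ennreal C1 * ?E) +
    ennreal ?Z * (ennreal C1 * ?E) + ennreal ?Y * (ennreal C2 * ?F))"
   unfolding i1 i2 by (intro mult_left_mono add_mono i3 i4) auto
  also have "\<dots> \<le> ennreal (3 powr p) * (ennreal (2 * (C1 * ?Z) + ?Y * C2 + 1) *
    (?E + ?F))" (is "_ \<le> _ * (_ * ?S)")
  proof (rule mult_left_mono)
   let ?A = "C1 * ?Z" and ?B = "?Y * C2"
   have nn: "0 \<le> ?A" "0 \<le> ?B" using C1(1) C2(1) N(2) by auto
   have "ennreal ?Z * (ennreal C1 * ?E) = ennreal ?A * ?E"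
    using C1(1) N(2) by (subst mult.commute[of C1]) (simp add: ennreal_mult mult.assoc)
   also have "\<dots> \<le> ennreal ?A * ?S" by (intro mult_left_mono) auto
   finally have 1: "ennreal ?Z * (ennreal C1 * ?E) \<le> ennreal ?A * ?S" .
   have "ennreal ?Y * (ennreal C2 * ?F) = ennreal ?B * ?F"
    using C2(1) by (simp add: ennreal_mult mult.assoc)
   also have "\<dots> \<le> ennreal ?B * ?S" by (intro mult_left_mono) auto
   finally have 2: "ennreal ?Y * (ennreal C2 * ?F) \<le> ennreal ?B * ?S" .
   have "ennreal ?Z * (ennreal C1 * ?E) + ennreal ?Z * (ennreal C1 * ?E) +
     ennreal ?Y * (ennreal C2 * ?F) \<le> ennreal ?A * ?S + ennreal ?A * ?S + ennreal ?B * ?S"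
    by (intro add_mono 1 2)
   also have "\<dots> = ennreal (?A + ?A + ?B) * ?S" using nn by (simp only: ennreal_plus add_nonneg_nonneg distrib_right)
   also have "\<dots> \<le> ennreal (2 * ?A + ?B + 1) * ?S" by (intro mult_right_mono ennreal_leI) auto
   finally show "ennreal ?Z * (ennreal C1 * ?E) + ennreal ?Z * (ennreal C1 * ?E) +
     ennreal ?Y * (ennreal C2 * ?F) \<le> ennreal (2 * ?A + ?B + 1) * ?S" .
  qed simp
  also have "\<dots> = ennreal (3 powr p * (2 * (C1 * ?Z) + ?Y * C2 + 1)) *
    (?E + ?F)"
  proof -
   have "0 \<le> 2 * (C1 * ?Z) + ?Y * C2 + 1"
    using C1(1) C2(1) N(2) by simp
   from ennreal_mult[OF powr_ge_zero this, of 3 p] show ?thesis by (simp only: mult.assoc)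
  qed
  finally show "frac_energy \<theta> p UNIV (pull m T g) \<le>
   ennreal (3 powr p * (2 * (C1 * ?Z) + ?Y * C2 + 1)) * (?E + ?F)"
   unfolding h_def .
 qed
qed

end

section \<open>Differences of functions with integrable weak gradient\<close>

lemma integrable_translate:
 fixes f :: "'a::euclidean_space \<Rightarrow> real"
 assumes [measurable]: "f \<in> borel_measurable borel"
 shows "integrable lborel (\<lambda>x. f (c + x)) \<longleftrightarrow> integrable lborel f"
  and "(LBINT x. f (c + x)) = (LBINT x. f x)"
proof -
 have "integrable (distr lborel borel ((+) c)) f \<longleftrightarrow> integrable lborel (\<lambda>x. f (c + x))"
  by (rule integrable_distr_eq) auto
 thus "integrable lborel (\<lambda>x. f (c + x)) \<longleftrightarrow> integrable lborel f" by (simp add: lborel_distr_plus)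
 have "integral\<^sup>L (distr lborel borel ((+) c)) f = (LBINT x. f (c + x))"
  by (rule integral_distr) auto
 thus "(LBINT x. f (c + x)) = (LBINT x. f x)" by (simp add: lborel_distr_plus)
qed

text \<open>Integrability on the product that justifies the exchanges of integrals in
  \<open>difference_formula\<close>.\<close>

lemma integrable_shear:
 fixes f :: "real^'n::finite \<Rightarrow> real"
 assumes [measurable]: "f \<in> borel_measurable borel" and i: "integrable lborel f"
 shows "integrable (lborel \<Otimes>\<^sub>M lborel) (\<lambda>(t, x). indicator {0..1} t * f (t *\<^sub>R z + x))"
proof (rule lborel_pair.Fubini_integrable)
 show "(\<lambda>(t, x). indicator {0..1} t * f (t *\<^sub>R z + x)) \<in> borel_measurable (lborel \<Otimes>\<^sub>M lborel)"
  by measurable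
 have "(LBINT x. \<bar>f (t *\<^sub>R z + x)\<bar>) = (LBINT x. \<bar>f x\<bar>)" for t
  using integrable_translate(2)[of "\<lambda>x. \<bar>f x\<bar>" "t *\<^sub>R z"] by simp
 moreover have "integrable lborel (\<lambda>t. indicator {0..1::real} t * (LBINT x. \<bar>f x\<bar>))"
  by (intro integrable_mult_left integrable_real_indicator) auto
 ultimately show "integrable lborel (\<lambda>t. LBINT x. norm (case (t, x) of (t, x) \<Rightarrow> indicator {0..1} t * f (t *\<^sub>R z + x)))"
  by (simp add: abs_mult)
 show "AE t in lborel. integrable lborel (\<lambda>x. case (t, x) of (t, x) \<Rightarrow> indicator {0..1} t * f (t *\<^sub>R z + x))"
  using integrable_translate(1)[of f] i by simp
qed

lemma test_function_translate:
 fixes \<eta> :: "real^'n::finite \<Rightarrow> real"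
 assumes \<eta>: "\<eta> \<in> test_functions UNIV"
 shows "(\<lambda>x. \<eta> (x - c)) \<in> test_functions UNIV" "pd i (\<lambda>x. \<eta> (x - c)) x = pd i \<eta> (x - c)"
proof -
 obtain K where K: "compact K" "\<And>x. x \<notin> K \<Longrightarrow> \<eta> x = 0" using \<eta> by (auto simp: test_functions_iff)
 have "smooth_on UNIV (\<lambda>x. \<eta> (x - c))"
  by (rule smooth_on_compose[OF open_UNIV _ _ test_functions_smooth[OF \<eta>, of UNIV]])
    (auto intro!: smooth_on_diff smooth_on_const smooth_on_id)
 moreover have "compact ((\<lambda>x. x + c) ` K)" using compact_translation[OF K(1), of c] by (simp add: add.commute)
 moreover have "\<eta> (x - c) = 0" if "x \<notin> (\<lambda>x. x + c) ` K" for x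
  using that by (intro K(2)) (metis diff_add_cancel image_eqI)
 ultimately show "(\<lambda>x. \<eta> (x - c)) \<in> test_functions UNIV" by (auto simp: test_functions_iff)
 have "((\<lambda>x. \<eta> (x - c)) has_derivative (\<lambda>v. frechet_derivative \<eta> (at (x - c)) v)) (at x)"
  by (rule has_derivative_compose[where f = "\<lambda>x. x - c" and g = \<eta>, OF _ smooth_on_has_derivative[OF test_functions_smooth[OF \<eta>, of UNIV] UNIV_I]])
    (auto intro!: derivative_eq_intros)
 from pd_eqI[OF this] show "pd i (\<lambda>x. \<eta> (x - c)) x = pd i \<eta> (x - c)" by (simp add: pd_def)
qed

lemma test_function_FTC:
 fixes \<eta> :: "real^'n::finite \<Rightarrow> real"
 assumes \<eta>: "\<eta> \<in> test_functions UNIV"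
 shows "(LBINT t. indicator {0..1} t * (\<Sum>i\<in>UNIV. z $ i * pd i \<eta> (x - t *\<^sub>R z))) = \<eta> x - \<eta> (x - z)"
proof -
 let ?g = "\<lambda>t. \<Sum>i\<in>UNIV. z $ i * pd i \<eta> (x - t *\<^sub>R z)"
 have s: "smooth_on UNIV \<eta>" by (rule test_functions_smooth[OF \<eta>])
 have d: "((\<lambda>t. - \<eta> (x - t *\<^sub>R z)) has_real_derivative ?g t) (at t)" for t
 proof -
  have l: "linear (frechet_derivative \<eta> (at y))" for y
   using smooth_on_has_derivative[OF s UNIV_I] has_derivative_linear by blast
  have "((\<lambda>t. - \<eta> (x - t *\<^sub>R z)) has_derivative (\<lambda>\<delta>. - frechet_derivative \<eta> (at (x - t *\<^sub>R z)) (- (\<delta> *\<^sub>R z)))) (at t)"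
   by (rule has_derivative_minus,
     rule has_derivative_compose[where f = "\<lambda>t. x - t *\<^sub>R z" and g = \<eta>, OF _ smooth_on_has_derivative[OF s UNIV_I]])
     (auto intro!: derivative_eq_intros)
  moreover have "- frechet_derivative \<eta> (at (x - t *\<^sub>R z)) (- (\<delta> *\<^sub>R z)) = ?g t * \<delta>" for \<delta>
   using frechet_derivative_pd[of \<eta> "x - t *\<^sub>R z" z] smooth_on_has_derivative[OF s UNIV_I]
   by (simp add: linear_neg[OF l] linear_cmul[OF l] differentiable_def) (metis mult.commute)
  ultimately show ?thesis by (simp add: has_field_derivative_def)
 qed
 have c: "continuous_on {0..1} ?g"
 proof (intro continuous_intros continuous_on_sum)
  fix i
  show "continuous_on {0..1} (\<lambda>t. pd i \<eta> (x - t *\<^sub>R z))"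
   by (rule continuous_on_compose2[OF smooth_on_continuous[OF smooth_on_pd[OF s]]]) (auto intro!: continuous_intros)
 qed
 have "(LBINT t. indicator {0..1} t *\<^sub>R ?g t) = - \<eta> (x - 1 *\<^sub>R z) - (- \<eta> (x - 0 *\<^sub>R z))"
  by (rule integral_FTC_atLeastAtMost)
    (use d c in \<open>auto intro: has_vector_derivative_at_within simp: has_real_derivative_iff_has_vector_derivative\<close>)
 thus ?thesis by simp
qed

definition integrable_gradient :: "(real^'n::finite \<Rightarrow> real) \<Rightarrow> ('n \<Rightarrow> real^'n \<Rightarrow> real) \<Rightarrow> bool" where
 "integrable_gradient h D \<longleftrightarrow> h \<in> borel_measurable borel \<and> integrable lborel h \<and>
   (\<forall>i. D i \<in> borel_measurable borel \<and> integrable lborel (D i)) \<and>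
   (\<forall>i. \<forall>\<eta>\<in>test_functions UNIV. (LBINT x. h x * pd i \<eta> x) = - (LBINT x. D i x * \<eta> x))"

lemma integrable_gradientD:
 assumes "integrable_gradient h D"
 shows "h \<in> borel_measurable borel" "D i \<in> borel_measurable borel" "integrable lborel h" "integrable lborel (D i)"
  "\<eta> \<in> test_functions UNIV \<Longrightarrow> (LBINT x. h x * pd i \<eta> x) = - (LBINT x. D i x * \<eta> x)"
 using assms by (simp_all add: integrable_gradient_def)

text \<open>Tested against \<open>\<eta>\<close>, the formula is the fundamental theorem of calculus for
  \<open>\<eta>\<close> along the segment, moved from \<open>\<eta>\<close> to \<open>h\<close> by Fubini's
  theorem and the definition of weak derivatives; the fundamental lemma then removes
  \<open>\<eta>\<close>.\<close>

lemma difference_formula: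
 fixes h :: "real^'n::finite \<Rightarrow> real"
 assumes g: "integrable_gradient h D"
 shows "AE x in lborel. h (z + x) - h x = (\<Sum>i\<in>UNIV. z $ i * (LBINT t. indicator {0..1} t * D i (t *\<^sub>R z + x)))"
proof -
 note [measurable] = integrable_gradientD(1,2)[OF g] and hi = integrable_gradientD(3)[OF g]
  and Di = integrable_gradientD(4)[OF g] and w = integrable_gradientD(5)[OF g]
 let ?G = "\<lambda>x. \<Sum>i\<in>UNIV. z $ i * (LBINT t. indicator {0..1} t * D i (t *\<^sub>R z + x))"
 have Gi: "integrable lborel (\<lambda>x. LBINT t. indicator {0..1} t * D i (t *\<^sub>R z + x))" for i
  using lborel_pair.integrable_snd[OF integrable_shear[OF integrable_gradientD(2)[OF g] Di]] by simp
 have hz: "integrable lborel (\<lambda>x. h (z + x))" using integrable_translate(1)[OF integrable_gradientD(1)[OF g]] hi by simp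
 have "AE x in lborel. x \<in> UNIV \<longrightarrow> (h (z + x) - h x) - ?G x = 0"
 proof (rule fundamental_lemma[OF open_UNIV])
  show "(\<lambda>x. (h (z + x) - h x) - ?G x) \<in> borel_measurable borel" by measurable
  have i: "integrable lborel (\<lambda>x. (h (z + x) - h x) - ?G x)"
   using hz hi Gi by (intro Bochner_Integration.integrable_diff Bochner_Integration.integrable_sum integrable_mult_right) auto
  show "integrable lborel (\<lambda>x. indicator K x * ((h (z + x) - h x) - ?G x))" if "compact K" for K
   using integrable_mult_indicator[OF _ i, of K] that by (simp add: borel_compact)
  fix \<eta> :: "real^'n \<Rightarrow> real" assume \<eta>: "\<eta> \<in> test_functions UNIV"
  note [measurable] = borel_test_function[OF \<eta>] borel_test_function[OF test_functions_pd[OF \<eta>]]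
  have mi: "integrable lborel (\<lambda>x. f x * \<zeta> x)" if f: "integrable lborel f" "\<zeta> \<in> test_functions UNIV"
   for f \<zeta> :: "real^'n \<Rightarrow> real"
  proof (rule integrable_times_test_function[OF _ f(2)])
   show "f \<in> borel_measurable borel" using f by auto
   show "integrable lborel (\<lambda>x. indicator K x * f x)" if "compact K" for K
    using integrable_mult_indicator[OF _ f(1), of K] that by (simp add: borel_compact)
  qed
  obtain B where B: "\<And>x. \<bar>\<eta> x\<bar> \<le> B" using test_functions_bounded[OF \<eta>] by blast
  have I2: "integrable (lborel \<Otimes>\<^sub>M lborel) (\<lambda>(t, x). indicator {0..1} t * h x * pd i \<eta> (x - t *\<^sub>R z))" for i
  proof -
   obtain B' where B': "\<And>x. \<bar>pd i \<eta> x\<bar> \<le> B'" using test_functions_bounded[OF test_functions_pd[OF \<eta>]] by blast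
   show ?thesis
   proof (rule Bochner_Integration.integrable_bound[OF integrable_mult_left[OF integrable_shear[OF integrable_gradientD(1)[OF g] hi, of 0], of B']])
    show "AE p in lborel \<Otimes>\<^sub>M lborel. norm (case p of (t, x) \<Rightarrow> indicator {0..1} t * h x * pd i \<eta> (x - t *\<^sub>R z)) \<le>
      norm ((case p of (t, x) \<Rightarrow> indicator {0..1} t * h (t *\<^sub>R 0 + x)) * B')"
     by (intro AE_I2) (auto simp: abs_mult intro!: mult_left_mono order_trans[OF B' abs_ge_self])
   qed measurable
  qed
  have parts: "(LBINT x. (LBINT t. indicator {0..1} t * D i (t *\<^sub>R z + x)) * \<eta> x) =
    - (LBINT x. h x * (LBINT t. indicator {0..1} t * pd i \<eta> (x - t *\<^sub>R z)))" for i
  proof -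
   have I1: "integrable (lborel \<Otimes>\<^sub>M lborel) (\<lambda>(t, x). indicator {0..1} t * D i (t *\<^sub>R z + x) * \<eta> x)"
   proof (rule Bochner_Integration.integrable_bound[OF integrable_mult_left[OF integrable_shear[OF integrable_gradientD(2)[OF g] Di[of i], of z], of B]])
    show "AE p in lborel \<Otimes>\<^sub>M lborel. norm (case p of (t, x) \<Rightarrow> indicator {0..1} t * D i (t *\<^sub>R z + x) * \<eta> x) \<le>
      norm ((case p of (t, x) \<Rightarrow> indicator {0..1} t * D i (t *\<^sub>R z + x)) * B)"
     by (intro AE_I2) (auto simp: abs_mult intro!: mult_left_mono order_trans[OF B abs_ge_self])
   qed measurable
   have "(LBINT x. (LBINT t. indicator {0..1} t * D i (t *\<^sub>R z + x)) * \<eta> x) =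
     (LBINT x. (LBINT t. indicator {0..1} t * D i (t *\<^sub>R z + x) * \<eta> x))" by simp
   also have "\<dots> = (LBINT t. (LBINT x. indicator {0..1} t * D i (t *\<^sub>R z + x) * \<eta> x))"
    by (rule lborel_pair.Fubini_integral[OF I1])
   also have "\<dots> = (LBINT t. - (LBINT x. indicator {0..1} t * h x * pd i \<eta> (x - t *\<^sub>R z)))"
   proof (intro Bochner_Integration.integral_cong refl)
    fix t
    have "(LBINT x. D i (t *\<^sub>R z + x) * \<eta> x) = (LBINT x. D i x * \<eta> (x - t *\<^sub>R z))"
     using integrable_translate(2)[of "\<lambda>x. D i x * \<eta> (x - t *\<^sub>R z)" "t *\<^sub>R z"] by simp
    also have "\<dots> = - (LBINT x. h x * pd i \<eta> (x - t *\<^sub>R z))"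
     using w[OF test_function_translate(1)[OF \<eta>], of i "t *\<^sub>R z"] by (simp add: test_function_translate(2)[OF \<eta>])
    finally show "(LBINT x. indicator {0..1} t * D i (t *\<^sub>R z + x) * \<eta> x) =
      - (LBINT x. indicator {0..1} t * h x * pd i \<eta> (x - t *\<^sub>R z))"
     by (simp add: mult.assoc)
   qed
   also have "\<dots> = - (LBINT t. (LBINT x. indicator {0..1} t * h x * pd i \<eta> (x - t *\<^sub>R z)))" by simp
   also have "(LBINT t. (LBINT x. indicator {0..1} t * h x * pd i \<eta> (x - t *\<^sub>R z))) =
     (LBINT x. (LBINT t. indicator {0..1} t * h x * pd i \<eta> (x - t *\<^sub>R z)))"
    by (rule lborel_pair.Fubini_integral[OF I2, symmetric])
   also have "\<dots> = (LBINT x. h x * (LBINT t. indicator {0..1} t * pd i \<eta> (x - t *\<^sub>R z)))"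
   proof (intro Bochner_Integration.integral_cong refl)
    fix x
    have "(LBINT t. indicator {0..1} t * h x * pd i \<eta> (x - t *\<^sub>R z)) =
      (LBINT t. h x * (indicator {0..1} t * pd i \<eta> (x - t *\<^sub>R z)))"
     by (intro Bochner_Integration.integral_cong refl) (simp add: ac_simps)
    thus "(LBINT t. indicator {0..1} t * h x * pd i \<eta> (x - t *\<^sub>R z)) =
      h x * (LBINT t. indicator {0..1} t * pd i \<eta> (x - t *\<^sub>R z))" by simp
   qed
   finally show ?thesis .
  qed
  have ti: "integrable lborel (\<lambda>t. indicator {0..1} t * pd i \<eta> (x - t *\<^sub>R z))" for i x
  proof -
   have "continuous_on {0..1} (\<lambda>t. pd i \<eta> (x - t *\<^sub>R z))"
    by (rule continuous_on_compose2[OF smooth_on_continuous[OF smooth_on_pd[OF test_functions_smooth[OF \<eta>, of UNIV]]]])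
      (auto intro!: continuous_intros)
   from borel_integrable_atLeastAtMost'[OF this] show ?thesis by (simp add: set_integrable_def)
  qed
  have hti: "integrable lborel (\<lambda>x. h x * (LBINT t. indicator {0..1} t * pd i \<eta> (x - t *\<^sub>R z)))" for i
  proof -
   have "(\<lambda>x. LBINT t. indicator {0..1} t * h x * pd i \<eta> (x - t *\<^sub>R z)) =
     (\<lambda>x. h x * (LBINT t. indicator {0..1} t * pd i \<eta> (x - t *\<^sub>R z)))"
    by (simp add: mult.assoc mult.left_commute[of _ "h _"])
   thus ?thesis using lborel_pair.integrable_snd[OF I2[of i]] by simp
  qed
  have "(LBINT x. ?G x * \<eta> x) = (\<Sum>i\<in>UNIV. z $ i * (LBINT x. (LBINT t. indicator {0..1} t * D i (t *\<^sub>R z + x)) * \<eta> x))"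
   using mi[OF Gi \<eta>] by (simp add: sum_distrib_right mult.assoc Bochner_Integration.integral_sum)
  also have "\<dots> = - (LBINT x. h x * (\<Sum>i\<in>UNIV. z $ i * (LBINT t. indicator {0..1} t * pd i \<eta> (x - t *\<^sub>R z))))"
   using hti by (simp add: parts sum_negf sum_distrib_left mult.left_commute[of "h _"] Bochner_Integration.integral_sum)
  also have "\<dots> = - (LBINT x. h x * (\<eta> x - \<eta> (x - z)))"
  proof -
   have "(\<Sum>i\<in>UNIV. z $ i * (LBINT t. indicator {0..1} t * pd i \<eta> (x - t *\<^sub>R z))) = \<eta> x - \<eta> (x - z)" for x
   proof -
    have "(LBINT t. indicator {0..1} t * (\<Sum>i\<in>UNIV. z $ i * pd i \<eta> (x - t *\<^sub>R z))) =
      (LBINT t. (\<Sum>i\<in>UNIV. z $ i * (indicator {0..1} t * pd i \<eta> (x - t *\<^sub>R z))))"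
     by (simp add: sum_distrib_left mult.left_commute)
    also have "\<dots> = (\<Sum>i\<in>UNIV. z $ i * (LBINT t. indicator {0..1} t * pd i \<eta> (x - t *\<^sub>R z)))"
     using ti by (simp add: Bochner_Integration.integral_sum)
    finally show ?thesis using test_function_FTC[OF \<eta>, of z x] by simp
   qed
   thus ?thesis by simp
  qed
  also have "\<dots> = (LBINT x. h x * \<eta> (x - z)) - (LBINT x. h x * \<eta> x)"
   using mi[OF hi \<eta>] mi[OF hi test_function_translate(1)[OF \<eta>]] by (simp add: right_diff_distrib)
  also have "(LBINT x. h x * \<eta> (x - z)) = (LBINT x. h (z + x) * \<eta> x)"
   using integrable_translate(2)[of "\<lambda>x. h x * \<eta> (x - z)" z] by simp
  finally have "(LBINT x. ?G x * \<eta> x) = (LBINT x. h (z + x) * \<eta> x) - (LBINT x. h x * \<eta> x)" .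
  moreover have "integrable lborel (\<lambda>x. ?G x * \<eta> x)"
   by (rule mi[OF _ \<eta>]) (use Gi in \<open>intro Bochner_Integration.integrable_sum integrable_mult_right\<close>)
  ultimately show "(LBINT x. ((h (z + x) - h x) - ?G x) * \<eta> x) = 0"
   using mi[OF hz \<eta>] mi[OF hi \<eta>] by (simp add: left_diff_distrib)
 qed
 thus ?thesis by (rule AE_mp) (auto intro!: AE_I2)
qed

text \<open>Jensen's inequality on the unit interval, obtained from Young's inequality with the mean
  \<open>l\<close> of \<open>\<bar>u\<bar>\<close> in the second factor.  If \<open>u\<close> is not integrable,
  the left-hand side is \<open>0\<close> by convention.\<close>

lemma mean_powr_le:
 fixes u :: "real \<Rightarrow> real"
 assumes [measurable]: "u \<in> borel_measurable borel" and p: "p > 1"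
 shows "ennreal (\<bar>(LBINT t. indicator {0..1} t * u t)\<bar> powr p) \<le> (\<integral>\<^sup>+t. indicator {0..1} t * ennreal (\<bar>u t\<bar> powr p) \<partial>lborel)"
proof (cases "integrable lborel (\<lambda>t. indicator {0..1} t * u t) \<and> (\<integral>\<^sup>+t. indicator {0..1} t * ennreal (\<bar>u t\<bar> powr p) \<partial>lborel) < \<infinity>")
 case True
 define l where "l = (LBINT t. indicator {0..1} t * \<bar>u t\<bar>)"
 have ui: "integrable lborel (\<lambda>t. indicator {0..1} t * \<bar>u t\<bar>)"
  using integrable_abs[OF conjunct1[OF True]] by (simp add: abs_mult)
 have eq: "(\<integral>\<^sup>+t. ennreal (indicator {0..1} t * \<bar>u t\<bar> powr p) \<partial>lborel) = (\<integral>\<^sup>+t. indicator {0..1} t * ennreal (\<bar>u t\<bar> powr p) \<partial>lborel)"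
  by (intro nn_integral_cong) (auto simp: indicator_def)
 have pint: "integrable lborel (\<lambda>t. indicator {0..1} t * \<bar>u t\<bar> powr p)"
  using True by (intro integrableI_bounded) (auto simp: eq abs_mult)
 define I where "I = (LBINT t. indicator {0..1} t * \<bar>u t\<bar> powr p)"
 have l: "\<bar>(LBINT t. indicator {0..1} t * u t)\<bar> \<le> l"
  using integral_abs_bound[of lborel "\<lambda>t. indicator {0..1} t * u t"] by (simp add: l_def abs_mult)
 hence l0: "l \<ge> 0" by linarith
 define q where "q = p / (p - 1)"
 have q: "q > 1" "1 / p + 1 / q = 1" using p by (auto simp: q_def field_simps)
 have ind: "integrable lborel (indicator {0..1::real} :: real \<Rightarrow> real)" by (rule integrable_real_indicator) auto
 have "l powr p \<le> I"
 proof (cases "l = 0")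
  case False
  have "(LBINT t. (indicator {0..1} t * \<bar>u t\<bar>) * l powr (p - 1)) \<le>
    (LBINT t. (indicator {0..1} t * \<bar>u t\<bar> powr p) / p + indicator {0..1} t * (l powr p / q))"
  proof (rule integral_mono)
   fix t
   have "\<bar>u t\<bar> * l powr (p - 1) \<le> \<bar>u t\<bar> powr p / p + (l powr (p - 1)) powr q / q"
    using p q l0 by (intro Youngs_inequality) auto
   also have "(l powr (p - 1)) powr q = l powr p" using p by (simp add: powr_powr q_def)
   finally show "indicator {0..1} t * \<bar>u t\<bar> * l powr (p - 1) \<le> indicator {0..1} t * \<bar>u t\<bar> powr p / p + indicator {0..1} t * (l powr p / q)"
    by (auto simp: indicator_def)
  qed (use ui pint ind in auto)
  hence "l * l powr (p - 1) \<le> I / p + l powr p / q"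
   using ui pint ind by (simp add: l_def[symmetric] I_def[symmetric])
  moreover have "l * l powr (p - 1) = l powr p" using False l0 by (simp add: powr_mult_base)
  moreover have "l powr p = l powr p / p + l powr p / q"
   using q(2) by (metis add_divide_distrib distrib_left mult.right_neutral times_divide_eq_right)
  ultimately have "l powr p / p \<le> I / p" by linarith
  thus ?thesis using p by (simp add: field_simps)
 qed (use p in \<open>simp add: I_def\<close>)
 moreover have "\<bar>(LBINT t. indicator {0..1} t * u t)\<bar> powr p \<le> l powr p" using l p by (intro powr_mono2) auto
 ultimately have "ennreal (\<bar>(LBINT t. indicator {0..1} t * u t)\<bar> powr p) \<le> ennreal I" by (intro ennreal_leI) linarith
 also have "ennreal I = (\<integral>\<^sup>+t. ennreal (indicator {0..1} t * \<bar>u t\<bar> powr p) \<partial>lborel)"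
  unfolding I_def by (rule nn_integral_eq_integral[symmetric, OF pint]) auto
 finally show ?thesis by (simp add: eq)
next
 case False
 then consider "\<not> integrable lborel (\<lambda>t. indicator {0..1} t * u t)"
  | "(\<integral>\<^sup>+t. indicator {0..1} t * ennreal (\<bar>u t\<bar> powr p) \<partial>lborel) = \<infinity>" by (auto simp: not_less top_unique)
 thus ?thesis
  by cases (simp_all add: not_integrable_integral_eq)
qed

lemma difference_energy:
 fixes h :: "real^'n::finite \<Rightarrow> real"
 assumes p: "p > 1" and g: "integrable_gradient h D"
 shows "(\<integral>\<^sup>+x. ennreal (\<bar>h (z + x) - h x\<bar> powr p) \<partial>lborel) \<le>
  ennreal (norm z powr p) * (ennreal (real CARD('n) powr p) * (\<Sum>i\<in>UNIV. p_energy p UNIV (D i)))"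
proof -
 note [measurable] = integrable_gradientD(1,2)[OF g] and hi = integrable_gradientD(3)[OF g]
  and Di = integrable_gradientD(4)[OF g] and w = integrable_gradientD(5)[OF g]
 let ?J = "\<lambda>i x. \<integral>\<^sup>+t. indicator {0..1} t * ennreal (\<bar>D i (t *\<^sub>R z + x)\<bar> powr p) \<partial>lborel"
 let ?c = "ennreal (norm z powr p) * ennreal (real CARD('n) powr p)"
 have ae: "AE x in lborel. h (z + x) - h x = (\<Sum>i\<in>UNIV. z $ i * (LBINT t. indicator {0..1} t * D i (t *\<^sub>R z + x)))"
  by (rule difference_formula[OF g])
 have "(\<integral>\<^sup>+x. ennreal (\<bar>h (z + x) - h x\<bar> powr p) \<partial>lborel) \<le> (\<integral>\<^sup>+x. ?c * (\<Sum>i\<in>UNIV. ?J i x) \<partial>lborel)"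
 proof (rule nn_integral_mono_AE, use ae in eventually_elim)
  fix x
  let ?m = "\<lambda>i. (LBINT t. indicator {0..1} t * D i (t *\<^sub>R z + x))"
  assume e: "h (z + x) - h x = (\<Sum>i\<in>UNIV. z $ i * ?m i)"
  have "\<bar>h (z + x) - h x\<bar> \<le> (\<Sum>i\<in>UNIV. norm z * \<bar>?m i\<bar>)"
   unfolding e by (rule order_trans[OF sum_abs]) (auto simp: abs_mult intro!: sum_mono mult_right_mono component_le_norm_cart)
  hence "\<bar>h (z + x) - h x\<bar> powr p \<le> (\<Sum>i\<in>UNIV. norm z * \<bar>?m i\<bar>) powr p" using p by (intro powr_mono2) auto
  also have "\<dots> \<le> real CARD('n) powr p * (\<Sum>i\<in>UNIV. (norm z * \<bar>?m i\<bar>) powr p)"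
   using p by (intro sum_powr_bound) auto
  also have "\<dots> = norm z powr p * real CARD('n) powr p * (\<Sum>i\<in>UNIV. \<bar>?m i\<bar> powr p)"
   by (simp add: powr_mult sum_distrib_left ac_simps)
  finally have "ennreal (\<bar>h (z + x) - h x\<bar> powr p) \<le> ?c * ennreal (\<Sum>i\<in>UNIV. \<bar>?m i\<bar> powr p)"
   by (simp add: ennreal_mult[symmetric] ennreal_leI sum_nonneg)
  also have "\<dots> = ?c * (\<Sum>i\<in>UNIV. ennreal (\<bar>?m i\<bar> powr p))" by (simp add: sum_ennreal)
  also have "\<dots> \<le> ?c * (\<Sum>i\<in>UNIV. ?J i x)"
   using p by (intro mult_left_mono sum_mono mean_powr_le) auto
  finally show "ennreal (\<bar>h (z + x) - h x\<bar> powr p) \<le> ?c * (\<Sum>i\<in>UNIV. ?J i x)" .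
 qed
 also have "\<dots> = ?c * (\<Sum>i\<in>UNIV. \<integral>\<^sup>+x. ?J i x \<partial>lborel)"
  by (subst nn_integral_cmult, measurable, subst nn_integral_sum, measurable)
 finally have le: "(\<integral>\<^sup>+x. ennreal (\<bar>h (z + x) - h x\<bar> powr p) \<partial>lborel) \<le> ?c * (\<Sum>i\<in>UNIV. \<integral>\<^sup>+x. ?J i x \<partial>lborel)" .
 have "(\<integral>\<^sup>+x. ?J i x \<partial>lborel) = p_energy p UNIV (D i)" for i
 proof -
  have "(\<integral>\<^sup>+x. ?J i x \<partial>lborel) = (\<integral>\<^sup>+t. \<integral>\<^sup>+x. indicator {0..1} t * ennreal (\<bar>D i (t *\<^sub>R z + x)\<bar> powr p) \<partial>lborel \<partial>lborel)"
   by (rule lborel_pair.Fubini') measurable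
  also have "\<dots> = (\<integral>\<^sup>+t. indicator {0..1::real} t * p_energy p UNIV (D i) \<partial>lborel)"
  proof (intro nn_integral_cong)
   fix t :: real
   have "(\<integral>\<^sup>+x. indicator {0..1} t * ennreal (\<bar>D i (t *\<^sub>R z + x)\<bar> powr p) \<partial>lborel) =
     indicator {0..1} t * (\<integral>\<^sup>+x. ennreal (\<bar>D i (t *\<^sub>R z + x)\<bar> powr p) \<partial>lborel)"
    by (rule nn_integral_cmult) measurable
   also have "(\<integral>\<^sup>+x. ennreal (\<bar>D i (t *\<^sub>R z + x)\<bar> powr p) \<partial>lborel) = p_energy p UNIV (D i)"
    unfolding p_energy_def using nn_integral_translate[of "\<lambda>x. ennreal (\<bar>D i x\<bar> powr p)" "t *\<^sub>R z"] by simp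
   finally show "(\<integral>\<^sup>+x. indicator {0..1} t * ennreal (\<bar>D i (t *\<^sub>R z + x)\<bar> powr p) \<partial>lborel) =
     indicator {0..1} t * p_energy p UNIV (D i)" .
  qed
  also have "\<dots> = p_energy p UNIV (D i)" by (subst nn_integral_multc) auto
  finally show ?thesis .
 qed
 with le show ?thesis by (simp add: mult.assoc)
qed

text \<open>With \<open>y = x + z\<close>, the integral over \<open>x\<close> of the \<open>p\<close>-th power
  of the difference is at most a constant times \<open>min 1 (|z|\<^sup>p)\<close>, by the gradient for
  \<open>|z| \<le> 1\<close> and by \<open>h\<close> itself for \<open>|z| > 1\<close>; what is left is the
  integrable kernel.\<close>

lemma frac_energy_gradient:
 fixes p \<theta> :: real
 assumes p: "p > 1" and \<theta>: "0 < \<theta>" "\<theta> < 1"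
 obtains C where "C > 0" "\<And>(h :: real^'n::finite \<Rightarrow> real) D. integrable_gradient h D \<Longrightarrow>
  frac_energy \<theta> p UNIV h \<le> ennreal C * (p_energy p UNIV h + (\<Sum>i\<in>UNIV. p_energy p UNIV (D i)))"
proof -
 define a where "a = real CARD('n) + \<theta> * p"
 have p0: "p > 0" using p by simp
 define N where "N = enn2real (\<integral>\<^sup>+z. ennreal (kernel \<theta> p (z :: real^'n)) \<partial>lborel)"
 have N: "(\<integral>\<^sup>+z. ennreal (kernel \<theta> p (z :: real^'n)) \<partial>lborel) = ennreal N" "N \<ge> 0"
  using kernel_integrable[OF p0 \<theta>, where 'a = "real^'n"] by (simp_all add: N_def less_top)
 define Q where "Q = max (real CARD('n) powr p) (2 powr p * 2)"
 have Q: "Q > 0" by (simp add: Q_def less_max_iff_disj)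
 show thesis
 proof (rule that[of "N * Q + 1"])
  show "N * Q + 1 > 0" using N(2) Q by (intro add_nonneg_pos mult_nonneg_nonneg) auto
  fix h :: "real^'n \<Rightarrow> real" and D
  assume g: "integrable_gradient h D"
  note [measurable] = integrable_gradientD(1)[OF g]
  define R where "R = p_energy p UNIV h + (\<Sum>i\<in>UNIV. p_energy p UNIV (D i))"
  let ?I = "\<lambda>z. \<integral>\<^sup>+x. ennreal (\<bar>h (z + x) - h x\<bar> powr p) \<partial>lborel"
  have I: "?I z \<le> ennreal (min 1 (norm z powr p)) * (ennreal Q * R)" for z
  proof (cases "norm z \<le> 1")
   case True
   have "?I z \<le> ennreal (norm z powr p) * (ennreal (real CARD('n) powr p) * (\<Sum>i\<in>UNIV. p_energy p UNIV (D i)))"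
    by (rule difference_energy[OF p g])
   also have "\<dots> \<le> ennreal (norm z powr p) * (ennreal Q * R)"
    by (intro mult_left_mono mult_mono ennreal_leI) (auto simp: Q_def R_def)
   also have "norm z powr p = min 1 (norm z powr p)" using True p0 by (simp add: powr_le1)
   finally show ?thesis .
  next
   case False
   have "?I z \<le> (\<integral>\<^sup>+x. ennreal (2 powr p) * (ennreal (\<bar>h (z + x)\<bar> powr p) + ennreal (\<bar>h x\<bar> powr p)) \<partial>lborel)"
    using abs_powr_add_bound[of p "h (z + _)" "- h _"] p
    by (intro nn_integral_mono) (simp add: ennreal_mult[symmetric] ennreal_plus[symmetric] ennreal_leI del: ennreal_plus)
   also have "\<dots> = ennreal (2 powr p) * ((\<integral>\<^sup>+x. ennreal (\<bar>h (z + x)\<bar> powr p) \<partial>lborel) + (\<integral>\<^sup>+x. ennreal (\<bar>h x\<bar> powr p) \<partial>lborel))"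
    by (subst nn_integral_cmult, measurable, subst nn_integral_add, measurable)
   also have "\<dots> = ennreal (2 powr p) * (2 * p_energy p UNIV h)"
    using nn_integral_translate[of "\<lambda>x. ennreal (\<bar>h x\<bar> powr p)" z] by (simp add: p_energy_def mult_2)
   also have "\<dots> = ennreal (2 powr p * 2) * p_energy p UNIV h" by (simp add: ennreal_mult mult.assoc)
   also have "\<dots> \<le> ennreal Q * R" by (intro mult_mono ennreal_leI) (auto simp: Q_def R_def)
   also have "\<dots> = ennreal (min 1 (norm z powr p)) * (ennreal Q * R)"
    using False p0 ge_one_powr_ge_zero[of "norm z" p] by (simp add: min_def)
   finally show ?thesis .
  qed
  have "frac_energy \<theta> p UNIV h =
    (\<integral>\<^sup>+x. \<integral>\<^sup>+z. ennreal (\<bar>h (z + x) - h x\<bar> powr p / norm z powr a) \<partial>lborel \<partial>lborel)"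
   unfolding frac_energy_def
  proof (rule nn_integral_cong)
   fix x
   show "(\<integral>\<^sup>+y. indicator UNIV x * indicator UNIV y * ennreal (\<bar>h x - h y\<bar> powr p / norm (x - y) powr (real CARD('n) + \<theta> * p)) \<partial>lborel)
    = (\<integral>\<^sup>+z. ennreal (\<bar>h (z + x) - h x\<bar> powr p / norm z powr a) \<partial>lborel)"
    using nn_integral_translate[of "\<lambda>y. ennreal (\<bar>h x - h y\<bar> powr p / norm (x - y) powr a)" x]
    by (simp add: a_def add.commute abs_minus_commute)
  qed
  also have "\<dots> = (\<integral>\<^sup>+z. \<integral>\<^sup>+x. ennreal (\<bar>h (z + x) - h x\<bar> powr p / norm z powr a) \<partial>lborel \<partial>lborel)"
   by (rule lborel_pair.Fubini') measurable
  also have "\<dots> \<le> (\<integral>\<^sup>+z. ennreal (kernel \<theta> p (z :: real^'n)) * (ennreal Q * R) \<partial>lborel)"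
  proof (rule nn_integral_mono)
   fix z :: "real^'n"
   have "(\<integral>\<^sup>+x. ennreal (\<bar>h (z + x) - h x\<bar> powr p / norm z powr a) \<partial>lborel) =
     (\<integral>\<^sup>+x. ennreal (1 / norm z powr a) * ennreal (\<bar>h (z + x) - h x\<bar> powr p) \<partial>lborel)"
    by (intro nn_integral_cong) (simp add: ennreal_mult[symmetric])
   also have "\<dots> = ennreal (1 / norm z powr a) * ?I z" by (rule nn_integral_cmult) measurable
   also have "\<dots> \<le> ennreal (1 / norm z powr a) * (ennreal (min 1 (norm z powr p)) * (ennreal Q * R))"
    by (intro mult_left_mono I) auto
   also have "\<dots> = ennreal (kernel \<theta> p z) * (ennreal Q * R)"
    by (simp add: mult.assoc[symmetric] ennreal_mult[symmetric] kernel_def a_def)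
   finally show "(\<integral>\<^sup>+x. ennreal (\<bar>h (z + x) - h x\<bar> powr p / norm z powr a) \<partial>lborel) \<le> ennreal (kernel \<theta> p z) * (ennreal Q * R)" .
  qed
  also have "\<dots> = ennreal N * (ennreal Q * R)" by (subst nn_integral_multc) (auto simp: N(1))
  also have "\<dots> \<le> ennreal (N * Q + 1) * R"
   unfolding mult.assoc[symmetric] using N(2) Q by (intro mult_right_mono) (auto simp: ennreal_mult[symmetric] intro!: ennreal_leI)
  finally show "frac_energy \<theta> p UNIV h \<le> ennreal (N * Q + 1) * (p_energy p UNIV h + (\<Sum>i\<in>UNIV. p_energy p UNIV (D i)))"
   by (simp add: R_def)
 qed
qed

section \<open>Sobolev norms of functions\<close>

lemma version_self_test: "\<eta> \<in> test_functions V \<Longrightarrow> version_on \<O> \<eta> \<eta>"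
 by (simp add: version_on_def borel_test_function)

text \<open>Convexity of the power replaces Minkowski's inequality at the cost of the constant
  \<open>4\<close>.\<close>

lemma Lp_norm_quasi_add:
 assumes \<O>: "open \<O>" and p: "p \<ge> 1" and v: "version_on \<O> f f'" "version_on \<O> g g'"
 shows "Lp_norm p \<O> (\<lambda>x. f x + g x) \<le> 4 * (Lp_norm p \<O> f + Lp_norm p \<O> g)"
proof -
 have [measurable]: "f' \<in> borel_measurable borel" "g' \<in> borel_measurable borel" "\<O> \<in> sets borel"
  using v \<O> by (auto simp: version_on_def)
 have "p_energy p \<O> (\<lambda>x. f' x + g' x) \<le> (\<integral>\<^sup>+x. ennreal (2 powr p) *
   (indicator \<O> x * ennreal (\<bar>f' x\<bar> powr p) + indicator \<O> x * ennreal (\<bar>g' x\<bar> powr p)) \<partial>lborel)"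
  unfolding p_energy_def
 proof (rule nn_integral_mono)
  fix x
  have "ennreal (\<bar>f' x + g' x\<bar> powr p) \<le> ennreal (2 powr p) * (ennreal (\<bar>f' x\<bar> powr p) + ennreal (\<bar>g' x\<bar> powr p))"
   using abs_powr_add_bound[of p "f' x" "g' x"] p
   by (simp add: ennreal_mult[symmetric] ennreal_plus[symmetric] ennreal_leI del: ennreal_plus)
  thus "indicator \<O> x * ennreal (\<bar>f' x + g' x\<bar> powr p) \<le> ennreal (2 powr p) *
   (indicator \<O> x * ennreal (\<bar>f' x\<bar> powr p) + indicator \<O> x * ennreal (\<bar>g' x\<bar> powr p))"
   by (auto simp: indicator_def)
 qed
 also have "\<dots> = ennreal (2 powr p) * (p_energy p \<O> f' + p_energy p \<O> g')"
  unfolding p_energy_def by (subst nn_integral_cmult, measurable, subst nn_integral_add, measurable)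
 finally have "enn_root p (p_energy p \<O> (\<lambda>x. f' x + g' x)) \<le> enn_root p (ennreal (2 powr p) * (p_energy p \<O> f' + p_energy p \<O> g'))"
  using p by (intro enn_root_mono) auto
 also have "\<dots> = 2 * enn_root p (p_energy p \<O> f' + p_energy p \<O> g')"
  using p by (subst enn_root_cmult) (auto simp: powr_powr)
 also have "\<dots> \<le> 2 * (2 * (enn_root p (p_energy p \<O> f') + enn_root p (p_energy p \<O> g')))"
  using p by (intro mult_left_mono enn_root_add) auto
 finally show ?thesis
  by (simp add: Lp_norm_version[OF \<O> v(1)] Lp_norm_version[OF \<O> v(2)] Lp_norm_version[OF \<O> version_add[OF v]] mult.assoc[symmetric])
qed

lemma frac_measurable:
 fixes f :: "real^'n::finite \<Rightarrow> real"
 assumes [measurable]: "f \<in> borel_measurable borel" "\<O> \<in> sets borel"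
 shows "(\<lambda>(x, y). indicator \<O> x * indicator \<O> y * ennreal (\<bar>f x - f y\<bar> powr p / norm (x - y) powr a))
  \<in> borel_measurable (borel \<Otimes>\<^sub>M borel)"
 by measurable

lemma gagliardo_quasi_add:
 fixes \<O> :: "(real^'n::finite) set"
 assumes \<O>: "open \<O>" and p: "p \<ge> 1" and v: "version_on \<O> f f'" "version_on \<O> g g'"
 shows "gagliardo \<theta> p \<O> (\<lambda>x. f x + g x) \<le> 4 * (gagliardo \<theta> p \<O> f + gagliardo \<theta> p \<O> g)"
proof -
 have [measurable]: "f' \<in> borel_measurable borel" "g' \<in> borel_measurable borel" "\<O> \<in> sets borel"
  using v \<O> by (auto simp: version_on_def)
 let ?a = "real CARD('n) + \<theta> * p"
 let ?k = "\<lambda>f x y. indicator \<O> x * indicator \<O> y * ennreal (\<bar>f x - f y\<bar> powr p / norm (x - y) powr ?a)"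
 have "frac_energy \<theta> p \<O> (\<lambda>x. f' x + g' x) \<le> (\<integral>\<^sup>+x. \<integral>\<^sup>+y. ennreal (2 powr p) * (?k f' x y + ?k g' x y + 0) \<partial>lborel \<partial>lborel)"
  unfolding frac_energy_def
 proof (intro nn_integral_mono)
  fix x y
  have "\<bar>f' x + g' x - (f' y + g' y)\<bar> powr p \<le> 2 powr p * (\<bar>f' x - f' y\<bar> powr p + \<bar>g' x - g' y\<bar> powr p)"
   using abs_powr_add_bound[of p "f' x - f' y" "g' x - g' y"] p by (simp add: algebra_simps)
  hence "\<bar>f' x + g' x - (f' y + g' y)\<bar> powr p / norm (x - y) powr ?a \<le>
    2 powr p * (\<bar>f' x - f' y\<bar> powr p / norm (x - y) powr ?a + \<bar>g' x - g' y\<bar> powr p / norm (x - y) powr ?a)"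
   by (simp add: divide_right_mono add_divide_distrib[symmetric])
  hence "ennreal (\<bar>f' x + g' x - (f' y + g' y)\<bar> powr p / norm (x - y) powr ?a) \<le> ennreal (2 powr p) *
    (ennreal (\<bar>f' x - f' y\<bar> powr p / norm (x - y) powr ?a) + ennreal (\<bar>g' x - g' y\<bar> powr p / norm (x - y) powr ?a))"
   by (simp add: ennreal_mult[symmetric] ennreal_plus[symmetric] ennreal_leI del: ennreal_plus)
  thus "?k (\<lambda>x. f' x + g' x) x y \<le> ennreal (2 powr p) * (?k f' x y + ?k g' x y + 0)"
   by (auto simp: indicator_def)
 qed
 also have "\<dots> = ennreal (2 powr p) * (frac_energy \<theta> p \<O> f' + frac_energy \<theta> p \<O> g')"
  unfolding frac_energy_def
  using nn_integral2_cmult_add3[where H = "\<lambda>x y. 0" and c = "ennreal (2 powr p)", OF frac_measurable[of f' \<O> p ?a] frac_measurable[of g' \<O> p ?a]]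
  by simp
 finally have "enn_root p (frac_energy \<theta> p \<O> (\<lambda>x. f' x + g' x)) \<le> enn_root p (ennreal (2 powr p) * (frac_energy \<theta> p \<O> f' + frac_energy \<theta> p \<O> g'))"
  using p by (intro enn_root_mono) auto
 also have "\<dots> = 2 * enn_root p (frac_energy \<theta> p \<O> f' + frac_energy \<theta> p \<O> g')"
  using p by (subst enn_root_cmult) (auto simp: powr_powr)
 also have "\<dots> \<le> 2 * (2 * (enn_root p (frac_energy \<theta> p \<O> f') + enn_root p (frac_energy \<theta> p \<O> g')))"
  using p by (intro mult_left_mono enn_root_add) auto
 finally show ?thesis
  by (simp add: gagliardo_version[OF \<O> v(1)] gagliardo_version[OF \<O> v(2)] gagliardo_version[OF \<O> version_add[OF v]] mult.assoc[symmetric])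
qed

lemma norms_zero: "Lp_norm p \<O> (\<lambda>x. 0) = 0" "gagliardo \<theta> p \<O> (\<lambda>x. 0) = 0"
 by (simp_all add: Lp_norm_def gagliardo_def enn_root_def)

lemma norms_cmult:
 assumes \<O>: "open \<O>" and p: "p > 0" and c: "c > 0" and v: "version_on \<O> f f'"
 shows "Lp_norm p \<O> (\<lambda>x. c * f x) = ennreal c * Lp_norm p \<O> f"
  and "gagliardo \<theta> p \<O> (\<lambda>x. c * f x) = ennreal c * gagliardo \<theta> p \<O> f"
proof -
 have [measurable]: "f' \<in> borel_measurable borel" "\<O> \<in> sets borel"
  using v \<O> by (auto simp: version_on_def)
 note vc = version_cmult[OF v, of c]
 have cp: "(c powr p) powr (1 / p) = c" using c p by (simp add: powr_powr)
 have "p_energy p \<O> (\<lambda>x. c * f' x) = (\<integral>\<^sup>+x. ennreal (c powr p) * (indicator \<O> x * ennreal (\<bar>f' x\<bar> powr p)) \<partial>lborel)"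
  unfolding p_energy_def using c
  by (intro nn_integral_cong) (simp add: abs_mult powr_mult ennreal_mult mult.left_commute)
 also have "\<dots> = ennreal (c powr p) * p_energy p \<O> f'"
  unfolding p_energy_def by (rule nn_integral_cmult) measurable
 finally have "p_energy p \<O> (\<lambda>x. c * f' x) = ennreal (c powr p) * p_energy p \<O> f'" .
 thus "Lp_norm p \<O> (\<lambda>x. c * f x) = ennreal c * Lp_norm p \<O> f"
  using c by (simp add: Lp_norm_version[OF \<O> v] Lp_norm_version[OF \<O> vc] enn_root_cmult cp)
 have "frac_energy \<theta> p \<O> (\<lambda>x. c * f' x) = (\<integral>\<^sup>+x. \<integral>\<^sup>+y. ennreal (c powr p) * ((indicator \<O> x * indicator \<O> y *
   ennreal (\<bar>f' x - f' y\<bar> powr p / norm (x - y) powr (real CARD('a) + \<theta> * p))) + 0 + 0) \<partial>lborel \<partial>lborel)"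
  unfolding frac_energy_def
 proof (intro nn_integral_cong)
  fix x y
  have "\<bar>c * f' x - c * f' y\<bar> powr p = c powr p * \<bar>f' x - f' y\<bar> powr p"
   using c by (simp add: right_diff_distrib[symmetric] abs_mult powr_mult)
  thus "indicator \<O> x * indicator \<O> y * ennreal (\<bar>c * f' x - c * f' y\<bar> powr p / norm (x - y) powr (real CARD('a) + \<theta> * p)) =
   ennreal (c powr p) * ((indicator \<O> x * indicator \<O> y *
    ennreal (\<bar>f' x - f' y\<bar> powr p / norm (x - y) powr (real CARD('a) + \<theta> * p))) + 0 + 0)"
   using c by (simp add: ennreal_mult[symmetric] indicator_def)
 qed
 also have "\<dots> = ennreal (c powr p) * frac_energy \<theta> p \<O> f'"
  unfolding frac_energy_def
  using nn_integral2_cmult_add3[where G = "\<lambda>x y. 0" and H = "\<lambda>x y. 0" and c = "ennreal (c powr p)",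
    OF frac_measurable[of f' \<O> p "real CARD('a) + \<theta> * p"]]
  by simp
 finally have "frac_energy \<theta> p \<O> (\<lambda>x. c * f' x) = ennreal (c powr p) * frac_energy \<theta> p \<O> f'" .
 thus "gagliardo \<theta> p \<O> (\<lambda>x. c * f x) = ennreal c * gagliardo \<theta> p \<O> f"
  using c by (simp add: gagliardo_version[OF \<O> v] gagliardo_version[OF \<O> vc] enn_root_cmult cp)
qed

text \<open>By uniqueness the infima in the Sobolev norm can be dropped once weak derivatives are chosen.\<close>

definition weak_family :: "real \<Rightarrow> (real^'n::finite) set \<Rightarrow> (real^'n \<Rightarrow> real) \<Rightarrow> (('n \<Rightarrow> nat) \<Rightarrow> real^'n \<Rightarrow> real) \<Rightarrow> bool" where
 "weak_family s \<O> f G \<longleftrightarrow> (\<forall>\<nu>. order_of \<nu> \<le> nat \<lfloor>s\<rfloor> \<longrightarrow> is_weak_deriv \<O> \<nu> f (G \<nu>))"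

lemma weak_familyD: "weak_family s \<O> f G \<Longrightarrow> order_of \<nu> \<le> nat \<lfloor>s\<rfloor> \<Longrightarrow> weak_pds \<O> (list_of \<nu>) f (G \<nu>)"
 by (simp add: weak_family_def is_weak_deriv_iff)

lemma weak_familyI:
 "(\<And>\<nu>. order_of \<nu> \<le> nat \<lfloor>s\<rfloor> \<Longrightarrow> weak_pds \<O> (list_of \<nu>) f (G \<nu>)) \<Longrightarrow> weak_family s \<O> f G"
 by (simp add: weak_family_def is_weak_deriv_iff)

lemma sob_norm_fun_eq:
 fixes \<O> :: "(real^'n::finite) set"
 assumes \<O>: "open \<O>" and G: "weak_family s \<O> f G"
 shows "sob_norm_fun s p \<O> f = (\<Sum>\<nu> | order_of \<nu> \<le> nat \<lfloor>s\<rfloor>. Lp_norm p \<O> (G \<nu>)) +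
  (if s - of_int \<lfloor>s\<rfloor> = 0 then 0 else \<Sum>\<nu> | order_of \<nu> = nat \<lfloor>s\<rfloor>. gagliardo (s - of_int \<lfloor>s\<rfloor>) p \<O> (G \<nu>))"
proof -
 have same: "\<exists>v. version_on \<O> (G \<nu>) v \<and> (\<forall>g. is_weak_deriv \<O> \<nu> f g \<longrightarrow> version_on \<O> g v)"
  if o: "order_of \<nu> \<le> nat \<lfloor>s\<rfloor>" for \<nu>
 proof -
  note w = weak_familyD[OF G o]
  from w obtain v where v: "version_on \<O> (G \<nu>) v"
   using version_exists[OF \<O> locally_integrable_measurable[OF \<O>]] by (auto simp: weak_pds_def)
  thus ?thesis using weak_pds_unique[OF \<O> w _ v] by (auto simp: is_weak_deriv_iff)
 qed
 have L: "(INF g\<in>{g. is_weak_deriv \<O> \<nu> f g}. Lp_norm p \<O> g) = Lp_norm p \<O> (G \<nu>)"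
  if o: "order_of \<nu> \<le> nat \<lfloor>s\<rfloor>" for \<nu>
 proof -
  obtain v where v: "version_on \<O> (G \<nu>) v" "\<And>g. is_weak_deriv \<O> \<nu> f g \<Longrightarrow> version_on \<O> g v"
   using same[OF o] by blast
  have eq: "Lp_norm p \<O> g = Lp_norm p \<O> (G \<nu>)" if "is_weak_deriv \<O> \<nu> f g" for g
   using Lp_norm_version[OF \<O> v(1)] Lp_norm_version[OF \<O> v(2)[OF that]] by simp
  have "{g. is_weak_deriv \<O> \<nu> f g} \<noteq> {}" using G o by (auto simp: weak_family_def)
  thus ?thesis by (rule INF_eq_const) (use eq in blast)
 qed
 have R: "(INF g\<in>{g. is_weak_deriv \<O> \<nu> f g}. gagliardo \<theta> p \<O> g) = gagliardo \<theta> p \<O> (G \<nu>)"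
  if o: "order_of \<nu> \<le> nat \<lfloor>s\<rfloor>" for \<nu> \<theta>
 proof -
  obtain v where v: "version_on \<O> (G \<nu>) v" "\<And>g. is_weak_deriv \<O> \<nu> f g \<Longrightarrow> version_on \<O> g v"
   using same[OF o] by blast
  have eq: "gagliardo \<theta> p \<O> g = gagliardo \<theta> p \<O> (G \<nu>)" if "is_weak_deriv \<O> \<nu> f g" for g
   using gagliardo_version[OF \<O> v(1)] gagliardo_version[OF \<O> v(2)[OF that]] by simp
  have "{g. is_weak_deriv \<O> \<nu> f g} \<noteq> {}" using G o by (auto simp: weak_family_def)
  thus ?thesis by (rule INF_eq_const) (use eq in blast)
 qed
 show ?thesis
  unfolding sob_norm_fun_def Let_def
  by (intro arg_cong2[where f = "(+)"] if_cong sum.cong refl) (auto simp: L R)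
qed

text \<open>The infimum over the empty set is \<open>\<infinity>\<close>, so a finite norm provides all weak
  derivatives.\<close>

lemma sob_norm_fun_weak_derivs:
 fixes \<O> :: "(real^'n::finite) set"
 assumes fin: "sob_norm_fun s p \<O> f < \<infinity>"
 obtains G where "weak_family s \<O> f G"
proof -
 have "\<exists>g. is_weak_deriv \<O> \<nu> f g" if o: "order_of \<nu> \<le> nat \<lfloor>s\<rfloor>" for \<nu>
 proof (rule ccontr)
  assume "\<nexists>g. is_weak_deriv \<O> \<nu> f g"
  hence "(INF g\<in>{g. is_weak_deriv \<O> \<nu> f g}. Lp_norm p \<O> g) = \<infinity>" by simp
  moreover have "(INF g\<in>{g. is_weak_deriv \<O> \<nu> f g}. Lp_norm p \<O> g) \<le>
    (\<Sum>\<nu> | order_of \<nu> \<le> nat \<lfloor>s\<rfloor>. INF g\<in>{g. is_weak_deriv \<O> \<nu> f g}. Lp_norm p \<O> g)"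
   using o finite_order_le[of "nat \<lfloor>s\<rfloor>"] by (intro member_le_sum) auto
  ultimately have "(\<Sum>\<nu> | order_of \<nu> \<le> nat \<lfloor>s\<rfloor>. INF g\<in>{g. is_weak_deriv \<O> \<nu> f g}. Lp_norm p \<O> g) = \<infinity>"
   by (simp add: top_unique)
  thus False using fin by (simp add: sob_norm_fun_def Let_def)
 qed
 thus thesis using that unfolding weak_family_def by metis
qed

lemma version_mono: "version_on \<O> f f' \<Longrightarrow> \<O>' \<subseteq> \<O> \<Longrightarrow> version_on \<O>' f f'"
 unfolding version_on_def by (auto elim!: eventually_mono)

lemma weak_pds_restrict:
 assumes w: "weak_pds \<O> is f g" and o: "open \<O>" "open \<O>'" and sub: "\<O>' \<subseteq> \<O>"
 shows "weak_pds \<O>' is f g"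
proof -
 have li: "locally_integrable \<O> f" "locally_integrable \<O> g" using w by (auto simp: weak_pds_def)
 obtain f' g' where v: "version_on \<O> f f'" "version_on \<O> g g'"
  using version_exists[OF o(1) locally_integrable_measurable[OF o(1)]] li by metis
 have v': "version_on \<O>' f f'" "version_on \<O>' g g'"
  using version_mono v sub by blast+
 show ?thesis unfolding weak_pds_def
 proof (intro conjI ballI)
  show "locally_integrable \<O>' f" "locally_integrable \<O>' g"
   using li sub by (auto simp: locally_integrable_def)
  fix \<eta> assume \<eta>: "\<eta> \<in> test_functions \<O>'"
  note \<eta>' = test_functions_mono[OF \<eta> sub]
  have "regular_dist \<O> f (pds is \<eta>) = (-1) ^ length is * regular_dist \<O> g \<eta>"
   using w \<eta>' by (simp add: weak_pds_def)
  thus "regular_dist \<O>' f (pds is \<eta>) = (-1) ^ length is * regular_dist \<O>' g \<eta>"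
   by (simp add: regular_dist_version[OF o(1) v(1) test_functions_pds[OF \<eta>']] regular_dist_version[OF o(1) v(2) \<eta>']
     regular_dist_version[OF o(2) v'(1) test_functions_pds[OF \<eta>]] regular_dist_version[OF o(2) v'(2) \<eta>])
 qed
qed

lemma weak_pds_version:
 assumes "open \<O>" "weak_pds \<O> is f g" obtains v where "version_on \<O> g v"
 using version_exists[OF assms(1) locally_integrable_measurable[OF assms(1)]] assms(2)
 by (auto simp: weak_pds_def)

lemma norms_restrict:
 fixes \<O> :: "(real^'n::finite) set"
 assumes o: "open \<O>" "open \<O>'" and sub: "\<O>' \<subseteq> \<O>" and v: "version_on \<O> g v" and p: "p > 0"
 shows "Lp_norm p \<O>' g \<le> Lp_norm p \<O> g" "gagliardo \<theta> p \<O>' g \<le> gagliardo \<theta> p \<O> g"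
proof -
 have v': "version_on \<O>' g v" using version_mono v sub by blast+
 show "Lp_norm p \<O>' g \<le> Lp_norm p \<O> g"
  unfolding Lp_norm_version[OF o(1) v] Lp_norm_version[OF o(2) v'] p_energy_def using sub
  by (intro enn_root_mono p nn_integral_mono) (auto simp: indicator_def)
 show "gagliardo \<theta> p \<O>' g \<le> gagliardo \<theta> p \<O> g"
  unfolding gagliardo_version[OF o(1) v] gagliardo_version[OF o(2) v'] frac_energy_def using sub
  by (intro enn_root_mono p nn_integral_mono) (auto simp: indicator_def)
qed

lemma sob_norm_fun_restrict:
 fixes \<O> :: "(real^'n::finite) set"
 assumes o: "open \<O>" "open \<O>'" and sub: "\<O>' \<subseteq> \<O>" and p: "p > 0"
 shows "sob_norm_fun s p \<O>' f \<le> sob_norm_fun s p \<O> f"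
proof (cases "sob_norm_fun s p \<O> f < \<infinity>")
 case True
 obtain G where G: "weak_family s \<O> f G"
  using sob_norm_fun_weak_derivs[OF True] by blast
 have G': "weak_family s \<O>' f G"
  by (intro weak_familyI weak_pds_restrict[OF weak_familyD[OF G] o sub])
 have le: "Lp_norm p \<O>' (G \<nu>) \<le> Lp_norm p \<O> (G \<nu>)" "gagliardo \<theta> p \<O>' (G \<nu>) \<le> gagliardo \<theta> p \<O> (G \<nu>)"
  if ord: "order_of \<nu> \<le> nat \<lfloor>s\<rfloor>" for \<nu> \<theta>
 proof -
  obtain v where v: "version_on \<O> (G \<nu>) v"
   using weak_pds_version[OF o(1) weak_familyD[OF G ord]] .
  show "Lp_norm p \<O>' (G \<nu>) \<le> Lp_norm p \<O> (G \<nu>)" "gagliardo \<theta> p \<O>' (G \<nu>) \<le> gagliardo \<theta> p \<O> (G \<nu>)"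
   using norms_restrict[OF o sub v p] by auto
 qed
 show ?thesis
  unfolding sob_norm_fun_eq[OF o(1) G] sob_norm_fun_eq[OF o(2) G'] using le
  by (auto intro!: add_mono sum_mono)
qed (simp add: not_less top_unique)

lemma sob_fun_spaceI:
 fixes \<O> :: "(real^'n::finite) set"
 assumes \<O>: "open \<O>" and m: "f \<in> borel_measurable (lebesgue_on \<O>)" and fin: "sob_norm_fun s p \<O> f < \<infinity>"
 shows "f \<in> sob_fun_space s p \<O>"
proof -
 obtain G where G: "weak_family s \<O> f G"
  using sob_norm_fun_weak_derivs[OF fin] by blast
 define z :: "'n \<Rightarrow> nat" where "z = (\<lambda>i. 0)"
 have z: "order_of z = 0" "count_list [] = z" by (auto simp: z_def order_of_def)
 have w: "weak_pds \<O> [] f (G z)" unfolding weak_pds_iff z(2) using G z(1) by (simp add: weak_family_def)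
 hence w': "weak_pds \<O> [] f f" by (auto simp: weak_pds_def pds_simps)
 obtain v where v: "version_on \<O> f v" using version_exists[OF \<O> m] .
 have "Lp_norm p \<O> f = Lp_norm p \<O> (G z)"
  using Lp_norm_version[OF \<O> v] Lp_norm_version[OF \<O> weak_pds_unique[OF \<O> w' w v]] by simp
 also have "\<dots> \<le> (\<Sum>\<nu> | order_of \<nu> \<le> nat \<lfloor>s\<rfloor>. Lp_norm p \<O> (G \<nu>))"
  using z(1) finite_order_le[of "nat \<lfloor>s\<rfloor>"] by (intro member_le_sum) auto
 also have "\<dots> \<le> sob_norm_fun s p \<O> f" unfolding sob_norm_fun_eq[OF \<O> G] by simp
 finally show ?thesis using m fin by (auto simp: sob_fun_space_def intro: le_less_trans)
qed

lemma sob_norm_fun_quasi_add: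
 fixes \<O> :: "(real^'n::finite) set"
 assumes \<O>: "open \<O>" and p: "p \<ge> 1"
 shows "sob_norm_fun s p \<O> (\<lambda>x. f x + g x) \<le> 4 * (sob_norm_fun s p \<O> f + sob_norm_fun s p \<O> g)"
proof (cases "sob_norm_fun s p \<O> f < \<infinity> \<and> sob_norm_fun s p \<O> g < \<infinity>")
 case True
 obtain F where F: "weak_family s \<O> f F"
  using sob_norm_fun_weak_derivs[of s p \<O> f] True by blast
 obtain G where G: "weak_family s \<O> g G"
  using sob_norm_fun_weak_derivs[of s p \<O> g] True by blast
 have FGw: "weak_pds \<O> (list_of \<nu>) (\<lambda>x. f x + g x) (\<lambda>x. F \<nu> x + G \<nu> x)"
  and le: "Lp_norm p \<O> (\<lambda>x. F \<nu> x + G \<nu> x) \<le> 4 * (Lp_norm p \<O> (F \<nu>) + Lp_norm p \<O> (G \<nu>))"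
   "gagliardo \<theta> p \<O> (\<lambda>x. F \<nu> x + G \<nu> x) \<le> 4 * (gagliardo \<theta> p \<O> (F \<nu>) + gagliardo \<theta> p \<O> (G \<nu>))"
  if o: "order_of \<nu> \<le> nat \<lfloor>s\<rfloor>" for \<nu> \<theta>
 proof -
  note w = weak_familyD[OF F o] weak_familyD[OF G o]
  hence li: "locally_integrable \<O> f" "locally_integrable \<O> (F \<nu>)" "locally_integrable \<O> g" "locally_integrable \<O> (G \<nu>)"
   by (auto simp: weak_pds_def)
  have ex: "\<exists>v. version_on \<O> u v" if "locally_integrable \<O> u" for u
   using version_exists[OF \<O> locally_integrable_measurable[OF \<O> that]] by blast
  obtain f' F' g' G' where v: "version_on \<O> f f'" "version_on \<O> (F \<nu>) F'" "version_on \<O> g g'" "version_on \<O> (G \<nu>) G'"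
   using ex li by metis
  show "Lp_norm p \<O> (\<lambda>x. F \<nu> x + G \<nu> x) \<le> 4 * (Lp_norm p \<O> (F \<nu>) + Lp_norm p \<O> (G \<nu>))"
   "gagliardo \<theta> p \<O> (\<lambda>x. F \<nu> x + G \<nu> x) \<le> 4 * (gagliardo \<theta> p \<O> (F \<nu>) + gagliardo \<theta> p \<O> (G \<nu>))"
   using Lp_norm_quasi_add[OF \<O> p v(2,4)] gagliardo_quasi_add[OF \<O> p v(2,4)] by auto
  have rd: "regular_dist \<O> (\<lambda>x. u x + w x) \<eta> = regular_dist \<O> u \<eta> + regular_dist \<O> w \<eta>"
   if vu: "version_on \<O> u u'" and vw: "version_on \<O> w w'" and lu: "locally_integrable \<O> u" and lw: "locally_integrable \<O> w"
    and \<eta>: "\<eta> \<in> test_functions \<O>" for u u' w w' \<eta>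
  proof -
   have "integrable lborel (\<lambda>x. u' x * \<eta> x)"
    using vu locally_integrable_version[OF \<O> vu] lu by (intro integrable_times_test_function[OF _ \<eta>]) (auto simp: version_on_def)
   moreover have "integrable lborel (\<lambda>x. w' x * \<eta> x)"
    using vw locally_integrable_version[OF \<O> vw] lw by (intro integrable_times_test_function[OF _ \<eta>]) (auto simp: version_on_def)
   ultimately show ?thesis
    by (simp add: regular_dist_version[OF \<O> version_add[OF vu vw] \<eta>] regular_dist_version[OF \<O> vu \<eta>]
      regular_dist_version[OF \<O> vw \<eta>] distrib_right)
  qed
  have la: "locally_integrable \<O> (\<lambda>x. u x + w x)" if "locally_integrable \<O> u" "locally_integrable \<O> w" for u w
   using that unfolding locally_integrable_def by (auto intro: set_integral_add(1))
  show "weak_pds \<O> (list_of \<nu>) (\<lambda>x. f x + g x) (\<lambda>x. F \<nu> x + G \<nu> x)"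
   unfolding weak_pds_def
  proof (intro conjI ballI la li)
   fix \<eta> assume \<eta>: "\<eta> \<in> test_functions \<O>"
   show "regular_dist \<O> (\<lambda>x. f x + g x) (pds (list_of \<nu>) \<eta>) = (-1) ^ length (list_of \<nu>) * regular_dist \<O> (\<lambda>x. F \<nu> x + G \<nu> x) \<eta>"
    using w \<eta> by (simp add: rd[OF v(1,3) li(1,3) test_functions_pds[OF \<eta>]] rd[OF v(2,4) li(2,4) \<eta>] weak_pds_def distrib_left)
  qed
 qed
 have FG: "weak_family s \<O> (\<lambda>x. f x + g x) (\<lambda>\<nu> x. F \<nu> x + G \<nu> x)"
  by (intro weak_familyI FGw)
 have "sob_norm_fun s p \<O> (\<lambda>x. f x + g x) \<le>
   (\<Sum>\<nu> | order_of \<nu> \<le> nat \<lfloor>s\<rfloor>. 4 * (Lp_norm p \<O> (F \<nu>) + Lp_norm p \<O> (G \<nu>))) +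
   (if s - of_int \<lfloor>s\<rfloor> = 0 then 0 else \<Sum>\<nu> | order_of \<nu> = nat \<lfloor>s\<rfloor>.
    4 * (gagliardo (s - of_int \<lfloor>s\<rfloor>) p \<O> (F \<nu>) + gagliardo (s - of_int \<lfloor>s\<rfloor>) p \<O> (G \<nu>)))"
  unfolding sob_norm_fun_eq[OF \<O> FG] using le by (auto intro!: add_mono sum_mono)
 also have "\<dots> = 4 * (sob_norm_fun s p \<O> f + sob_norm_fun s p \<O> g)"
  unfolding sob_norm_fun_eq[OF \<O> F] sob_norm_fun_eq[OF \<O> G]
  by (simp add: sum_distrib_left[symmetric] sum.distrib distrib_left ac_simps)
 finally show ?thesis .
qed (auto simp: not_less top_unique ennreal_mult_top)

lemma sob_norm_fun_cmult:
 fixes \<O> :: "(real^'n::finite) set"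
 assumes \<O>: "open \<O>" and p: "p > 0" and c: "c > 0" and fin: "sob_norm_fun s p \<O> f < \<infinity>"
 shows "sob_norm_fun s p \<O> (\<lambda>x. c * f x) = ennreal c * sob_norm_fun s p \<O> f"
proof -
 obtain G where G: "weak_family s \<O> f G"
  using sob_norm_fun_weak_derivs[OF fin] by blast
 have rd: "regular_dist \<O> (\<lambda>x. c * u x) \<eta> = c * regular_dist \<O> u \<eta>" for u \<eta>
  by (simp add: regular_dist_def mult.assoc)
 have lc: "locally_integrable \<O> (\<lambda>x. c * u x)" if "locally_integrable \<O> u" for u
  using that unfolding locally_integrable_def by (auto simp: set_integrable_def mult.left_commute)
 have G': "weak_family s \<O> (\<lambda>x. c * f x) (\<lambda>\<nu> x. c * G \<nu> x)"
  using weak_familyD[OF G] by (intro weak_familyI) (auto simp: weak_pds_def rd lc)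
 have e: "Lp_norm p \<O> (\<lambda>x. c * G \<nu> x) = ennreal c * Lp_norm p \<O> (G \<nu>)"
  "gagliardo \<theta> p \<O> (\<lambda>x. c * G \<nu> x) = ennreal c * gagliardo \<theta> p \<O> (G \<nu>)" if o: "order_of \<nu> \<le> nat \<lfloor>s\<rfloor>" for \<nu> \<theta>
 proof -
  obtain v where v: "version_on \<O> (G \<nu>) v"
   using weak_pds_version[OF \<O> weak_familyD[OF G o]] .
  show "Lp_norm p \<O> (\<lambda>x. c * G \<nu> x) = ennreal c * Lp_norm p \<O> (G \<nu>)"
   "gagliardo \<theta> p \<O> (\<lambda>x. c * G \<nu> x) = ennreal c * gagliardo \<theta> p \<O> (G \<nu>)"
   using norms_cmult[OF \<O> p c v] by auto
 qed
 show ?thesis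
  unfolding sob_norm_fun_eq[OF \<O> G'] sob_norm_fun_eq[OF \<O> G]
  by (simp add: sum_distrib_left distrib_left e)
qed

section \<open>Weighted pullbacks act boundedly on Sobolev spaces\<close>

text \<open>The class on which the norms are quasi-additive; it contains the weighted pullbacks of all locally
  integrable functions.\<close>

definition int_version :: "(real^'n::finite \<Rightarrow> real) \<Rightarrow> bool" where
 "int_version f \<longleftrightarrow> (\<exists>v. version_on UNIV f v \<and> integrable lborel v)"

lemma int_version_add: "int_version f \<Longrightarrow> int_version g \<Longrightarrow> int_version (\<lambda>x. f x + g x)"
 unfolding int_version_def using version_add Bochner_Integration.integrable_add by blast

lemma int_version_zero: "int_version (\<lambda>x. 0)"
 unfolding int_version_def using version_zero by (intro exI[of _ "\<lambda>x. 0"]) auto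

lemma (in diffeo) int_version_pull:
 assumes \<O>: "open \<O>" "W \<subseteq> \<O>" and m: "m \<in> test_functions W'" and g: "locally_integrable \<O> g"
 shows "int_version (pull m T g)"
proof -
 obtain v where v: "version_on \<O> g v"
  using version_exists[OF \<O>(1) locally_integrable_measurable[OF \<O>(1) g]] .
 have vm: "v \<in> borel_measurable borel" using v by (simp add: version_on_def)
 have "integrable lborel (pull m T v)"
  by (rule integrable_pull[OF \<O>(2) m vm]) (use locally_integrable_version[OF \<O>(1) v] g in auto)
 thus ?thesis using version_pull[OF \<O>(2) m v] by (auto simp: int_version_def)
qed

text \<open>The parameter \<open>x\<close> ranges over functions together with their weak derivatives; the point
  is a constant that is uniform in \<open>x\<close>.\<close>

lemma list_quasi_bound:
 fixes \<Phi> :: "(real^'n::finite \<Rightarrow> real) \<Rightarrow> ennreal" and N :: "'x \<Rightarrow> ennreal"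
 assumes t: "\<And>a. a \<in> set xs \<Longrightarrow> \<exists>C>0. \<forall>x\<in>X. int_version (h a x) \<and> \<Phi> (h a x) \<le> ennreal C * N x"
  and z: "\<Phi> (\<lambda>y. 0) = 0"
  and q: "\<And>f g. int_version f \<Longrightarrow> int_version g \<Longrightarrow> \<Phi> (\<lambda>y. f y + g y) \<le> 4 * (\<Phi> f + \<Phi> g)"
 shows "\<exists>C>0. \<forall>x\<in>X. int_version (\<lambda>y. \<Sum>a\<leftarrow>xs. h a x y) \<and> \<Phi> (\<lambda>y. \<Sum>a\<leftarrow>xs. h a x y) \<le> ennreal C * N x"
 using t
proof (induction xs)
 case Nil
 thus ?case by (intro exI[of _ 1]) (simp add: z int_version_zero)
next
 case (Cons a xs)
 obtain C where C: "C > 0" "\<And>x. x \<in> X \<Longrightarrow> int_version (\<lambda>y. \<Sum>a\<leftarrow>xs. h a x y) \<and> \<Phi> (\<lambda>y. \<Sum>a\<leftarrow>xs. h a x y) \<le> ennreal C * N x"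
  using Cons.IH Cons.prems by auto
 obtain B where B: "B > 0" "\<And>x. x \<in> X \<Longrightarrow> int_version (h a x) \<and> \<Phi> (h a x) \<le> ennreal B * N x"
  using Cons.prems[of a] by auto
 show ?case
 proof (intro exI[of _ "4 * (B + C)"] conjI ballI)
  show "0 < 4 * (B + C)" using B C by simp
  fix x assume x: "x \<in> X"
  show "int_version (\<lambda>y. \<Sum>a\<leftarrow>a # xs. h a x y)" using int_version_add[OF conjunct1[OF B(2)[OF x]] conjunct1[OF C(2)[OF x]]] by simp
  have "\<Phi> (\<lambda>y. h a x y + (\<Sum>a\<leftarrow>xs. h a x y)) \<le> 4 * (\<Phi> (h a x) + \<Phi> (\<lambda>y. \<Sum>a\<leftarrow>xs. h a x y))"
   using q B(2)[OF x] C(2)[OF x] by blast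
  also have "\<dots> \<le> 4 * (ennreal B * N x + ennreal C * N x)"
   using B(2)[OF x] C(2)[OF x] by (intro mult_left_mono add_mono) auto
  also have "\<dots> = ennreal (4 * (B + C)) * N x"
   using B(1) C(1) by (simp add: ennreal_mult ennreal_plus distrib_right mult.assoc)
  finally show "\<Phi> (\<lambda>y. \<Sum>a\<leftarrow>a # xs. h a x y) \<le> ennreal (4 * (B + C)) * N x" by simp
 qed
qed

lemma sum_bound:
 fixes \<Phi> :: "'a \<Rightarrow> 'x \<Rightarrow> ennreal" and N :: "'x \<Rightarrow> ennreal"
 assumes "\<And>a. a \<in> A \<Longrightarrow> \<exists>C>0. \<forall>x\<in>X. \<Phi> a x \<le> ennreal C * N x"
 shows "\<exists>C>0. \<forall>x\<in>X. (\<Sum>a\<in>A. \<Phi> a x) \<le> ennreal C * N x"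
 using assms
proof (induction A rule: infinite_finite_induct)
 case (insert a A)
 obtain C where C: "C > 0" "\<And>x. x \<in> X \<Longrightarrow> (\<Sum>a\<in>A. \<Phi> a x) \<le> ennreal C * N x" using insert by auto
 obtain B where B: "B > 0" "\<And>x. x \<in> X \<Longrightarrow> \<Phi> a x \<le> ennreal B * N x" using insert.prems[of a] by auto
 show ?case
 proof (intro exI[of _ "B + C"] conjI ballI)
  fix x assume x: "x \<in> X"
  show "(\<Sum>a\<in>insert a A. \<Phi> a x) \<le> ennreal (B + C) * N x"
   using insert(1,2) add_mono[OF B(2)[OF x] C(2)[OF x]] B(1) C(1) by (simp add: ennreal_plus distrib_right)
 qed (use B C in simp)
qed (auto intro: exI[of _ 1])

lemma enn_root_sum_le:
 assumes A: "finite A" and p: "p > 0" and le: "\<And>i. i \<in> A \<Longrightarrow> enn_root p (J i) \<le> N"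
 shows "enn_root p (\<Sum>i\<in>A. J i) \<le> ennreal (real (card A + 1) powr (1 / p)) * N"
proof (cases "A = {}")
 case False
 define M where "M = Max (J ` A)"
 have "M \<in> J ` A" unfolding M_def using A False by (intro Max_in) auto
 then obtain j where j: "j \<in> A" "M = J j" by auto
 have "(\<Sum>i\<in>A. J i) \<le> of_nat (card A) * M" using A by (intro sum_bounded_above) (auto simp: M_def)
 also have "\<dots> \<le> ennreal (real (card A + 1)) * M"
  unfolding ennreal_of_nat_eq_real_of_nat by (intro mult_right_mono ennreal_leI) auto
 finally have "enn_root p (\<Sum>i\<in>A. J i) \<le> enn_root p (ennreal (real (card A + 1)) * M)"
  by (rule enn_root_mono[OF p])
 also have "\<dots> = ennreal (real (card A + 1) powr (1 / p)) * enn_root p M" by (rule enn_root_cmult) simp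
 also have "\<dots> \<le> ennreal (real (card A + 1) powr (1 / p)) * N" using le[OF j(1)] j(2) by (intro mult_left_mono) auto
 finally show ?thesis .
qed (simp add: enn_root_def)

lemma gagliardo_gradient:
 fixes p \<theta> :: real
 assumes p: "p > 1" and \<theta>: "0 < \<theta>" "\<theta> < 1"
 obtains C where "C > 0" "\<And>(h :: real^'n::finite \<Rightarrow> real) D N. int_version h \<Longrightarrow> (\<And>i. int_version (D i)) \<Longrightarrow>
  (\<And>i. weak_pds UNIV [i] h (D i)) \<Longrightarrow> Lp_norm p UNIV h \<le> N \<Longrightarrow> (\<And>i. Lp_norm p UNIV (D i) \<le> N) \<Longrightarrow>
  gagliardo \<theta> p UNIV h \<le> ennreal C * N"
proof -
 have p0: "p > 0" using p by simp
 obtain C where C: "C > 0" "\<And>(h :: real^'n \<Rightarrow> real) D. integrable_gradient h D \<Longrightarrow>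
  frac_energy \<theta> p UNIV h \<le> ennreal C * (p_energy p UNIV h + (\<Sum>i\<in>UNIV. p_energy p UNIV (D i)))"
  by (rule frac_energy_gradient[OF p \<theta>, where 'n = 'n]) (rule that, assumption, blast)
 define B where "B = real (CARD('n) + 1) powr (1 / p)"
 have B: "B > 0" by (simp add: B_def)
 show thesis
 proof (rule that[of "C powr (1 / p) * (2 * (1 + B))"])
  show "C powr (1 / p) * (2 * (1 + B)) > 0" using C B by simp
  fix h :: "real^'n \<Rightarrow> real" and D N
  assume h: "int_version h" and D: "\<And>i. int_version (D i)" and w: "\<And>i. weak_pds UNIV [i] h (D i)"
   and N: "Lp_norm p UNIV h \<le> N" "\<And>i. Lp_norm p UNIV (D i) \<le> N"
  obtain h' where h': "version_on UNIV h h'" "integrable lborel h'" using h by (auto simp: int_version_def)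
  obtain D' where D': "\<And>i. version_on UNIV (D i) (D' i)" "\<And>i. integrable lborel (D' i)"
   using D unfolding int_version_def by metis
  have e: "frac_energy \<theta> p UNIV h' \<le> ennreal C * (p_energy p UNIV h' + (\<Sum>i\<in>UNIV. p_energy p UNIV (D' i)))"
  proof (rule C(2), unfold integrable_gradient_def, intro conjI allI ballI)
   fix i \<eta> assume \<eta>: "\<eta> \<in> test_functions (UNIV :: (real^'n) set)"
   have "regular_dist UNIV h (pd i \<eta>) = - regular_dist UNIV (D i) \<eta>"
    using w[of i] \<eta> by (simp add: weak_pds_def pds_simps)
   thus "(LBINT x. h' x * pd i \<eta> x) = - (LBINT x. D' i x * \<eta> x)"
    by (simp add: regular_dist_version[OF open_UNIV h'(1) test_functions_pd[OF \<eta>]] regular_dist_version[OF open_UNIV D'(1) \<eta>])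
  qed (use h' D' in \<open>auto simp: version_on_def\<close>)
  have "gagliardo \<theta> p UNIV h = enn_root p (frac_energy \<theta> p UNIV h')" by (rule gagliardo_version[OF open_UNIV h'(1)])
  also have "\<dots> \<le> enn_root p (ennreal C * (p_energy p UNIV h' + (\<Sum>i\<in>UNIV. p_energy p UNIV (D' i))))"
   by (rule enn_root_mono[OF p0 e])
  also have "\<dots> = ennreal (C powr (1 / p)) * enn_root p (p_energy p UNIV h' + (\<Sum>i\<in>UNIV. p_energy p UNIV (D' i)))"
   by (rule enn_root_cmult[OF C(1)])
  also have "\<dots> \<le> ennreal (C powr (1 / p)) * (2 * (enn_root p (p_energy p UNIV h') + enn_root p (\<Sum>i\<in>UNIV. p_energy p UNIV (D' i))))"
   using p by (intro mult_left_mono enn_root_add) auto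
  also have "\<dots> \<le> ennreal (C powr (1 / p)) * (2 * (N + ennreal B * N))"
  proof (intro mult_left_mono add_mono)
   show "enn_root p (p_energy p UNIV h') \<le> N" using N(1) Lp_norm_version[OF open_UNIV h'(1)] by simp
   show "enn_root p (\<Sum>i\<in>UNIV. p_energy p UNIV (D' i)) \<le> ennreal B * N"
    unfolding B_def by (rule enn_root_sum_le[OF finite p0]) (use N(2) Lp_norm_version[OF open_UNIV D'(1)] in simp)
  qed auto
  also have "\<dots> = ennreal (C powr (1 / p) * (2 * (1 + B))) * N"
   using B by (simp add: ennreal_mult ennreal_plus distrib_right mult.assoc)
  finally show "gagliardo \<theta> p UNIV h \<le> ennreal (C powr (1 / p) * (2 * (1 + B))) * N" .
 qed
qed

context diffeo
begin

lemma Lp_pull: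
 assumes \<O>: "open \<O>" "W \<subseteq> \<O>" and m: "m \<in> test_functions W'" and p: "p > 0"
 obtains C where "C > 0" "\<And>g N. locally_integrable \<O> g \<Longrightarrow> Lp_norm p \<O> g \<le> N \<Longrightarrow> Lp_norm p UNIV (pull m T g) \<le> ennreal C * N"
proof -
 obtain C where C: "C > 0" "\<And>g. g \<in> borel_measurable borel \<Longrightarrow> p_energy p UNIV (pull m T g) \<le> ennreal C * p_energy p \<O> g"
  by (rule p_energy_pull[OF \<O>(2) m less_imp_le[OF p]]) (rule that, assumption, blast)
 show thesis
 proof (rule that[of "C powr (1 / p)"])
  fix g N assume g: "locally_integrable \<O> g" and N: "Lp_norm p \<O> g \<le> N"
  obtain v where v: "version_on \<O> g v"
   using version_exists[OF \<O>(1) locally_integrable_measurable[OF \<O>(1) g]] .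
  have "Lp_norm p UNIV (pull m T g) = enn_root p (p_energy p UNIV (pull m T v))"
   by (rule Lp_norm_version[OF open_UNIV version_pull[OF \<O>(2) m v]])
  also have "\<dots> \<le> enn_root p (ennreal C * p_energy p \<O> v)"
   using v by (intro enn_root_mono[OF p] C(2)) (simp add: version_on_def)
  also have "\<dots> = ennreal (C powr (1 / p)) * Lp_norm p \<O> g"
   unfolding Lp_norm_version[OF \<O>(1) v] by (rule enn_root_cmult[OF C(1)])
  also have "\<dots> \<le> ennreal (C powr (1 / p)) * N" by (intro mult_left_mono N) auto
  finally show "Lp_norm p UNIV (pull m T g) \<le> ennreal (C powr (1 / p)) * N" .
 qed (use C in simp)
qed

lemma gagliardo_pull:
 assumes \<O>: "open \<O>" "W \<subseteq> \<O>" and m: "m \<in> test_functions W'" and p: "p > 1" and \<theta>: "0 < \<theta>" "\<theta> < 1"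
 obtains C where "C > 0" "\<And>g N. locally_integrable \<O> g \<Longrightarrow> Lp_norm p \<O> g \<le> N \<Longrightarrow> gagliardo \<theta> p \<O> g \<le> N \<Longrightarrow>
  gagliardo \<theta> p UNIV (pull m T g) \<le> ennreal C * N"
proof -
 have p0: "p > 0" using p by simp
 obtain C where C: "C > 0" "\<And>g. g \<in> borel_measurable borel \<Longrightarrow>
  frac_energy \<theta> p UNIV (pull m T g) \<le> ennreal C * (p_energy p \<O> g + frac_energy \<theta> p \<O> g)"
  by (rule frac_energy_pull[OF \<O>(2,1) m p0 \<theta>]) (rule that, assumption, blast)
 show thesis
 proof (rule that[of "C powr (1 / p) * 4"])
  fix g N assume g: "locally_integrable \<O> g" and N: "Lp_norm p \<O> g \<le> N" "gagliardo \<theta> p \<O> g \<le> N"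
  obtain v where v: "version_on \<O> g v"
   using version_exists[OF \<O>(1) locally_integrable_measurable[OF \<O>(1) g]] .
  have "gagliardo \<theta> p UNIV (pull m T g) = enn_root p (frac_energy \<theta> p UNIV (pull m T v))"
   by (rule gagliardo_version[OF open_UNIV version_pull[OF \<O>(2) m v]])
  also have "\<dots> \<le> enn_root p (ennreal C * (p_energy p \<O> v + frac_energy \<theta> p \<O> v))"
   using v by (intro enn_root_mono[OF p0] C(2)) (simp add: version_on_def)
  also have "\<dots> = ennreal (C powr (1 / p)) * enn_root p (p_energy p \<O> v + frac_energy \<theta> p \<O> v)"
   by (rule enn_root_cmult[OF C(1)])
  also have "\<dots> \<le> ennreal (C powr (1 / p)) * (2 * (Lp_norm p \<O> g + gagliardo \<theta> p \<O> g))"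
   unfolding Lp_norm_version[OF \<O>(1) v] gagliardo_version[OF \<O>(1) v]
   using p by (intro mult_left_mono enn_root_add) auto
  also have "\<dots> \<le> ennreal (C powr (1 / p)) * (2 * (N + N))"
   by (intro mult_left_mono add_mono N) auto
  also have "\<dots> = ennreal (C powr (1 / p) * 4) * N"
   by (simp add: ennreal_mult mult_2[symmetric] mult.assoc[symmetric])
  finally show "gagliardo \<theta> p UNIV (pull m T g) \<le> ennreal (C powr (1 / p) * 4) * N" .
 qed (use C in simp)
qed

text \<open>The Gagliardo norm of \<open>g\<close> may be infinite here: the pullback has a weak gradient in
  \<open>L\<^sup>p\<close>, and \<open>gagliardo_gradient\<close> applies to it.\<close>

lemma gagliardo_pull_lower_order:
 assumes \<O>: "open \<O>" "W \<subseteq> \<O>" and m: "m \<in> test_functions W'" and p: "p > 1" and \<theta>: "0 < \<theta>" "\<theta> < 1"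
 obtains C where "C > 0" "\<And>g \<gamma> N. (\<And>is. length is \<le> 1 \<Longrightarrow> weak_pds \<O> is g (\<gamma> is) \<and> Lp_norm p \<O> (\<gamma> is) \<le> N) \<Longrightarrow>
  Lp_norm p \<O> g \<le> N \<Longrightarrow> gagliardo \<theta> p UNIV (pull m T g) \<le> ennreal C * N"
proof -
 have p0: "p > 0" and p1: "p \<ge> 1" using p by auto
 define X where "X = {(g, \<gamma>, N). (\<forall>is. length is \<le> 1 \<longrightarrow> weak_pds \<O> is g (\<gamma> is) \<and> Lp_norm p \<O> (\<gamma> is) \<le> N) \<and> Lp_norm p \<O> g \<le> N}"
 have "\<exists>E C. C > 0 \<and> (\<forall>(g, \<gamma>, N)\<in>X. weak_pds UNIV [i] (pull m T g) (E \<gamma>) \<and> int_version (E \<gamma>) \<and>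
   Lp_norm p UNIV (E \<gamma>) \<le> ennreal C * N)" for i
 proof -
  obtain xs where xs: "\<And>c is. (c, is) \<in> set xs \<Longrightarrow> c \<in> test_functions W' \<and> length is \<le> 1"
   and w: "\<And>f g. (\<forall>is. length is \<le> 1 \<longrightarrow> weak_pds \<O> is f (g is)) \<Longrightarrow>
    weak_pds UNIV [i] (pull m T f) (\<lambda>y. \<Sum>(c, is)\<leftarrow>xs. pull c T (g is) y)"
   using weak_pds_pull[OF \<O> m, of "[i]"] by auto
  have "\<exists>C>0. \<forall>x\<in>X. int_version (\<lambda>y. \<Sum>a\<leftarrow>xs. (\<lambda>(c, is) (g, \<gamma>, N). pull c T (\<gamma> is)) a x y) \<and>
    Lp_norm p UNIV (\<lambda>y. \<Sum>a\<leftarrow>xs. (\<lambda>(c, is) (g, \<gamma>, N). pull c T (\<gamma> is)) a x y) \<le> ennreal C * (snd (snd x))"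
  proof (rule list_quasi_bound[where \<Phi> = "Lp_norm p UNIV"])
   fix a assume a: "a \<in> set xs"
   obtain c "is" where ci: "a = (c, is)" by force
   have c: "c \<in> test_functions W'" "length is \<le> 1" using xs a ci by auto
   obtain C where C: "C > 0" "\<And>g N. locally_integrable \<O> g \<Longrightarrow> Lp_norm p \<O> g \<le> N \<Longrightarrow> Lp_norm p UNIV (pull c T g) \<le> ennreal C * N"
    by (rule Lp_pull[OF \<O> c(1) p0]) (rule that, assumption, blast)
   have li: "locally_integrable \<O> (\<gamma> is)" if "(g, \<gamma>, N) \<in> X" for g \<gamma> N
    using that c(2) by (auto simp: X_def weak_pds_def)
   show "\<exists>C>0. \<forall>x\<in>X. int_version ((\<lambda>(c, is) (g, \<gamma>, N). pull c T (\<gamma> is)) a x) \<and>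
     Lp_norm p UNIV ((\<lambda>(c, is) (g, \<gamma>, N). pull c T (\<gamma> is)) a x) \<le> ennreal C * (snd (snd x))"
    using C(1) int_version_pull[OF \<O> c(1) li] c(2)
    by (intro exI[of _ C]) (auto simp: ci intro!: C(2) li, auto simp: X_def)
  next
   show "Lp_norm p UNIV (\<lambda>y. f y + g y) \<le> 4 * (Lp_norm p UNIV f + Lp_norm p UNIV g)"
    if "int_version f" "int_version g" for f g :: "real^'n \<Rightarrow> real"
    using that Lp_norm_quasi_add[OF open_UNIV p1] by (auto simp: int_version_def)
  qed (rule norms_zero)
  then obtain C where "C > 0" and C: "\<And>x. x \<in> X \<Longrightarrow> int_version (\<lambda>y. \<Sum>a\<leftarrow>xs. (\<lambda>(c, is) (g, \<gamma>, N). pull c T (\<gamma> is)) a x y) \<and>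
    Lp_norm p UNIV (\<lambda>y. \<Sum>a\<leftarrow>xs. (\<lambda>(c, is) (g, \<gamma>, N). pull c T (\<gamma> is)) a x y) \<le> ennreal C * (snd (snd x))"
   by blast
  show ?thesis
  proof (intro exI[of _ C] exI[of _ "\<lambda>\<gamma> y. \<Sum>(c, is)\<leftarrow>xs. pull c T (\<gamma> is) y"] conjI ballI)
   fix x assume x: "x \<in> X"
   obtain g \<gamma> N where gN: "x = (g, \<gamma>, N)" by (cases x) auto
   have "weak_pds UNIV [i] (pull m T g) (\<lambda>y. \<Sum>(c, is)\<leftarrow>xs. pull c T (\<gamma> is) y)"
    using x by (intro w) (auto simp: gN X_def)
   thus "case x of (g, \<gamma>, N) \<Rightarrow> weak_pds UNIV [i] (pull m T g) (\<lambda>y. \<Sum>(c, is)\<leftarrow>xs. pull c T (\<gamma> is) y) \<and>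
     int_version (\<lambda>y. \<Sum>(c, is)\<leftarrow>xs. pull c T (\<gamma> is) y) \<and>
     Lp_norm p UNIV (\<lambda>y. \<Sum>(c, is)\<leftarrow>xs. pull c T (\<gamma> is) y) \<le> ennreal C * N"
    using C[OF x] by (simp add: gN case_prod_beta')
  qed fact
 qed
 then obtain E C where EC: "\<And>i. C i > 0" "\<And>i g \<gamma> N. (g, \<gamma>, N) \<in> X \<Longrightarrow> weak_pds UNIV [i] (pull m T g) (E i \<gamma>) \<and> int_version (E i \<gamma>) \<and>
   Lp_norm p UNIV (E i \<gamma>) \<le> ennreal (C i) * N" by (metis (mono_tags, lifting) case_prodD)
 obtain B where B: "B > 0" "\<And>g N. locally_integrable \<O> g \<Longrightarrow> Lp_norm p \<O> g \<le> N \<Longrightarrow> Lp_norm p UNIV (pull m T g) \<le> ennreal B * N"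
  by (rule Lp_pull[OF \<O> m p0]) (rule that, assumption, blast)
 obtain A where A: "A > 0" "\<And>(h :: real^'n::finite \<Rightarrow> real) D N. int_version h \<Longrightarrow> (\<And>i. int_version (D i)) \<Longrightarrow>
  (\<And>i. weak_pds UNIV [i] h (D i)) \<Longrightarrow> Lp_norm p UNIV h \<le> N \<Longrightarrow> (\<And>i. Lp_norm p UNIV (D i) \<le> N) \<Longrightarrow>
  gagliardo \<theta> p UNIV h \<le> ennreal A * N"
  by (rule gagliardo_gradient[OF p \<theta>, where 'n = 'n]) (rule that, assumption, blast)
 define M where "M = B + (\<Sum>i\<in>UNIV. C i)"
 have Ci: "C i \<le> (\<Sum>i\<in>UNIV. C i)" for i
  by (intro member_le_sum) (auto simp: less_imp_le EC(1))
 have M: "M > 0" "B \<le> M" "C i \<le> M" for i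
  using B(1) EC(1) Ci[of i] by (auto simp: M_def sum_nonneg less_imp_le intro: add_pos_nonneg order_trans)
 show thesis
 proof (rule that[of "A * M"])
  fix g \<gamma> N
  assume g: "\<And>is. length is \<le> 1 \<Longrightarrow> weak_pds \<O> is g (\<gamma> is) \<and> Lp_norm p \<O> (\<gamma> is) \<le> N" and N: "Lp_norm p \<O> g \<le> N"
  have x: "(g, \<gamma>, N) \<in> X" using g N by (auto simp: X_def)
  have li: "locally_integrable \<O> g" using g[of "[]"] by (simp add: weak_pds_def)
  have "gagliardo \<theta> p UNIV (pull m T g) \<le> ennreal A * (ennreal M * N)"
  proof (rule A(2))
   show "int_version (pull m T g)" by (rule int_version_pull[OF \<O> m li])
   show "int_version (E i \<gamma>)" "weak_pds UNIV [i] (pull m T g) (E i \<gamma>)" for i using EC(2)[OF x] by auto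
   show "Lp_norm p UNIV (pull m T g) \<le> ennreal M * N"
    using B(2)[OF li N] by (rule order_trans) (intro mult_right_mono ennreal_leI M; simp)
   show "Lp_norm p UNIV (E i \<gamma>) \<le> ennreal M * N" for i
    using EC(2)[OF x, of i] by (elim conjE order_trans) (intro mult_right_mono ennreal_leI M; simp)
  qed
  thus "gagliardo \<theta> p UNIV (pull m T g) \<le> ennreal (A * M) * N"
   using A(1) M(1) by (simp add: ennreal_mult mult.assoc)
 qed (use A M in simp)
qed

text \<open>A derivative of order \<open>k\<close> of the pullback is a sum of pullbacks of derivatives
  \<open>G\<close> of \<open>f\<close> of order at most \<open>k\<close>.  Those of order \<open>k\<close> have
  finite Gagliardo norm; those of lower order have a weak gradient among the \<open>G\<close>.\<close>

theorem sob_pull_UNIV: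
 assumes \<O>: "open \<O>" "W \<subseteq> \<O>" and m: "m \<in> test_functions W'" and p: "p > 1"
 shows "\<exists>C>0. \<forall>f. sob_norm_fun s p \<O> f < \<infinity> \<longrightarrow> sob_norm_fun s p UNIV (pull m T f) \<le> ennreal C * sob_norm_fun s p \<O> f"
proof -
 define k where "k = nat \<lfloor>s\<rfloor>"
 define \<theta> where "\<theta> = s - of_int \<lfloor>s\<rfloor>"
 have \<theta>: "0 \<le> \<theta>" "\<theta> < 1" unfolding \<theta>_def by linarith+
 have p0: "p > 0" and p1: "p \<ge> 1" using p by auto
 define X where "X = {(f, G). weak_family s \<O> f G}"
 define N where "N = (\<lambda>(f, G :: ('n \<Rightarrow> nat) \<Rightarrow> real^'n \<Rightarrow> real). sob_norm_fun s p \<O> f)"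
 have fin: "finite {\<nu> :: 'n \<Rightarrow> nat. order_of \<nu> \<le> k}" by (rule finite_order_le)
 have Neq: "N (f, G) = (\<Sum>\<nu> | order_of \<nu> \<le> k. Lp_norm p \<O> (G \<nu>)) + (if \<theta> = 0 then 0 else \<Sum>\<nu> | order_of \<nu> = k. gagliardo \<theta> p \<O> (G \<nu>))"
  if "(f, G) \<in> X" for f G
  using that sob_norm_fun_eq[OF \<O>(1), of s f G p] by (simp add: X_def N_def k_def \<theta>_def)
 have NL: "Lp_norm p \<O> (G \<nu>) \<le> N (f, G)" if "(f, G) \<in> X" "order_of \<nu> \<le> k" for f G \<nu>
 proof -
  have "Lp_norm p \<O> (G \<nu>) \<le> (\<Sum>\<nu> | order_of \<nu> \<le> k. Lp_norm p \<O> (G \<nu>))"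
   using fin that by (intro member_le_sum) auto
  thus ?thesis unfolding Neq[OF that(1)] by (rule order_trans) simp
 qed
 have NG: "gagliardo \<theta> p \<O> (G \<nu>) \<le> N (f, G)" if "(f, G) \<in> X" "order_of \<nu> = k" "\<theta> \<noteq> 0" for f G \<nu>
 proof -
  have "gagliardo \<theta> p \<O> (G \<nu>) \<le> (\<Sum>\<nu> | order_of \<nu> = k. gagliardo \<theta> p \<O> (G \<nu>))"
  proof (rule member_le_sum)
   show "finite {\<nu> :: 'n \<Rightarrow> nat. order_of \<nu> = k}" by (rule finite_subset[OF _ fin]) auto
  qed (use that in auto)
  thus ?thesis unfolding Neq[OF that(1)] using that(3) by (simp add: add_increasing)
 qed
 have wX: "weak_pds \<O> is f (G (count_list is))" if "(f, G) \<in> X" "length is \<le> k" for f G "is"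
  using that unfolding X_def weak_family_def weak_pds_iff by (auto simp: length_eq_order_of k_def)
 have "\<exists>D C. C > 0 \<and> (\<forall>(f, G)\<in>X. weak_pds UNIV js (pull m T f) (D G) \<and> Lp_norm p UNIV (D G) \<le> ennreal C * N (f, G) \<and>
   (length js = k \<and> \<theta> \<noteq> 0 \<longrightarrow> gagliardo \<theta> p UNIV (D G) \<le> ennreal C * N (f, G)))" if js: "length js \<le> k" for js
 proof -
  obtain xs where xs: "\<And>c is. (c, is) \<in> set xs \<Longrightarrow> c \<in> test_functions W' \<and> length is \<le> length js"
   and w: "\<And>f g. (\<forall>is. length is \<le> length js \<longrightarrow> weak_pds \<O> is f (g is)) \<Longrightarrow>
    weak_pds UNIV js (pull m T f) (\<lambda>y. \<Sum>(c, is)\<leftarrow>xs. pull c T (g is) y)"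
   using weak_pds_pull[OF \<O> m, of js] by fast
  define h where "h = (\<lambda>(c, is :: 'n list) (f :: real^'n \<Rightarrow> real, G). pull c T (G (count_list is)))"
  define D where "D G y = (\<Sum>(c, is)\<leftarrow>xs. pull c T (G (count_list is)) y)" for G y
  let ?S = "\<lambda>x y. \<Sum>a\<leftarrow>xs. h a x y"
  have Dh: "(\<lambda>y. \<Sum>a\<leftarrow>xs. h a (f, G) y) = D G" for f G
   by (simp add: D_def h_def case_prod_beta' fun_eq_iff)
  have li: "locally_integrable \<O> (G (count_list is))" if "(f, G) \<in> X" "length is \<le> k" for f G "is"
   using wX[OF that] by (simp add: weak_pds_def)
  have iv: "int_version (h (c, is) x)" if "(c, is) \<in> set xs" "x \<in> X" for c "is" x
   using xs[OF that(1)] that(2) js by (cases x) (auto simp: h_def intro!: int_version_pull[OF \<O>] li)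
  have L: "\<exists>C>0. \<forall>x\<in>X. int_version (?S x) \<and> Lp_norm p UNIV (?S x) \<le> ennreal C * N x"
  proof (rule list_quasi_bound[where \<Phi> = "Lp_norm p UNIV"])
   fix a assume a: "a \<in> set xs"
   obtain c "is" where ci: "a = (c, is)" by force
   have c: "c \<in> test_functions W'" "length is \<le> k" using xs[of c "is"] a ci js by auto
   obtain C where C: "C > 0" "\<And>g N. locally_integrable \<O> g \<Longrightarrow> Lp_norm p \<O> g \<le> N \<Longrightarrow> Lp_norm p UNIV (pull c T g) \<le> ennreal C * N"
    by (rule Lp_pull[OF \<O> c(1) p0]) (rule that, assumption, blast)
   show "\<exists>C>0. \<forall>x\<in>X. int_version (h a x) \<and> Lp_norm p UNIV (h a x) \<le> ennreal C * N x"
   proof (intro exI[of _ C] conjI ballI C(1))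
    fix x assume x: "x \<in> X"
    obtain f G where fG: "x = (f, G)" by force
    show "int_version (h a x)" using iv a ci x by blast
    show "Lp_norm p UNIV (h a x) \<le> ennreal C * N x"
     using x c(2) unfolding ci fG h_def prod.case by (intro C(2) li NL) (auto simp: length_eq_order_of)
   qed
  next
   show "Lp_norm p UNIV (\<lambda>y. f y + g y) \<le> 4 * (Lp_norm p UNIV f + Lp_norm p UNIV g)"
    if "int_version f" "int_version g" for f g :: "real^'n \<Rightarrow> real"
    using that Lp_norm_quasi_add[OF open_UNIV p1] by (auto simp: int_version_def)
  qed (rule norms_zero)
  have Gg: "\<exists>C>0. \<forall>x\<in>X. int_version (?S x) \<and> gagliardo \<theta> p UNIV (?S x) \<le> ennreal C * N x"
   if jk: "length js = k" and t0: "\<theta> \<noteq> 0"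
  proof (rule list_quasi_bound[where \<Phi> = "gagliardo \<theta> p UNIV"])
   have \<theta>': "0 < \<theta>" using \<theta> t0 by simp
   fix a assume a: "a \<in> set xs"
   obtain c "is" where ci: "a = (c, is)" by force
   have c: "c \<in> test_functions W'" "length is \<le> k" using xs[of c "is"] a ci js by auto
   show "\<exists>C>0. \<forall>x\<in>X. int_version (h a x) \<and> gagliardo \<theta> p UNIV (h a x) \<le> ennreal C * N x"
   proof (cases "length is = k")
    case True
    obtain C where C: "C > 0" "\<And>g N. locally_integrable \<O> g \<Longrightarrow> Lp_norm p \<O> g \<le> N \<Longrightarrow> gagliardo \<theta> p \<O> g \<le> N \<Longrightarrow>
      gagliardo \<theta> p UNIV (pull c T g) \<le> ennreal C * N"
     by (rule gagliardo_pull[OF \<O> c(1) p \<theta>' \<theta>(2)]) (rule that, assumption, blast)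
    show ?thesis
    proof (intro exI[of _ C] conjI ballI C(1))
     fix x assume x: "x \<in> X"
     obtain f G where fG: "x = (f, G)" by force
     show "int_version (h a x)" using iv a ci x by blast
     show "gagliardo \<theta> p UNIV (h a x) \<le> ennreal C * N x"
      using x c(2) True t0 unfolding ci fG h_def prod.case by (intro C(2) li NL NG) (auto simp: length_eq_order_of)
    qed
   next
    case False
    hence lt: "length is < k" using c(2) by simp
    obtain C where C: "C > 0" "\<And>g \<gamma> N. (\<And>is. length is \<le> 1 \<Longrightarrow> weak_pds \<O> is g (\<gamma> is) \<and> Lp_norm p \<O> (\<gamma> is) \<le> N) \<Longrightarrow>
      Lp_norm p \<O> g \<le> N \<Longrightarrow> gagliardo \<theta> p UNIV (pull c T g) \<le> ennreal C * N"
     by (rule gagliardo_pull_lower_order[OF \<O> c(1) p \<theta>' \<theta>(2)]) (rule that, assumption, blast)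
    show ?thesis
    proof (intro exI[of _ C] conjI ballI C(1))
     fix x assume x: "x \<in> X"
     obtain f G where fG: "x = (f, G)" by force
     show "int_version (h a x)" using iv a ci x by blast
     have fGX: "(f, G) \<in> X" using x fG by simp
     show "gagliardo \<theta> p UNIV (h a x) \<le> ennreal C * N x"
      unfolding ci fG h_def prod.case
     proof (rule C(2)[where \<gamma> = "\<lambda>is'. G (count_list (is @ is'))"])
      fix is' :: "'n list" assume l: "length is' \<le> 1"
      hence l': "length (is @ is') \<le> k" using lt by simp
      show "weak_pds \<O> is' (G (count_list is)) (G (count_list (is @ is'))) \<and> Lp_norm p \<O> (G (count_list (is @ is'))) \<le> N (f, G)"
       using weak_pds_shift[OF wX[OF fGX c(2)] wX[OF fGX l']] NL[OF fGX] l' by (simp add: length_eq_order_of del: count_list_append)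
     next
      show "Lp_norm p \<O> (G (count_list is)) \<le> N (f, G)"
       using NL[OF fGX] c(2) by (simp add: length_eq_order_of)
     qed
    qed
   qed
  next
   show "gagliardo \<theta> p UNIV (\<lambda>y. f y + g y) \<le> 4 * (gagliardo \<theta> p UNIV f + gagliardo \<theta> p UNIV g)"
    if "int_version f" "int_version g" for f g :: "real^'n \<Rightarrow> real"
    using that gagliardo_quasi_add[OF open_UNIV p1] by (auto simp: int_version_def)
  qed (rule norms_zero)
  obtain C1 where C1: "C1 > 0" "\<And>f G. (f, G) \<in> X \<Longrightarrow> Lp_norm p UNIV (D G) \<le> ennreal C1 * N (f, G)"
  proof -
   obtain C where C: "C > 0" "\<forall>x\<in>X. int_version (?S x) \<and> Lp_norm p UNIV (?S x) \<le> ennreal C * N x"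
    using L by (elim exE conjE)
   have "Lp_norm p UNIV (D G) \<le> ennreal C * N (f, G)" if "(f, G) \<in> X" for f G
    using bspec[OF C(2) that] by (simp only: Dh)
   with C(1) show thesis by (rule that)
  qed
  obtain C2 where C2: "C2 > 0" "\<And>f G. length js = k \<Longrightarrow> \<theta> \<noteq> 0 \<Longrightarrow> (f, G) \<in> X \<Longrightarrow> gagliardo \<theta> p UNIV (D G) \<le> ennreal C2 * N (f, G)"
  proof (cases "length js = k \<and> \<theta> \<noteq> 0")
   case True
   obtain C where C: "C > 0" "\<forall>x\<in>X. int_version (?S x) \<and> gagliardo \<theta> p UNIV (?S x) \<le> ennreal C * N x"
    using Gg True by (elim exE conjE) blast
   have "gagliardo \<theta> p UNIV (D G) \<le> ennreal C * N (f, G)" if "(f, G) \<in> X" for f G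
    using bspec[OF C(2) that] by (simp only: Dh)
   with C(1) show thesis using that by simp
  next
   case False
   thus thesis using that[of 1] by auto
  qed
  show ?thesis
  proof (intro exI[of _ D] exI[of _ "max C1 C2"] conjI ballI)
   show "max C1 C2 > 0" using C1(1) by (simp add: less_max_iff_disj)
   fix x assume x: "x \<in> X"
   obtain f G where fG: "x = (f, G)" by force
   have 1: "weak_pds UNIV js (pull m T f) (D G)"
    unfolding D_def using wX[of f G] x js by (intro w) (auto simp: fG)
   have 2: "ennreal C1 * N (f, G) \<le> ennreal (max C1 C2) * N (f, G)" "ennreal C2 * N (f, G) \<le> ennreal (max C1 C2) * N (f, G)"
    by (intro mult_right_mono ennreal_leI; simp)+
   show "case x of (f, G) \<Rightarrow> weak_pds UNIV js (pull m T f) (D G) \<and> Lp_norm p UNIV (D G) \<le> ennreal (max C1 C2) * N (f, G) \<and>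
     (length js = k \<and> \<theta> \<noteq> 0 \<longrightarrow> gagliardo \<theta> p UNIV (D G) \<le> ennreal (max C1 C2) * N (f, G))"
    using 1 order_trans[OF C1(2) 2(1)] order_trans[OF C2(2) 2(2)] x by (simp add: fG)
  qed
 qed
 hence "\<forall>js. \<exists>D C. length js \<le> k \<longrightarrow> C > 0 \<and> (\<forall>(f, G)\<in>X. weak_pds UNIV js (pull m T f) (D G) \<and> Lp_norm p UNIV (D G) \<le> ennreal C * N (f, G) \<and>
   (length js = k \<and> \<theta> \<noteq> 0 \<longrightarrow> gagliardo \<theta> p UNIV (D G) \<le> ennreal C * N (f, G)))" by blast
 then obtain D C where DC: "\<And>js. length js \<le> k \<Longrightarrow> C js > 0 \<and> (\<forall>(f, G)\<in>X. weak_pds UNIV js (pull m T f) (D js G) \<and> Lp_norm p UNIV (D js G) \<le> ennreal (C js) * N (f, G) \<and>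
   (length js = k \<and> \<theta> \<noteq> 0 \<longrightarrow> gagliardo \<theta> p UNIV (D js G) \<le> ennreal (C js) * N (f, G)))"
  unfolding choice_iff by blast
 have S1: "\<exists>B>0. \<forall>x\<in>X. (\<Sum>\<nu> | order_of \<nu> \<le> k. Lp_norm p UNIV (D (list_of \<nu>) (snd x))) \<le> ennreal B * N x"
 proof (rule sum_bound)
  fix \<nu> :: "'n \<Rightarrow> nat" assume "\<nu> \<in> {\<nu>. order_of \<nu> \<le> k}"
  hence "length (list_of \<nu>) \<le> k" by (simp add: length_list_of)
  from DC[OF this] show "\<exists>C>0. \<forall>x\<in>X. Lp_norm p UNIV (D (list_of \<nu>) (snd x)) \<le> ennreal C * N x"
   by (intro exI[of _ "C (list_of \<nu>)"]) auto
 qed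
 have S2: "\<exists>B>0. \<forall>x\<in>X. (\<Sum>\<nu> | order_of \<nu> = k. gagliardo \<theta> p UNIV (D (list_of \<nu>) (snd x))) \<le> ennreal B * N x"
  if t0: "\<theta> \<noteq> 0"
 proof (rule sum_bound)
  fix \<nu> :: "'n \<Rightarrow> nat" assume "\<nu> \<in> {\<nu>. order_of \<nu> = k}"
  hence l: "length (list_of \<nu>) \<le> k" "length (list_of \<nu>) = k" by (simp_all add: length_list_of)
  from DC[OF l(1)] l(2) t0 show "\<exists>C>0. \<forall>x\<in>X. gagliardo \<theta> p UNIV (D (list_of \<nu>) (snd x)) \<le> ennreal C * N x"
   by (intro exI[of _ "C (list_of \<nu>)"]) auto
 qed
 obtain B1 where B1: "B1 > 0" "\<And>x. x \<in> X \<Longrightarrow> (\<Sum>\<nu> | order_of \<nu> \<le> k. Lp_norm p UNIV (D (list_of \<nu>) (snd x))) \<le> ennreal B1 * N x"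
  using S1 by blast
 obtain B2 where B2: "B2 > 0" "\<And>x. \<theta> \<noteq> 0 \<Longrightarrow> x \<in> X \<Longrightarrow> (\<Sum>\<nu> | order_of \<nu> = k. gagliardo \<theta> p UNIV (D (list_of \<nu>) (snd x))) \<le> ennreal B2 * N x"
 proof (cases "\<theta> = 0")
  case False
  thus thesis using S2 that by blast
 qed (use that[of 1] in auto)
 show ?thesis
 proof (intro exI[of _ "B1 + B2"] conjI allI impI)
  show "B1 + B2 > 0" using B1(1) B2(1) by simp
  fix f assume "sob_norm_fun s p \<O> f < \<infinity>"
  then obtain G where G: "weak_family s \<O> f G" using sob_norm_fun_weak_derivs by blast
  hence x: "(f, G) \<in> X" by (simp add: X_def)
  have wf: "weak_family s UNIV (pull m T f) (\<lambda>\<nu>. D (list_of \<nu>) G)"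
  proof (rule weak_familyI)
   fix \<nu> :: "'n \<Rightarrow> nat" assume "order_of \<nu> \<le> nat \<lfloor>s\<rfloor>"
   hence "length (list_of \<nu>) \<le> k" by (simp add: length_list_of k_def)
   from DC[OF this] x show "weak_pds UNIV (list_of \<nu>) (pull m T f) (D (list_of \<nu>) G)" by auto
  qed
  have "sob_norm_fun s p UNIV (pull m T f) = (\<Sum>\<nu> | order_of \<nu> \<le> k. Lp_norm p UNIV (D (list_of \<nu>) G)) +
    (if \<theta> = 0 then 0 else \<Sum>\<nu> | order_of \<nu> = k. gagliardo \<theta> p UNIV (D (list_of \<nu>) G))"
   using sob_norm_fun_eq[OF open_UNIV wf] by (simp add: k_def \<theta>_def)
  also have "\<dots> \<le> ennreal B1 * N (f, G) + ennreal B2 * N (f, G)"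
   using B1(2)[OF x] B2(2)[OF _ x] by (intro add_mono) auto
  also have "\<dots> = ennreal (B1 + B2) * sob_norm_fun s p \<O> f"
   using B1(1) B2(1) by (simp add: N_def ennreal_plus distrib_right)
  finally show "sob_norm_fun s p UNIV (pull m T f) \<le> ennreal (B1 + B2) * sob_norm_fun s p \<O> f" .
 qed
qed

theorem sob_pull:
 assumes \<O>: "open \<O>" "W \<subseteq> \<O>" and m: "m \<in> test_functions W'" and p: "p > 1" and \<O>': "open \<O>'"
 obtains C where "C > 0" "\<And>f. f \<in> sob_fun_space s p \<O> \<Longrightarrow> pull m T f \<in> sob_fun_space s p \<O>'"
  "\<And>f. f \<in> sob_fun_space s p \<O> \<Longrightarrow> sob_norm_fun s p \<O>' (pull m T f) \<le> ennreal C * sob_norm_fun s p \<O> f"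
proof -
 have p0: "p > 0" using p by simp
 obtain C where C: "C > 0" "\<And>f. sob_norm_fun s p \<O> f < \<infinity> \<Longrightarrow> sob_norm_fun s p UNIV (pull m T f) \<le> ennreal C * sob_norm_fun s p \<O> f"
  using sob_pull_UNIV[OF \<O> m p] by blast
 have le: "sob_norm_fun s p \<O>' (pull m T f) \<le> ennreal C * sob_norm_fun s p \<O> f" if f: "f \<in> sob_fun_space s p \<O>" for f
  using order_trans[OF sob_norm_fun_restrict[OF open_UNIV \<O>' subset_UNIV p0] C(2)] f by (simp add: sob_fun_space_def)
 show thesis
 proof (rule that[OF C(1) _ le])
  fix f assume f: "f \<in> sob_fun_space s p \<O>"
  obtain v where v: "version_on \<O> f v" using version_exists[OF \<O>(1)] f by (auto simp: sob_fun_space_def)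
  show "pull m T f \<in> sob_fun_space s p \<O>'"
  proof (rule sob_fun_spaceI[OF \<O>'])
   show "pull m T f \<in> borel_measurable (lebesgue_on \<O>')"
    by (rule version_measurable[OF \<O>' version_mono[OF version_pull[OF \<O>(2) m v] subset_UNIV]])
   show "sob_norm_fun s p \<O>' (pull m T f) < \<infinity>"
    using le[OF f] f by (auto simp: sob_fun_space_def ennreal_mult_less_top intro: le_less_trans)
  qed
 qed
qed

end

section \<open>Sobolev norms of distributions\<close>

lemma INF_cmult_le:
 fixes f :: "'a \<Rightarrow> ennreal"
 assumes c: "c > 0" and le: "\<And>a. a \<in> A \<Longrightarrow> x \<le> ennreal c * f a"
 shows "x \<le> ennreal c * (INF a\<in>A. f a)"
proof -
 have 1: "ennreal c * ennreal (1 / c) = 1" using c by (simp add: ennreal_mult[symmetric])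
 have "ennreal (1 / c) * x \<le> f a" if "a \<in> A" for a
 proof -
  have "ennreal (1 / c) * x \<le> ennreal (1 / c) * (ennreal c * f a)" by (intro mult_left_mono le that) auto
  thus ?thesis using 1 by (simp add: mult.assoc[symmetric] mult.commute)
 qed
 hence "ennreal (1 / c) * x \<le> (INF a\<in>A. f a)" by (rule INF_greatest)
 hence "ennreal c * (ennreal (1 / c) * x) \<le> ennreal c * (INF a\<in>A. f a)" by (rule mult_left_mono) simp
 thus ?thesis using 1 by (simp add: mult.assoc[symmetric])
qed

lemma INF_const_add_le: "(INF a\<in>A. c + f a) \<le> c + (INF a\<in>A. f a)" for f :: "'a \<Rightarrow> ennreal"
proof (cases "c = top")
 case False
 have "(INF a\<in>A. c + f a) - c \<le> f b" if "b \<in> A" for b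
  using INF_lower[OF that, of "\<lambda>a. c + f a"] False by (simp add: ennreal_minus_le_iff)
 hence "(INF a\<in>A. c + f a) - c \<le> (INF a\<in>A. f a)" by (rule INF_greatest)
 thus ?thesis using False by (simp add: ennreal_minus_le_iff)
qed simp

lemma INF_add_le:
 fixes f :: "'a \<Rightarrow> ennreal" and g :: "'b \<Rightarrow> ennreal"
 assumes c: "c > 0" and le: "\<And>a b. a \<in> A \<Longrightarrow> b \<in> B \<Longrightarrow> x \<le> ennreal c * (f a + g b)"
 shows "x \<le> ennreal c * ((INF a\<in>A. f a) + (INF b\<in>B. g b))"
proof -
 have "x \<le> ennreal c * (f a + (INF b\<in>B. g b))" if a: "a \<in> A" for a
 proof -
  have "x \<le> ennreal c * (INF b\<in>B. f a + g b)" by (rule INF_cmult_le[OF c le[OF a]])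
  also have "\<dots> \<le> ennreal c * (f a + (INF b\<in>B. g b))" by (intro mult_left_mono INF_const_add_le) auto
  finally show ?thesis .
 qed
 hence "x \<le> ennreal c * (INF a\<in>A. (INF b\<in>B. g b) + f a)"
  by (intro INF_cmult_le[OF c]) (simp add: add.commute)
 also have "\<dots> \<le> ennreal c * ((INF b\<in>B. g b) + (INF a\<in>A. f a))"
  by (intro mult_left_mono INF_const_add_le) auto
 finally show ?thesis by (simp add: add.commute)
qed

text \<open>The dual norm is a supremum over the unit ball, into which \<open>f\<close> is scaled.\<close>

lemma sob0_dual_norm_le:
 fixes \<O> :: "(real^'n::finite) set"
 assumes \<O>: "open \<O>" and p: "p > 0" and L: "L \<in> sob0_dual s p \<O>" and c: "c > 0"
  and f: "f \<in> sob_fun_space0 s p \<O>" "sob_norm_fun s p \<O> f \<le> ennreal c"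
  and fc: "(\<lambda>x. (1 / c) * f x) \<in> sob_fun_space0 s p \<O>"
 shows "ennreal \<bar>L f\<bar> \<le> ennreal c * sob0_dual_norm s p \<O> L"
proof -
 have lin: "linear_functional_on (sob_fun_space0 s p \<O>) L" using L by (simp add: sob0_dual_def)
 have "sob_norm_fun s p \<O> f < \<infinity>" using f(1) by (simp add: sob_fun_space0_def sob_fun_space_def)
 hence "sob_norm_fun s p \<O> (\<lambda>x. (1 / c) * f x) = ennreal (1 / c) * sob_norm_fun s p \<O> f"
  using c by (intro sob_norm_fun_cmult[OF \<O> p]) auto
 also have "\<dots> \<le> ennreal (1 / c) * ennreal c" by (intro mult_left_mono f(2)) auto
 also have "\<dots> = 1" using c by (simp add: ennreal_mult[symmetric])
 finally have 1: "ennreal \<bar>L (\<lambda>x. (1 / c) * f x)\<bar> \<le> sob0_dual_norm s p \<O> L"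
  unfolding sob0_dual_norm_def using fc by (intro SUP_upper) auto
 have "L (\<lambda>x. (1 / c) * f x + 0 * f x) = (1 / c) * L f + 0 * L f"
  using lin f(1) unfolding linear_functional_on_def by blast
 hence "\<bar>L f\<bar> = c * \<bar>L (\<lambda>x. (1 / c) * f x)\<bar>" using c by (simp add: abs_mult)
 hence "ennreal \<bar>L f\<bar> = ennreal c * ennreal \<bar>L (\<lambda>x. (1 / c) * f x)\<bar>" using c by (simp add: ennreal_mult)
 also have "\<dots> \<le> ennreal c * sob0_dual_norm s p \<O> L" by (intro mult_left_mono 1) auto
 finally show ?thesis .
qed

text \<open>Approximating test functions are mapped to approximating test functions.\<close>

lemma (in diffeo) sob_pull0:
 assumes \<O>: "open \<O>" "W \<subseteq> \<O>" and m: "m \<in> test_functions W'" and p: "p > 1" and \<O>': "open \<O>'" "W' \<subseteq> \<O>'"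
  and f: "f \<in> sob_fun_space0 s p \<O>"
 shows "pull m T f \<in> sob_fun_space0 s p \<O>'"
proof -
 obtain C where C: "C > 0" "\<And>f. f \<in> sob_fun_space s p \<O> \<Longrightarrow> pull m T f \<in> sob_fun_space s p \<O>'"
  "\<And>f. f \<in> sob_fun_space s p \<O> \<Longrightarrow> sob_norm_fun s p \<O>' (pull m T f) \<le> ennreal C * sob_norm_fun s p \<O> f"
  using sob_pull[OF \<O> m p \<O>'(1), of s] by metis
 have fs: "f \<in> sob_fun_space s p \<O>" using f by (simp add: sob_fun_space0_def)
 have "\<exists>\<zeta>\<in>test_functions \<O>'. sob_norm_fun s p \<O>' (\<lambda>x. pull m T f x - \<zeta> x) < \<epsilon>" if \<epsilon>: "\<epsilon> > 0" for \<epsilon>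
 proof -
  obtain r where r: "r > 0" "ennreal r \<le> \<epsilon>"
  proof (cases \<epsilon>)
   case (real r)
   thus thesis using that[of r] \<epsilon> by auto
  qed (use that[of 1] in auto)
  have "ennreal (r / C) > 0" using r C by simp
  moreover have "\<forall>\<epsilon>>0. \<exists>\<eta>\<in>test_functions \<O>. sob_norm_fun s p \<O> (\<lambda>x. f x - \<eta> x) < \<epsilon>"
   using f unfolding sob_fun_space0_def by blast
  ultimately obtain \<eta> where \<eta>: "\<eta> \<in> test_functions \<O>" "sob_norm_fun s p \<O> (\<lambda>x. f x - \<eta> x) < ennreal (r / C)"
   by blast
  have d: "(\<lambda>x. f x - \<eta> x) \<in> sob_fun_space s p \<O>"
  proof (rule sob_fun_spaceI[OF \<O>(1)])
   obtain v where v: "version_on \<O> f v" using version_exists[OF \<O>(1)] fs by (auto simp: sob_fun_space_def)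
   have "version_on \<O> (\<lambda>x. f x + (-1) * \<eta> x) (\<lambda>x. v x + (-1) * \<eta> x)"
    by (intro version_add v version_cmult version_self_test[OF \<eta>(1)])
   from version_measurable[OF \<O>(1) this] show "(\<lambda>x. f x - \<eta> x) \<in> borel_measurable (lebesgue_on \<O>)" by simp
   show "sob_norm_fun s p \<O> (\<lambda>x. f x - \<eta> x) < \<infinity>" using \<eta>(2) by (rule less_trans) simp
  qed
  have "sob_norm_fun s p \<O>' (\<lambda>x. pull m T f x - pull m T \<eta> x) = sob_norm_fun s p \<O>' (pull m T (\<lambda>x. f x - \<eta> x))"
   by (simp add: pull_def right_diff_distrib)
  also have "\<dots> \<le> ennreal C * sob_norm_fun s p \<O> (\<lambda>x. f x - \<eta> x)" by (rule C(3)[OF d])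
  also have "\<dots> < ennreal C * ennreal (r / C)"
   using C(1) \<eta>(2) by (intro ennreal_mult_strict_left_mono) auto
  also have "\<dots> = ennreal r" using C(1) r(1) by (simp add: ennreal_mult[symmetric])
  finally have "sob_norm_fun s p \<O>' (\<lambda>x. pull m T f x - pull m T \<eta> x) < \<epsilon>" using r(2) by (rule less_le_trans)
  moreover have "pull m T \<eta> \<in> test_functions \<O>'"
   by (rule test_functions_mono[OF test_pull[OF m test_functions_smooth[OF \<eta>(1)]] \<O>'(2)])
  ultimately show ?thesis by blast
 qed
 thus ?thesis using C(2)[OF fs] by (simp add: sob_fun_space0_def)
qed

text \<open>For \<open>e < 0\<close> the transported distribution is the composition of a functional with the weighted
  pullback; for \<open>e \<ge> 0\<close> it is the function obtained by the adjoint weighted pullback.\<close>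

theorem (in diffeo) sob_norm_pull:
 fixes e q :: real
 assumes \<O>1: "open \<O>1" "W' \<subseteq> \<O>1" and \<O>2: "open \<O>2" "W \<subseteq> \<O>2" and m: "m \<in> test_functions W'" and q: "q > 1"
 shows "\<exists>C>0. \<forall>F. sob_norm e q \<O>2 (\<lambda>\<eta>. F (pull m T \<eta>)) \<le> ennreal C * sob_norm e q \<O>1 F"
proof (cases "e \<ge> 0")
 case True
 interpret R: diffeo W W' S T by (rule diffeo_sym)
 obtain C where C: "C > 0" "\<And>f. f \<in> sob_fun_space e q \<O>1 \<Longrightarrow> pull (adj m) S f \<in> sob_fun_space e q \<O>2"
  "\<And>f. f \<in> sob_fun_space e q \<O>1 \<Longrightarrow> sob_norm_fun e q \<O>2 (pull (adj m) S f) \<le> ennreal C * sob_norm_fun e q \<O>1 f"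
  using R.sob_pull[OF \<O>1 test_adj[OF m] q \<O>2(1), of e] by metis
 show ?thesis
 proof (intro exI[of _ C] conjI allI C(1))
  fix F :: "(real^'n \<Rightarrow> real) \<Rightarrow> real"
  let ?A = "{f \<in> sob_fun_space e q \<O>1. \<forall>\<eta>\<in>test_functions \<O>1. F \<eta> = regular_dist \<O>1 f \<eta>}"
  let ?B = "{f \<in> sob_fun_space e q \<O>2. \<forall>\<eta>\<in>test_functions \<O>2. F (pull m T \<eta>) = regular_dist \<O>2 f \<eta>}"
  have "(INF f\<in>?B. sob_norm_fun e q \<O>2 f) \<le> ennreal C * sob_norm_fun e q \<O>1 f" if f: "f \<in> ?A" for f
  proof -
   have fs: "f \<in> sob_fun_space e q \<O>1" using f by simp
   obtain v where v: "version_on \<O>1 f v" using version_exists[OF \<O>1(1)] fs by (auto simp: sob_fun_space_def)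
   have vm: "v \<in> borel_measurable borel" using v by (simp add: version_on_def)
   have "F (pull m T \<eta>) = regular_dist \<O>2 (pull (adj m) S f) \<eta>" if \<eta>: "\<eta> \<in> test_functions \<O>2" for \<eta>
   proof -
    have p: "pull m T \<eta> \<in> test_functions \<O>1"
     by (rule test_functions_mono[OF test_pull[OF m test_functions_smooth[OF \<eta>]] \<O>1(2)])
    have "F (pull m T \<eta>) = regular_dist \<O>1 f (pull m T \<eta>)" using f p by blast
    also have "\<dots> = (LBINT y. pull m T \<eta> y * v y)"
     by (simp add: regular_dist_version[OF \<O>1(1) v p] mult.commute)
    also have "\<dots> = (LBINT x. \<eta> x * pull (adj m) S v x)"
     by (rule pull_adjoint[OF m borel_test_function[OF \<eta>] vm])
    also have "\<dots> = regular_dist \<O>2 (pull (adj m) S f) \<eta>"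
     by (simp add: mult.commute regular_dist_version[OF \<O>2(1) version_mono[OF R.version_pull[OF \<O>1(2) test_adj[OF m] v] subset_UNIV] \<eta>])
    finally show ?thesis .
   qed
   hence "pull (adj m) S f \<in> ?B" using C(2)[OF fs] by blast
   hence "(INF f\<in>?B. sob_norm_fun e q \<O>2 f) \<le> sob_norm_fun e q \<O>2 (pull (adj m) S f)" by (rule INF_lower)
   also have "\<dots> \<le> ennreal C * sob_norm_fun e q \<O>1 f" by (rule C(3)[OF fs])
   finally show ?thesis .
  qed
  hence "(INF f\<in>?B. sob_norm_fun e q \<O>2 f) \<le> ennreal C * (INF f\<in>?A. sob_norm_fun e q \<O>1 f)"
   by (rule INF_cmult_le[OF C(1)])
  thus "sob_norm e q \<O>2 (\<lambda>\<eta>. F (pull m T \<eta>)) \<le> ennreal C * sob_norm e q \<O>1 F"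
   using True by (simp add: sob_norm_def)
 qed
next
 case False
 define p where "p = q / (q - 1)"
 have p: "p > 1" "p > 0" using q by (simp_all add: p_def)
 obtain C where C: "C > 0" "\<And>f. f \<in> sob_fun_space (- e) p \<O>2 \<Longrightarrow> pull m T f \<in> sob_fun_space (- e) p \<O>1"
  "\<And>f. f \<in> sob_fun_space (- e) p \<O>2 \<Longrightarrow> sob_norm_fun (- e) p \<O>1 (pull m T f) \<le> ennreal C * sob_norm_fun (- e) p \<O>2 f"
  using sob_pull[OF \<O>2 m p(1) \<O>1(1), of "- e"] by metis
 have P0: "pull m' T f \<in> sob_fun_space0 (- e) p \<O>1" if "f \<in> sob_fun_space0 (- e) p \<O>2" "m' \<in> test_functions W'" for f m'
  by (rule sob_pull0[OF \<O>2 that(2) p(1) \<O>1 that(1)])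
 show ?thesis
 proof (intro exI[of _ C] conjI allI C(1))
  fix F :: "(real^'n \<Rightarrow> real) \<Rightarrow> real"
  let ?A = "{L \<in> sob0_dual (- e) p \<O>1. \<forall>\<eta>\<in>test_functions \<O>1. F \<eta> = L \<eta>}"
  let ?B = "{L \<in> sob0_dual (- e) p \<O>2. \<forall>\<eta>\<in>test_functions \<O>2. F (pull m T \<eta>) = L \<eta>}"
  have "(INF L\<in>?B. sob0_dual_norm (- e) p \<O>2 L) \<le> ennreal C * sob0_dual_norm (- e) p \<O>1 L" if L: "L \<in> ?A" for L
  proof -
   have Ld: "L \<in> sob0_dual (- e) p \<O>1" using L by simp
   define L' where "L' f = L (pull m T f)" for f
   have le: "sob0_dual_norm (- e) p \<O>2 L' \<le> ennreal C * sob0_dual_norm (- e) p \<O>1 L"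
    unfolding sob0_dual_norm_def[of "- e" p \<O>2]
   proof (rule SUP_least)
    fix f assume "f \<in> {f \<in> sob_fun_space0 (- e) p \<O>2. sob_norm_fun (- e) p \<O>2 f \<le> 1}"
    hence f: "f \<in> sob_fun_space0 (- e) p \<O>2" "sob_norm_fun (- e) p \<O>2 f \<le> 1" by auto
    show "ennreal \<bar>L' f\<bar> \<le> ennreal C * sob0_dual_norm (- e) p \<O>1 L"
     unfolding L'_def
    proof (rule sob0_dual_norm_le[OF \<O>1(1) p(2) Ld C(1) P0[OF f(1) m]])
     have "sob_norm_fun (- e) p \<O>1 (pull m T f) \<le> ennreal C * sob_norm_fun (- e) p \<O>2 f"
      using f(1) by (intro C(3)) (simp add: sob_fun_space0_def)
     also have "\<dots> \<le> ennreal C * 1" by (intro mult_left_mono f(2)) auto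
     finally show "sob_norm_fun (- e) p \<O>1 (pull m T f) \<le> ennreal C" by simp
     have "(\<lambda>x. 1 / C * pull m T f x) = pull (\<lambda>x. (1 / C) * m x) T f" by (simp add: pull_def)
     also have "\<dots> \<in> sob_fun_space0 (- e) p \<O>1" by (rule P0[OF f(1) test_functions_cmult[OF m]])
     finally show "(\<lambda>x. 1 / C * pull m T f x) \<in> sob_fun_space0 (- e) p \<O>1" .
    qed
   qed
   have "linear_functional_on (sob_fun_space0 (- e) p \<O>2) L'"
    unfolding linear_functional_on_def
   proof (intro ballI allI)
    fix f g a b assume fg: "f \<in> sob_fun_space0 (- e) p \<O>2" "g \<in> sob_fun_space0 (- e) p \<O>2"
    have "pull m T (\<lambda>x. a * f x + b * g x) = (\<lambda>x. a * pull m T f x + b * pull m T g x)"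
     by (simp add: pull_def algebra_simps)
    thus "L' (\<lambda>x. a * f x + b * g x) = a * L' f + b * L' g"
     using Ld P0[OF fg(1) m] P0[OF fg(2) m] by (simp add: L'_def sob0_dual_def linear_functional_on_def)
   qed
   moreover have "sob0_dual_norm (- e) p \<O>2 L' < \<infinity>"
    using le Ld by (auto simp: sob0_dual_def ennreal_mult_less_top intro: le_less_trans)
   moreover have "F (pull m T \<eta>) = L' \<eta>" if \<eta>: "\<eta> \<in> test_functions \<O>2" for \<eta>
    using L test_functions_mono[OF test_pull[OF m test_functions_smooth[OF \<eta>]] \<O>1(2)] by (simp add: L'_def)
   ultimately have "L' \<in> ?B" by (simp add: sob0_dual_def)
   hence "(INF L\<in>?B. sob0_dual_norm (- e) p \<O>2 L) \<le> sob0_dual_norm (- e) p \<O>2 L'" by (rule INF_lower)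
   thus ?thesis using le by (rule order_trans)
  qed
  hence "(INF L\<in>?B. sob0_dual_norm (- e) p \<O>2 L) \<le> ennreal C * (INF L\<in>?A. sob0_dual_norm (- e) p \<O>1 L)"
   by (rule INF_cmult_le[OF C(1)])
  thus "sob_norm e q \<O>2 (\<lambda>\<eta>. F (pull m T \<eta>)) \<le> ennreal C * sob_norm e q \<O>1 F"
   using False by (simp add: sob_norm_def p_def)
 qed
qed

lemma sob_norm_add:
 fixes \<O> :: "(real^'n::finite) set"
 assumes \<O>: "open \<O>" and q: "q > 1"
 shows "sob_norm e q \<O> (\<lambda>\<eta>. F \<eta> + G \<eta>) \<le> ennreal 4 * (sob_norm e q \<O> F + sob_norm e q \<O> G)"
proof (cases "e \<ge> 0")
 case True
 have "sob_norm e q \<O> (\<lambda>\<eta>. F \<eta> + G \<eta>) \<le> ennreal 4 * (sob_norm_fun e q \<O> f + sob_norm_fun e q \<O> g)"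
  if f: "f \<in> {f \<in> sob_fun_space e q \<O>. \<forall>\<eta>\<in>test_functions \<O>. F \<eta> = regular_dist \<O> f \<eta>}"
   and g: "g \<in> {f \<in> sob_fun_space e q \<O>. \<forall>\<eta>\<in>test_functions \<O>. G \<eta> = regular_dist \<O> f \<eta>}" for f g
 proof -
  have le: "sob_norm_fun e q \<O> (\<lambda>x. f x + g x) \<le> ennreal 4 * (sob_norm_fun e q \<O> f + sob_norm_fun e q \<O> g)"
   using sob_norm_fun_quasi_add[OF \<O>, of q e f g] q by simp
  obtain v w where vw: "version_on \<O> f v" "version_on \<O> g w"
   using version_exists[OF \<O>] f g by (metis (mono_tags, lifting) mem_Collect_eq sob_fun_space_def)
  have fs: "(\<lambda>x. f x + g x) \<in> sob_fun_space e q \<O>"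
  proof (rule sob_fun_spaceI[OF \<O> version_measurable[OF \<O> version_add[OF vw]]])
   show "sob_norm_fun e q \<O> (\<lambda>x. f x + g x) < \<infinity>"
    using le f g by (auto simp: sob_fun_space_def ennreal_mult_less_top intro: le_less_trans)
  qed
  have li: "locally_integrable \<O> f" if "f \<in> sob_fun_space e q \<O>" for f :: "real^'n \<Rightarrow> real"
  proof -
   have "sob_norm_fun e q \<O> f < \<infinity>" using that by (simp add: sob_fun_space_def)
   then obtain H where "weak_family e \<O> f H" by (rule sob_norm_fun_weak_derivs)
   thus ?thesis unfolding weak_family_def is_weak_deriv_def
    by (metis zero_le order_of_def sum.neutral_const le0)
  qed
  have "F \<eta> + G \<eta> = regular_dist \<O> (\<lambda>x. f x + g x) \<eta>" if \<eta>: "\<eta> \<in> test_functions \<O>" for \<eta>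
  proof -
   have "integrable lborel (\<lambda>x. v x * \<eta> x)" "integrable lborel (\<lambda>x. w x * \<eta> x)"
    using vw locally_integrable_version[OF \<O> vw(1)] locally_integrable_version[OF \<O> vw(2)] li f g
    by (auto intro!: integrable_times_test_function[OF _ \<eta>] simp: version_on_def)
   thus ?thesis using f g \<eta>
    by (simp add: regular_dist_version[OF \<O> vw(1) \<eta>] regular_dist_version[OF \<O> vw(2) \<eta>]
      regular_dist_version[OF \<O> version_add[OF vw] \<eta>] distrib_right)
  qed
  hence "sob_norm e q \<O> (\<lambda>\<eta>. F \<eta> + G \<eta>) \<le> sob_norm_fun e q \<O> (\<lambda>x. f x + g x)"
   unfolding sob_norm_def using True fs by (auto intro: INF_lower)
  thus ?thesis using le by (rule order_trans)
 qed
 from INF_add_le[where f = "sob_norm_fun e q \<O>" and g = "sob_norm_fun e q \<O>", OF _ this] show ?thesis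
  using True unfolding sob_norm_def[of e q \<O> F] sob_norm_def[of e q \<O> G] by (simp only: if_True)
next
 case False
 define p where "p = q / (q - 1)"
 have "sob_norm e q \<O> (\<lambda>\<eta>. F \<eta> + G \<eta>) \<le> ennreal 4 * (sob0_dual_norm (- e) p \<O> K + sob0_dual_norm (- e) p \<O> L)"
  if K: "K \<in> {L \<in> sob0_dual (- e) p \<O>. \<forall>\<eta>\<in>test_functions \<O>. F \<eta> = L \<eta>}"
   and L: "L \<in> {L \<in> sob0_dual (- e) p \<O>. \<forall>\<eta>\<in>test_functions \<O>. G \<eta> = L \<eta>}" for K L
 proof -
  have le: "sob0_dual_norm (- e) p \<O> (\<lambda>f. K f + L f) \<le> sob0_dual_norm (- e) p \<O> K + sob0_dual_norm (- e) p \<O> L"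
   unfolding sob0_dual_norm_def[of _ _ _ "\<lambda>f. K f + L f"]
  proof (rule SUP_least)
   fix f assume f: "f \<in> {f \<in> sob_fun_space0 (- e) p \<O>. sob_norm_fun (- e) p \<O> f \<le> 1}"
   have "ennreal \<bar>K f + L f\<bar> \<le> ennreal (\<bar>K f\<bar> + \<bar>L f\<bar>)" by (intro ennreal_leI) auto
   also have "\<dots> = ennreal \<bar>K f\<bar> + ennreal \<bar>L f\<bar>" by simp
   also have "\<dots> \<le> sob0_dual_norm (- e) p \<O> K + sob0_dual_norm (- e) p \<O> L"
    unfolding sob0_dual_norm_def by (intro add_mono SUP_upper f)
   finally show "ennreal \<bar>K f + L f\<bar> \<le> sob0_dual_norm (- e) p \<O> K + sob0_dual_norm (- e) p \<O> L" .
  qed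
  have "linear_functional_on (sob_fun_space0 (- e) p \<O>) (\<lambda>f. K f + L f)"
   using K L by (auto simp: sob0_dual_def linear_functional_on_def algebra_simps)
  moreover have "sob0_dual_norm (- e) p \<O> (\<lambda>f. K f + L f) < \<infinity>"
   using le K L by (auto simp: sob0_dual_def intro: le_less_trans)
  ultimately have "(\<lambda>f. K f + L f) \<in> {L \<in> sob0_dual (- e) p \<O>. \<forall>\<eta>\<in>test_functions \<O>. F \<eta> + G \<eta> = L \<eta>}"
   using K L by (simp add: sob0_dual_def)
  hence "sob_norm e q \<O> (\<lambda>\<eta>. F \<eta> + G \<eta>) \<le> sob0_dual_norm (- e) p \<O> (\<lambda>f. K f + L f)"
   unfolding sob_norm_def p_def[symmetric] using False by (simp only: if_False) (rule INF_lower)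
  also have "\<dots> \<le> 1 * (sob0_dual_norm (- e) p \<O> K + sob0_dual_norm (- e) p \<O> L)" using le by simp
  also have "\<dots> \<le> ennreal 4 * (sob0_dual_norm (- e) p \<O> K + sob0_dual_norm (- e) p \<O> L)"
   by (intro mult_right_mono) auto
  finally show ?thesis .
 qed
 from INF_add_le[where f = "sob0_dual_norm (- e) p \<O>" and g = "sob0_dual_norm (- e) p \<O>", OF _ this] show ?thesis
  using False unfolding sob_norm_def[of e q \<O> F] sob_norm_def[of e q \<O> G] p_def[symmetric] by (simp only: if_False)
qed

lemma sob_norm_zero:
 fixes \<O> :: "(real^'n::finite) set"
 assumes \<O>: "open \<O>"
 shows "sob_norm e q \<O> (\<lambda>\<eta>. 0) = 0"
proof (cases "e \<ge> 0")
 case True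
 have li: "locally_integrable \<O> (\<lambda>x. 0)" by (simp add: locally_integrable_def set_integrable_def)
 have wf: "weak_family e \<O> (\<lambda>x. 0) (\<lambda>\<nu> x. 0)"
  by (intro weak_familyI) (simp add: weak_pds_def li regular_dist_def)
 have z: "sob_norm_fun e q \<O> (\<lambda>x. 0) = 0"
  unfolding sob_norm_fun_eq[OF \<O> wf] by (simp add: norms_zero)
 hence "(\<lambda>x. 0) \<in> {f \<in> sob_fun_space e q \<O>. \<forall>\<eta>\<in>test_functions \<O>. 0 = regular_dist \<O> f \<eta>}"
  by (auto simp: regular_dist_def intro!: sob_fun_spaceI[OF \<O>])
 from INF_lower[OF this, of "sob_norm_fun e q \<O>"] show ?thesis using True z by (simp add: sob_norm_def)
next
 case False
 have z: "sob0_dual_norm (- e) (q / (q - 1)) \<O> (\<lambda>f. 0) = 0"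
  unfolding sob0_dual_norm_def by (simp add: SUP_eq_iff bot_ennreal[symmetric])
 hence "(\<lambda>f. 0) \<in> {L \<in> sob0_dual (- e) (q / (q - 1)) \<O>. \<forall>\<eta>\<in>test_functions \<O>. 0 = L \<eta>}"
  by (simp add: sob0_dual_def linear_functional_on_def)
 from INF_lower[OF this, of "sob0_dual_norm (- e) (q / (q - 1)) \<O>"] show ?thesis using False z by (simp add: sob_norm_def)
qed

lemma sob_norm_sum:
 fixes \<O> :: "(real^'n::finite) set"
 assumes \<O>: "open \<O>" and q: "q > 1" and A: "finite A"
 shows "\<exists>C>0. \<forall>F. sob_norm e q \<O> (\<lambda>\<eta>. \<Sum>a\<in>A. F a \<eta>) \<le> ennreal C * (\<Sum>a\<in>A. sob_norm e q \<O> (F a))"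
 using A
proof (induction A)
 case empty
 show ?case by (intro exI[of _ 1]) (simp add: sob_norm_zero[OF \<O>])
next
 case (insert a A)
 then obtain C where C: "C > 0" "\<And>F. sob_norm e q \<O> (\<lambda>\<eta>. \<Sum>a\<in>A. F a \<eta>) \<le> ennreal C * (\<Sum>a\<in>A. sob_norm e q \<O> (F a))"
  by blast
 show ?case
 proof (intro exI[of _ "4 * (1 + C)"] conjI allI)
  fix F :: "'a \<Rightarrow> (real^'n \<Rightarrow> real) \<Rightarrow> real"
  let ?x = "sob_norm e q \<O> (F a)" and ?y = "\<Sum>a\<in>A. sob_norm e q \<O> (F a)"
  have "sob_norm e q \<O> (\<lambda>\<eta>. \<Sum>a\<in>insert a A. F a \<eta>) \<le> ennreal 4 * (?x + sob_norm e q \<O> (\<lambda>\<eta>. \<Sum>a\<in>A. F a \<eta>))"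
   using sob_norm_add[OF \<O> q, of e "F a" "\<lambda>\<eta>. \<Sum>a\<in>A. F a \<eta>"] insert(1,2) by simp
  also have "\<dots> \<le> ennreal 4 * (ennreal (1 + C) * ?x + ennreal (1 + C) * ?y)"
  proof (intro mult_left_mono add_mono)
   have "1 * ?x \<le> ennreal (1 + C) * ?x" using C(1) by (intro mult_right_mono) auto
   thus "?x \<le> ennreal (1 + C) * ?x" by simp
   have "ennreal C * ?y \<le> ennreal (1 + C) * ?y" by (intro mult_right_mono ennreal_leI) auto
   with C(2)[of F] show "sob_norm e q \<O> (\<lambda>\<eta>. \<Sum>a\<in>A. F a \<eta>) \<le> ennreal (1 + C) * ?y" by (rule order_trans)
  qed auto
  also have "\<dots> = ennreal (4 * (1 + C)) * (\<Sum>a\<in>insert a A. sob_norm e q \<O> (F a))"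
  proof -
   have 1: "ennreal (4 * (1 + C)) = ennreal 4 * ennreal (1 + C)" using C(1) by (intro ennreal_mult) auto
   have 2: "(\<Sum>a\<in>insert a A. sob_norm e q \<O> (F a)) = ?x + ?y" using insert(1,2) by simp
   show ?thesis unfolding 1 2 by (simp only: mult.assoc distrib_left[symmetric])
  qed
  finally show "sob_norm e q \<O> (\<lambda>\<eta>. \<Sum>a\<in>insert a A. F a \<eta>) \<le> ennreal (4 * (1 + C)) * (\<Sum>a\<in>insert a A. sob_norm e q \<O> (F a))" .
 qed (use C in simp)
qed

section \<open>Pulling back continuous functionals\<close>

text \<open>The properties of the families of test function spaces that make the inductive limit a vector
  space.\<close>

definition directed_spaces :: "('x \<Rightarrow> real) set set \<Rightarrow> bool" where
 "directed_spaces \<D> \<longleftrightarrow> \<D> \<noteq> {} \<and> (\<forall>D\<in>\<D>. (\<lambda>x. 0) \<in> D \<and> (\<forall>f\<in>D. \<forall>g\<in>D. \<forall>a b. (\<lambda>x. a * f x + b * g x) \<in> D)) \<and>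
   (\<forall>D\<in>\<D>. \<forall>E\<in>\<D>. \<exists>F\<in>\<D>. D \<subseteq> F \<and> E \<subseteq> F)"

lemma directed_spaces_member:
 "directed_spaces \<D> \<Longrightarrow> D \<in> \<D> \<Longrightarrow> f \<in> D \<Longrightarrow> g \<in> D \<Longrightarrow> (\<lambda>x. a * f x + b * g x) \<in> D"
 by (simp add: directed_spaces_def)

lemma directed_spaces_lin:
 assumes "directed_spaces \<D>" "f \<in> \<Union>\<D>" "g \<in> \<Union>\<D>"
 shows "(\<lambda>x. a * f x + b * g x) \<in> \<Union>\<D>"
proof -
 obtain D E where "D \<in> \<D>" "f \<in> D" "E \<in> \<D>" "g \<in> E" using assms by blast
 moreover have "\<exists>F\<in>\<D>. D \<subseteq> F \<and> E \<subseteq> F"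
  using assms(1) \<open>D \<in> \<D>\<close> \<open>E \<in> \<D>\<close> by (simp add: directed_spaces_def)
 ultimately obtain F where "F \<in> \<D>" "f \<in> F" "g \<in> F" by blast
 thus ?thesis using directed_spaces_member[OF assms(1)] by (intro UnionI)
qed

lemma lf_nbhdsD:
 assumes "W \<in> lf_nbhds P \<D>"
 shows "W \<subseteq> \<Union>\<D>" "D \<in> \<D> \<Longrightarrow> seminorm_open P D (W \<inter> D)"
  "f \<in> W \<Longrightarrow> g \<in> W \<Longrightarrow> 0 \<le> t \<Longrightarrow> t \<le> 1 \<Longrightarrow> (\<lambda>x. (1 - t) * f x + t * g x) \<in> W"
  "f \<in> W \<Longrightarrow> \<bar>c\<bar> \<le> 1 \<Longrightarrow> (\<lambda>x. c * f x) \<in> W"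
 using assms by (simp_all add: lf_nbhds_def)

lemma lf_nbhdsI:
 assumes "W \<subseteq> \<Union>\<D>"
  and "\<And>f g t. f \<in> W \<Longrightarrow> g \<in> W \<Longrightarrow> t \<in> {0..1} \<Longrightarrow> (\<lambda>x. (1 - t) * f x + t * g x) \<in> W"
  and "\<And>f c. f \<in> W \<Longrightarrow> \<bar>c\<bar> \<le> 1 \<Longrightarrow> (\<lambda>x. c * f x) \<in> W"
  and "\<And>D. D \<in> \<D> \<Longrightarrow> seminorm_open P D (W \<inter> D)"
 shows "W \<in> lf_nbhds P \<D>"
 using assms by (simp add: lf_nbhds_def)

lemma seminorm_openD:
 assumes "seminorm_open P D V" "f \<in> V"
 obtains F \<epsilon> where "finite F" "F \<subseteq> P" "\<epsilon> > 0" "{g \<in> D. \<forall>p\<in>F. p (\<lambda>x. g x - f x) < \<epsilon>} \<subseteq> V"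
 using bspec[OF conjunct2[OF assms(1)[unfolded seminorm_open_def]] assms(2)] by (elim exE conjE)

lemma whole_nbhd:
 assumes d: "directed_spaces \<D>"
 shows "\<Union>\<D> \<in> lf_nbhds P \<D>"
proof -
 have "(\<lambda>x. c * f x) \<in> \<Union>\<D>" if "f \<in> \<Union>\<D>" for f c
  using directed_spaces_lin[OF d that that, of c 0] by simp
 moreover have "seminorm_open P D (\<Union>\<D> \<inter> D)" if "D \<in> \<D>" for D
  using that unfolding seminorm_open_def by (auto intro!: exI[of _ "{}"] exI[of _ 1])
 ultimately show ?thesis unfolding lf_nbhds_def using directed_spaces_lin[OF d] by auto
qed

lemma topspace_lf:
 assumes d: "directed_spaces \<D>"
 shows "topspace (lf_topology P \<D>) = \<Union>\<D>"
proof -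
 have *: "h \<in> \<Union>\<D>" if f: "f \<in> \<Union>\<D>" "W \<in> lf_nbhds P \<D>" "h \<in> (\<lambda>w x. f x + w x) ` W" for f W h
 proof -
  obtain w where w: "w \<in> W" "h = (\<lambda>x. f x + w x)" using f by auto
  hence "w \<in> \<Union>\<D>" using f(2) unfolding lf_nbhds_def by blast
  thus ?thesis using directed_spaces_lin[OF d f(1), of w 1 1] w by simp
 qed
 moreover have "h \<in> \<Union>{(\<lambda>w x. f x + w x) ` W | f W. f \<in> \<Union>\<D> \<and> W \<in> lf_nbhds P \<D>}" if h: "h \<in> \<Union>\<D>" for h
 proof -
  have "(\<lambda>x. 0) \<in> \<Union>\<D>" using directed_spaces_lin[OF d h h, of 0 0] by simp
  hence "h \<in> (\<lambda>w x. h x + w x) ` \<Union>\<D>" by (rule rev_image_eqI) simp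
  moreover have "(\<lambda>w x. h x + w x) ` \<Union>\<D> \<in> {(\<lambda>w x. f x + w x) ` W | f W. f \<in> \<Union>\<D> \<and> W \<in> lf_nbhds P \<D>}"
   using h whole_nbhd[OF d] by (intro CollectI exI[of _ h] exI[of _ "\<Union>\<D>"]) simp
  ultimately show ?thesis by (rule UnionI[rotated])
 qed
 moreover have "h \<in> \<Union>\<D>" if mem: "h \<in> \<Union>{(\<lambda>w x. f x + w x) ` W | f W. f \<in> \<Union>\<D> \<and> W \<in> lf_nbhds P \<D>}" for h
 proof -
  obtain X where "h \<in> X" "X \<in> {(\<lambda>w x. f x + w x) ` W | f W. f \<in> \<Union>\<D> \<and> W \<in> lf_nbhds P \<D>}"
   using mem by (rule UnionE)
  then obtain f W where fW: "h \<in> (\<lambda>w x. f x + w x) ` W" "f \<in> \<Union>\<D>" "W \<in> lf_nbhds P \<D>" by auto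
  show ?thesis by (rule *[OF fW(2,3,1)])
 qed
 ultimately show ?thesis unfolding lf_topology_def topology_generated_by_topspace by (intro equalityI subsetI)
qed

text \<open>Linear maps of inductive limits that map steps into steps and are bounded for the seminorms on each
  step.  The scalar \<open>c\<close> is part of the bound because multiples of \<open>G f\<close> have to be
  estimated, and elements of \<open>P\<close> are arbitrary functions, not assumed homogeneous.\<close>

locale lf_pullback =
 fixes P :: "(('x \<Rightarrow> real) \<Rightarrow> real) set" and \<D> :: "('x \<Rightarrow> real) set set"
  and P' :: "(('y \<Rightarrow> real) \<Rightarrow> real) set" and \<D>' :: "('y \<Rightarrow> real) set set"
  and G :: "('y \<Rightarrow> real) \<Rightarrow> ('x \<Rightarrow> real)"
 assumes dir: "directed_spaces \<D>" and dir': "directed_spaces \<D>'"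
  and hom: "\<And>p f. p \<in> P \<Longrightarrow> f \<in> \<Union>\<D> \<Longrightarrow> \<exists>B. \<forall>c. p (\<lambda>x. c * f x) \<le> \<bar>c\<bar> * B"
  and lin: "\<And>f g a b. f \<in> \<Union>\<D>' \<Longrightarrow> g \<in> \<Union>\<D>' \<Longrightarrow> G (\<lambda>y. a * f y + b * g y) = (\<lambda>x. a * G f x + b * G g x)"
  and maps: "\<And>D'. D' \<in> \<D>' \<Longrightarrow> \<exists>D\<in>\<D>. G ` D' \<subseteq> D"
  and bnd: "\<And>p D' c. p \<in> P \<Longrightarrow> D' \<in> \<D>' \<Longrightarrow> \<exists>F C. finite F \<and> F \<subseteq> P' \<and> C > 0 \<and> (\<forall>f\<in>D'. p (\<lambda>x. c * G f x) \<le> C * (\<Sum>p'\<in>F. p' f))"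
begin

lemma scale: "f \<in> \<Union>\<D>' \<Longrightarrow> G (\<lambda>y. a * f y) = (\<lambda>x. a * G f x)"
 using lin[of f f a 0] by simp

text \<open>Linearity transports convexity and balancedness to the preimage, and the seminorm bound transports
  openness on each step.\<close>

lemma nbhd_vimage:
 assumes W: "W \<in> lf_nbhds P \<D>"
 shows "{h \<in> \<Union>\<D>'. (\<lambda>x. c * G h x) \<in> W} \<in> lf_nbhds P' \<D>'" (is "?V \<in> _")
proof -
 have conv: "(\<lambda>x. (1 - t) * f x + t * g x) \<in> W" if "f \<in> W" "g \<in> W" "t \<in> {0..1}" for f g t
  using that by (intro lf_nbhdsD(3)[OF W]) auto
 have bal: "(\<lambda>x. c * f x) \<in> W" if "f \<in> W" "\<bar>c\<bar> \<le> 1" for f c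
  using that by (rule lf_nbhdsD(4)[OF W])
 have op: "seminorm_open P D (W \<inter> D)" if "D \<in> \<D>" for D
  using that by (rule lf_nbhdsD(2)[OF W])
 show ?thesis
 proof (rule lf_nbhdsI)
  fix f g and t :: real assume f: "f \<in> ?V" and g: "g \<in> ?V" and t: "t \<in> {0..1}"
  have fg: "f \<in> \<Union>\<D>'" "g \<in> \<Union>\<D>'" using f g by auto
  have "(\<lambda>x. (1 - t) * (c * G f x) + t * (c * G g x)) \<in> W" using conv[OF _ _ t] f g by auto
  also have "(\<lambda>x. (1 - t) * (c * G f x) + t * (c * G g x)) = (\<lambda>x. c * G (\<lambda>x. (1 - t) * f x + t * g x) x)"
   unfolding lin[OF fg] by (rule ext) (simp add: algebra_simps)
  finally show "(\<lambda>x. (1 - t) * f x + t * g x) \<in> ?V"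
   by (intro CollectI conjI directed_spaces_lin[OF dir' fg])
 next
  fix f and a :: real assume f: "f \<in> ?V" and a: "\<bar>a\<bar> \<le> 1"
  have f': "f \<in> \<Union>\<D>'" using f by auto
  have "(\<lambda>x. a * (c * G f x)) \<in> W" using bal[OF _ a] f by auto
  thus "(\<lambda>x. a * f x) \<in> ?V"
   using directed_spaces_lin[OF dir' f' f', of a 0] by (simp add: scale[OF f'] mult.left_commute)
 next
  fix D' assume D': "D' \<in> \<D>'"
  then obtain D where D: "D \<in> \<D>" "G ` D' \<subseteq> D" using maps by blast
  have lin': "(\<lambda>x. a * f x + b * g x) \<in> D'" if "f \<in> D'" "g \<in> D'" for f g a b
   using that by (rule directed_spaces_member[OF dir' D'])
  show "seminorm_open P' D' (?V \<inter> D')"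
   unfolding seminorm_open_def
  proof (intro conjI ballI)
   fix f assume f: "f \<in> ?V \<inter> D'"
   have cG: "(\<lambda>x. c * G h x) \<in> D" if "h \<in> D'" for h
   proof -
    have "G h \<in> D" using that D(2) by blast
    hence "(\<lambda>x. c * G h x + 0 * G h x) \<in> D" by (intro directed_spaces_member[OF dir D(1)])
    thus ?thesis by simp
   qed
   have "(\<lambda>x. c * G f x) \<in> W \<inter> D" using f cG by auto
   then obtain F e where F: "finite F" "F \<subseteq> P" "e > 0"
    "{g \<in> D. \<forall>p\<in>F. p (\<lambda>x. g x - c * G f x) < e} \<subseteq> W \<inter> D"
    by (rule seminorm_openD[OF op[OF D(1)]])
   have "\<forall>p\<in>F. \<exists>H C. finite H \<and> H \<subseteq> P' \<and> C > 0 \<and> (\<forall>f\<in>D'. p (\<lambda>x. c * G f x) \<le> C * (\<Sum>p'\<in>H. p' f))"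
    using bnd[OF _ D'] F(2) by blast
   then obtain H C where H: "\<And>p. p \<in> F \<Longrightarrow> finite (H p) \<and> H p \<subseteq> P' \<and> C p > 0 \<and>
     (\<forall>f\<in>D'. p (\<lambda>x. c * G f x) \<le> C p * (\<Sum>p'\<in>H p. p' f))" by metis
   define r where "r p = C p * real (card (H p))" for p
   define S where "S = (\<Sum>p\<in>F. r p) + 1"
   have r0: "r p \<ge> 0" if "p \<in> F" for p using H[OF that] by (simp add: r_def)
   have S: "S > 0" using r0 by (simp add: S_def sum_nonneg add_nonneg_pos)
   show "\<exists>F e. finite F \<and> F \<subseteq> P' \<and> 0 < e \<and> {g \<in> D'. \<forall>p\<in>F. p (\<lambda>x. g x - f x) < e} \<subseteq> ?V \<inter> D'"
   proof (intro exI[of _ "\<Union>p\<in>F. H p"] exI[of _ "e / S"] conjI)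
    show "finite (\<Union>p\<in>F. H p)" using F(1) H by blast
    show "(\<Union>p\<in>F. H p) \<subseteq> P'" using H by blast
    show "0 < e / S" using F(3) S by simp
    show "{g \<in> D'. \<forall>p\<in>\<Union>p\<in>F. H p. p (\<lambda>x. g x - f x) < e / S} \<subseteq> ?V \<inter> D'"
    proof (rule subsetI)
    fix g assume "g \<in> {g \<in> D'. \<forall>p\<in>\<Union>p\<in>F. H p. p (\<lambda>x. g x - f x) < e / S}"
    hence g: "g \<in> D'" "\<And>p p'. p \<in> F \<Longrightarrow> p' \<in> H p \<Longrightarrow> p' (\<lambda>x. g x - f x) < e / S" by auto
    have gf: "(\<lambda>x. g x - f x) \<in> D'" using lin'[OF g(1), of f 1 "-1"] f by simp
    have "g \<in> \<Union>\<D>'" "f \<in> \<Union>\<D>'" using g(1) f D' by blast+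
    from lin[OF this, of 1 "-1"] have Gd: "(\<lambda>x. c * G (\<lambda>x. g x - f x) x) = (\<lambda>x. c * G g x - c * G f x)"
     by (simp add: right_diff_distrib)
    have "p (\<lambda>x. c * G g x - c * G f x) < e" if p: "p \<in> F" for p
    proof -
     have "p (\<lambda>x. c * G g x - c * G f x) \<le> C p * (\<Sum>p'\<in>H p. p' (\<lambda>x. g x - f x))"
      using H[OF p] gf unfolding Gd[symmetric] by blast
     also have "\<dots> \<le> C p * (real (card (H p)) * (e / S))"
      using H[OF p] g(2)[OF p] by (intro mult_left_mono sum_bounded_above less_imp_le) auto
     also have "\<dots> = r p * (e / S)" by (simp add: r_def)
     also have "\<dots> < S * (e / S)"
     proof (rule mult_strict_right_mono)
      have "r p \<le> (\<Sum>p\<in>F. r p)" using p r0 F(1) by (intro member_le_sum) auto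
      thus "r p < S" by (simp add: S_def)
     qed (use F S in simp)
     finally show ?thesis using S by simp
    qed
    hence "(\<lambda>x. c * G g x) \<in> W" using F(4) cG[OF g(1)] by blast
    thus "g \<in> ?V \<inter> D'" using g(1) D' by blast
    qed
   qed
  qed auto
 qed auto
qed

text \<open>The trace of \<open>W\<close> on a step containing \<open>w\<close> is open, and the seminorms of \<open>\<delta> w\<close> are small for small \<open>\<delta>\<close>.\<close>

lemma nbhd_room:
 assumes W: "W \<in> lf_nbhds P \<D>" and w: "w \<in> W"
 obtains \<delta> where "\<delta> > 0" "(\<lambda>x. (1 + \<delta>) * w x) \<in> W"
proof -
 obtain D where D: "D \<in> \<D>" "w \<in> D" using lf_nbhdsD(1)[OF W] w by blast
 obtain F e where F: "finite F" "F \<subseteq> P" "e > 0" "{g \<in> D. \<forall>p\<in>F. p (\<lambda>x. g x - w x) < e} \<subseteq> W \<inter> D"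
  by (rule seminorm_openD[OF lf_nbhdsD(2)[OF W D(1)] IntI[OF w D(2)]])
 have "\<forall>p\<in>F. \<exists>B. \<forall>c. p (\<lambda>x. c * w x) \<le> \<bar>c\<bar> * B" using hom F(2) D by blast
 then obtain B where B: "\<And>p c. p \<in> F \<Longrightarrow> p (\<lambda>x. c * w x) \<le> \<bar>c\<bar> * B p" by metis
 define S where "S = (\<Sum>p\<in>F. \<bar>B p\<bar>) + 1"
 have S: "S > 0" by (simp add: S_def sum_nonneg add_nonneg_pos)
 define \<delta> where "\<delta> = e / S"
 have \<delta>: "\<delta> > 0" using F S by (simp add: \<delta>_def)
 have "(\<lambda>x. (1 + \<delta>) * w x + 0 * w x) \<in> D" by (rule directed_spaces_member[OF dir D(1) D(2) D(2)])
 moreover have "p (\<lambda>x. (1 + \<delta>) * w x - w x) < e" if p: "p \<in> F" for p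
 proof -
  have "p (\<lambda>x. (1 + \<delta>) * w x - w x) = p (\<lambda>x. \<delta> * w x)" by (simp add: algebra_simps)
  also have "\<dots> \<le> \<delta> * B p" using B[OF p, of \<delta>] \<delta> by simp
  also have "\<dots> < \<delta> * S"
  proof (rule mult_strict_left_mono[OF _ \<delta>])
   have "\<bar>B p\<bar> \<le> (\<Sum>p\<in>F. \<bar>B p\<bar>)" using p F(1) by (intro member_le_sum) auto
   thus "B p < S" by (simp add: S_def)
  qed
  finally show ?thesis using S by (simp add: \<delta>_def)
 qed
 ultimately have "(\<lambda>x. (1 + \<delta>) * w x) \<in> W" using F(4) by auto
 with \<delta> that show thesis by blast
qed

text \<open>Let \<open>G h = f + w\<close> with \<open>w \<in> W\<close>.  A point near \<open>h\<close> is
  mapped to \<open>f\<close> plus a convex combination of \<open>(1 + \<delta>) w\<close>, which is still in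
  \<open>W\<close>, and of another element of \<open>W\<close>.\<close>

lemma continuous_G: "continuous_map (lf_topology P' \<D>') (lf_topology P \<D>) G"
 unfolding lf_topology_def[of P \<D>]
proof (rule continuous_on_generated_topo)
 let ?T = "lf_topology P' \<D>'"
 have G: "G h \<in> \<Union>\<D>" if "h \<in> \<Union>\<D>'" for h using that maps by blast
 show "G ` topspace ?T \<subseteq> \<Union>{(\<lambda>w x. f x + w x) ` W | f W. f \<in> \<Union>\<D> \<and> W \<in> lf_nbhds P \<D>}"
  using G unfolding topspace_lf[OF dir']
   topspace_lf[OF dir, of P, unfolded lf_topology_def topology_generated_by_topspace] by blast
 fix U assume "U \<in> {(\<lambda>w x. f x + w x) ` W | f W. f \<in> \<Union>\<D> \<and> W \<in> lf_nbhds P \<D>}"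
 then obtain f W where f: "f \<in> \<Union>\<D>" and W: "W \<in> lf_nbhds P \<D>" and U: "U = (\<lambda>w x. f x + w x) ` W" by blast
 show "openin ?T (G -` U \<inter> topspace ?T)"
 proof (subst openin_subopen, intro ballI)
  fix h assume h: "h \<in> G -` U \<inter> topspace ?T"
  hence h': "h \<in> \<Union>\<D>'" using topspace_lf[OF dir'] by simp
  obtain w where w: "w \<in> W" "G h = (\<lambda>x. f x + w x)" using h U by auto
  obtain \<delta> where \<delta>: "\<delta> > 0" "(\<lambda>x. (1 + \<delta>) * w x) \<in> W" using nbhd_room[OF W w(1)] .
  define t where "t = \<delta> / (1 + \<delta>)"
  \<comment> \<open>chosen such that \<open>(1 - t) ((1 + \<delta>) w) = w\<close>\<close>
  have t: "0 < t" "t \<le> 1" "(1 - t) * (1 + \<delta>) = 1" using \<delta>(1) by (auto simp: t_def field_simps)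
  define V where "V = {k \<in> \<Union>\<D>'. (\<lambda>x. (1 / t) * G k x) \<in> W}"
  have V: "V \<in> lf_nbhds P' \<D>'" unfolding V_def by (rule nbhd_vimage[OF W])
  show "\<exists>A. openin ?T A \<and> h \<in> A \<and> A \<subseteq> G -` U \<inter> topspace ?T"
  proof (intro exI[of _ "(\<lambda>w x. h x + w x) ` V"] conjI subsetI)
   show "openin ?T ((\<lambda>w x. h x + w x) ` V)"
    unfolding lf_topology_def using V h' by (intro topology_generated_by_Basis) blast
   have "(\<lambda>x. 0 * w x) \<in> W" by (rule lf_nbhdsD(4)[OF W w(1)]) simp
   moreover have "(\<lambda>x. 0) \<in> \<Union>\<D>'" using directed_spaces_lin[OF dir' h' h', of 0 0] by simp
   moreover have "G (\<lambda>x. 0) = (\<lambda>x. 0)" using scale[OF h', of 0] by simp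
   ultimately have "(\<lambda>x. 0) \<in> V" by (simp add: V_def)
   thus "h \<in> (\<lambda>w x. h x + w x) ` V" by (rule rev_image_eqI) simp
   fix k assume "k \<in> (\<lambda>w x. h x + w x) ` V"
   then obtain v where v: "v \<in> V" "k = (\<lambda>x. h x + v x)" by auto
   have v': "v \<in> \<Union>\<D>'" and vW: "(\<lambda>x. (1 / t) * G v x) \<in> W" using v(1) by (auto simp: V_def)
   have k: "k \<in> \<Union>\<D>'" using directed_spaces_lin[OF dir' h' v', of 1 1] v(2) by simp
   have "G k = (\<lambda>x. G h x + G v x)" using lin[OF h' v', of 1 1] v(2) by simp
   also have "\<dots> = (\<lambda>x. f x + ((1 - t) * ((1 + \<delta>) * w x) + t * ((1 / t) * G v x)))"
    using t unfolding w(2) mult.assoc[symmetric] by (simp add: add.assoc)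
   finally have Gk: "G k = (\<lambda>x. f x + ((1 - t) * ((1 + \<delta>) * w x) + t * ((1 / t) * G v x)))" .
   have "(\<lambda>x. (1 - t) * ((1 + \<delta>) * w x) + t * ((1 / t) * G v x)) \<in> W"
    using t by (intro lf_nbhdsD(3)[OF W \<delta>(2) vW]) auto
   hence "G k \<in> U" unfolding U Gk by (rule rev_image_eqI) simp
   thus "k \<in> G -` U \<inter> topspace ?T" using k topspace_lf[OF dir'] by simp
  qed
 qed
qed

lemma lf_dual_pullback:
 assumes u: "u \<in> lf_dual P \<D>"
 shows "(\<lambda>\<eta>. u (G \<eta>)) \<in> lf_dual P' \<D>'"
proof -
 have "linear_functional_on (\<Union>\<D>') (\<lambda>\<eta>. u (G \<eta>))"
  unfolding linear_functional_on_def
 proof (intro ballI allI)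
  fix f g a b assume fg: "f \<in> \<Union>\<D>'" "g \<in> \<Union>\<D>'"
  have "G f \<in> \<Union>\<D>" "G g \<in> \<Union>\<D>" using fg maps by blast+
  thus "u (G (\<lambda>x. a * f x + b * g x)) = a * u (G f) + b * u (G g)"
   using u unfolding lin[OF fg] lf_dual_def linear_functional_on_def by blast
 qed
 moreover have "continuous_map (lf_topology P' \<D>') euclideanreal (u \<circ> G)"
  by (rule continuous_map_compose[OF continuous_G]) (use u in \<open>simp add: lf_dual_def\<close>)
 ultimately show ?thesis by (simp add: lf_dual_def o_def)
qed

end

section \<open>Spaces of test functions\<close>

lemma directed_test_function_family: "directed_spaces (test_function_family \<O>)"
 unfolding directed_spaces_def
proof (intro conjI ballI allI)
 show "test_function_family \<O> \<noteq> {}" by (auto simp: test_function_family_def intro: exI[of _ "{}"])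
next
 fix D assume "D \<in> test_function_family \<O>"
 then obtain K where K: "D = test_functions_in K" by (auto simp: test_function_family_def)
 show "(\<lambda>x. 0) \<in> D" by (simp add: K test_functions_in_def smooth_on_const)
 fix f g and a b :: real assume "f \<in> D" "g \<in> D"
 thus "(\<lambda>x. a * f x + b * g x) \<in> D"
  unfolding K test_functions_in_def by (auto intro!: smooth_on_add smooth_on_mult smooth_on_const)
next
 fix D E assume "D \<in> test_function_family \<O>" "E \<in> test_function_family \<O>"
 then obtain K L where KL: "D = test_functions_in K" "E = test_functions_in L" "compact K" "K \<subseteq> \<O>" "compact L" "L \<subseteq> \<O>"
  by (auto simp: test_function_family_def)
 show "\<exists>F\<in>test_function_family \<O>. D \<subseteq> F \<and> E \<subseteq> F"
 proof (intro bexI[of _ "test_functions_in (K \<union> L)"])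
  show "test_functions_in (K \<union> L) \<in> test_function_family \<O>"
   using KL unfolding test_function_family_def by (intro CollectI exI[of _ "K \<union> L"]) auto
 qed (use KL in \<open>auto simp: test_functions_in_def\<close>)
qed

definition sup_seminorm :: "('n::finite \<Rightarrow> nat) \<Rightarrow> (real^'n \<Rightarrow> real) \<Rightarrow> real" where
 "sup_seminorm \<nu> \<eta> = (SUP x. \<bar>mpd \<nu> \<eta> x\<bar>)"

lemma test_seminorms_eq: "test_seminorms = range sup_seminorm"
 by (simp add: test_seminorms_def sup_seminorm_def[abs_def])

lemma le_sup_seminorm:
 assumes \<eta>: "\<eta> \<in> test_functions V"
 shows "\<bar>pds is \<eta> x\<bar> \<le> sup_seminorm (count_list is) \<eta>"
proof -
 obtain B where B: "\<And>x. \<bar>pds is \<eta> x\<bar> \<le> B" using test_functions_bounded[OF test_functions_pds[OF \<eta>]] by blast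
 thus ?thesis
  unfolding sup_seminorm_def pds_eq_mpd[OF test_functions_smooth[OF \<eta>], symmetric]
  by (intro cSUP_upper) (auto intro!: bdd_aboveI[of _ B])
qed

lemma sup_seminorm_le: "(\<And>x. \<bar>mpd \<nu> \<eta> x\<bar> \<le> B) \<Longrightarrow> sup_seminorm \<nu> \<eta> \<le> B"
 unfolding sup_seminorm_def by (rule cSUP_least) auto

lemma test_seminorm_homogeneous:
 assumes p: "p \<in> test_seminorms" and \<eta>: "\<eta> \<in> \<Union>(test_function_family \<O>)"
 shows "\<exists>B. \<forall>c. p (\<lambda>x. c * \<eta> x) \<le> \<bar>c\<bar> * B"
proof -
 have \<eta>: "\<eta> \<in> test_functions \<O>" using \<eta> by (simp add: test_functions_def)
 obtain \<nu> where p: "p = sup_seminorm \<nu>" using p by (auto simp: test_seminorms_eq)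
 obtain B where B: "\<And>x. \<bar>mpd \<nu> \<eta> x\<bar> \<le> B"
  using test_functions_bounded[OF test_functions_pds[OF \<eta>]] unfolding mpd_eq_pds by metis
 have "p (\<lambda>x. c * \<eta> x) \<le> \<bar>c\<bar> * B" for c
  unfolding p
 proof (rule sup_seminorm_le)
  fix x
  have "mpd \<nu> (\<lambda>x. c * \<eta> x) x = c * mpd \<nu> \<eta> x"
   unfolding mpd_eq_pds by (rule pds_cmult[OF open_UNIV test_functions_smooth[OF \<eta>] UNIV_I])
  thus "\<bar>mpd \<nu> (\<lambda>x. c * \<eta> x) x\<bar> \<le> \<bar>c\<bar> * B"
   using B[of x] by (simp add: abs_mult mult_left_mono)
 qed
 thus ?thesis by blast
qed

lemma (in diffeo) pull_seminorm_bound: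
 assumes m: "m \<in> test_functions W'"
 shows "\<exists>F C. finite F \<and> F \<subseteq> test_seminorms \<and> C > 0 \<and>
  (\<forall>\<eta>\<in>test_functions V. \<forall>y. \<bar>pds js (pull m T \<eta>) y\<bar> \<le> C * (\<Sum>p\<in>F. p \<eta>))"
proof -
 obtain xs where xs: "\<And>c is. (c, is) \<in> set xs \<Longrightarrow> c \<in> test_functions W'"
  and e: "\<And>\<eta> y. smooth_on UNIV \<eta> \<Longrightarrow> pds js (pull m T \<eta>) y = (\<Sum>(c, is)\<leftarrow>xs. pull c T (pds is \<eta>) y)"
  using pds_pull[OF m, of js] by fast
 have nn: "0 \<le> p \<eta>" if P: "p \<in> test_seminorms" "\<eta> \<in> test_functions V" for p and \<eta> :: "real^'n \<Rightarrow> real"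
 proof -
  obtain \<nu> where p: "p = sup_seminorm \<nu>" using P(1) by (auto simp: test_seminorms_eq)
  have "0 \<le> \<bar>pds (list_of \<nu>) \<eta> 0\<bar>" by simp
  also have "\<dots> \<le> sup_seminorm (count_list (list_of \<nu>)) \<eta>" by (rule le_sup_seminorm[OF P(2)])
  also have "count_list (list_of \<nu>) = \<nu>" by (rule ext) (rule count_list_of)
  finally show ?thesis by (simp add: p)
 qed
 have "\<exists>F C. finite F \<and> F \<subseteq> test_seminorms \<and> C > 0 \<and>
  (\<forall>\<eta>\<in>test_functions V. \<forall>y. \<bar>\<Sum>(c, is)\<leftarrow>xs. pull c T (pds is \<eta>) y\<bar> \<le> C * (\<Sum>p\<in>F. p \<eta>))"
  using xs
 proof (induction xs)
  case Nil
  show ?case by (intro exI[of _ "{}"] exI[of _ 1]) simp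
 next
  case (Cons a xs)
  obtain c "is" where a: "a = (c, is)" by force
  obtain F C where F: "finite F" "F \<subseteq> test_seminorms" "C > 0"
   "\<And>\<eta> y. \<eta> \<in> test_functions V \<Longrightarrow> \<bar>\<Sum>(c, is)\<leftarrow>xs. pull c T (pds is \<eta>) y\<bar> \<le> C * (\<Sum>p\<in>F. p \<eta>)"
   using Cons.IH Cons.prems by (meson list.set_intros(2))
  obtain B where B: "B \<ge> 0" "\<And>x. \<bar>c x\<bar> \<le> B" using test_functions_bounded[of c W'] Cons.prems[of c "is"] by (auto simp: a)
  let ?q = "sup_seminorm (count_list is)"
  let ?F = "insert ?q F"
  have F': "finite ?F" "?F \<subseteq> test_seminorms" using F by (auto simp: test_seminorms_eq)
  show ?case
  proof (intro exI[of _ ?F] exI[of _ "C + B"] conjI ballI allI)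
   fix \<eta> y assume \<eta>: "\<eta> \<in> test_functions V"
   have "\<bar>c y * pds is \<eta> (T y)\<bar> \<le> B * ?q \<eta>"
    unfolding abs_mult using B by (intro mult_mono le_sup_seminorm[OF \<eta>]) auto
   also have "\<dots> \<le> B * (\<Sum>p\<in>?F. p \<eta>)"
    using F' nn[OF _ \<eta>] B by (intro mult_left_mono member_le_sum) auto
   finally have 1: "\<bar>pull c T (pds is \<eta>) y\<bar> \<le> B * (\<Sum>p\<in>?F. p \<eta>)" by (simp add: pull_def)
   have "(\<Sum>p\<in>F. p \<eta>) \<le> (\<Sum>p\<in>?F. p \<eta>)"
    using F' nn[OF _ \<eta>] by (intro sum_mono2) auto
   hence 2: "\<bar>\<Sum>(c, is)\<leftarrow>xs. pull c T (pds is \<eta>) y\<bar> \<le> C * (\<Sum>p\<in>?F. p \<eta>)"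
    using F(3) by (intro order_trans[OF F(4)[OF \<eta>] mult_left_mono]) auto
   show "\<bar>\<Sum>(c, is)\<leftarrow>a # xs. pull c T (pds is \<eta>) y\<bar> \<le> (C + B) * (\<Sum>p\<in>?F. p \<eta>)"
    using 1 2 by (simp add: a distrib_right)
  qed (use F' F(3) B in auto)
 qed
 moreover have "pds js (pull m T \<eta>) y = (\<Sum>(c, is)\<leftarrow>xs. pull c T (pds is \<eta>) y)" if "\<eta> \<in> test_functions V" for \<eta> y
  by (rule e[OF test_functions_smooth[OF that]])
 ultimately show ?thesis by simp
qed

lemma diffeo_id: "open \<O> \<Longrightarrow> diffeo \<O> \<O> (\<lambda>x. x) (\<lambda>x. x)"
 by unfold_locales (auto intro: smooth_on_id)

text \<open>Multiplication by \<open>\<phi>\<close> is a weighted pullback along the identity.\<close>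

lemma dist_mult_distributions:
 fixes \<O> :: "(real^'n::finite) set"
 assumes \<O>: "open \<O>" and \<phi>: "\<phi> \<in> test_functions \<O>" and u: "u \<in> distributions \<O>"
 shows "dist_mult \<phi> u \<in> distributions \<O>"
proof -
 interpret I: diffeo \<O> \<O> "\<lambda>x. x" "\<lambda>x. x" by (rule diffeo_id[OF \<O>])
 interpret lf_pullback test_seminorms "test_function_family \<O>" test_seminorms "test_function_family \<O>" "\<lambda>\<eta> x. \<phi> x * \<eta> x"
 proof
  show "directed_spaces (test_function_family \<O>)" by (rule directed_test_function_family)
  show "\<exists>B. \<forall>c. p (\<lambda>x. c * f x) \<le> \<bar>c\<bar> * B" if "p \<in> test_seminorms" "f \<in> \<Union>(test_function_family \<O>)" for p f
   using that by (rule test_seminorm_homogeneous)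
  show "(\<lambda>x. \<phi> x * (a * f x + b * g x)) = (\<lambda>x. a * (\<phi> x * f x) + b * (\<phi> x * g x))" for f g a b
   by (simp add: algebra_simps)
  show "\<exists>D\<in>test_function_family \<O>. (\<lambda>\<eta> x. \<phi> x * \<eta> x) ` D' \<subseteq> D" if "D' \<in> test_function_family \<O>" for D'
   using that test_functions_smooth[OF \<phi>]
   by (intro bexI[OF _ that]) (auto simp: test_function_family_def test_functions_in_def intro!: smooth_on_mult)
  show "\<exists>F C. finite F \<and> F \<subseteq> test_seminorms \<and> C > 0 \<and> (\<forall>f\<in>D'. p (\<lambda>x. c * (\<phi> x * f x)) \<le> C * (\<Sum>p'\<in>F. p' f))"
   if p: "p \<in> test_seminorms" and D': "D' \<in> test_function_family \<O>" for p D' c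
  proof -
   obtain \<nu> where p: "p = sup_seminorm \<nu>" using p by (auto simp: test_seminorms_eq)
   obtain F C where F: "finite F" "F \<subseteq> test_seminorms" "C > 0"
    "\<And>\<eta> y. \<eta> \<in> test_functions \<O> \<Longrightarrow> \<bar>pds (list_of \<nu>) (pull (\<lambda>x. c * \<phi> x) (\<lambda>x. x) \<eta>) y\<bar> \<le> C * (\<Sum>p\<in>F. p \<eta>)"
    using I.pull_seminorm_bound[where js = "list_of \<nu>" and V = \<O>, OF test_functions_cmult[OF \<phi>, of c]] by blast
   have "p (\<lambda>x. c * (\<phi> x * f x)) \<le> C * (\<Sum>p'\<in>F. p' f)" if "f \<in> D'" for f
   proof -
    have "f \<in> test_functions \<O>" using that D' by (auto simp: test_functions_def)
    from F(4)[OF this] show ?thesis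
     unfolding p by (intro sup_seminorm_le) (simp add: mpd_eq_pds pull_def mult.assoc)
   qed
   with F(1-3) show ?thesis by blast
  qed
 qed
 show ?thesis using lf_dual_pullback u by (simp add: distributions_def dist_mult_def)
qed

section \<open>Smooth maps between manifolds in charts\<close>

definition smooth_at :: "('a::euclidean_space \<Rightarrow> 'b::euclidean_space) \<Rightarrow> 'a \<Rightarrow> bool" where
 "smooth_at f z \<longleftrightarrow> (\<exists>N. open N \<and> z \<in> N \<and> smooth_on N f)"

lemma smooth_atI: "open N \<Longrightarrow> z \<in> N \<Longrightarrow> smooth_on N f \<Longrightarrow> smooth_at f z"
 by (auto simp: smooth_at_def)

lemma smooth_on_smooth_at: "(\<And>z. z \<in> S \<Longrightarrow> smooth_at f z) \<Longrightarrow> smooth_on S f"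
 unfolding smooth_at_def by (rule smooth_on_local)

lemma smooth_at_cong:
 assumes "smooth_at f z" "open N" "z \<in> N" "\<And>w. w \<in> N \<Longrightarrow> f w = g w"
 shows "smooth_at g z"
proof -
 obtain M where M: "open M" "z \<in> M" "smooth_on M f" using assms(1) by (auto simp: smooth_at_def)
 have "smooth_on (M \<inter> N) g"
  by (rule smooth_on_cong[OF open_Int[OF M(1) assms(2)] _ smooth_on_subset[OF M(3)]]) (use assms(4) in auto)
 thus ?thesis using M assms by (intro smooth_atI[of "M \<inter> N"]) auto
qed

lemma smooth_at_nbhd:
 assumes "smooth_at f z" "open V" "f z \<in> V"
 obtains N where "open N" "z \<in> N" "f ` N \<subseteq> V" "smooth_on N f"
proof -
 obtain M where M: "open M" "z \<in> M" "smooth_on M f" using assms(1) by (auto simp: smooth_at_def)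
 have "open (M \<inter> f -` V)" by (rule continuous_open_preimage[OF smooth_on_continuous[OF M(3)] M(1) assms(2)])
 thus thesis using M assms by (intro that[of "M \<inter> f -` V"]) (auto intro: smooth_on_subset)
qed

lemma smooth_at_compose:
 assumes f: "smooth_at f z" and g: "smooth_at g (f z)"
 shows "smooth_at (\<lambda>w. g (f w)) z"
proof -
 obtain V where V: "open V" "f z \<in> V" "smooth_on V g" using g by (auto simp: smooth_at_def)
 obtain N where N: "open N" "z \<in> N" "f ` N \<subseteq> V" "smooth_on N f" by (rule smooth_at_nbhd[OF f V(1,2)])
 show ?thesis by (rule smooth_atI[OF N(1,2) smooth_on_compose[OF N(1,3,4) V(3)]])
qed

lemma smooth_at_binary:
 assumes "smooth_at f z" "smooth_at g z"
  and "\<And>N. open N \<Longrightarrow> smooth_on N f \<Longrightarrow> smooth_on N g \<Longrightarrow> smooth_on N h"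
 shows "smooth_at h z"
proof -
 obtain M N where M: "open M" "z \<in> M" "smooth_on M f" and N: "open N" "z \<in> N" "smooth_on N g"
  using assms(1,2) by (auto simp: smooth_at_def)
 show ?thesis
  by (rule smooth_atI[of "M \<inter> N"]) (use M N in \<open>auto intro!: assms(3) intro: smooth_on_subset\<close>)
qed

lemma smooth_at_Pair: "smooth_at f z \<Longrightarrow> smooth_at g z \<Longrightarrow> smooth_at (\<lambda>w. (f w, g w)) z"
 by (erule smooth_at_binary, assumption, rule smooth_on_Pair)

lemma smooth_at_const: "smooth_at (\<lambda>w. c) z"
 by (rule smooth_atI[OF open_UNIV UNIV_I smooth_on_const[OF open_UNIV]])

lemma smooth_at_nth: "smooth_at f z \<Longrightarrow> smooth_at (\<lambda>w. f w $ i) z"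
 unfolding smooth_at_def using smooth_on_nth by blast

lemma smooth_at_has_derivative:
 "smooth_at f z \<Longrightarrow> (f has_derivative frechet_derivative f (at z)) (at z)"
 unfolding smooth_at_def using smooth_on_has_derivative by blast

lemma chart_facts:
 assumes "is_chart (U, \<phi>)"
 shows "open U" "open (\<phi> ` U)" "inj_on \<phi> U" "continuous_on U \<phi>" "continuous_on (\<phi> ` U) (inv_into U \<phi>)"
proof -
 obtain g where g: "homeomorphism U (\<phi> ` U) \<phi> g" and o: "open U" "open (\<phi> ` U)" using assms by auto
 show "open U" "open (\<phi> ` U)" "continuous_on U \<phi>" using g o by (auto simp: homeomorphism_def)
 have gx: "g (\<phi> x) = x" if "x \<in> U" for x using g that by (auto simp: homeomorphism_def)
 show inj: "inj_on \<phi> U" by (rule inj_on_inverseI[of _ g]) (rule gx)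
 have "inv_into U \<phi> z = g z" if "z \<in> \<phi> ` U" for z
  using that inv_into_f_f[OF inj] gx by auto
 thus "continuous_on (\<phi> ` U) (inv_into U \<phi>)"
  using g by (simp add: homeomorphism_def cong: continuous_on_cong)
qed

lemma chart_inv:
 assumes "is_chart (U, \<phi>)"
 shows "x \<in> U \<Longrightarrow> inv_into U \<phi> (\<phi> x) = x" "z \<in> \<phi> ` U \<Longrightarrow> inv_into U \<phi> z \<in> U" "z \<in> \<phi> ` U \<Longrightarrow> \<phi> (inv_into U \<phi> z) = z"
 using chart_facts(3)[OF assms] by (auto simp: inv_into_into f_inv_into_f)

lemma chart_image_Int:
 assumes c: "is_chart (U, \<phi>)"
 shows "\<phi> ` (U \<inter> V) = \<phi> ` U \<inter> inv_into U \<phi> -` V"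
 using chart_inv[OF c] by auto

lemma chart_open_image:
 assumes c: "is_chart (U, \<phi>)" and V: "open V"
 shows "open (\<phi> ` (U \<inter> V))"
 unfolding chart_image_Int[OF c] using chart_facts[OF c] V by (intro continuous_open_preimage) auto

lemma compatible_smooth_at:
 assumes c: "is_chart (U, \<phi>)" and d: "is_chart (V, \<psi>)" and k: "compatible (U, \<phi>) (V, \<psi>)" and x: "x \<in> U" "x \<in> V"
 shows "smooth_at (\<lambda>z. \<psi> (inv_into U \<phi> z)) (\<phi> x)" "smooth_at (\<lambda>z. \<phi> (inv_into V \<psi> z)) (\<psi> x)"
proof -
 show "smooth_at (\<lambda>z. \<psi> (inv_into U \<phi> z)) (\<phi> x)"
  using k x by (intro smooth_atI[OF chart_open_image[OF c chart_facts(1)[OF d]]]) (auto simp: o_def)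
 have "smooth_on (\<psi> ` (V \<inter> U)) (\<lambda>z. \<phi> (inv_into V \<psi> z))" using k by (auto simp: o_def Int_commute)
 thus "smooth_at (\<lambda>z. \<phi> (inv_into V \<psi> z)) (\<psi> x)"
  using x by (intro smooth_atI[OF chart_open_image[OF d chart_facts(1)[OF c]]]) auto
qed

text \<open>Two smooth charts are compatible with each other because both are compatible with a chart
  of the atlas around the point.\<close>

lemma smooth_charts_smooth_at:
 assumes A: "smooth_manifold A" and c: "smooth_chart A (U, \<phi>)" and d: "smooth_chart A (V, \<psi>)" and x: "x \<in> U" "x \<in> V"
 shows "smooth_at (\<lambda>z. \<psi> (inv_into U \<phi> z)) (\<phi> x)"
proof -
 have cc: "is_chart (U, \<phi>)" and cd: "is_chart (V, \<psi>)" using c d by (auto simp: smooth_chart_def)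
 have "x \<in> points A" using c x by (auto simp: smooth_chart_def)
 then obtain W \<omega> where W: "(W, \<omega>) \<in> A" "x \<in> W" by (auto simp: points_def)
 have cW: "is_chart (W, \<omega>)" using A W by (auto simp: smooth_manifold_def)
 have 1: "smooth_at (\<lambda>z. \<omega> (inv_into U \<phi> z)) (\<phi> x)"
  using compatible_smooth_at(1)[OF cc cW _ x(1) W(2)] c W(1) by (auto simp: smooth_chart_def)
 have "smooth_at (\<lambda>z. \<psi> (inv_into W \<omega> z)) (\<omega> x)"
  using compatible_smooth_at(2)[OF cd cW _ x(2) W(2)] d W(1) by (auto simp: smooth_chart_def)
 hence "smooth_at (\<lambda>z. \<psi> (inv_into W \<omega> z)) (\<omega> (inv_into U \<phi> (\<phi> x)))" using chart_inv(1)[OF cc x(1)] by simp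
 from smooth_at_compose[OF 1 this]
 show ?thesis
  by (rule smooth_at_cong[OF _ chart_open_image[OF cc chart_facts(1)[OF cW]]])
    (use x W(2) chart_inv[OF cc] chart_inv[OF cW] in auto)
qed

text \<open>A smooth map is given by smooth expressions in some charts around each point; compatibility carries
  this over to prescribed charts of the atlases.\<close>

lemma smooth_map_at:
 assumes f: "smooth_map A B f" and c: "(U0, \<phi>0) \<in> A" "is_chart (U0, \<phi>0)" and d: "(V0, \<psi>0) \<in> B" "is_chart (V0, \<psi>0)"
  and x: "x \<in> U0" "f x \<in> V0"
 shows "smooth_at (\<lambda>z. \<psi>0 (f (inv_into U0 \<phi>0 z))) (\<phi>0 x)"
  and "\<exists>N. open N \<and> \<phi>0 x \<in> N \<and> N \<subseteq> \<phi>0 ` U0 \<and> (\<forall>z\<in>N. f (inv_into U0 \<phi>0 z) \<in> V0)"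
proof -
 have "x \<in> points A" using c x unfolding points_def by force
 then obtain U \<phi> V \<psi> where UV: "smooth_chart A (U, \<phi>)" "smooth_chart B (V, \<psi>)" "x \<in> U" "f ` U \<subseteq> V"
   "smooth_on (\<phi> ` U) (\<psi> \<circ> f \<circ> inv_into U \<phi>)"
  using f unfolding smooth_map_def by blast
 have cU: "is_chart (U, \<phi>)" and cV: "is_chart (V, \<psi>)" using UV by (auto simp: smooth_chart_def)
 have fx: "f x \<in> V" using UV by auto
 have 1: "smooth_at (\<lambda>z. \<phi> (inv_into U0 \<phi>0 z)) (\<phi>0 x)"
  using compatible_smooth_at(2)[OF cU c(2) _ UV(3) x(1)] UV(1) c(1) by (auto simp: smooth_chart_def)
 have 2: "smooth_at (\<lambda>z. \<psi> (f (inv_into U \<phi> z))) (\<phi> (inv_into U0 \<phi>0 (\<phi>0 x)))"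
  using UV(3,5) chart_inv(1)[OF c(2) x(1)] by (intro smooth_atI[OF chart_facts(2)[OF cU]]) (auto simp: o_def)
 note s12 = smooth_at_compose[OF 1 2]
 have e: "inv_into U0 \<phi>0 (\<phi>0 x) = x" "inv_into U \<phi> (\<phi> x) = x" using chart_inv(1) c cU x UV by auto
 have 3: "smooth_at (\<lambda>z. \<psi>0 (inv_into V \<psi> z)) (\<psi> (f (inv_into U \<phi> (\<phi> (inv_into U0 \<phi>0 (\<phi>0 x))))))"
  using compatible_smooth_at(1)[OF cV d(2) _ fx x(2)] UV(2) d(1) unfolding e by (auto simp: smooth_chart_def)
 note op = chart_open_image[OF c(2) chart_facts(1)[OF cU]]
 have in_op: "\<phi>0 x \<in> \<phi>0 ` (U0 \<inter> U)" using x UV by auto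
 have eq: "inv_into U \<phi> (\<phi> (inv_into U0 \<phi>0 z)) = inv_into U0 \<phi>0 z"
  "f (inv_into U0 \<phi>0 z) \<in> V" if "z \<in> \<phi>0 ` (U0 \<inter> U)" for z
  using that chart_inv(1)[OF c(2)] chart_inv(1)[OF cU] UV(4) by auto
 show "smooth_at (\<lambda>z. \<psi>0 (f (inv_into U0 \<phi>0 z))) (\<phi>0 x)"
  by (rule smooth_at_cong[OF smooth_at_compose[OF s12 3] op in_op]) (use eq chart_inv(1)[OF cV] in auto)
 have "\<psi> (f (inv_into U \<phi> (\<phi> (inv_into U0 \<phi>0 (\<phi>0 x))))) \<in> \<psi> ` (V \<inter> V0)" using x fx e by auto
 from smooth_at_nbhd[OF s12 chart_open_image[OF cV chart_facts(1)[OF d(2)]] this]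
 obtain N where N: "open N" "\<phi>0 x \<in> N" "(\<lambda>z. \<psi> (f (inv_into U \<phi> (\<phi> (inv_into U0 \<phi>0 z))))) ` N \<subseteq> \<psi> ` (V \<inter> V0)" .
 show "\<exists>N. open N \<and> \<phi>0 x \<in> N \<and> N \<subseteq> \<phi>0 ` U0 \<and> (\<forall>z\<in>N. f (inv_into U0 \<phi>0 z) \<in> V0)"
 proof (intro exI[of _ "N \<inter> \<phi>0 ` (U0 \<inter> U)"] conjI ballI)
  fix z assume z: "z \<in> N \<inter> \<phi>0 ` (U0 \<inter> U)"
  hence "\<psi> (f (inv_into U0 \<phi>0 z)) \<in> \<psi> ` (V \<inter> V0)" using N(3) eq by auto
  thus "f (inv_into U0 \<phi>0 z) \<in> V0"
   using eq(2)[of z] z chart_facts(3)[OF cV] by (auto dest: inj_onD)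
 qed (use N op in_op in auto)
qed

lemma smooth_map_open_preimage:
 assumes f: "smooth_map A B f" and O: "open O'"
 shows "open {x \<in> points A. f x \<in> O'}"
proof (subst open_subopen, intro ballI)
 fix x assume x: "x \<in> {x \<in> points A. f x \<in> O'}"
 then obtain U \<phi> V \<psi> where UV: "smooth_chart A (U, \<phi>)" "smooth_chart B (V, \<psi>)" "x \<in> U" "f ` U \<subseteq> V"
   "smooth_on (\<phi> ` U) (\<psi> \<circ> f \<circ> inv_into U \<phi>)"
  using f unfolding smooth_map_def by blast
 have cU: "is_chart (U, \<phi>)" and cV: "is_chart (V, \<psi>)" using UV by (auto simp: smooth_chart_def)
 have s: "smooth_at (\<lambda>z. \<psi> (f (inv_into U \<phi> z))) (\<phi> x)"
  using UV(3,5) by (intro smooth_atI[OF chart_facts(2)[OF cU]]) (auto simp: o_def)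
 have "\<psi> (f (inv_into U \<phi> (\<phi> x))) \<in> \<psi> ` (V \<inter> O')" using x UV chart_inv(1)[OF cU UV(3)] by auto
 from smooth_at_nbhd[OF s chart_open_image[OF cV O] this]
 obtain N where N: "open N" "\<phi> x \<in> N" "(\<lambda>z. \<psi> (f (inv_into U \<phi> z))) ` N \<subseteq> \<psi> ` (V \<inter> O')" .
 show "\<exists>T. open T \<and> x \<in> T \<and> T \<subseteq> {x \<in> points A. f x \<in> O'}"
 proof (intro exI[of _ "U \<inter> \<phi> -` N"] conjI subsetI)
  show "open (U \<inter> \<phi> -` N)" using chart_facts[OF cU] N(1) by (intro continuous_open_preimage) auto
  show "x \<in> U \<inter> \<phi> -` N" using UV N by auto
  fix y assume y: "y \<in> U \<inter> \<phi> -` N"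
  hence "\<psi> (f (inv_into U \<phi> (\<phi> y))) \<in> \<psi> ` (V \<inter> O')" using N(3) by auto
  hence "\<psi> (f y) \<in> \<psi> ` (V \<inter> O')" using chart_inv(1)[OF cU] y by auto
  moreover have "f y \<in> V" using y UV by auto
  ultimately have "f y \<in> O'" using chart_facts(3)[OF cV] by (auto dest: inj_onD)
  thus "y \<in> {x \<in> points A. f x \<in> O'}" using y UV(1) by (auto simp: smooth_chart_def)
 qed
qed

lemma is_chart_restrict:
 assumes c: "is_chart (U, \<phi>)" and W: "open W"
 shows "is_chart (U \<inter> W, \<phi>)"
proof -
 obtain g where "homeomorphism U (\<phi> ` U) \<phi> g" using c by auto
 hence "homeomorphism (U \<inter> W) (\<phi> ` (U \<inter> W)) \<phi> g"
  by (rule homeomorphism_of_subsets) auto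
 thus ?thesis using chart_facts(1)[OF c] W chart_open_image[OF c W] by auto
qed

lemma is_chart_Times:
 fixes \<phi> :: "'a::topological_space \<Rightarrow> 'b::euclidean_space"
 assumes c: "is_chart (U, \<phi>)"
 shows "is_chart (U \<times> (UNIV :: 'c::euclidean_space set), map_prod \<phi> (\<lambda>x. x))"
proof -
 obtain g where g: "homeomorphism U (\<phi> ` U) \<phi> g" using c by auto
 have im: "map_prod \<phi> (\<lambda>x. x) ` (U \<times> (UNIV :: 'c set)) = \<phi> ` U \<times> UNIV" by (auto simp: map_prod_def)
 have "homeomorphism (U \<times> (UNIV :: 'c set)) (\<phi> ` U \<times> UNIV) (map_prod \<phi> (\<lambda>x. x)) (map_prod g (\<lambda>x. x))"
  using g unfolding homeomorphism_def map_prod_def case_prod_beta'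
  by (auto intro!: continuous_on_Pair continuous_on_compose2[of _ _ _ fst] continuous_on_fst continuous_on_snd continuous_on_id)
    (auto simp: image_iff intro!: bexI rev_image_eqI)
 thus ?thesis using chart_facts[OF c] by (auto simp: im intro!: open_Times)
qed

lemma is_chart_id: "is_chart (UNIV, \<lambda>x. x)"
 by (auto simp: homeomorphism_def intro!: exI[of _ "\<lambda>x. x"])

lemma diffeo_charts:
 fixes \<phi> \<psi> :: "'m::{t2_space,second_countable_topology} \<Rightarrow> real^'n::finite"
 assumes A: "smooth_manifold A" and c: "smooth_chart A (U, \<phi>)" and d: "smooth_chart A (V, \<psi>)"
 shows "diffeo (\<phi> ` (U \<inter> V)) (\<psi> ` (U \<inter> V)) (\<lambda>z. \<psi> (inv_into U \<phi> z)) (\<lambda>z. \<phi> (inv_into V \<psi> z))"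
proof -
 have cc: "is_chart (U, \<phi>)" and cd: "is_chart (V, \<psi>)" using c d by (auto simp: smooth_chart_def)
 show ?thesis
 proof
  show "open (\<phi> ` (U \<inter> V))" "open (\<psi> ` (U \<inter> V))"
   using chart_open_image[OF cc chart_facts(1)[OF cd]] chart_open_image[OF cd chart_facts(1)[OF cc]] by (simp_all add: Int_commute)
  show "smooth_on (\<phi> ` (U \<inter> V)) (\<lambda>z. \<psi> (inv_into U \<phi> z))"
   by (rule smooth_on_smooth_at) (use smooth_charts_smooth_at[OF A c d] in auto)
  show "smooth_on (\<psi> ` (U \<inter> V)) (\<lambda>z. \<phi> (inv_into V \<psi> z))"
   by (rule smooth_on_smooth_at) (use smooth_charts_smooth_at[OF A d c] in auto)
 qed (use chart_inv[OF cc] chart_inv[OF cd] in auto)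
qed

section \<open>Tangent frames and densities\<close>

lemma transition_cocycle:
 assumes A: "smooth_manifold A" and c: "smooth_chart A c" "x \<in> fst c" and d: "smooth_chart A d" "x \<in> fst d"
  and e: "smooth_chart A e" "x \<in> fst e"
 shows "transition_deriv d e x (transition_deriv c d x v) = transition_deriv c e x v"
proof -
 obtain U \<phi> where c': "c = (U, \<phi>)" by force
 obtain V \<psi> where d': "d = (V, \<psi>)" by force
 obtain W \<omega> where e': "e = (W, \<omega>)" by force
 have cc: "is_chart (U, \<phi>)" and cd: "is_chart (V, \<psi>)" using c d by (auto simp: smooth_chart_def c' d')
 note 1 = smooth_at_has_derivative[OF smooth_charts_smooth_at[OF A c(1)[unfolded c'] d(1)[unfolded d']]]
 have 2: "((\<lambda>z. \<omega> (inv_into V \<psi> z)) has_derivative frechet_derivative (\<lambda>z. \<omega> (inv_into V \<psi> z)) (at (\<psi> x))) (at (\<psi> (inv_into U \<phi> (\<phi> x))))"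
  using smooth_at_has_derivative[OF smooth_charts_smooth_at[OF A d(1)[unfolded d'] e(1)[unfolded e']]] d e c chart_inv(1)[OF cc]
  by (simp add: c' d' e')
 have "((\<lambda>z. \<omega> (inv_into V \<psi> (\<psi> (inv_into U \<phi> z)))) has_derivative
   (\<lambda>v. frechet_derivative (\<lambda>z. \<omega> (inv_into V \<psi> z)) (at (\<psi> x)) (frechet_derivative (\<lambda>z. \<psi> (inv_into U \<phi> z)) (at (\<phi> x)) v))) (at (\<phi> x))"
  by (rule has_derivative_compose[OF 1 2]) (use c d in \<open>auto simp: c' d'\<close>)
 hence "((\<lambda>z. \<omega> (inv_into U \<phi> z)) has_derivative
   (\<lambda>v. frechet_derivative (\<lambda>z. \<omega> (inv_into V \<psi> z)) (at (\<psi> x)) (frechet_derivative (\<lambda>z. \<psi> (inv_into U \<phi> z)) (at (\<phi> x)) v))) (at (\<phi> x))"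
  by (rule has_derivative_transform_within_open[OF _ chart_open_image[OF cc chart_facts(1)[OF cd]]])
    (use c d chart_inv(1)[OF cc] chart_inv(1)[OF cd] in \<open>auto simp: c' d'\<close>)
 from frechet_derivative_at[OF this] show ?thesis
  by (simp add: transition_deriv_def c' d' e' o_def) (metis (no_types))
qed

lemma transition_self:
 assumes c: "smooth_chart A c" "x \<in> fst c"
 shows "transition_deriv c c x v = v"
proof -
 obtain U \<phi> where c': "c = (U, \<phi>)" by force
 have cc: "is_chart (U, \<phi>)" using c by (auto simp: smooth_chart_def c')
 have "((\<lambda>z. \<phi> (inv_into U \<phi> z)) has_derivative (\<lambda>v. v)) (at (\<phi> x))"
  by (rule has_derivative_transform_within_open[OF has_derivative_ident chart_facts(2)[OF cc]])
    (use c chart_inv[OF cc] in \<open>auto simp: c'\<close>)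
 from frechet_derivative_at[OF this] show ?thesis by (simp add: transition_deriv_def c' o_def) (metis)
qed

lemma transition_linear:
 assumes A: "smooth_manifold A" and c: "smooth_chart A c" "x \<in> fst c" and d: "smooth_chart A d" "x \<in> fst d"
 shows "linear (transition_deriv c d x)"
 using has_derivative_linear[OF smooth_at_has_derivative[OF smooth_charts_smooth_at[OF A, of "fst c" "snd c" "fst d" "snd d" x]]] c d
 by (simp add: transition_deriv_def o_def)

text \<open>The transpose of the Jacobian matrix: coordinate frames are arranged by rows in
  \<open>coord_density\<close>.\<close>

definition transition_rows :: "('m, real^'n::finite) chart \<Rightarrow> ('m, real^'n) chart \<Rightarrow> 'm \<Rightarrow> real^'n^'n" where
 "transition_rows c d x = (\<chi> i j. transition_deriv c d x (axis i 1) $ j)"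

lemma transition_expand:
 assumes A: "smooth_manifold A" and c: "smooth_chart A c" "x \<in> fst c" and d: "smooth_chart A d" "x \<in> fst d"
 shows "transition_deriv c d x v $ j = (\<Sum>k\<in>UNIV. v $ k * transition_rows c d x $ k $ j)"
proof -
 note l = transition_linear[OF A c d]
 have "transition_deriv c d x v = transition_deriv c d x (\<Sum>k\<in>UNIV. v $ k *\<^sub>R axis k 1)"
  by (simp add: basis_expansion scalar_mult_eq_scaleR[symmetric])
 thus ?thesis by (simp add: linear_sum[OF l] linear_cmul[OF l] transition_rows_def)
qed

lemma det_transition_rows:
 fixes A :: "('m::{t2_space,second_countable_topology}, real^'n::finite) chart set"
 assumes A: "smooth_manifold A" and c: "smooth_chart A c" "x \<in> fst c" and d: "smooth_chart A d" "x \<in> fst d"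
 shows "det (transition_rows c d x) \<noteq> 0"
proof -
 have "transition_rows d c x ** transition_rows c d x = mat 1" if "smooth_chart A c" "x \<in> fst c" "smooth_chart A d" "x \<in> fst d"
  for c d :: "('m, real^'n) chart"
 proof -
  have "(transition_rows d c x ** transition_rows c d x) $ i $ j = (mat 1 :: real^'n^'n) $ i $ j" for i j
  proof -
   have "(transition_rows d c x ** transition_rows c d x) $ i $ j = transition_deriv c d x (transition_deriv d c x (axis i 1)) $ j"
    using transition_expand[OF A that, of "transition_deriv d c x (axis i 1)" j]
    by (simp add: matrix_matrix_mult_def transition_rows_def)
   also have "\<dots> = axis i 1 $ j"
    using transition_cocycle[OF A that(3,4,1,2,3,4)] transition_self[OF that(3,4)] by simp
   finally show ?thesis by (simp add: mat_def axis_def)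
  qed
  thus ?thesis by (simp add: vec_eq_iff)
 qed
 from this[OF c d] have "det (transition_rows d c x) * det (transition_rows c d x) = 1"
  by (metis det_mul det_I)
 thus ?thesis by auto
qed

lemma coord_density_transition:
 assumes A: "smooth_manifold A" and c: "smooth_chart A c" "x \<in> fst c" and d: "smooth_chart A d" "x \<in> fst d"
 shows "coord_density A d x X = \<bar>det (transition_rows c d x)\<bar> * coord_density A c x X"
proof (cases "\<forall>i. X i \<in> tangent_space A x")
 case True
 have "X i d $ j = (\<Sum>k\<in>UNIV. X i c $ k * transition_rows c d x $ k $ j)" for i j
 proof -
  have "X i d = transition_deriv c d x (X i c)" using True c d unfolding tangent_space_def by blast
  thus ?thesis using transition_expand[OF A c d] by simp
 qed
 hence "(\<chi> i j. X i d $ j) = (\<chi> i j. X i c $ j) ** transition_rows c d x"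
  by (simp add: vec_eq_iff matrix_matrix_mult_def)
 thus ?thesis using True by (simp add: coord_density_def det_mul abs_mult mult.commute)
next
 case False
 thus ?thesis unfolding coord_density_def by (simp only: if_False mult_zero_right)
qed

lemma coord_frame_tangent:
 assumes A: "smooth_manifold A" and c: "smooth_chart A c" "x \<in> fst c"
 shows "coord_frame A c x i \<in> tangent_space A x"
 unfolding tangent_space_def coord_frame_def using transition_cocycle[OF A c] by auto

lemma coord_density_frame:
 assumes A: "smooth_manifold A" and c: "smooth_chart A c" "x \<in> fst c" and d: "smooth_chart A d" "x \<in> fst d"
 shows "coord_density A d x (coord_frame A c x) = \<bar>det (transition_rows c d x)\<bar>"
 using coord_frame_tangent[OF A c] d by (simp add: coord_density_def coord_frame_def transition_rows_def)

lemma smooth_transition_det: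
 fixes \<phi> \<psi> :: "'m::{t2_space,second_countable_topology} \<Rightarrow> real^'n::finite"
 assumes A: "smooth_manifold A" and c: "smooth_chart A (U, \<phi>)" and d: "smooth_chart A (V, \<psi>)"
 shows "smooth_on (\<phi> ` (U \<inter> V)) (\<lambda>z. \<bar>det (transition_rows (U, \<phi>) (V, \<psi>) (inv_into U \<phi> z))\<bar>)"
proof -
 interpret diffeo "\<phi> ` (U \<inter> V)" "\<psi> ` (U \<inter> V)" "\<lambda>z. \<psi> (inv_into U \<phi> z)" "\<lambda>z. \<phi> (inv_into V \<psi> z)"
  by (rule diffeo_charts[OF A c d])
 have cc: "is_chart (U, \<phi>)" using c by (auto simp: smooth_chart_def)
 have e: "transition_rows (U, \<phi>) (V, \<psi>) (inv_into U \<phi> z) $ i $ j = frechet_derivative (\<lambda>z. \<psi> (inv_into U \<phi> z)) (at z) (axis i 1) $ j"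
  if "z \<in> \<phi> ` (U \<inter> V)" for z i j
  using that chart_inv[OF cc] by (auto simp: transition_rows_def transition_deriv_def o_def)
 show ?thesis
 proof (intro smooth_on_abs smooth_on_det open_dom)
  show "det (transition_rows (U, \<phi>) (V, \<psi>) (inv_into U \<phi> z)) \<noteq> 0" if "z \<in> \<phi> ` (U \<inter> V)" for z
   using that chart_inv(1)[OF cc] by (intro det_transition_rows[OF A c _ d]) auto
  show "smooth_on (\<phi> ` (U \<inter> V)) (\<lambda>z. transition_rows (U, \<phi>) (V, \<psi>) (inv_into U \<phi> z) $ i $ j)" for i j
   by (rule smooth_on_cong[OF open_dom _ smooth_on_nth[OF open_dom smooth_on_frechet[OF smooth(1)]]]) (use e in auto)
 qed
qed

lemma tangent_space_lin:
 assumes A: "smooth_manifold A" and X: "\<And>j. X j \<in> tangent_space A x"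
 shows "(\<lambda>c. \<Sum>j\<in>UNIV. a j *\<^sub>R X j c) \<in> tangent_space A (x :: 'm::{t2_space,second_countable_topology})"
 unfolding tangent_space_def
proof (intro CollectI conjI allI impI)
 fix c d assume cd: "smooth_chart A c \<and> x \<in> fst c \<and> smooth_chart A d \<and> x \<in> fst d"
 have l: "linear (transition_deriv c d x)" using cd transition_linear[OF A] by blast
 have "X j d = transition_deriv c d x (X j c)" for j using X[of j] cd unfolding tangent_space_def by blast
 thus "(\<Sum>j\<in>UNIV. a j *\<^sub>R X j d) = transition_deriv c d x (\<Sum>j\<in>UNIV. a j *\<^sub>R X j c)"
  by (simp add: linear_sum[OF l] linear_cmul[OF l])
next
 fix c assume "\<not> (smooth_chart A c \<and> x \<in> fst c)"
 hence "X j c = 0" for j using X[of j] unfolding tangent_space_def by blast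
 thus "(\<Sum>j\<in>UNIV. a j *\<^sub>R X j c) = 0" by simp
qed

lemma coord_density_densities:
 fixes A :: "('m::{t2_space,second_countable_topology}, real^'n::finite) chart set"
 assumes A: "smooth_manifold A"
 shows "(\<lambda>X. s * coord_density A c x X) \<in> densities A x"
 unfolding densities_def
proof (intro CollectI conjI allI impI)
 fix X :: "'n \<Rightarrow> ('m, 'n) tangent" and a :: "real^'n^'n"
 assume X: "\<forall>i. X i \<in> tangent_space A x"
 have t: "(\<lambda>c. \<Sum>j\<in>UNIV. a $ i $ j *\<^sub>R X j c) \<in> tangent_space A x" for i
  by (rule tangent_space_lin[OF A]) (use X in blast)
 have "(\<chi> i. \<Sum>j\<in>UNIV. a $ i $ j *\<^sub>R X j c) = a ** (\<chi> i. X i c)"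
  by (simp add: vec_eq_iff matrix_matrix_mult_def)
 thus "s * coord_density A c x (\<lambda>i c. \<Sum>j\<in>UNIV. a $ i $ j *\<^sub>R X j c) = \<bar>det a\<bar> * (s * coord_density A c x X)"
  using X t by (simp add: coord_density_def det_mul abs_mult)
qed (auto simp: coord_density_def)

section \<open>Local frames of a vector bundle\<close>

lemma points_open_submanifold: "points (open_submanifold A W) = points A \<inter> W"
 unfolding points_def open_submanifold_def by (auto simp: image_iff split_beta')

lemma open_submanifoldI: "(U, \<phi>) \<in> A \<Longrightarrow> (U \<inter> W, \<phi>) \<in> open_submanifold A W"
 unfolding open_submanifold_def by (rule rev_image_eqI) auto

lemma product_euclidI: "(U, \<phi>) \<in> A \<Longrightarrow> (U \<times> UNIV, map_prod \<phi> (\<lambda>v. v)) \<in> product_manifold A euclid"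
 unfolding product_manifold_def euclid_def by auto

locale vector_bundle =
 fixes E :: "('m::{t2_space, second_countable_topology}, 'e::{t2_space, second_countable_topology},
  'n::finite, 'r::finite) vbundle"
 assumes vb: "smooth_vector_bundle E"
begin

lemma base_manifold: "smooth_manifold (base E)"
 using vb by (simp add: smooth_vector_bundle_def)

lemma triple_facts:
 assumes "total_triv_triple E U \<phi> \<rho>"
 shows "smooth_chart (base E) (U, \<phi>)" "is_chart (U, \<phi>)" "U \<subseteq> points (base E)"
  "x \<in> U \<Longrightarrow> linear_iso_on_fibre E x \<rho>"
 using assms by (auto simp: total_triv_triple_def smooth_chart_def local_trivialization_def)

lemma fibre_closed:
 assumes "x \<in> points (base E)" "a \<in> fibre E x"
 shows "vscale E t a \<in> fibre E x" "b \<in> fibre E x \<Longrightarrow> vadd E a b \<in> fibre E x"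
 using vb assms unfolding smooth_vector_bundle_def real_vector_space_on_def by blast+

lemma fibre_frame:
 assumes "total_triv_triple E U \<phi> \<rho>" "x \<in> U"
 shows "fibre_frame E \<rho> x l \<in> fibre E x" "\<rho> (fibre_frame E \<rho> x l) = axis l 1"
 using triple_facts(4)[OF assms] unfolding linear_iso_on_fibre_def fibre_frame_def bij_betw_def
 by (metis UNIV_I inv_into_into) (metis UNIV_I f_inv_into_f triple_facts(4)[OF assms] linear_iso_on_fibre_def bij_betw_def)

text \<open>Over \<open>x\<close>, the map \<open>\<rho>' \<circ> \<rho>\<^sup>-\<^sup>1\<close> is linear, and
  the frame consists of the preimages of the standard basis.\<close>

lemma frame_expand:
 assumes t: "total_triv_triple E U \<phi> \<rho>" and t': "total_triv_triple E U' \<phi>' \<rho>'"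
  and x: "x \<in> U" "x \<in> U'" and a: "a \<in> fibre E x"
 shows "\<rho>' a $ i = (\<Sum>l\<in>UNIV. \<rho> a $ l * \<rho>' (fibre_frame E \<rho> x l) $ i)"
proof -
 let ?I = "inv_into (fibre E x) \<rho>"
 have px: "x \<in> points (base E)" using triple_facts(3)[OF t] x by blast
 have L: "linear_iso_on_fibre E x \<rho>" "linear_iso_on_fibre E x \<rho>'" using triple_facts(4) t t' x by blast+
 hence bij: "inj_on \<rho> (fibre E x)" "\<rho> ` fibre E x = UNIV" by (auto simp: linear_iso_on_fibre_def bij_betw_def)
 have I: "?I v \<in> fibre E x" "\<rho> (?I v) = v" for v
  using bij(2) by (auto intro: inv_into_into f_inv_into_f)
 have inj: "?I v = a" if "a \<in> fibre E x" "\<rho> a = v" for a v using that bij(1) by auto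
 have "linear (\<lambda>v. \<rho>' (?I v))"
 proof
  fix v w :: "real^'r" and t :: real
  have "?I (v + w) = vadd E (?I v) (?I w)"
   using I L fibre_closed(2)[OF px] by (intro inj) (auto simp: linear_iso_on_fibre_def)
  thus "\<rho>' (?I (v + w)) = \<rho>' (?I v) + \<rho>' (?I w)" using I L by (auto simp: linear_iso_on_fibre_def)
  have "?I (t *\<^sub>R v) = vscale E t (?I v)"
   using I L fibre_closed(1)[OF px] by (intro inj) (auto simp: linear_iso_on_fibre_def)
  thus "\<rho>' (?I (t *\<^sub>R v)) = t *\<^sub>R \<rho>' (?I v)" using I L by (auto simp: linear_iso_on_fibre_def)
 qed
 note l = this
 have "\<rho>' a = \<rho>' (?I (\<Sum>l\<in>UNIV. \<rho> a $ l *\<^sub>R axis l 1))"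
  using inj[OF a refl] by (simp add: basis_expansion scalar_mult_eq_scaleR[symmetric])
 thus ?thesis by (simp add: linear_sum[OF l] linear_cmul[OF l] fibre_frame_def)
qed

text \<open>The frame of \<open>\<rho>\<close> is the image of the constant section under the inverse of the diffeomorphism
  \<open>(\<pi>, \<rho>)\<close>; it is smooth, and so are its components with respect to another trivialization.\<close>

lemma smooth_frame:
 assumes t: "total_triv_triple E U \<phi> \<rho>" and t': "total_triv_triple E U' \<phi>' \<rho>'"
  and x: "x \<in> U" "x \<in> U'"
 shows "smooth_at (\<lambda>z. \<rho>' (fibre_frame E \<rho> (inv_into U \<phi> z) l)) (\<phi> x)"
proof -
 let ?A = "base E" and ?P = "preimage E U" and ?P' = "preimage E U'"
 let ?G = "\<lambda>a. (proj E a, \<rho> a)"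
 let ?sub = "open_submanifold (tot E) ?P" and ?sub' = "open_submanifold (tot E) ?P'"
 let ?M = "product_manifold (open_submanifold ?A U) (euclid :: (real^'r, real^'r) chart set)"
 let ?b = "fibre_frame E \<rho> x l"
 note c = triple_facts[OF t] and c' = triple_facts[OF t']
 have oU: "open U" "open U'" using chart_facts(1) c(2) c'(2) by blast+
 have pr: "smooth_map (tot E) ?A (proj E)" "smooth_manifold (tot E)"
  using vb by (auto simp: smooth_vector_bundle_def)
 have oP: "open ?P" "open ?P'"
  unfolding preimage_def using smooth_map_open_preimage[OF pr(1)] oU by blast+
 have psub: "points ?sub = ?P" by (auto simp: points_open_submanifold preimage_def)
 have "local_trivialization E U \<rho>" "local_trivialization E U' \<rho>'" using t t' by (auto simp: total_triv_triple_def)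
 hence inj: "inj_on ?G ?P" and s1: "smooth_map ?M ?sub (inv_into ?P ?G)" and s2: "smooth_map ?sub' euclid \<rho>'"
  by (auto simp: local_trivialization_def diffeomorphism_def bij_betw_def psub)
 have frame_in: "fibre_frame E \<rho> y l \<in> ?P" "inv_into ?P ?G (y, axis l 1) = fibre_frame E \<rho> y l" if "y \<in> U" for y
 proof -
  show f: "fibre_frame E \<rho> y l \<in> ?P"
   using fibre_frame(1)[OF t that] that by (auto simp: preimage_def fibre_def)
  have "?G (fibre_frame E \<rho> y l) = (y, axis l 1)"
   using fibre_frame[OF t that] by (auto simp: fibre_def)
  thus "inv_into ?P ?G (y, axis l 1) = fibre_frame E \<rho> y l"
   using inv_into_f_f[OF inj f] by simp
 qed
 have frame_in': "fibre_frame E \<rho> y l \<in> ?P'" if "y \<in> U" "y \<in> U'" for y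
  using fibre_frame(1)[OF t that(1)] that by (auto simp: preimage_def fibre_def)
 obtain U0 \<phi>0 where U0: "(U0, \<phi>0) \<in> ?A" "x \<in> U0" using x c(3) by (auto simp: points_def)
 have "?b \<in> points (tot E)" using frame_in(1)[OF x(1)] by (simp add: preimage_def)
 then obtain V0 \<psi>0 where V0: "(V0, \<psi>0) \<in> tot E" "?b \<in> V0" by (auto simp: points_def)
 have cU0: "is_chart (U0, \<phi>0)" using base_manifold U0 by (auto simp: smooth_manifold_def)
 have cV0: "is_chart (V0, \<psi>0)" using pr(2) V0 by (auto simp: smooth_manifold_def)
 have sU0: "smooth_chart ?A (U0, \<phi>0)"
  using base_manifold U0 unfolding smooth_chart_def smooth_manifold_def points_def by force
 define C1 where "C1 = (U0 \<inter> U) \<times> (UNIV :: (real^'r) set)"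
 define \<phi>1 where "\<phi>1 = map_prod \<phi>0 (\<lambda>v. v :: real^'r)"
 have cC1: "is_chart (C1, \<phi>1)" unfolding C1_def \<phi>1_def by (intro is_chart_Times is_chart_restrict cU0 oU)
 have mC1: "(C1, \<phi>1) \<in> ?M"
  unfolding C1_def \<phi>1_def by (intro product_euclidI open_submanifoldI U0)
 have cD: "is_chart (V0 \<inter> ?P, \<psi>0)" "is_chart (V0 \<inter> ?P', \<psi>0)" by (intro is_chart_restrict cV0 oP)+
 have mD: "(V0 \<inter> ?P, \<psi>0) \<in> ?sub" "(V0 \<inter> ?P', \<psi>0) \<in> ?sub'"
  using V0 by (auto intro: open_submanifoldI)
 have x1: "(x, axis l 1) \<in> C1" "inv_into ?P ?G (x, axis l 1) \<in> V0 \<inter> ?P"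
  using U0 x V0 frame_in[OF x(1)] by (auto simp: C1_def)
 let ?f1 = "\<lambda>w. inv_into ?P ?G (inv_into C1 \<phi>1 w)"
 note f1 = smooth_map_at[OF s1 mC1 cC1 mD(1) cD(1) x1]
 obtain N where N: "open N" "\<phi>1 (x, axis l 1) \<in> N" "\<And>w. w \<in> N \<Longrightarrow> ?f1 w \<in> V0 \<inter> ?P" using f1(2) by blast
 have f2: "smooth_at (\<lambda>w. \<rho>' (inv_into (V0 \<inter> ?P') \<psi>0 w)) (\<psi>0 ?b)"
  using smooth_map_at(1)[OF s2 mD(2) cD(2), of UNIV "\<lambda>v. v" ?b] V0 frame_in'[OF x] is_chart_id
  by (simp add: euclid_def)
 define h where "h z = (\<phi>0 (inv_into U \<phi> z), axis l 1 :: real^'r)" for z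
 have hs: "smooth_at h (\<phi> x)"
  unfolding h_def by (intro smooth_at_Pair smooth_at_const smooth_charts_smooth_at[OF base_manifold c(1) sU0 x(1) U0(2)])
 have hx: "h (\<phi> x) = \<phi>1 (x, axis l 1)" using chart_inv(1)[OF c(2) x(1)] by (simp add: h_def \<phi>1_def)
 have h1: "?f1 (h z) = fibre_frame E \<rho> (inv_into U \<phi> z) l" if "z \<in> \<phi> ` (U \<inter> U0)" for z
 proof -
  obtain y where y: "y \<in> U" "y \<in> U0" "z = \<phi> y" using \<open>z \<in> \<phi> ` (U \<inter> U0)\<close> by blast
  have "h z = \<phi>1 (y, axis l 1)" using chart_inv(1)[OF c(2) y(1)] by (simp add: h_def y \<phi>1_def)
  moreover have "inv_into C1 \<phi>1 (\<phi>1 (y, axis l 1)) = (y, axis l 1)" using y by (intro chart_inv(1)[OF cC1]) (simp add: C1_def)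
  ultimately show ?thesis using frame_in(2)[OF y(1)] chart_inv(1)[OF c(2) y(1)] by (simp add: y)
 qed
 have xU: "\<phi> x \<in> \<phi> ` (U \<inter> U0)" using x U0 by auto
 have s3: "smooth_at (\<lambda>z. \<psi>0 (?f1 (h z))) (\<phi> x)"
  using f1(1) by (intro smooth_at_compose[OF hs]) (simp add: hx)
 have s4: "smooth_at (\<lambda>z. \<rho>' (inv_into (V0 \<inter> ?P') \<psi>0 (\<psi>0 (?f1 (h z))))) (\<phi> x)"
  using f2 h1[OF xU] chart_inv(1)[OF c(2) x(1)] by (intro smooth_at_compose[OF s3]) simp
 obtain N' where N': "open N'" "\<phi> x \<in> N'" "h ` N' \<subseteq> N" using smooth_at_nbhd[OF hs N(1)] N(2) hx by metis
 show ?thesis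
 proof (rule smooth_at_cong[OF s4, of "N' \<inter> \<phi> ` (U \<inter> (U0 \<inter> U'))"])
  show "open (N' \<inter> \<phi> ` (U \<inter> (U0 \<inter> U')))"
   using N'(1) chart_open_image[OF c(2)] chart_facts(1)[OF cU0] oU by blast
  show "\<phi> x \<in> N' \<inter> \<phi> ` (U \<inter> (U0 \<inter> U'))" using N' x U0 by auto
  fix z assume z: "z \<in> N' \<inter> \<phi> ` (U \<inter> (U0 \<inter> U'))"
  have e: "?f1 (h z) = fibre_frame E \<rho> (inv_into U \<phi> z) l" using z by (intro h1) auto
  have "?f1 (h z) \<in> V0" using N(3) N'(3) z by blast
  moreover have "fibre_frame E \<rho> (inv_into U \<phi> z) l \<in> ?P'"
   using z chart_inv(1)[OF c(2)] by (intro frame_in') auto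
  ultimately have "fibre_frame E \<rho> (inv_into U \<phi> z) l \<in> V0 \<inter> ?P'" unfolding e by blast
  thus "\<rho>' (inv_into (V0 \<inter> ?P') \<psi>0 (\<psi>0 (?f1 (h z)))) = \<rho>' (fibre_frame E \<rho> (inv_into U \<phi> z) l)"
   unfolding e using chart_inv(1)[OF cD(2)] by simp
 qed
qed

lemma smooth_function_in_chart:
 assumes \<psi>: "smooth_map (base E) euclid \<psi>" and c: "smooth_chart (base E) (U, \<phi>)"
 shows "smooth_on (\<phi> ` U) (\<lambda>z. \<psi> (inv_into U \<phi> z) :: real)"
proof (rule smooth_on_smooth_at)
 fix z assume "z \<in> \<phi> ` U"
 then obtain x where x: "x \<in> U" "z = \<phi> x" by blast
 have cc: "is_chart (U, \<phi>)" using c by (simp add: smooth_chart_def)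
 obtain U0 \<phi>0 where U0: "(U0, \<phi>0) \<in> base E" "x \<in> U0" using x c by (auto simp: points_def smooth_chart_def)
 have cU0: "is_chart (U0, \<phi>0)" using base_manifold U0 by (auto simp: smooth_manifold_def)
 have sU0: "smooth_chart (base E) (U0, \<phi>0)"
  using base_manifold U0 unfolding smooth_chart_def smooth_manifold_def points_def by force
 have "smooth_at (\<lambda>z. \<psi> (inv_into U0 \<phi>0 z)) (\<phi>0 x)"
  using smooth_map_at(1)[OF \<psi> U0(1) cU0, of UNIV "\<lambda>v. v" x] U0 is_chart_id by (simp add: euclid_def)
 hence "smooth_at (\<lambda>z. \<psi> (inv_into U0 \<phi>0 (\<phi>0 (inv_into U \<phi> z)))) z"
  using chart_inv(1)[OF cc x(1)] unfolding x(2)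
  by (intro smooth_at_compose[OF smooth_charts_smooth_at[OF base_manifold c sU0 x(1) U0(2)]]) simp
 thus "smooth_at (\<lambda>z. \<psi> (inv_into U \<phi> z)) z"
  by (rule smooth_at_cong[OF _ chart_open_image[OF cc chart_facts(1)[OF cU0]]])
    (use x U0 chart_inv(1)[OF cc] chart_inv(1)[OF cU0] in auto)
qed

end

section \<open>Sections with given coefficients in a local frame\<close>

lemma linear_functional_on_sum:
 assumes d: "directed_spaces \<D>" and u: "linear_functional_on (\<Union>\<D>) u" and A: "finite A"
  and f: "\<And>a. a \<in> A \<Longrightarrow> f a \<in> \<Union>\<D>" and ne: "g \<in> \<Union>\<D>"
 shows "(\<lambda>x. \<Sum>a\<in>A. f a x) \<in> \<Union>\<D> \<and> u (\<lambda>x. \<Sum>a\<in>A. f a x) = (\<Sum>a\<in>A. u (f a))"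
 using A f
proof (induction A)
 case empty
 have "u (\<lambda>x. 0 * g x + 0 * g x) = 0 * u g + 0 * u g"
  using u ne unfolding linear_functional_on_def by blast
 thus ?case using directed_spaces_lin[OF d ne ne, of 0 0] by simp
next
 case (insert a A)
 have IH: "(\<lambda>x. \<Sum>a\<in>A. f a x) \<in> \<Union>\<D>" "u (\<lambda>x. \<Sum>a\<in>A. f a x) = (\<Sum>a\<in>A. u (f a))" and fa: "f a \<in> \<Union>\<D>"
  using insert.IH insert.prems by (simp_all only: insert_iff simp_thms)
 have "u (\<lambda>x. f a x + (\<Sum>a\<in>A. f a x)) = u (f a) + u (\<lambda>x. \<Sum>a\<in>A. f a x)"
  using bspec[OF bspec[OF u[unfolded linear_functional_on_def] fa] IH(1), THEN spec, of 1, THEN spec, of 1] by simp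
 thus ?case
  using directed_spaces_lin[OF d fa IH(1), of 1 1] insert.hyps IH(2) by simp
qed

context vector_bundle
begin

lemma section_coeff_linear:
 "section_coeff E U \<phi> \<rho> l (\<lambda>p. a * f p + b * g p) =
  (\<lambda>z. a * section_coeff E U \<phi> \<rho> l f z + b * section_coeff E U \<phi> \<rho> l g z)"
 by (simp add: section_coeff_def Let_def)

lemma smooth_dual_sections_coeff:
 "\<eta> \<in> smooth_dual_sections E \<Longrightarrow> total_triv_triple E U \<phi> \<rho> \<Longrightarrow> smooth_on (\<phi> ` U) (section_coeff E U \<phi> \<rho> l \<eta>)"
 by (simp add: smooth_dual_sections_def)

lemma zero_dual_section: "(\<lambda>p. 0) \<in> smooth_dual_sections E"
proof -
 have "smooth_on (\<phi> ` U) (section_coeff E U \<phi> \<rho> l (\<lambda>p. 0))" if "total_triv_triple E U \<phi> \<rho>" for U \<phi> \<rho> l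
  using smooth_on_const[OF chart_facts(2)[OF triple_facts(2)[OF that]]] by (simp add: section_coeff_def Let_def)
 thus ?thesis by (simp add: smooth_dual_sections_def densities_def)
qed

lemma dual_sections_linear:
 assumes f: "f \<in> smooth_dual_sections E" and g: "g \<in> smooth_dual_sections E"
 shows "(\<lambda>p. a * f p + b * g p) \<in> smooth_dual_sections E"
proof -
 have "smooth_on (\<phi> ` U) (section_coeff E U \<phi> \<rho> l (\<lambda>p. a * f p + b * g p))" if t: "total_triv_triple E U \<phi> \<rho>" for U \<phi> \<rho> l
  using chart_facts(2)[OF triple_facts(2)[OF t]] smooth_dual_sections_coeff[OF f t] smooth_dual_sections_coeff[OF g t]
  unfolding section_coeff_linear by (intro smooth_on_add smooth_on_mult smooth_on_const)
 thus ?thesis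
  using f g unfolding smooth_dual_sections_def densities_def by (simp add: algebra_simps)
qed

definition sections_in :: "'m set \<Rightarrow> ('m, 'e, 'n) dual_section set" where
 "sections_in K = {\<eta> \<in> smooth_dual_sections E. \<forall>x a X. x \<notin> K \<longrightarrow> \<eta> (x, a, X) = 0}"

lemma test_section_family_eq: "test_section_family E = {sections_in K | K. compact K \<and> K \<subseteq> points (base E)}"
 by (simp add: test_section_family_def sections_in_def)

lemma sections_inI: "compact K \<Longrightarrow> K \<subseteq> points (base E) \<Longrightarrow> sections_in K \<in> test_section_family E"
 by (auto simp: test_section_family_eq)

lemma directed_test_section_family: "directed_spaces (test_section_family E)"
 unfolding directed_spaces_def
proof (intro conjI ballI allI)
 show "test_section_family E \<noteq> {}" using sections_inI[of "{}"] by auto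
next
 fix D assume "D \<in> test_section_family E"
 then obtain K where K: "D = sections_in K" by (auto simp: test_section_family_eq)
 show "(\<lambda>x. 0) \<in> D" using zero_dual_section by (simp add: K sections_in_def)
 fix f g and a b :: real assume "f \<in> D" "g \<in> D"
 thus "(\<lambda>x. a * f x + b * g x) \<in> D"
  unfolding K sections_in_def by (simp add: dual_sections_linear)
next
 fix D F assume "D \<in> test_section_family E" "F \<in> test_section_family E"
 then obtain K L where KL: "D = sections_in K" "F = sections_in L" "compact K" "K \<subseteq> points (base E)" "compact L" "L \<subseteq> points (base E)"
  by (auto simp: test_section_family_eq)
 show "\<exists>H\<in>test_section_family E. D \<subseteq> H \<and> F \<subseteq> H"
 proof (rule bexI[of _ "sections_in (K \<union> L)"])
  show "D \<subseteq> sections_in (K \<union> L) \<and> F \<subseteq> sections_in (K \<union> L)" by (auto simp: KL sections_in_def)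
 qed (use KL in \<open>auto intro: sections_inI\<close>)
qed

text \<open>The coefficients are smooth, so their derivatives are bounded on the compact set.\<close>

lemma section_seminorm_homogeneous:
 assumes p: "p \<in> section_seminorms E" and f: "f \<in> \<Union>(test_section_family E)"
 shows "\<exists>B. \<forall>c. p (\<lambda>x. c * f x) \<le> \<bar>c\<bar> * B"
proof -
 obtain U \<phi> \<rho> K \<nu> l where p: "p = (\<lambda>\<eta>. SUP z\<in>\<phi> ` K. \<bar>mpd \<nu> (section_coeff E U \<phi> \<rho> l \<eta>) z\<bar>)"
  and t: "total_triv_triple E U \<phi> \<rho>" and K: "compact K" "K \<noteq> {}" "K \<subseteq> U"
  using p unfolding section_seminorms_def by blast
 note c = triple_facts[OF t]
 have fs: "f \<in> smooth_dual_sections E" using f by (auto simp: test_section_family_eq sections_in_def)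
 let ?h = "section_coeff E U \<phi> \<rho> l f"
 have h: "smooth_on (\<phi> ` U) ?h" by (rule smooth_dual_sections_coeff[OF fs t])
 have K': "compact (\<phi> ` K)" "\<phi> ` K \<subseteq> \<phi> ` U"
  using K continuous_on_subset[OF chart_facts(4)[OF c(2)] K(3)] by (auto intro: compact_continuous_image)
 have "bounded (pds (list_of \<nu>) ?h ` \<phi> ` K)"
  by (rule compact_imp_bounded[OF compact_continuous_image[OF
    continuous_on_subset[OF smooth_on_continuous[OF smooth_on_pds[OF h]] K'(2)] K'(1)]])
 then obtain B where B: "\<And>z. z \<in> \<phi> ` K \<Longrightarrow> \<bar>pds (list_of \<nu>) ?h z\<bar> \<le> B" by (auto simp: bounded_iff)
 have "p (\<lambda>x. c * f x) \<le> \<bar>c\<bar> * B" for c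
  unfolding p
 proof (rule cSUP_least)
  fix z assume z: "z \<in> \<phi> ` K"
  have "section_coeff E U \<phi> \<rho> l (\<lambda>x. c * f x) = (\<lambda>z. c * ?h z)" using section_coeff_linear[of U \<phi> \<rho> l c f 0 f] by simp
  thus "\<bar>mpd \<nu> (section_coeff E U \<phi> \<rho> l (\<lambda>x. c * f x)) z\<bar> \<le> \<bar>c\<bar> * B"
   using B[OF z] pds_cmult[OF chart_facts(2)[OF c(2)] h subsetD[OF K'(2) z], of "list_of \<nu>" c]
   by (simp add: mpd_eq_pds abs_mult mult_left_mono)
 qed (use K in simp)
 thus ?thesis by blast
qed

text \<open>Coefficients of the frame section \<open>\<rho>\<^sup>l \<otimes> |dx\<^sup>1 \<and> \<dots> \<and> dx\<^sup>n|\<close> of the second trivialization with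
  respect to the first one.\<close>

definition frame_change ::
 "'m set \<Rightarrow> ('m \<Rightarrow> real^'n) \<Rightarrow> ('e \<Rightarrow> real^'r) \<Rightarrow> ('m, 'e, 'n, 'r) aug_triv \<Rightarrow> 'r \<Rightarrow> 'r \<Rightarrow> real^'n \<Rightarrow> real" where
 "frame_change U \<phi> \<rho> \<tau> k l z =
  triv \<tau> (fibre_frame E \<rho> (inv_into U \<phi> z) k) $ l *
  \<bar>det (transition_rows (U, \<phi>) (chart_dom \<tau>, chart_map \<tau>) (inv_into U \<phi> z))\<bar>"

abbreviation trivializes :: "('m, 'e, 'n, 'r) aug_triv \<Rightarrow> bool" where
 "trivializes \<tau> \<equiv> total_triv_triple E (chart_dom \<tau>) (chart_map \<tau>) (triv \<tau>)"

lemma smooth_frame_change: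
 assumes t: "total_triv_triple E U \<phi> \<rho>" and t': "trivializes \<tau>"
 shows "smooth_on (\<phi> ` (U \<inter> chart_dom \<tau>)) (frame_change U \<phi> \<rho> \<tau> k l)"
proof -
 let ?V = "\<phi> ` (U \<inter> chart_dom \<tau>)"
 note c = triple_facts[OF t] and c' = triple_facts[OF t']
 have V: "open ?V" using chart_open_image[OF c(2)] chart_facts(1)[OF c'(2)] .
 have "smooth_on ?V (\<lambda>z. triv \<tau> (fibre_frame E \<rho> (inv_into U \<phi> z) k) $ l)"
  by (intro smooth_on_smooth_at smooth_at_nth) (use smooth_frame[OF t t'] in blast)
 thus ?thesis unfolding frame_change_def[abs_def]
  using smooth_transition_det[OF base_manifold c(1) c'(1)] by (intro smooth_on_mult[OF V])
qed

lemma coeff_local_test_section: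
 assumes t: "total_triv_triple E U \<phi> \<rho>" and t': "trivializes \<tau>" and z: "z \<in> \<phi> ` U"
 shows "section_coeff E U \<phi> \<rho> k (local_test_section E \<tau> l \<zeta>) z =
  (if inv_into U \<phi> z \<in> chart_dom \<tau> then \<zeta> (chart_map \<tau> (inv_into U \<phi> z)) * frame_change U \<phi> \<rho> \<tau> k l z else 0)"
proof -
 note c = triple_facts[OF t] and c' = triple_facts[OF t']
 have y: "inv_into U \<phi> z \<in> U" using chart_inv(2)[OF c(2) z] .
 show ?thesis
  using coord_density_frame[OF base_manifold c(1), of "inv_into U \<phi> z" "(chart_dom \<tau>, chart_map \<tau>)"] c'(1) y fibre_frame(1)[OF t y]
  by (simp add: section_coeff_def Let_def local_test_section_def frame_change_def)
qed

lemma chart_compact: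
 assumes t: "trivializes \<tau>" and K: "compact K" "K \<subseteq> image_domain \<tau>"
 shows "compact (inv_into (chart_dom \<tau>) (chart_map \<tau>) ` K)" "inv_into (chart_dom \<tau>) (chart_map \<tau>) ` K \<subseteq> chart_dom \<tau>"
  "x \<in> chart_dom \<tau> \<Longrightarrow> chart_map \<tau> x \<in> K \<Longrightarrow> x \<in> inv_into (chart_dom \<tau>) (chart_map \<tau>) ` K"
proof -
 note c = triple_facts[OF t]
 show "compact (inv_into (chart_dom \<tau>) (chart_map \<tau>) ` K)"
  using K continuous_on_subset[OF chart_facts(5)[OF c(2)]] by (intro compact_continuous_image) (auto simp: image_domain_def)
 show "inv_into (chart_dom \<tau>) (chart_map \<tau>) ` K \<subseteq> chart_dom \<tau>"
  using K chart_inv(2)[OF c(2)] by (auto simp: image_domain_def)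
 show "x \<in> inv_into (chart_dom \<tau>) (chart_map \<tau>) ` K" if "x \<in> chart_dom \<tau>" "chart_map \<tau> x \<in> K"
  using chart_inv(1)[OF c(2) that(1)] that(2) by (metis imageI)
qed

lemma open_image_domain: "trivializes \<tau> \<Longrightarrow> open (image_domain \<tau>)"
 using chart_facts(2)[OF triple_facts(2)] by (simp add: image_domain_def)

text \<open>Points outside the chart domain of \<open>\<tau>\<close> have a neighbourhood in which the
  coefficients vanish, since the preimage of \<open>K\<close> is compact and therefore closed.\<close>

lemma local_test_section_in:
 assumes t': "trivializes \<tau>" and K: "compact K" "K \<subseteq> image_domain \<tau>" and \<zeta>: "\<zeta> \<in> test_functions_in K"
 shows "local_test_section E \<tau> l \<zeta> \<in> sections_in (inv_into (chart_dom \<tau>) (chart_map \<tau>) ` K)"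
proof -
 let ?L = "inv_into (chart_dom \<tau>) (chart_map \<tau>) ` K" and ?g = "local_test_section E \<tau> l \<zeta>"
 note L = chart_compact[OF t' K] and c' = triple_facts[OF t']
 have \<zeta>0: "\<zeta> w = 0" if "w \<notin> K" for w using \<zeta> that by (auto simp: test_functions_in_def)
 have \<zeta>s: "smooth_on UNIV \<zeta>" using \<zeta> by (auto simp: test_functions_in_def)
 have out: "?g (x, a, X) = 0" if "x \<notin> ?L" for x a X
  using L(3)[of x] \<zeta>0[of "chart_map \<tau> x"] that by (auto simp: local_test_section_def)
 have "smooth_on (\<phi> ` U) (section_coeff E U \<phi> \<rho> k ?g)" if t: "total_triv_triple E U \<phi> \<rho>" for U \<phi> \<rho> k
 proof (rule smooth_on_smooth_at)
  note c = triple_facts[OF t]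
  fix z assume "z \<in> \<phi> ` U"
  then obtain x where x: "x \<in> U" "z = \<phi> x" by blast
  show "smooth_at (section_coeff E U \<phi> \<rho> k ?g) z"
  proof (cases "x \<in> chart_dom \<tau>")
   case True
   let ?V = "\<phi> ` (U \<inter> chart_dom \<tau>)" and ?T = "\<lambda>z. chart_map \<tau> (inv_into U \<phi> z)"
   have V: "open ?V" "z \<in> ?V" using chart_open_image[OF c(2) chart_facts(1)[OF c'(2)]] x True by auto
   have "smooth_on ?V ?T" using diffeo.smooth(1)[OF diffeo_charts[OF base_manifold c(1) c'(1)]] .
   hence "smooth_on ?V (\<lambda>z. \<zeta> (?T z))" by (rule smooth_on_compose[OF V(1) subset_UNIV _ \<zeta>s])
   hence "smooth_on ?V (\<lambda>z. \<zeta> (?T z) * frame_change U \<phi> \<rho> \<tau> k l z)"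
    by (rule smooth_on_mult[OF V(1) _ smooth_frame_change[OF t t']])
   hence "smooth_on ?V (section_coeff E U \<phi> \<rho> k ?g)"
    by (rule smooth_on_cong[OF V(1), rotated]) (use coeff_local_test_section[OF t t'] chart_inv(1)[OF c(2)] in auto)
   thus ?thesis by (rule smooth_atI[OF V])
  next
   case False
   let ?V = "\<phi> ` (U \<inter> - ?L)"
   have "x \<in> U \<inter> - ?L" using L(2) False x(1) by blast
   hence V: "open ?V" "z \<in> ?V"
    using chart_open_image[OF c(2)] compact_imp_closed[OF L(1)] x(2) by auto
   have "smooth_on ?V (section_coeff E U \<phi> \<rho> k ?g)"
    by (rule smooth_on_cong[OF V(1) _ smooth_on_const[OF V(1), of 0]])
      (use out chart_inv(1)[OF c(2)] in \<open>auto simp: section_coeff_def Let_def\<close>)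
   thus ?thesis by (rule smooth_atI[OF V])
  qed
 qed
 moreover have "(\<lambda>X. ?g (x, a, X)) \<in> densities (base E) x" for x a
 proof -
  have "(\<lambda>X. ?g (x, a, X)) = (\<lambda>X. (if x \<in> chart_dom \<tau> \<and> a \<in> fibre E x then \<zeta> (chart_map \<tau> x) * (triv \<tau> a $ l) else 0) *
    coord_density (base E) (chart_dom \<tau>, chart_map \<tau>) x X)"
   by (rule ext) (simp add: local_test_section_def)
  thus ?thesis using coord_density_densities[OF base_manifold] by simp
 qed
 moreover have "?g (x, vadd E a b, X) = ?g (x, a, X) + ?g (x, b, X)" "?g (x, vscale E s a, X) = s * ?g (x, a, X)"
  if "x \<in> points (base E)" "a \<in> fibre E x" "b \<in> fibre E x" for x a b X s
  using that fibre_closed[OF that(1,2)] c'(4)[of x]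
  by (auto simp: local_test_section_def linear_iso_on_fibre_def algebra_simps)
 moreover have "?g (x, a, X) = 0" if "\<not> (x \<in> points (base E) \<and> a \<in> fibre E x)" for x a X
  using that c'(3) by (auto simp: local_test_section_def)
 ultimately show ?thesis using out unfolding sections_in_def smooth_dual_sections_def by blast
qed

lemma local_test_section_linear:
 "local_test_section E \<tau> l (\<lambda>z. a * f z + b * g z) = (\<lambda>p. a * local_test_section E \<tau> l f p + b * local_test_section E \<tau> l g p)"
 by (auto simp: local_test_section_def fun_eq_iff algebra_simps)

lemma local_test_section_member:
 assumes "trivializes \<tau>" "\<zeta> \<in> test_functions (image_domain \<tau>)"
 shows "local_test_section E \<tau> l \<zeta> \<in> \<Union>(test_section_family E)"
proof -
 obtain K where K: "compact K" "K \<subseteq> image_domain \<tau>" "\<zeta> \<in> test_functions_in K"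
  using assms(2) by (auto simp: test_functions_def test_function_family_def)
 show ?thesis
 proof (rule UnionI)
  show "local_test_section E \<tau> l \<zeta> \<in> sections_in (inv_into (chart_dom \<tau>) (chart_map \<tau>) ` K)"
   by (rule local_test_section_in[OF assms(1) K])
  show "sections_in (inv_into (chart_dom \<tau>) (chart_map \<tau>) ` K) \<in> test_section_family E"
   using chart_compact[OF assms(1) K(1,2)] triple_facts(3)[OF assms(1)] by (intro sections_inI) auto
 qed
qed

text \<open>In another trivialization the coefficients are a weighted pullback of \<open>f\<close>.  Its weight
  is made compactly supported by a cutoff that is \<open>1\<close> near the compact set where the seminorm sees
  the section.\<close>

lemma local_test_section_bound:
 assumes t': "trivializes \<tau>" and p: "p \<in> section_seminorms E" and D: "D \<in> test_function_family (image_domain \<tau>)"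
 shows "\<exists>F C. finite F \<and> F \<subseteq> test_seminorms \<and> C > 0 \<and>
  (\<forall>f\<in>D. p (\<lambda>x. s * local_test_section E \<tau> l f x) \<le> C * (\<Sum>p'\<in>F. p' f))"
proof -
 obtain U \<phi> \<rho> K \<nu> k where p: "p = (\<lambda>\<eta>. SUP z\<in>\<phi> ` K. \<bar>mpd \<nu> (section_coeff E U \<phi> \<rho> k \<eta>) z\<bar>)"
  and t: "total_triv_triple E U \<phi> \<rho>" and K: "compact K" "K \<noteq> {}" "K \<subseteq> U"
  using p unfolding section_seminorms_def by blast
 obtain K0 where D: "D = test_functions_in K0" and K0: "compact K0" "K0 \<subseteq> image_domain \<tau>"
  using D by (auto simp: test_function_family_def)
 note c = triple_facts[OF t] and c' = triple_facts[OF t'] and L = chart_compact[OF t' K0]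
 let ?L = "inv_into (chart_dom \<tau>) (chart_map \<tau>) ` K0"
 let ?W = "\<phi> ` (U \<inter> chart_dom \<tau>)" and ?T = "\<lambda>z. chart_map \<tau> (inv_into U \<phi> z)"
 interpret diffeo ?W "chart_map \<tau> ` (U \<inter> chart_dom \<tau>)" ?T "\<lambda>z. \<phi> (inv_into (chart_dom \<tau>) (chart_map \<tau>) z)"
  by (rule diffeo_charts[OF base_manifold c(1) c'(1)])
 have "compact (\<phi> ` (K \<inter> ?L))"
 proof (rule compact_continuous_image)
  show "continuous_on (K \<inter> ?L) \<phi>" by (rule continuous_on_subset[OF chart_facts(4)[OF c(2)]]) (use K in auto)
  show "compact (K \<inter> ?L)" using K(1) compact_imp_closed[OF L(1)] by (rule compact_Int_closed)
 qed
 moreover have "\<phi> ` (K \<inter> ?L) \<subseteq> ?W" using K(3) L(2) by blast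
 ultimately obtain \<kappa> O' where \<kappa>: "\<kappa> \<in> test_functions ?W" "open O'" "\<phi> ` (K \<inter> ?L) \<subseteq> O'" "\<And>z. z \<in> O' \<Longrightarrow> \<kappa> z = 1"
  using test_functions_cutoff[OF _ open_dom] by metis
 define m where "m z = s * (\<kappa> z * frame_change U \<phi> \<rho> \<tau> k l z)" for z
 have m: "m \<in> test_functions ?W"
  unfolding m_def[abs_def] by (intro test_functions_cmult test_functions_mult[OF open_dom \<kappa>(1) smooth_frame_change[OF t t']])
 obtain F C where F: "finite F" "F \<subseteq> test_seminorms" "C > 0"
  "\<And>\<eta> y. \<eta> \<in> test_functions (image_domain \<tau>) \<Longrightarrow> \<bar>pds (list_of \<nu>) (pull m ?T \<eta>) y\<bar> \<le> C * (\<Sum>p\<in>F. p \<eta>)"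
  using pull_seminorm_bound[OF m, where js = "list_of \<nu>" and V = "image_domain \<tau>"] by blast
 let ?O = "O' \<inter> ?W \<union> \<phi> ` (U \<inter> - ?L)"
 have O: "open ?O" using \<kappa>(2) open_dom chart_open_image[OF c(2)] compact_imp_closed[OF L(1)] by blast
 have bound: "p (\<lambda>x. s * local_test_section E \<tau> l f x) \<le> C * (\<Sum>p'\<in>F. p' f)" if f: "f \<in> D" for f
  unfolding p
 proof (rule cSUP_least)
  let ?h = "section_coeff E U \<phi> \<rho> k (\<lambda>x. s * local_test_section E \<tau> l f x)"
  have f': "f \<in> test_functions_in K0" "f \<in> test_functions (image_domain \<tau>)"
   using f D K0 by (auto simp: test_functions_def test_function_family_def)
  have f0: "f w = 0" if "w \<notin> K0" for w using f' that by (auto simp: test_functions_in_def)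
  have h: "?h z = (if inv_into U \<phi> z \<in> chart_dom \<tau> then s * (f (?T z) * frame_change U \<phi> \<rho> \<tau> k l z) else 0)"
   if "z \<in> \<phi> ` U" for z
   using coeff_local_test_section[OF t t' that, of k l f] section_coeff_linear[of U \<phi> \<rho> k s "local_test_section E \<tau> l f" 0 "local_test_section E \<tau> l f"]
   by auto
  have e: "pull m ?T f z = ?h z" if z: "z \<in> ?O" for z
  proof (cases "z \<in> O' \<inter> ?W")
   case True
   thus ?thesis using h[of z] \<kappa>(4)[of z] chart_inv(1)[OF c(2)] by (auto simp: pull_def m_def)
  next
   case False
   then obtain y where y: "y \<in> U" "y \<notin> ?L" "z = \<phi> y" using z by blast
   have iy: "inv_into U \<phi> z = y" using chart_inv(1)[OF c(2) y(1)] y(3) by simp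
   show ?thesis
   proof (cases "y \<in> chart_dom \<tau>")
    case True
    hence "f (?T z) = 0" using f0 L(3) y(2) iy by auto
    thus ?thesis using h[of z] y iy by (simp add: pull_def)
   next
    case False
    hence "z \<notin> ?W" using chart_inv(1)[OF c(2)] iy by auto
    hence "m z = 0" by (rule test_functions_outside[OF m])
    thus ?thesis using h[of z] y iy False by (simp add: pull_def)
   qed
  qed
  fix z assume z: "z \<in> \<phi> ` K"
  hence zO: "z \<in> ?O" using \<kappa>(3) K(3) L(2) by blast
  have "pds (list_of \<nu>) (pull m ?T f) z = pds (list_of \<nu>) ?h z"
   using test_functions_smooth[OF test_pull[OF m test_functions_smooth[OF f'(2)]]]
   by (intro pds_cong[OF O e _ zO])
  thus "\<bar>mpd \<nu> ?h z\<bar> \<le> C * (\<Sum>p'\<in>F. p' f)" using F(4)[OF f'(2), of z] by (simp add: mpd_eq_pds)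
 qed (use K in simp)
 show ?thesis using F(1-3) bound by blast
qed

lemma local_rep_distribution:
 assumes t: "trivializes \<tau>" and u: "u \<in> bundle_distributions E"
 shows "local_rep E \<tau> u l \<in> distributions (image_domain \<tau>)"
proof -
 interpret lf_pullback "section_seminorms E" "test_section_family E" test_seminorms
  "test_function_family (image_domain \<tau>)" "local_test_section E \<tau> l"
 proof
  show "\<exists>D\<in>test_section_family E. local_test_section E \<tau> l ` D' \<subseteq> D" if D': "D' \<in> test_function_family (image_domain \<tau>)" for D'
  proof -
   obtain K where K: "D' = test_functions_in K" "compact K" "K \<subseteq> image_domain \<tau>"
    using D' by (auto simp: test_function_family_def)
   show ?thesis
    using local_test_section_in[OF t K(2,3)] chart_compact[OF t K(2,3)] triple_facts(3)[OF t]
    by (intro bexI[OF _ sections_inI[of "inv_into (chart_dom \<tau>) (chart_map \<tau>) ` K"]]) (auto simp: K(1))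
  qed
 qed (rule directed_test_section_family directed_test_function_family section_seminorm_homogeneous
  local_test_section_linear local_test_section_bound[OF t]; assumption?)+
 show ?thesis
  using lf_dual_pullback u by (simp add: distributions_def local_rep_def bundle_distributions_def)
qed

section \<open>Localization by the partition of unity\<close>

text \<open>The part of a section with coefficient \<open>\<xi>\<eta>\<close> that lies over \<open>supp \<psi>\<close> is expressed in the frame of
  the second trivialization, with coefficients obtained from \<open>\<eta>\<close> by the coordinate change and
  multiplication with fixed test functions.  The cutoff \<open>\<kappa>\<close> makes them compactly supported in the
  overlap of the charts; it is invisible after multiplication with \<open>\<psi>\<close> and \<open>\<xi>\<close>.\<close>

lemma localized_section:
 assumes M: "compact (points (base E))" and a: "trivializes \<tau>" and b: "trivializes \<sigma>"
  and supp: "points (base E) \<inter> closure {x \<in> points (base E). \<psi> x \<noteq> 0} \<subseteq> chart_dom \<sigma>"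
  and \<xi>: "\<xi> \<in> test_functions (image_domain \<tau>)"
 shows "\<exists>m. (\<forall>l. m l \<in> test_functions (chart_map \<sigma> ` (chart_dom \<sigma> \<inter> chart_dom \<tau>))) \<and>
  (\<forall>\<eta> x a X. \<psi> x * local_test_section E \<tau> i (\<lambda>z. \<xi> z * \<eta> z) (x, a, X) =
   (\<Sum>l\<in>UNIV. \<psi> x * local_test_section E \<sigma> l
    (pull (m l) (\<lambda>z. chart_map \<tau> (inv_into (chart_dom \<sigma>) (chart_map \<sigma>) z)) \<eta>) (x, a, X)))"
proof -
 note ca = triple_facts[OF a] and cb = triple_facts[OF b]
 let ?W = "chart_map \<sigma> ` (chart_dom \<sigma> \<inter> chart_dom \<tau>)"
 let ?T = "\<lambda>z. chart_map \<tau> (inv_into (chart_dom \<sigma>) (chart_map \<sigma>) z)"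
 let ?S = "points (base E) \<inter> closure {x \<in> points (base E). \<psi> x \<noteq> 0}"
 interpret diffeo ?W "chart_map \<tau> ` (chart_dom \<sigma> \<inter> chart_dom \<tau>)" ?T
   "\<lambda>z. chart_map \<sigma> (inv_into (chart_dom \<tau>) (chart_map \<tau>) z)"
  by (rule diffeo_charts[OF base_manifold cb(1) ca(1)])
 obtain K where K: "compact K" "K \<subseteq> image_domain \<tau>" "\<And>w. w \<notin> K \<Longrightarrow> \<xi> w = 0"
  using \<xi> by (auto simp: test_functions_iff)
 note L = chart_compact[OF a K(1,2)]
 let ?L = "inv_into (chart_dom \<tau>) (chart_map \<tau>) ` K"
 have in_S: "x \<in> ?S" if "x \<in> points (base E)" "\<psi> x \<noteq> 0" for x
  using that by (intro IntI subsetD[OF closure_subset] CollectI conjI)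
 have cpt: "compact (chart_map \<sigma> ` (?S \<inter> ?L))"
 proof (rule compact_continuous_image)
  show "continuous_on (?S \<inter> ?L) (chart_map \<sigma>)"
   by (rule continuous_on_subset[OF chart_facts(4)[OF cb(2)]]) (use supp in blast)
  show "compact (?S \<inter> ?L)"
   by (rule compact_Int_closed[OF compact_Int_closed[OF M closed_closure] compact_imp_closed[OF L(1)]])
 qed
 have sub: "chart_map \<sigma> ` (?S \<inter> ?L) \<subseteq> ?W" using supp L(2) by (intro image_mono Int_mono)
 obtain \<kappa> O' where \<kappa>: "\<kappa> \<in> test_functions ?W" "chart_map \<sigma> ` (?S \<inter> ?L) \<subseteq> O'" "\<And>z. z \<in> O' \<Longrightarrow> \<kappa> z = 1"
  by (rule test_functions_cutoff[OF cpt open_dom sub], rule that)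
 define m where "m l z = \<kappa> z * (\<xi> (?T z) * frame_change (chart_dom \<sigma>) (chart_map \<sigma>) (triv \<sigma>) \<tau> l i z)" for l z
 have m: "m l \<in> test_functions ?W" for l
  unfolding m_def[abs_def]
  by (rule test_functions_mult[OF open_dom \<kappa>(1) smooth_on_mult[OF open_dom
     smooth_on_compose[OF open_dom subset_UNIV smooth(1) test_functions_smooth[OF \<xi>]] smooth_frame_change[OF b a]]])
 have "\<psi> x * local_test_section E \<tau> i (\<lambda>z. \<xi> z * \<eta> z) (x, v, X) =
   (\<Sum>l\<in>UNIV. \<psi> x * local_test_section E \<sigma> l (pull (m l) ?T \<eta>) (x, v, X))" for \<eta> x v X
 proof (cases "x \<in> chart_dom \<sigma> \<and> v \<in> fibre E x")
  case False
  have "\<psi> x * local_test_section E \<tau> i (\<lambda>z. \<xi> z * \<eta> z) (x, v, X) = 0"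
  proof (cases "x \<in> chart_dom \<tau> \<and> v \<in> fibre E x")
   case True
   hence "x \<in> points (base E)" "x \<notin> chart_dom \<sigma>" using ca(3) False by auto
   hence "\<psi> x = 0" using subsetD[OF supp in_S] by blast
   thus ?thesis by simp
  qed (auto simp: local_test_section_def)
  moreover have "local_test_section E \<sigma> l f (x, v, X) = 0" for l f using False by (auto simp: local_test_section_def)
  ultimately show ?thesis by simp
 next
  case True
  hence x: "x \<in> chart_dom \<sigma>" and v: "v \<in> fibre E x" by auto
  let ?z = "chart_map \<sigma> x"
  have iz: "inv_into (chart_dom \<sigma>) (chart_map \<sigma>) ?z = x" using chart_inv(1)[OF cb(2) x] .
  show ?thesis
  proof (cases "x \<in> chart_dom \<tau>")
   case False
   have "?z \<notin> ?W" using False chart_inv(1)[OF cb(2)] iz by auto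
   hence "m l ?z = 0" for l by (rule test_functions_outside[OF m])
   thus ?thesis using False x v by (simp add: local_test_section_def pull_def)
  next
   case xa: True
   let ?cb = "coord_density (base E) (chart_dom \<sigma>, chart_map \<sigma>) x X"
    and ?det = "\<bar>det (transition_rows (chart_dom \<sigma>, chart_map \<sigma>) (chart_dom \<tau>, chart_map \<tau>) x)\<bar>"
   let ?t = "\<psi> x * (\<xi> (chart_map \<tau> x) * \<eta> (chart_map \<tau> x))"
   have \<kappa>1: "?t = ?t * \<kappa> ?z"
   proof (cases "x \<in> ?S \<inter> ?L")
    case True
    hence "?z \<in> O'" using \<kappa>(2) by blast
    from \<kappa>(3)[OF this] show ?thesis by simp
   next
    case False
    have "x \<in> ?S" if "\<psi> x \<noteq> 0"
     by (rule in_S[OF subsetD[OF cb(3) x] that])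
    moreover have "x \<in> ?L" if "\<xi> (chart_map \<tau> x) \<noteq> 0" using that K(3) L(3)[OF xa] by blast
    ultimately have "\<psi> x = 0 \<or> \<xi> (chart_map \<tau> x) = 0" using False by blast
    thus ?thesis by auto
   qed
   have "\<psi> x * local_test_section E \<tau> i (\<lambda>z. \<xi> z * \<eta> z) (x, v, X) = ?t * \<kappa> ?z * (triv \<tau> v $ i) * (?det * ?cb)"
    using xa v coord_density_transition[OF base_manifold cb(1) _ ca(1), of x X] x \<kappa>1
    by (auto simp: local_test_section_def mult.assoc)
   also have "\<dots> = (\<Sum>l\<in>UNIV. ?t * \<kappa> ?z * (triv \<sigma> v $ l * triv \<tau> (fibre_frame E (triv \<sigma>) x l) $ i) * (?det * ?cb))"
    unfolding frame_expand[OF b a x xa v, of i] sum_distrib_left sum_distrib_right ..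
   also have "\<dots> = (\<Sum>l\<in>UNIV. \<psi> x * local_test_section E \<sigma> l (pull (m l) ?T \<eta>) (x, v, X))"
    by (rule sum.cong) (simp_all add: local_test_section_def pull_def m_def frame_change_def iz x v mult_ac)
   finally show ?thesis .
  qed
 qed
 with m show ?thesis by (intro exI[of _ m] conjI allI)
qed

text \<open>The factor \<open>\<psi>\<close> is absorbed into the coefficient.\<close>

lemma pou_local_test_section:
 assumes b: "trivializes \<sigma>" and \<psi>: "smooth_map (base E) euclid \<psi>" and \<zeta>: "\<zeta> \<in> test_functions (image_domain \<sigma>)"
 shows "(\<lambda>p. (case p of (x, a, X) \<Rightarrow> \<psi> x) * local_test_section E \<sigma> l \<zeta> p) \<in> \<Union>(test_section_family E)"
proof -
 note c = triple_facts[OF b]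
 let ?\<zeta> = "\<lambda>z. \<zeta> z * \<psi> (inv_into (chart_dom \<sigma>) (chart_map \<sigma>) z)"
 have "?\<zeta> \<in> test_functions (image_domain \<sigma>)"
  using smooth_function_in_chart[OF \<psi> c(1)] by (intro test_functions_mult open_image_domain b \<zeta>) (simp add: image_domain_def)
 moreover have "local_test_section E \<sigma> l ?\<zeta> = (\<lambda>p. (case p of (x, a, X) \<Rightarrow> \<psi> x) * local_test_section E \<sigma> l \<zeta> p)"
  using chart_inv(1)[OF c(2)] by (auto simp: local_test_section_def fun_eq_iff)
 ultimately show ?thesis using local_test_section_member[OF b, of ?\<zeta> l] by simp
qed

end

lemma sob_norm_cong:
 assumes "\<And>\<eta>. \<eta> \<in> test_functions \<O> \<Longrightarrow> F \<eta> = G \<eta>"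
 shows "sob_norm e q \<O> F = sob_norm e q \<O> G"
proof -
 have "(\<forall>\<eta>\<in>test_functions \<O>. F \<eta> = L \<eta>) \<longleftrightarrow> (\<forall>\<eta>\<in>test_functions \<O>. G \<eta> = L \<eta>)" for L using assms by simp
 thus ?thesis unfolding sob_norm_def by simp
qed

section \<open>The estimate for local representations\<close>

locale trivialized_bundle = vector_bundle E
 for E :: "('m::{t2_space, second_countable_topology}, 'e::{t2_space, second_countable_topology},
  'n::finite, 'r::finite) vbundle" +
 fixes N :: nat and \<Lambda> :: "nat \<Rightarrow> ('m, 'e, 'n, 'r) aug_triv"
 assumes atlas: "aug_total_triv_atlas E N \<Lambda>" and closed_manifold: "compact (points (base E))"
begin

lemma atlas_facts:
 assumes "\<beta> \<in> {1..N}"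
 shows "trivializes (\<Lambda> \<beta>)" "smooth_map (base E) euclid (pou (\<Lambda> \<beta>))"
  "points (base E) \<inter> closure {x \<in> points (base E). pou (\<Lambda> \<beta>) x \<noteq> 0} \<subseteq> chart_dom (\<Lambda> \<beta>)"
 using atlas assms unfolding aug_total_triv_atlas_def by blast+

lemma pou_sum: "x \<in> points (base E) \<Longrightarrow> (\<Sum>\<beta>=1..N. pou (\<Lambda> \<beta>) x) = 1"
 using atlas unfolding aug_total_triv_atlas_def by blast

definition transition :: "nat \<Rightarrow> nat \<Rightarrow> real^'n \<Rightarrow> real^'n" where
 "transition \<beta> \<alpha> z = chart_map (\<Lambda> \<alpha>) (inv_into (chart_dom (\<Lambda> \<beta>)) (chart_map (\<Lambda> \<beta>)) z)"

definition overlap :: "nat \<Rightarrow> nat \<Rightarrow> (real^'n) set" where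
 "overlap \<beta> \<alpha> = chart_map (\<Lambda> \<beta>) ` (chart_dom (\<Lambda> \<beta>) \<inter> chart_dom (\<Lambda> \<alpha>))"

lemma diffeo_transition:
 assumes "\<alpha> \<in> {1..N}" "\<beta> \<in> {1..N}"
 shows "diffeo (overlap \<beta> \<alpha>) (overlap \<alpha> \<beta>) (transition \<beta> \<alpha>) (transition \<alpha> \<beta>)"
 using diffeo_charts[OF base_manifold triple_facts(1)[OF atlas_facts(1)[OF assms(2)]] triple_facts(1)[OF atlas_facts(1)[OF assms(1)]]]
 unfolding transition_def[abs_def] overlap_def by (simp add: Int_commute)

text \<open>The functions \<open>\<psi>\<^sub>\<beta>\<close> sum up to \<open>1\<close>, and \<open>u\<close>
 is evaluated on each localized section separately.\<close>

lemma local_rep_decomposition: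
 assumes \<alpha>: "\<alpha> \<in> {1..N}" and \<xi>: "\<xi> \<in> test_functions (image_domain (\<Lambda> \<alpha>))"
 shows "\<exists>m. (\<forall>\<beta>\<in>{1..N}. \<forall>l. m \<beta> l \<in> test_functions (overlap \<beta> \<alpha>)) \<and>
  (\<forall>u\<in>bundle_distributions E. \<forall>\<eta>\<in>test_functions (image_domain (\<Lambda> \<alpha>)).
   dist_mult \<xi> (local_rep E (\<Lambda> \<alpha>) u i) \<eta> =
   (\<Sum>(\<beta>, l)\<in>{1..N} \<times> UNIV.
    local_rep E (\<Lambda> \<beta>) (pou_mult (pou (\<Lambda> \<beta>)) u) l (pull (m \<beta> l) (transition \<beta> \<alpha>) \<eta>)))"
proof -
 note ta = atlas_facts(1)[OF \<alpha>]
 have "\<forall>\<beta>\<in>{1..N}. \<exists>m. (\<forall>l. m l \<in> test_functions (overlap \<beta> \<alpha>)) \<and>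
  (\<forall>\<eta> x a X. pou (\<Lambda> \<beta>) x * local_test_section E (\<Lambda> \<alpha>) i (\<lambda>z. \<xi> z * \<eta> z) (x, a, X) =
   (\<Sum>l\<in>UNIV. pou (\<Lambda> \<beta>) x * local_test_section E (\<Lambda> \<beta>) l (pull (m l) (transition \<beta> \<alpha>) \<eta>) (x, a, X)))"
  using localized_section[OF closed_manifold ta atlas_facts(1) atlas_facts(3) \<xi>]
  unfolding transition_def[abs_def] overlap_def by (rule ballI)
 from bchoice[OF this] obtain m where m: "\<And>\<beta> l. \<beta> \<in> {1..N} \<Longrightarrow> m \<beta> l \<in> test_functions (overlap \<beta> \<alpha>)"
  and split: "\<And>\<beta> \<eta> x a X. \<beta> \<in> {1..N} \<Longrightarrow> pou (\<Lambda> \<beta>) x * local_test_section E (\<Lambda> \<alpha>) i (\<lambda>z. \<xi> z * \<eta> z) (x, a, X) =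
   (\<Sum>l\<in>UNIV. pou (\<Lambda> \<beta>) x * local_test_section E (\<Lambda> \<beta>) l (pull (m \<beta> l) (transition \<beta> \<alpha>) \<eta>) (x, a, X))"
  by blast
 let ?g = "\<lambda>\<eta> (\<beta>, l) p. (case p of (x, a, X) \<Rightarrow> pou (\<Lambda> \<beta>) x) * local_test_section E (\<Lambda> \<beta>) l (pull (m \<beta> l) (transition \<beta> \<alpha>) \<eta>) p"
 have rep: "dist_mult \<xi> (local_rep E (\<Lambda> \<alpha>) u i) \<eta> =
   (\<Sum>(\<beta>, l)\<in>{1..N} \<times> UNIV.
    local_rep E (\<Lambda> \<beta>) (pou_mult (pou (\<Lambda> \<beta>)) u) l (pull (m \<beta> l) (transition \<beta> \<alpha>) \<eta>))"
  if u: "u \<in> bundle_distributions E" and \<eta>: "\<eta> \<in> test_functions (image_domain (\<Lambda> \<alpha>))" for u \<eta>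
 proof -
  have lin: "linear_functional_on (\<Union>(test_section_family E)) u"
   using u by (simp add: bundle_distributions_def lf_dual_def)
  have mem: "?g \<eta> b \<in> \<Union>(test_section_family E)" if b: "b \<in> {1..N} \<times> UNIV" for b
  proof -
   obtain \<beta> l where b': "b = (\<beta>, l)" "\<beta> \<in> {1..N}" using b by blast
   interpret diffeo "overlap \<beta> \<alpha>" "overlap \<alpha> \<beta>" "transition \<beta> \<alpha>" "transition \<alpha> \<beta>" by (rule diffeo_transition[OF \<alpha> b'(2)])
   have "overlap \<beta> \<alpha> \<subseteq> image_domain (\<Lambda> \<beta>)" by (auto simp: overlap_def image_domain_def)
   hence "pull (m \<beta> l) (transition \<beta> \<alpha>) \<eta> \<in> test_functions (image_domain (\<Lambda> \<beta>))"
    by (rule test_functions_mono[OF test_pull[OF m[OF b'(2)] test_functions_smooth[OF \<eta>]]])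
   from pou_local_test_section[OF atlas_facts(1,2)[OF b'(2)] this, of l] show ?thesis by (simp add: b')
  qed
  have "local_test_section E (\<Lambda> \<alpha>) i (\<lambda>z. \<xi> z * \<eta> z) p = (\<Sum>b\<in>{1..N} \<times> UNIV. ?g \<eta> b p)" for p
  proof -
   obtain x a X where p: "p = (x, a, X)" by (cases p)
   have "local_test_section E (\<Lambda> \<alpha>) i (\<lambda>z. \<xi> z * \<eta> z) p =
     (\<Sum>\<beta>=1..N. pou (\<Lambda> \<beta>) x * local_test_section E (\<Lambda> \<alpha>) i (\<lambda>z. \<xi> z * \<eta> z) p)"
   proof (cases "x \<in> chart_dom (\<Lambda> \<alpha>)")
    case True
    thus ?thesis using pou_sum triple_facts(3)[OF ta] by (auto simp: sum_distrib_right[symmetric])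
   qed (simp add: local_test_section_def p)
   also have "\<dots> = (\<Sum>\<beta>=1..N. \<Sum>l\<in>UNIV. ?g \<eta> (\<beta>, l) p)"
    by (rule sum.cong[OF refl]) (simp add: split p)
   also have "\<dots> = (\<Sum>b\<in>{1..N} \<times> UNIV. ?g \<eta> b p)" by (simp add: sum.cartesian_product split_beta')
   finally show ?thesis .
  qed
  hence "local_test_section E (\<Lambda> \<alpha>) i (\<lambda>z. \<xi> z * \<eta> z) = (\<lambda>p. \<Sum>b\<in>{1..N} \<times> UNIV. ?g \<eta> b p)" by (rule ext)
  hence "dist_mult \<xi> (local_rep E (\<Lambda> \<alpha>) u i) \<eta> = u (\<lambda>p. \<Sum>b\<in>{1..N} \<times> UNIV. ?g \<eta> b p)"
   unfolding dist_mult_def local_rep_def by (rule arg_cong)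
  also have "\<dots> = (\<Sum>b\<in>{1..N} \<times> UNIV. u (?g \<eta> b))"
   by (rule linear_functional_on_sum[OF directed_test_section_family lin _ mem
      local_test_section_member[OF ta \<eta>, where l = i], THEN conjunct2]) simp_all
  finally show ?thesis by (simp add: local_rep_def pou_mult_def dist_mult_def split_beta')
 qed
 show ?thesis using m rep by (intro exI[of _ m] conjI ballI allI)
qed

theorem local_rep_estimate:
 assumes q: "1 < q" and \<alpha>: "\<alpha> \<in> {1..N}" and \<xi>: "\<xi> \<in> test_functions (image_domain (\<Lambda> \<alpha>))"
 shows "\<exists>C\<ge>0. \<forall>u\<in>bundle_distributions E.
  sob_norm e q (image_domain (\<Lambda> \<alpha>)) (dist_mult \<xi> (local_rep E (\<Lambda> \<alpha>) u i)) \<le> ennreal C * bundle_sob_norm E N \<Lambda> e q u"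
proof -
 let ?\<O> = "\<lambda>\<beta>. image_domain (\<Lambda> \<beta>)" and ?A = "{1..N} \<times> (UNIV :: 'r set)"
 let ?u = "\<lambda>u \<beta> l. local_rep E (\<Lambda> \<beta>) (pou_mult (pou (\<Lambda> \<beta>)) u) l"
 have op: "open (?\<O> \<beta>)" if "\<beta> \<in> {1..N}" for \<beta> using open_image_domain[OF atlas_facts(1)[OF that]] .
 obtain m where m: "\<forall>\<beta>\<in>{1..N}. \<forall>l. m \<beta> l \<in> test_functions (overlap \<beta> \<alpha>)"
  and rep: "\<forall>u\<in>bundle_distributions E. \<forall>\<eta>\<in>test_functions (?\<O> \<alpha>).
   dist_mult \<xi> (local_rep E (\<Lambda> \<alpha>) u i) \<eta> = (\<Sum>(\<beta>, l)\<in>?A. ?u u \<beta> l (pull (m \<beta> l) (transition \<beta> \<alpha>) \<eta>))"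
  using local_rep_decomposition[OF \<alpha> \<xi>, of i] by (elim exE conjE) (rule that)
 have "\<exists>C>0. \<forall>F. sob_norm e q (?\<O> \<alpha>) (\<lambda>\<eta>. F (pull (m \<beta> l) (transition \<beta> \<alpha>) \<eta>)) \<le> ennreal C * sob_norm e q (?\<O> \<beta>) F"
  if \<beta>: "\<beta> \<in> {1..N}" for \<beta> l
  by (rule diffeo.sob_norm_pull[OF diffeo_transition[OF \<alpha> \<beta>] op[OF \<beta>] _ op[OF \<alpha>] _ m[rule_format, OF \<beta>] q])
    (auto simp: overlap_def image_domain_def)
 hence "\<forall>b\<in>?A. \<exists>C>0. \<forall>F. sob_norm e q (?\<O> \<alpha>) (\<lambda>\<eta>. F (pull (m (fst b) (snd b)) (transition (fst b) \<alpha>) \<eta>)) \<le> ennreal C * sob_norm e q (?\<O> (fst b)) F"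
  by auto
 from bchoice[OF this] obtain c where c': "\<forall>b\<in>?A. c b > 0 \<and> (\<forall>F. sob_norm e q (?\<O> \<alpha>) (\<lambda>\<eta>. F (pull (m (fst b) (snd b)) (transition (fst b) \<alpha>) \<eta>)) \<le> ennreal (c b) * sob_norm e q (?\<O> (fst b)) F)"
  by (rule exE)
 have c: "c b > 0" "sob_norm e q (?\<O> \<alpha>) (\<lambda>\<eta>. F (pull (m (fst b) (snd b)) (transition (fst b) \<alpha>) \<eta>)) \<le> ennreal (c b) * sob_norm e q (?\<O> (fst b)) F"
  if "b \<in> ?A" for b F
  by (rule conjunct1[OF bspec[OF c' that]]) (rule spec[OF conjunct2[OF bspec[OF c' that]]])
 obtain C0 where C0: "C0 > 0" "\<And>F. sob_norm e q (?\<O> \<alpha>) (\<lambda>\<eta>. \<Sum>b\<in>?A. F b \<eta>) \<le> ennreal C0 * (\<Sum>b\<in>?A. sob_norm e q (?\<O> \<alpha>) (F b))"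
  using sob_norm_sum[OF op[OF \<alpha>] q, of ?A e] by auto
 define D where "D = (\<Sum>b\<in>?A. c b)"
 have D: "c b \<le> D" if "b \<in> ?A" for b
  unfolding D_def using c(1) that by (intro member_le_sum) (auto intro: less_imp_le)
 have D0: "D \<ge> 0" unfolding D_def using c(1) by (intro sum_nonneg) (auto intro: less_imp_le)
 have "sob_norm e q (?\<O> \<alpha>) (dist_mult \<xi> (local_rep E (\<Lambda> \<alpha>) u i)) \<le> ennreal (C0 * D) * bundle_sob_norm E N \<Lambda> e q u"
  if u: "u \<in> bundle_distributions E" for u
 proof -
  have "sob_norm e q (?\<O> \<alpha>) (dist_mult \<xi> (local_rep E (\<Lambda> \<alpha>) u i)) =
    sob_norm e q (?\<O> \<alpha>) (\<lambda>\<eta>. \<Sum>b\<in>?A. ?u u (fst b) (snd b) (pull (m (fst b) (snd b)) (transition (fst b) \<alpha>) \<eta>))"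
   by (rule sob_norm_cong) (simp add: rep[rule_format, OF u] split_beta')
  also have "\<dots> \<le> ennreal C0 * (\<Sum>b\<in>?A. sob_norm e q (?\<O> \<alpha>) (\<lambda>\<eta>. ?u u (fst b) (snd b) (pull (m (fst b) (snd b)) (transition (fst b) \<alpha>) \<eta>)))"
   by (rule C0(2))
  also have "\<dots> \<le> ennreal C0 * (\<Sum>b\<in>?A. ennreal D * sob_norm e q (?\<O> (fst b)) (?u u (fst b) (snd b)))"
   by (intro mult_left_mono sum_mono order_trans[OF c(2)] mult_right_mono ennreal_leI D) auto
  also have "\<dots> = ennreal (C0 * D) * bundle_sob_norm E N \<Lambda> e q u"
   using C0(1) D0 by (simp add: bundle_sob_norm_def sum.cartesian_product sum_distrib_left[symmetric] split_beta' ennreal_mult mult.assoc)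
  finally show ?thesis .
 qed
 thus ?thesis using C0(1) D0 by (intro exI[of _ "C0 * D"] conjI ballI) auto
qed

end

theorem corollary9p18:
  fixes E :: "('m::{t2_space, second_countable_topology},
               'e::{t2_space, second_countable_topology}, 'n::finite, 'r::finite) vbundle"
    and \<Lambda> :: "nat \<Rightarrow> ('m, 'e, 'n, 'r) aug_triv"
    and N :: nat and e q :: real
  assumes "smooth_vector_bundle E"
    and "compact (points (base E))"
    and "1 < q"
    and "aug_total_triv_atlas E N \<Lambda>"
    and "e \<notin> \<int> \<and> e < -1 \<longrightarrow> GL_compatible N \<Lambda>"
  shows "\<forall>\<alpha>\<in>{1..N}. \<forall>i.
    (\<forall>u\<in>bundle_sob_space E N \<Lambda> e q.
       local_rep E (\<Lambda> \<alpha>) u i \<in> sob_space_loc e q (image_domain (\<Lambda> \<alpha>))) \<and>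
    (\<forall>\<xi>\<in>test_functions (image_domain (\<Lambda> \<alpha>)). \<exists>C::real. C \<ge> 0 \<and>
       (\<forall>u\<in>bundle_sob_space E N \<Lambda> e q.
          sob_norm e q (image_domain (\<Lambda> \<alpha>)) (dist_mult \<xi> (local_rep E (\<Lambda> \<alpha>) u i))
            \<le> ennreal C * bundle_sob_norm E N \<Lambda> e q u))"
proof -
 interpret trivialized_bundle E N \<Lambda> by unfold_locales (rule assms)+
 have est: "\<exists>C\<ge>0. \<forall>u\<in>bundle_distributions E.
   sob_norm e q (image_domain (\<Lambda> \<alpha>)) (dist_mult \<xi> (local_rep E (\<Lambda> \<alpha>) u i)) \<le> ennreal C * bundle_sob_norm E N \<Lambda> e q u"
  if "\<alpha> \<in> {1..N}" "\<xi> \<in> test_functions (image_domain (\<Lambda> \<alpha>))" for \<alpha> \<xi> i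
  by (rule local_rep_estimate[OF \<open>1 < q\<close> that])
 have space: "bundle_sob_space E N \<Lambda> e q \<subseteq> bundle_distributions E" by (auto simp: bundle_sob_space_def)
 show ?thesis
 proof (intro ballI allI conjI)
  fix \<alpha> i \<xi> assume "\<alpha> \<in> {1..N}" "\<xi> \<in> test_functions (image_domain (\<Lambda> \<alpha>))"
  from est[OF this, of i] space show "\<exists>C::real. C \<ge> 0 \<and> (\<forall>u\<in>bundle_sob_space E N \<Lambda> e q.
    sob_norm e q (image_domain (\<Lambda> \<alpha>)) (dist_mult \<xi> (local_rep E (\<Lambda> \<alpha>) u i)) \<le> ennreal C * bundle_sob_norm E N \<Lambda> e q u)"
   by (meson subsetD)
 next
  fix \<alpha> i u assume \<alpha>: "\<alpha> \<in> {1..N}" and u: "u \<in> bundle_sob_space E N \<Lambda> e q"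
  have u': "u \<in> bundle_distributions E" "bundle_sob_norm E N \<Lambda> e q u < \<infinity>" using u by (auto simp: bundle_sob_space_def)
  note ta = atlas_facts(1)[OF \<alpha>]
  have d: "local_rep E (\<Lambda> \<alpha>) u i \<in> distributions (image_domain (\<Lambda> \<alpha>))" by (rule local_rep_distribution[OF ta u'(1)])
  have "dist_mult \<xi> (local_rep E (\<Lambda> \<alpha>) u i) \<in> sob_space e q (image_domain (\<Lambda> \<alpha>))"
   if \<xi>: "\<xi> \<in> test_functions (image_domain (\<Lambda> \<alpha>))" for \<xi>
  proof -
   obtain C where C: "sob_norm e q (image_domain (\<Lambda> \<alpha>)) (dist_mult \<xi> (local_rep E (\<Lambda> \<alpha>) u i)) \<le> ennreal C * bundle_sob_norm E N \<Lambda> e q u"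
    using est[OF \<alpha> \<xi>, of i] u'(1) by blast
   also have "\<dots> < \<infinity>" using u'(2) by (simp add: ennreal_mult_less_top)
   finally show ?thesis
    using dist_mult_distributions[OF open_image_domain[OF ta] \<xi> d] by (simp add: sob_space_def)
  qed
  thus "local_rep E (\<Lambda> \<alpha>) u i \<in> sob_space_loc e q (image_domain (\<Lambda> \<alpha>))"
   using d by (simp add: sob_space_loc_def)
 qed
qed

end
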